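(* Let $p\in\mathbb N$ with $\rho:=(p+1)\alpha>1$, let $\mathbf X$ be an $\alpha$-Hölder rough path over $\mathbb R^d$ on $[0,T]$, let $\mathbf Z=(Z,Z')\in\mathcal D^\alpha_{\mathbf X}([0,T];\mathbb R^m)$, and let $F_a\in C_b^{p+1}(\mathbb R^e;\mathbb R^e)$ for $a\in\mathcal A=\{1,\dots,m\}$. Let $(Y,Y')\in\mathcal D^\alpha_{\mathbf X}([0,T];\mathbb R^e)$ be the solution of $dY_t=\sum_{a=1}^mF_a(Y_t)\,d\mathbf Z^a_t$ with initial value $Y_0$. Consider a controlled Runge-Kutta method with coefficients $\mathcal Z^{(a)}_{u,v}\in\mathbb R^{q\times q}$, $\zeta^{(a)}_{u,v}\in\mathbb R^q$ such that, for some $C_{\mathrm{CRK}}>0$, $\|\mathcal Z^{(a)}_{u,v}\|_\infty+|\zeta^{(a)}_{u,v}|_\infty\le C_{\mathrm{CRK}}|v-u|^\alpha$ for all $[u,v]\subset[0,T]$ and $a\in\mathcal A$, such that its stage system is solvable on each one-step interval, and which has tree order $p$, i.e. $a_{u,v}(\tau)=Z^\tau_{u,v}$ for all $\tau\in\mathcal T_{\le p}$ and $0\le u\le v\le T$. For a partition $\pi_h=\{0=t_0<\dots<t_N=T\}$ with mesh $h=\max_n|t_{n+1}-t_n|$ define $y_0^{\mathrm{CRK}}:=Y_0$, $y_{n+1}^{\mathrm{CRK}}:=\Psi^{\mathrm{CRK}}_{t_n,t_{n+1}}(y_n^{\mathrm{CRK}})$, $n=0,\dots,N-1$. Let $R>0$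 be such that $y_n^{\mathrm{CRK}}$, $\varphi_{t_n,t_{n+1}}(y_n^{\mathrm{CRK}})$ and $\Psi^{\mathrm{CRK}}_{t_n,t_{n+1}}(y_n^{\mathrm{CRK}})$ all belong to $B_R=\{y\in\mathbb R^e:|y|\le R\}$ for every $n=0,\dots,N-1$. Then there exists a constant $C_{p,R,T}>0$, independent of $h$ (i.e. the same constant serves for all partitions satisfying this condition with the given $R$), such that $$\max_{0\le n\le N}|Y_{t_n}-y_n^{\mathrm{CRK}}|\le C_{p,R,T}\,h^{\rho-1}.$$
   Context: Fix $\alpha\in(1/3,1/2]$, $T>0$ and $d,m,e,q\in\mathbb N=\{1,2,\dots\}$. Write $X_{s,t}:=X_t-X_s$. $C_b^k$ denotes $k$ times continuously differentiable maps with all derivatives of orders $0,\dots,k$ bounded. Rough and controlled paths. An $\alpha$-Hölder rough path over $\mathbb R^d$ is a pair $\mathbf X=(X,\mathbb X)$ with $X\in C^\alpha([0,T];\mathbb R^d)$ and $\mathbb X:\{0\le s\le t\le T\}\to\mathbb R^{d\times d}$ with $\sup_{s<t}|\mathbb X_{s,t}|/|t-s|^{2\alpha}<\infty$ and $\mathbb X_{s,t}=\mathbb X_{s,u}+\mathbb X_{u,t}+X_{s,u}\otimes X_{u,t}$. $\mathcal D^\alpha_{\mathbf X}([0,T];V)$ is the set of pairs $(Y,Y')$ ($\mathbf X$-controlled rough paths) with $Y\in C^\alpha([0,T];V)$, $Y'\in C^\alpha([0,T];\mathcal L(\mathbb R^d,V))$ (Gubinelli derivative) and $R^Y_{s,t}:=Y_{s,t}-Y'_sX_{s,t}$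 satisfying $\sup_{s<t}|R^Y_{s,t}|/|t-s|^{2\alpha}<\infty$; similarly on subintervals. Controlled rough integral. For controlled $(H,H')$ with values in $\mathcal L(\mathbb R^k,V)$ and controlled $(W,W')$ with values in $\mathbb R^k$, $\int_s^tH_r\,d\mathbf W_r:=\lim_{|P|\to0}\sum_{[u,v]\in P}(H_uW_{u,v}+(H'_u\diamond W'_u)\mathbb X_{u,v})$ over partitions $P$ of $[s,t]$ (the limit exists), where $(A\diamond B)(x\otimes\tilde x):=A(x)(B\tilde x)$. The indefinite integral is controlled with Gubinelli derivative $H_tW'_t$. Solution and flow. With $F(y)e_a=F_a(y)$, a solution is $(Y,Y')\in\mathcal D^\alpha_{\mathbf X}([0,T];\mathbb R^e)$ with $Y_t=Y_0+\int_0^tF(Y_r)\,d\mathbf Z_r$ and $Y'_t=F(Y_t)Z'_t$, where $F(Y)$ is controlled with Gubinelli derivative $DF(Y_t)Y'_t$. $\varphi_{s,t}(y)$ ($0\le s\le t\le T$) denotes the value at time $t$ of the (unique) solution of the same equation started from $y$ at time $s$; $\varphi_{s,s}=\mathrm{Id}$, $\varphi_{s,t}=\varphi_{r,t}\circ\varphi_{s,r}$. Trees. $\mathcal T$ is the set of (nonplanar) rooted trees with vertices decorated by $\mathcal A$; $\mathbf 1$ is the empty tree/forest. $[\tau_1\cdots\tau_n]_a$ is the tree obtained by joining the roots of $\tau_1,\dots,\tau_n$ to a new root decorated by $a$; $\bullet_a=[\mathbf 1]_a$. $|\tau|$ is the number of vertices; $\mathcal T_{\le p}=\{\tau\in\mathcal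 T:|\tau|\le p\}$. Controlled coefficients. For fixed $s$ and $t\in[s,T]$: $Z^{\mathbf 1}_{s,t}:=1$; for forests $Z^{\tau_1\cdots\tau_n}_{s,t}:=\prod_jZ^{\tau_j}_{s,t}$; $Z^{[\eta]_a}_{s,t}:=\int_s^tZ^\eta_{s,u}\,d\mathbf Z^a_u$ (controlled rough integral), with Gubinelli derivatives $(Z^{\mathbf 1}_{s,\cdot})'=0$, $(Z^{\tau_1\cdots\tau_n}_{s,\cdot})'_r=\sum_j(Z^{\tau_j}_{s,\cdot})'_r\prod_{i\ne j}Z^{\tau_i}_{s,r}$, $(Z^{[\eta]_a}_{s,\cdot})'_r=Z^\eta_{s,r}(Z^a)'_r$. Controlled Runge-Kutta method. Prescribed coefficients $\mathcal Z^{(a)}_{u,v},\zeta^{(a)}_{u,v}$ for each $[u,v]\subset[0,T]$, $a\in\mathcal A$ (which may depend on the values $Z^\eta_{u,v}$ over forests $\eta$ with at most $p$ vertices). Stages: $Y_i^{u,v}(y)=y+\sum_{a}\sum_{j=1}^q(\mathcal Z^{(a)}_{u,v})_{i,j}F_a(Y_j^{u,v}(y))$, $i=1,\dots,q$ (a solution, assumed to exist). One-step map: $\Psi^{\mathrm{CRK}}_{u,v}(y):=y+\sum_a\sum_{i=1}^q(\zeta^{(a)}_{u,v})_iF_a(Y_i^{u,v}(y))$. $|\cdot|_\infty$ is the max norm on $\mathbb R^q$, $\|\cdot\|_\infty$ the induced matrix norm. Numerical tree coefficients. With $\odot$ the componentwise product on $\mathbb R^q$ and $\mathbf 1_q=(1,\dots,1)^\top$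 (the empty product): $\Phi_{u,v}(\mathbf 1)=\mathbf 1_q$, $a_{u,v}(\mathbf 1)=1$, and for $\tau=[\tau_1\cdots\tau_n]_a$, $\Phi_{u,v}(\tau)=\mathcal Z^{(a)}_{u,v}(\Phi_{u,v}(\tau_1)\odot\cdots\odot\Phi_{u,v}(\tau_n))$ and $a_{u,v}(\tau)=\langle\zeta^{(a)}_{u,v},\Phi_{u,v}(\tau_1)\odot\cdots\odot\Phi_{u,v}(\tau_n)\rangle_{\mathbb R^q}$, with $\Phi_{u,v}(\bullet_a)=\mathcal Z^{(a)}_{u,v}\mathbf 1_q$, $a_{u,v}(\bullet_a)=\langle\zeta^{(a)}_{u,v},\mathbf 1_q\rangle$. *)

theory Defs
  imports "HOL-Analysis.Analysis" "HOL-Library.Multiset"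
begin

section \<open>Function spaces\<close>

text \<open>The space of \<open>k\<close> times continuously differentiable maps whose derivatives of orders
  \<open>0, \<dots>, k\<close> are bounded. The derivative of order \<open>j\<close> is handled through its values
  \<open>D\<^sup>jf(x)(v\<^sub>1,\<dots>,v\<^sub>j)\<close> for arbitrary fixed \<open>v\<^sub>1,\<dots>,v\<^sub>j\<close>, since its type would otherwise depend on
  \<open>j\<close>; in finite dimension, continuity and boundedness for all choices of directions are continuity
  and boundedness in the norm of multilinear maps.\<close>

primrec Cb :: "nat \<Rightarrow> ('a::euclidean_space \<Rightarrow> 'b::real_normed_vector) \<Rightarrow> bool" where
  "Cb 0 f \<longleftrightarrow> continuous_on UNIV f \<and> bounded (range f)"
| "Cb (Suc k) f \<longleftrightarrow> bounded (range f) \<and> (\<forall>x. f differentiable (at x)) \<and>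
     (\<forall>v. Cb k (\<lambda>x. frechet_derivative f (at x) v))"

definition holder_on :: "real \<Rightarrow> real \<Rightarrow> real \<Rightarrow> (real \<Rightarrow> 'v::real_normed_vector) \<Rightarrow> bool" where
  "holder_on \<alpha> a b f \<longleftrightarrow>
     (\<exists>C. \<forall>s\<in>{a..b}. \<forall>t\<in>{a..b}. norm (f t - f s) \<le> C * \<bar>t - s\<bar> powr \<alpha>)"

section \<open>Rough paths and controlled rough paths\<close>

definition tensor :: "real^'d \<Rightarrow> real^'d \<Rightarrow> real^'d^'d" where
  "tensor x y = (\<chi> i j. x $ i * y $ j)"

definition rough_path ::
  "real \<Rightarrow> real \<Rightarrow> (real \<Rightarrow> real^'d) \<Rightarrow> (real \<Rightarrow> real \<Rightarrow> real^'d^'d) \<Rightarrow> bool" where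
  "rough_path \<alpha> T X XX \<longleftrightarrow>
     holder_on \<alpha> 0 T X \<and>
     (\<exists>C. \<forall>s t. 0 \<le> s \<and> s < t \<and> t \<le> T \<longrightarrow> norm (XX s t) \<le> C * \<bar>t - s\<bar> powr (2 * \<alpha>)) \<and>
     (\<forall>s u t. 0 \<le> s \<and> s \<le> u \<and> u \<le> t \<and> t \<le> T \<longrightarrow>
        XX s t = XX s u + XX u t + tensor (X u - X s) (X t - X u))"

definition controlled ::
  "real \<Rightarrow> (real \<Rightarrow> real^'d) \<Rightarrow> real \<Rightarrow> real \<Rightarrow>
   (real \<Rightarrow> 'v::real_normed_vector) \<Rightarrow> (real \<Rightarrow> (real^'d) \<Rightarrow>\<^sub>L 'v) \<Rightarrow> bool" where
  "controlled \<alpha> X a b Y Y' \<longleftrightarrow>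
     holder_on \<alpha> a b Y \<and> holder_on \<alpha> a b Y' \<and>
     (\<exists>C. \<forall>s t. a \<le> s \<and> s < t \<and> t \<le> b \<longrightarrow>
        norm (Y t - Y s - blinfun_apply (Y' s) (X t - X s)) \<le> C * \<bar>t - s\<bar> powr (2 * \<alpha>))"

section \<open>The controlled rough integral\<close>

text \<open>A partition \<open>s = t\<^sub>0 < \<dots> < t\<^sub>N = e\<close> is given by \<open>N\<close> and the function \<open>t\<close>, of which only the values
  at \<open>0, \<dots>, N\<close> matter; for \<open>s = e\<close> the only partition has \<open>N = 0\<close>.\<close>

definition is_partition :: "real \<Rightarrow> real \<Rightarrow> nat \<Rightarrow> (nat \<Rightarrow> real) \<Rightarrow> bool" where
  "is_partition s e N t \<longleftrightarrow> t 0 = s \<and> t N = e \<and> (\<forall>n<N. t n < t (Suc n))"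

text \<open>The linear extension to matrices of \<open>(A \<diamondop> B)(x \<otimes> y) = A(x)(B y)\<close>.\<close>

definition diamond ::
  "((real^'d) \<Rightarrow>\<^sub>L ('w::real_normed_vector \<Rightarrow>\<^sub>L 'v::real_normed_vector)) \<Rightarrow>
   ((real^'d) \<Rightarrow>\<^sub>L 'w) \<Rightarrow> real^'d^'d \<Rightarrow> 'v" where
  "diamond A B M = (\<Sum>i\<in>UNIV. \<Sum>j\<in>UNIV.
     (M $ i $ j) *\<^sub>R blinfun_apply (blinfun_apply A (axis i 1)) (blinfun_apply B (axis j 1)))"

definition has_rough_integral ::
  "(real \<Rightarrow> real \<Rightarrow> real^'d^'d) \<Rightarrow>
   (real \<Rightarrow> 'w::real_normed_vector \<Rightarrow>\<^sub>L 'v::real_normed_vector) \<Rightarrow>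
   (real \<Rightarrow> (real^'d) \<Rightarrow>\<^sub>L ('w \<Rightarrow>\<^sub>L 'v)) \<Rightarrow>
   (real \<Rightarrow> 'w) \<Rightarrow> (real \<Rightarrow> (real^'d) \<Rightarrow>\<^sub>L 'w) \<Rightarrow> real \<Rightarrow> real \<Rightarrow> 'v \<Rightarrow> bool" where
  "has_rough_integral XX H H' W W' s e I \<longleftrightarrow>
     (\<forall>\<epsilon>>0. \<exists>\<delta>>0. \<forall>N t. is_partition s e N t \<and> (\<forall>n<N. t (Suc n) - t n < \<delta>) \<longrightarrow>
        norm ((\<Sum>n<N. blinfun_apply (H (t n)) (W (t (Suc n)) - W (t n))
                      + diamond (H' (t n)) (W' (t n)) (XX (t n) (t (Suc n)))) - I) < \<epsilon>)"

definition rough_integral ::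
  "(real \<Rightarrow> real \<Rightarrow> real^'d^'d) \<Rightarrow>
   (real \<Rightarrow> 'w::real_normed_vector \<Rightarrow>\<^sub>L 'v::real_normed_vector) \<Rightarrow>
   (real \<Rightarrow> (real^'d) \<Rightarrow>\<^sub>L ('w \<Rightarrow>\<^sub>L 'v)) \<Rightarrow>
   (real \<Rightarrow> 'w) \<Rightarrow> (real \<Rightarrow> (real^'d) \<Rightarrow>\<^sub>L 'w) \<Rightarrow> real \<Rightarrow> real \<Rightarrow> 'v" where
  "rough_integral XX H H' W W' s e = (THE I. has_rough_integral XX H H' W W' s e I)"

section \<open>Solutions and flow\<close>

text \<open>The map \<open>F\<close> with \<open>F(y)e\<^sub>a = F\<^sub>a(y)\<close>.\<close>

definition vf :: "('m \<Rightarrow> real^'e \<Rightarrow> real^'e) \<Rightarrow> real^'e \<Rightarrow> (real^'m) \<Rightarrow>\<^sub>L (real^'e)" where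
  "vf F y = Blinfun (\<lambda>z. \<Sum>a\<in>UNIV. (z $ a) *\<^sub>R F a y)"

definition vf_deriv ::
  "('m \<Rightarrow> real^'e \<Rightarrow> real^'e) \<Rightarrow> real^'e \<Rightarrow> (real^'e) \<Rightarrow>\<^sub>L ((real^'m) \<Rightarrow>\<^sub>L (real^'e))" where
  "vf_deriv F y = Blinfun (frechet_derivative (vf F) (at y))"

text \<open>\<open>(Y, Y')\<close> solves \<open>dY = F(Y) d\<^bold>Z\<close> on \<open>[s, T]\<close> with value \<open>y\<close> at time \<open>s\<close>.\<close>

definition rde_solution ::
  "real \<Rightarrow> real \<Rightarrow> (real \<Rightarrow> real^'d) \<Rightarrow> (real \<Rightarrow> real \<Rightarrow> real^'d^'d) \<Rightarrow>
   (real \<Rightarrow> real^'m) \<Rightarrow> (real \<Rightarrow> (real^'d) \<Rightarrow>\<^sub>L (real^'m)) \<Rightarrow>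
   ('m \<Rightarrow> real^'e \<Rightarrow> real^'e) \<Rightarrow> real \<Rightarrow> real^'e \<Rightarrow>
   (real \<Rightarrow> real^'e) \<Rightarrow> (real \<Rightarrow> (real^'d) \<Rightarrow>\<^sub>L (real^'e)) \<Rightarrow> bool" where
  "rde_solution \<alpha> T X XX Z Z' F s y Y Y' \<longleftrightarrow>
     controlled \<alpha> X s T Y Y' \<and> Y s = y \<and>
     (\<forall>t\<in>{s..T}.
        has_rough_integral XX (\<lambda>r. vf F (Y r)) (\<lambda>r. vf_deriv F (Y r) o\<^sub>L Y' r) Z Z' s t (Y t - y) \<and>
        Y' t = vf F (Y t) o\<^sub>L Z' t)"

definition rde_flow ::
  "real \<Rightarrow> real \<Rightarrow> (real \<Rightarrow> real^'d) \<Rightarrow> (real \<Rightarrow> real \<Rightarrow> real^'d^'d) \<Rightarrow>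
   (real \<Rightarrow> real^'m) \<Rightarrow> (real \<Rightarrow> (real^'d) \<Rightarrow>\<^sub>L (real^'m)) \<Rightarrow>
   ('m \<Rightarrow> real^'e \<Rightarrow> real^'e) \<Rightarrow> real \<Rightarrow> real \<Rightarrow> real^'e \<Rightarrow> real^'e" where
  "rde_flow \<alpha> T X XX Z Z' F s t y =
     (THE z. \<exists>Y Y'. rde_solution \<alpha> T X XX Z Z' F s y Y Y' \<and> z = Y t)"

section \<open>Decorated rooted trees and the coefficients of the driver\<close>

text \<open>\<open>Node a {#\<tau>\<^sub>1, \<dots>, \<tau>\<^sub>n#}\<close> is \<open>[\<tau>\<^sub>1 \<cdots> \<tau>\<^sub>n]\<^sub>a\<close>; multisets make the trees nonplanar. Forests are
  multisets of trees, and \<open>{#}\<close> is the empty tree/forest, which is not an element of the type.\<close>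

datatype 'a rtree = Node 'a "'a rtree multiset"

primrec vertices :: "'a rtree \<Rightarrow> nat" where
  "vertices (Node a ts) = Suc (\<Sum>\<^sub># (image_mset vertices ts))"

text \<open>The value and the Gubinelli derivative of the product of a multiset of controlled scalar paths.
  For the empty multiset (the empty forest) they are \<open>1\<close> and \<open>0\<close>.\<close>

definition forest_val ::
  "((real \<Rightarrow> real) \<times> (real \<Rightarrow> (real^'d) \<Rightarrow>\<^sub>L real)) multiset \<Rightarrow> real \<Rightarrow> real" where
  "forest_val M r = (\<Prod>p\<in>#M. fst p r)"

definition forest_deriv ::
  "((real \<Rightarrow> real) \<times> (real \<Rightarrow> (real^'d) \<Rightarrow>\<^sub>L real)) multiset \<Rightarrow> real \<Rightarrow> (real^'d) \<Rightarrow>\<^sub>L real" where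
  "forest_deriv M r = (\<Sum>p\<in>#M. (\<Prod>q\<in>#M - {#p#}. fst q r) *\<^sub>R snd p r)"

definition comp_deriv ::
  "(real \<Rightarrow> (real^'d) \<Rightarrow>\<^sub>L (real^'m)) \<Rightarrow> 'm \<Rightarrow> real \<Rightarrow> (real^'d) \<Rightarrow>\<^sub>L real" where
  "comp_deriv Z' a r = blinfun_inner_left (axis a 1) o\<^sub>L Z' r"

text \<open>The pair \<open>(Z\<^sup>\<tau>\<^sub>s\<^sub>,\<^sub>\<cdot>, (Z\<^sup>\<tau>\<^sub>s\<^sub>,\<^sub>\<cdot>)')\<close>. In the integral, a real number \<open>x\<close> is identified with the element
  \<open>blinfun_scaleR_left x\<close> (multiplication by \<open>x\<close>) of \<open>\<L>(\<real>, \<real>)\<close>.\<close>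

primrec tree_path ::
  "(real \<Rightarrow> real \<Rightarrow> real^'d^'d) \<Rightarrow> (real \<Rightarrow> real^'m) \<Rightarrow> (real \<Rightarrow> (real^'d) \<Rightarrow>\<^sub>L (real^'m)) \<Rightarrow>
   real \<Rightarrow> 'm rtree \<Rightarrow> (real \<Rightarrow> real) \<times> (real \<Rightarrow> (real^'d) \<Rightarrow>\<^sub>L real)" where
  "tree_path XX Z Z' s (Node a ts) =
     (let M = image_mset (tree_path XX Z Z' s) ts in
      (\<lambda>t. rough_integral XX
             (\<lambda>r. blinfun_scaleR_left (forest_val M r))
             (\<lambda>r. Blinfun blinfun_scaleR_left o\<^sub>L forest_deriv M r)
             (\<lambda>r. Z r $ a) (comp_deriv Z' a) s t,
       \<lambda>r. forest_val M r *\<^sub>R comp_deriv Z' a r))"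

definition tree_coeff ::
  "(real \<Rightarrow> real \<Rightarrow> real^'d^'d) \<Rightarrow> (real \<Rightarrow> real^'m) \<Rightarrow> (real \<Rightarrow> (real^'d) \<Rightarrow>\<^sub>L (real^'m)) \<Rightarrow>
   real \<Rightarrow> real \<Rightarrow> 'm rtree \<Rightarrow> real" where
  "tree_coeff XX Z Z' s t \<tau> = fst (tree_path XX Z Z' s \<tau>) t"

section \<open>Controlled Runge--Kutta methods\<close>

text \<open>On \<^typ>\<open>real^'q\<close>, \<open>*\<close> is the componentwise product and \<open>1\<close> is the vector of ones, so \<open>\<Prod>\<^sub>#\<close> is
  the iterated componentwise product. Below, \<open>A\<close> and \<open>\<zeta>\<close> are the coefficients of the method on one
  fixed interval.\<close>

primrec rk_Phi :: "('m \<Rightarrow> real^'q^'q) \<Rightarrow> 'm rtree \<Rightarrow> real^'q" where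
  "rk_Phi A (Node a ts) = A a *v (\<Prod>\<^sub># (image_mset (rk_Phi A) ts))"

primrec rk_weight :: "('m \<Rightarrow> real^'q^'q) \<Rightarrow> ('m \<Rightarrow> real^'q) \<Rightarrow> 'm rtree \<Rightarrow> real" where
  "rk_weight A \<zeta> (Node a ts) = \<zeta> a \<bullet> (\<Prod>\<^sub># (image_mset (rk_Phi A) ts))"

definition rk_stages ::
  "('m \<Rightarrow> real^'q^'q) \<Rightarrow> ('m \<Rightarrow> real^'e \<Rightarrow> real^'e) \<Rightarrow> real^'e \<Rightarrow> ('q \<Rightarrow> real^'e) \<Rightarrow> bool" where
  "rk_stages A F y S \<longleftrightarrow>
     (\<forall>i. S i = y + (\<Sum>a\<in>UNIV. \<Sum>j\<in>UNIV. (A a $ i $ j) *\<^sub>R F a (S j)))"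

definition rk_step ::
  "('m \<Rightarrow> real^'q) \<Rightarrow> ('m \<Rightarrow> real^'e \<Rightarrow> real^'e) \<Rightarrow> real^'e \<Rightarrow> ('q \<Rightarrow> real^'e) \<Rightarrow> real^'e" where
  "rk_step \<zeta> F y S = y + (\<Sum>a\<in>UNIV. \<Sum>i\<in>UNIV. (\<zeta> a $ i) *\<^sub>R F a (S i))"

text \<open>The one-step map. The stage system may have several solutions, so the stages
  \<open>S u v y i = Y\<^sub>i\<^sup>u\<^sup>,\<^sup>v(y)\<close> used by the method are part of its data.\<close>

definition crk_map ::
  "(real \<Rightarrow> real \<Rightarrow> 'm \<Rightarrow> real^'q) \<Rightarrow> ('m \<Rightarrow> real^'e \<Rightarrow> real^'e) \<Rightarrow>
   (real \<Rightarrow> real \<Rightarrow> real^'e \<Rightarrow> 'q \<Rightarrow> real^'e) \<Rightarrow> real \<Rightarrow> real \<Rightarrow> real^'e \<Rightarrow> real^'e" where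
  "crk_map \<zeta> F S u v y = rk_step (\<zeta> u v) F y (S u v y)"

primrec one_step_iter ::
  "(real \<Rightarrow> real \<Rightarrow> 'v \<Rightarrow> 'v) \<Rightarrow> (nat \<Rightarrow> real) \<Rightarrow> 'v \<Rightarrow> nat \<Rightarrow> 'v" where
  "one_step_iter \<Psi> t y0 0 = y0"
| "one_step_iter \<Psi> t y0 (Suc n) = \<Psi> (t n) (t (Suc n)) (one_step_iter \<Psi> t y0 n)"

text \<open>The matrix norm induced by the max norm \<^const>\<open>infnorm\<close>.\<close>

definition mat_infnorm :: "real^'q^'q \<Rightarrow> real" where
  "mat_infnorm M = (SUP x\<in>{x. infnorm x \<le> 1}. infnorm (M *v x))"

definition has_tree_order ::
  "real \<Rightarrow> (real \<Rightarrow> real \<Rightarrow> real^'d^'d) \<Rightarrow> (real \<Rightarrow> real^'m) \<Rightarrow>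
   (real \<Rightarrow> (real^'d) \<Rightarrow>\<^sub>L (real^'m)) \<Rightarrow> (real \<Rightarrow> real \<Rightarrow> 'm \<Rightarrow> real^'q^'q) \<Rightarrow>
   (real \<Rightarrow> real \<Rightarrow> 'm \<Rightarrow> real^'q) \<Rightarrow> nat \<Rightarrow> bool" where
  "has_tree_order T XX Z Z' A \<zeta> p \<longleftrightarrow>
     (\<forall>\<tau> u v. vertices \<tau> \<le> p \<and> 0 \<le> u \<and> u \<le> v \<and> v \<le> T \<longrightarrow>
        rk_weight (A u v) (\<zeta> u v) \<tau> = tree_coeff XX Z Z' u v \<tau>)"

end

(* The exact solution on [u, v] and the stages of the method on [u, v] solve the same fixed point
   equation W_i = sum_a I_a (F_a^i (y + W)), once in the ring of scalar controlled paths, where I_a is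
   integration against Z^a, and once in R^q with the componentwise product, where I_a is the matrix of
   the method. In both rings I_a gains a factor |v - u|^alpha, so iterating the Taylor expansion of F
   expresses W through trees with at most p vertices up to |v - u|^rho; the coefficients agree by the
   order condition. Solution and scheme are therefore two perturbations of one one-step map.

   Composing local errors needs a stability estimate with a constant independent of the partition,
   although the increments are only of order |v - u|^alpha. As 3 alpha > 1, Davie's discrete sewing
   bounds the increments of any such perturbed sequence. It is applied to the pair (x, y) of solution
   and scheme in the norm |x| + |x - y| / l, where l is the largest distance on a block of fixed length:
   the fields and the local errors relative to l stay bounded as long as l >= h^(rho - 1). Thus the
   error at most doubles from block to block. *)

theory Submission
  imports Defs
begin

section \<open>Differential calculus for bounded smooth maps\<close>

text \<open>Increments of order |v - u|^\<alpha> with \<alpha> \<le> 1/2 do not sum up along a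
  partition, so no Gronwall argument applies to the difference of the two sequences; only the defect
  from a second order germ, of order |v - u|^(3\<alpha>), is summable. With w = |v - u|^\<alpha>,
  the tree series differs from that germ by O(w^3), with Lipschitz constant O(w^3) in the starting
  point, and a local error w^(p+1) = h * h^(\<rho>-1) is at most h * l once l \<ge> mesh^(\<rho>-1).
  Both perturbations are thus at most of the order of the step length, which is what sewing
  tolerates.

  Two places fix the regularity. In the ring of controlled paths a Taylor remainder along Y must be
  small together with its Gubinelli derivative and its Hoelder constants, of orders w^p, w^(p-1),
  w^(p-2); this takes two derivatives of the remainder. Linearizing the fields at two points at once
  takes C^3 instead of the C^2 of a single sequence. Both are available because \<rho> > 1 and
  \<alpha> \<le> 1/2 force p \<ge> 2.

  The block length depends only on bounds of the data, hence so does the number of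
  doublings.\<close>

lemma Cb_bounded: "Cb k f \<Longrightarrow> \<exists>C\<ge>0. \<forall>x. norm (f x) \<le> C"
  by (cases k) (auto simp: bounded_iff intro: order_trans[OF norm_ge_zero])

lemma Cb_has_derivative:
  "Cb (Suc k) f \<Longrightarrow> (f has_derivative frechet_derivative f (at x)) (at x)"
  by (simp add: frechet_derivative_works)

lemma Cb_SucD: "Cb (Suc k) f \<Longrightarrow> Cb k f"
proof (induction k arbitrary: f)
  case 0
  then show ?case
    by (auto intro!: continuous_at_imp_continuous_on differentiable_imp_continuous_within)
qed simp

lemma Cb_le: "Cb k f \<Longrightarrow> l \<le> k \<Longrightarrow> Cb l f"
  by (induction k) (auto simp del: Cb.simps simp: le_Suc_eq dest: Cb_SucD)

text \<open>By uniqueness of derivatives an explicit \<open>f'\<close> may replace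
  \<open>frechet_derivative\<close>, to which the recursive definition refers; the closure
  properties below go through this rule.\<close>

lemma Cb_SucI:
  assumes "\<And>x. (f has_derivative f' x) (at x)" "\<And>v. Cb k (\<lambda>x. f' x v)" "bounded (range f)"
  shows "Cb (Suc k) f"
proof -
  have "frechet_derivative f (at x) = f' x" for x
    using frechet_derivative_at[OF assms(1)[of x]] by simp
  with assms show ?thesis by (auto simp: differentiable_def)
qed

lemma Cb_const: "Cb k (\<lambda>x. c)"
proof (induction k arbitrary: c)
  case (Suc k)
  show ?case by (rule Cb_SucI[where f'="\<lambda>_ _. 0"]) (auto intro: Suc)
qed simp

lemma Cb_add: "Cb k f \<Longrightarrow> Cb k g \<Longrightarrow> Cb k (\<lambda>x. f x + g x)"
proof (induction k arbitrary: f g)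
  case 0
  then show ?case by (auto intro: continuous_on_add bounded_plus_comp)
next
  case (Suc k)
  show ?case
    by (rule Cb_SucI[OF has_derivative_add[OF Cb_has_derivative[OF Suc.prems(1)]
            Cb_has_derivative[OF Suc.prems(2)]]])
      (use Suc in \<open>auto intro: bounded_plus_comp\<close>)
qed

lemma bounded_range_mult:
  fixes f g :: "'a \<Rightarrow> real"
  assumes "bounded (range f)" "bounded (range g)"
  shows "bounded (range (\<lambda>x. f x * g x))"
proof -
  obtain B where "\<And>x. norm (f x) \<le> B" using assms by (auto simp: bounded_iff)
  moreover obtain C where "\<And>x. norm (g x) \<le> C" using assms by (auto simp: bounded_iff)
  ultimately have "norm (f x * g x) \<le> B * C" for x
    by (metis norm_mult mult_mono norm_ge_zero order_trans)
  then show ?thesis by (auto simp: bounded_iff)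
qed

lemma Cb_mult:
  fixes f g :: "'a::euclidean_space \<Rightarrow> real"
  shows "Cb k f \<Longrightarrow> Cb k g \<Longrightarrow> Cb k (\<lambda>x. f x * g x)"
proof (induction k arbitrary: f g)
  case 0
  then show ?case by (auto intro: continuous_on_mult bounded_range_mult)
next
  case (Suc k)
  have "Cb k f" "Cb k g" using Suc.prems by (auto dest: Cb_SucD simp del: Cb.simps)
  show ?case
    by (rule Cb_SucI[OF has_derivative_mult[OF Cb_has_derivative[OF Suc.prems(1)]
            Cb_has_derivative[OF Suc.prems(2)]]])
      (use Suc \<open>Cb k f\<close> \<open>Cb k g\<close> in \<open>auto intro!: Cb_add bounded_range_mult\<close>)
qed

lemma Cb_sum: "finite A \<Longrightarrow> (\<And>i. i \<in> A \<Longrightarrow> Cb k (f i)) \<Longrightarrow> Cb k (\<lambda>x. \<Sum>i\<in>A. f i x)"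
  by (induction A rule: finite_induct) (auto intro: Cb_add Cb_const)

lemma Cb_prod_list:
  fixes f :: "'i \<Rightarrow> 'a::euclidean_space \<Rightarrow> real"
  shows "(\<And>i. i \<in> set is \<Longrightarrow> Cb k (f i)) \<Longrightarrow> Cb k (\<lambda>x. prod_list (map (\<lambda>i. f i x) is))"
  by (induction "is") (auto intro: Cb_mult Cb_const)

lemma Cb_bounded_linear:
  assumes "bounded_linear h"
  shows "Cb k f \<Longrightarrow> Cb k (\<lambda>x. h (f x))"
proof (induction k arbitrary: f)
  case 0
  then show ?case
    using bounded_linear_image[OF _ assms, of "range f"]
    by (auto intro!: bounded_linear.continuous_on[OF assms] simp: image_image)
next
  case (Suc k)
  have "bounded (range (\<lambda>x. h (f x)))"
    using bounded_linear_image[OF _ assms, of "range f"] Suc.prems by (auto simp: image_image)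
  with Suc show ?case
    by (intro Cb_SucI[OF bounded_linear.has_derivative[OF assms Cb_has_derivative[OF Suc.prems]]]) auto
qed

section \<open>Partial derivatives and finite difference estimates\<close>

text \<open>Iterated partial derivatives keep the codomain fixed, whereas an iterated Frechet
  derivative changes its type with the order.\<close>

abbreviation pder :: "'e \<Rightarrow> (real^'e \<Rightarrow> 'b::real_normed_vector) \<Rightarrow> real^'e \<Rightarrow> 'b" where
  "pder i f x \<equiv> frechet_derivative f (at x) (axis i 1)"

lemma Cb_pder: "Cb (Suc k) f \<Longrightarrow> Cb k (pder i f)"
  by simp

lemma vec_eq_sum_axis: "(v :: real^'e) = (\<Sum>i\<in>UNIV. v $ i *\<^sub>R axis i 1)"
  by (simp add: vec_eq_iff axis_def if_distrib cong: if_cong)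

lemma frechet_derivative_pder:
  fixes f :: "real^'e \<Rightarrow> 'b::real_normed_vector"
  assumes "f differentiable (at x)"
  shows "frechet_derivative f (at x) v = (\<Sum>i\<in>UNIV. v $ i *\<^sub>R pder i f x)"
proof -
  have l: "linear (frechet_derivative f (at x))"
    using assms by (simp add: frechet_derivative_works has_derivative_linear)
  show ?thesis
    by (subst vec_eq_sum_axis[of v]) (simp add: linear_sum[OF l] linear_scale[OF l])
qed

lemma Cb_has_derivative_pder:
  fixes f :: "real^'e \<Rightarrow> 'b::real_normed_vector"
  assumes "Cb (Suc k) f"
  shows "(f has_derivative (\<lambda>v. \<Sum>i\<in>UNIV. v $ i *\<^sub>R pder i f x)) (at x)"
proof -
  have "frechet_derivative f (at x) = (\<lambda>v. \<Sum>i\<in>UNIV. v $ i *\<^sub>R pder i f x)"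
    using assms by (intro ext frechet_derivative_pder) simp
  with Cb_has_derivative[OF assms] show ?thesis by simp
qed

text \<open>\<open>Cb\<close> bounds the derivative only for each fixed direction; expanding the
  direction in the standard basis turns finitely many such bounds into one on the operator
  norm.\<close>

lemma Cb_frechet_bound:
  fixes f :: "real^'e \<Rightarrow> 'b::real_normed_vector"
  assumes "Cb (Suc k) f"
  obtains C where "C \<ge> 0" "\<And>x v. norm (frechet_derivative f (at x) v) \<le> C * norm v"
proof -
  have "\<exists>C\<ge>0. \<forall>x. norm (pder i f x) \<le> C" for i
    using Cb_bounded[OF Cb_pder[OF assms]] .
  then obtain C where C: "\<And>i. C i \<ge> 0" "\<And>i x. norm (pder i f x) \<le> C i" by metis
  have d: "f differentiable (at x)" for x
    using Cb_has_derivative[OF assms] by (rule differentiableI)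
  have "norm (frechet_derivative f (at x) v) \<le> (\<Sum>i\<in>UNIV. C i) * norm v" for x v
  proof -
    have "norm (frechet_derivative f (at x) v) \<le> (\<Sum>i\<in>UNIV. norm (v $ i *\<^sub>R pder i f x))"
      unfolding frechet_derivative_pder[OF d, of x v] by (rule norm_sum)
    also have "\<dots> \<le> (\<Sum>i\<in>UNIV. norm v * C i)"
      by (intro sum_mono) (auto intro!: mult_mono C simp: component_le_norm_cart)
    finally show ?thesis by (simp add: sum_distrib_left mult.commute)
  qed
  with C show ?thesis by (intro that[of "\<Sum>i\<in>UNIV. C i"]) (auto intro: sum_nonneg)
qed

lemma Cb_lipschitz:
  fixes f :: "real^'e \<Rightarrow> 'b::real_normed_vector"
  assumes "Cb (Suc k) f"
  obtains C where "C \<ge> 0" "\<And>x y. norm (f x - f y) \<le> C * norm (x - y)"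
proof -
  obtain C where C: "C \<ge> 0" "\<And>x v. norm (frechet_derivative f (at x) v) \<le> C * norm v"
    by (rule Cb_frechet_bound[OF assms]; blast)
  have "norm (f x - f y) \<le> C * norm (x - y)" for x y
    by (rule differentiable_bound[of UNIV f "\<lambda>x. frechet_derivative f (at x)"])
      (auto intro!: onorm_bound C Cb_has_derivative[OF assms])
  with C show ?thesis using that by blast
qed

lemma Cb_line_derivative:
  fixes f :: "real^'e \<Rightarrow> 'b::real_normed_vector"
  assumes "Cb (Suc k) f"
  shows "((\<lambda>s. f (x + s *\<^sub>R v)) has_vector_derivative
     frechet_derivative f (at (x + s *\<^sub>R v)) v) (at s within S)"
proof -
  have "((\<lambda>s. x + s *\<^sub>R v) has_derivative (\<lambda>h. h *\<^sub>R v)) (at s within S)"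
    by (auto intro!: derivative_eq_intros)
  from has_derivative_compose[OF this Cb_has_derivative[OF assms]]
  have "((\<lambda>s. f (x + s *\<^sub>R v)) has_derivative
      (\<lambda>h. frechet_derivative f (at (x + s *\<^sub>R v)) (h *\<^sub>R v))) (at s within S)" .
  moreover have "linear (frechet_derivative f (at (x + s *\<^sub>R v)))"
    by (rule has_derivative_linear[OF Cb_has_derivative[OF assms]])
  ultimately show ?thesis
    by (simp add: has_vector_derivative_def linear_scale)
qed

lemma vector_derivative_bound_01:
  fixes g :: "real \<Rightarrow> 'b::real_normed_vector"
  assumes "\<And>s. s \<in> {0..1} \<Longrightarrow> (g has_vector_derivative g' s) (at s within {0..1})"
    and "\<And>s. s \<in> {0..1} \<Longrightarrow> norm (g' s) \<le> B"
  shows "norm (g 1 - g 0) \<le> B"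
proof -
  have "norm (g 1 - g 0) \<le> B * norm (1 - 0 :: real)"
  proof (rule differentiable_bound[of "{0..1}" g "\<lambda>s h. h *\<^sub>R g' s"])
    fix s :: real assume "s \<in> {0..1}"
    then have "norm (g' s) \<le> B" "0 \<le> B"
      using assms(2)[of s] norm_ge_zero[of "g' s"] by linarith+
    then show "onorm (\<lambda>h. h *\<^sub>R g' s) \<le> B"
      by (intro onorm_bound) (simp_all add: mult.commute[of B] mult_left_mono)
  qed (use assms(1) in \<open>auto simp: has_vector_derivative_def\<close>)
  then show ?thesis by simp
qed

text \<open>The difference of two segments with a common parameter is again a segment, and balls are
  convex.\<close>

lemma norm_line_diff_le:
  fixes x y \<xi> \<eta> :: "'a::real_normed_vector"
  assumes "norm (x - y) \<le> l" "norm ((x + \<xi>) - (y + \<eta>)) \<le> l" "s \<in> {0..1}"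
  shows "norm ((x + s *\<^sub>R \<xi>) - (y + s *\<^sub>R \<eta>)) \<le> l"
proof -
  have "(x + s *\<^sub>R \<xi>) - (y + s *\<^sub>R \<eta>) = (1 - s) *\<^sub>R (x - y) + s *\<^sub>R ((x + \<xi>) - (y + \<eta>))"
    by (simp add: algebra_simps)
  also have "norm \<dots> \<le> (1 - s) * l + s * l"
    using assms by (intro order_trans[OF norm_triangle_ineq] add_mono) (auto intro: mult_left_mono)
  finally show ?thesis by (simp add: algebra_simps)
qed

lemma Cb2_frechet_lipschitz:
  fixes f :: "real^'e \<Rightarrow> 'b::real_normed_vector"
  assumes "Cb 2 f"
  obtains C where "C \<ge> 0" "\<And>x y v. norm (frechet_derivative f (at x) v - frechet_derivative f (at y) v)
      \<le> C * (norm (x - y) * norm v)"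
proof -
  have c1: "Cb (Suc 1) f" using assms by (simp add: numeral_2_eq_2)
  have d: "f differentiable (at z)" for z
    using Cb_has_derivative[OF c1] by (rule differentiableI)
  have "\<exists>D\<ge>0. \<forall>x y. norm (pder i f x - pder i f y) \<le> D * norm (x - y)" for i
    using Cb_lipschitz[of 0 "pder i f"] Cb_pder[OF c1] by (metis One_nat_def)
  then obtain D where D: "\<And>i. D i \<ge> 0" "\<And>i x y. norm (pder i f x - pder i f y) \<le> D i * norm (x - y)"
    by metis
  have "norm (frechet_derivative f (at x) v - frechet_derivative f (at y) v)
      \<le> (\<Sum>i\<in>UNIV. D i) * (norm (x - y) * norm v)" for x y v
  proof -
    have "norm (frechet_derivative f (at x) v - frechet_derivative f (at y) v)
        = norm (\<Sum>i\<in>UNIV. v $ i *\<^sub>R (pder i f x - pder i f y))"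
      unfolding frechet_derivative_pder[OF d, of _ v] sum_subtractf[symmetric] scaleR_diff_right ..
    also have "\<dots> \<le> (\<Sum>i\<in>UNIV. norm v * (D i * norm (x - y)))"
      by (intro order_trans[OF norm_sum] sum_mono)
         (auto intro!: mult_mono D simp: component_le_norm_cart)
    also have "\<dots> = (\<Sum>i\<in>UNIV. D i) * (norm (x - y) * norm v)"
      by (simp add: sum_distrib_left sum_distrib_right mult_ac)
    finally show ?thesis .
  qed
  with D show ?thesis using that[of "\<Sum>i\<in>UNIV. D i"] by (auto simp: sum_nonneg)
qed

text \<open>The increments along two segments are compared by differentiating their difference in
  the common parameter: one part is a change of base point by at most \<open>l\<close>, handled by
  the Lipschitz derivative, the other a change of direction from \<xi> to \<eta>. Measuring the
  distance of the segments by a single \<open>l\<close> at both ends is what later allows division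
  by \<open>l\<close>.\<close>

lemma Cb2_four_point:
  fixes f :: "real^'e \<Rightarrow> 'b::real_normed_vector"
  assumes "Cb 2 f"
  obtains C where "C \<ge> 0" "\<And>x y \<xi> \<eta> l. norm (x - y) \<le> l \<Longrightarrow> norm ((x + \<xi>) - (y + \<eta>)) \<le> l \<Longrightarrow>
     norm (f (x + \<xi>) - f x - (f (y + \<eta>) - f y)) \<le> C * (l * norm \<xi> + norm (\<xi> - \<eta>))"
proof -
  have c1: "Cb (Suc 1) f" using assms by (simp add: numeral_2_eq_2)
  obtain C where C: "C \<ge> 0" "\<And>x v. norm (frechet_derivative f (at x) v) \<le> C * norm v"
    by (rule Cb_frechet_bound[OF c1]; blast)
  obtain D where D: "D \<ge> 0" "\<And>x y v. norm (frechet_derivative f (at x) v - frechet_derivative f (at y) v)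
      \<le> D * (norm (x - y) * norm v)"
    using Cb2_frechet_lipschitz[OF assms] by blast
  define E where "E = C + D"
  have DE: "D \<le> E" "C \<le> E" "E \<ge> 0" using C D by (auto simp: E_def)
  have lip: "norm (frechet_derivative f (at x) v - frechet_derivative f (at y) v)
      \<le> E * (norm (x - y) * norm v)" for x y v
    by (rule order_trans[OF D(2) mult_right_mono[OF DE(1)]]) simp
  have "norm (f (x + \<xi>) - f x - (f (y + \<eta>) - f y)) \<le> E * (l * norm \<xi> + norm (\<xi> - \<eta>))"
    if l: "norm (x - y) \<le> l" "norm ((x + \<xi>) - (y + \<eta>)) \<le> l" for x y \<xi> \<eta> l
  proof -
    let ?D = "\<lambda>x v. frechet_derivative f (at x) v"
    define g where "g = (\<lambda>s. f (x + s *\<^sub>R \<xi>) - f (y + s *\<^sub>R \<eta>))"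
    have "norm (g 1 - g 0) \<le> E * (l * norm \<xi> + norm (\<xi> - \<eta>))"
    proof (rule vector_derivative_bound_01)
      fix s :: real assume s: "s \<in> {0..1}"
      show "(g has_vector_derivative (?D (x + s *\<^sub>R \<xi>) \<xi> - ?D (y + s *\<^sub>R \<eta>) \<eta>)) (at s within {0..1})"
        unfolding g_def by (intro has_vector_derivative_diff Cb_line_derivative[OF c1])
      have lin: "linear (?D z)" for z
        by (rule has_derivative_linear[OF Cb_has_derivative[OF c1]])
      have "norm (?D (x + s *\<^sub>R \<xi>) \<xi> - ?D (y + s *\<^sub>R \<eta>) \<eta>)
          = norm ((?D (x + s *\<^sub>R \<xi>) \<xi> - ?D (y + s *\<^sub>R \<eta>) \<xi>) + ?D (y + s *\<^sub>R \<eta>) (\<xi> - \<eta>))"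
        by (simp add: linear_diff[OF lin])
      also have "\<dots> \<le> E * (l * norm \<xi>) + E * norm (\<xi> - \<eta>)"
      proof (intro order_trans[OF norm_triangle_ineq] add_mono)
        show "norm (?D (x + s *\<^sub>R \<xi>) \<xi> - ?D (y + s *\<^sub>R \<eta>) \<xi>) \<le> E * (l * norm \<xi>)"
          by (intro order_trans[OF lip] mult_left_mono mult_right_mono norm_line_diff_le l s DE) auto
        show "norm (?D (y + s *\<^sub>R \<eta>) (\<xi> - \<eta>)) \<le> E * norm (\<xi> - \<eta>)"
          by (intro order_trans[OF C(2)] mult_right_mono DE) auto
      qed
      finally show "norm (?D (x + s *\<^sub>R \<xi>) \<xi> - ?D (y + s *\<^sub>R \<eta>) \<eta>) \<le> E * (l * norm \<xi> + norm (\<xi> - \<eta>))"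
        by (simp add: algebra_simps)
    qed
    moreover have "g 1 - g 0 = f (x + \<xi>) - f x - (f (y + \<eta>) - f y)"
      by (simp add: g_def)
    ultimately show ?thesis by simp
  qed
  with DE show ?thesis using that by blast
qed

lemma Cb2_linearization:
  fixes f :: "real^'e \<Rightarrow> 'b::real_normed_vector"
  assumes "Cb 2 f"
  obtains C where "C \<ge> 0"
    "\<And>x \<xi>. norm (f (x + \<xi>) - f x - frechet_derivative f (at x) \<xi>) \<le> C * (norm \<xi>)\<^sup>2"
proof -
  have c1: "Cb (Suc 1) f" using assms by (simp add: numeral_2_eq_2)
  obtain D where D: "D \<ge> 0" "\<And>x y v. norm (frechet_derivative f (at x) v - frechet_derivative f (at y) v)
      \<le> D * (norm (x - y) * norm v)"
    using Cb2_frechet_lipschitz[OF assms] by blast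
  have "norm (f (x + \<xi>) - f x - frechet_derivative f (at x) \<xi>) \<le> D * (norm \<xi>)\<^sup>2" for x \<xi>
  proof -
    define g where "g = (\<lambda>s. f (x + s *\<^sub>R \<xi>) - s *\<^sub>R frechet_derivative f (at x) \<xi>)"
    have "norm (g 1 - g 0) \<le> D * (norm \<xi>)\<^sup>2"
    proof (rule vector_derivative_bound_01)
      fix s :: real assume s: "s \<in> {0..1}"
      show "(g has_vector_derivative (frechet_derivative f (at (x + s *\<^sub>R \<xi>)) \<xi>
          - frechet_derivative f (at x) \<xi>)) (at s within {0..1})"
        unfolding g_def
        by (intro has_vector_derivative_diff Cb_line_derivative[OF c1])
           (auto intro!: derivative_eq_intros)
      have "norm (x + s *\<^sub>R \<xi> - x) * norm \<xi> \<le> (norm \<xi>)\<^sup>2"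
        using s by (auto simp: power2_eq_square intro!: mult_right_mono mult_left_le_one_le)
      then show "norm (frechet_derivative f (at (x + s *\<^sub>R \<xi>)) \<xi> - frechet_derivative f (at x) \<xi>)
          \<le> D * (norm \<xi>)\<^sup>2"
        by (intro order_trans[OF D(2)] mult_left_mono D(1))
    qed
    then show ?thesis by (simp add: g_def algebra_simps)
  qed
  with D(1) show ?thesis using that by blast
qed

text \<open>The four point estimate raised by one order: it is applied to the partial derivatives,
  which costs the third derivative of \<open>f\<close>. Every term on the right contains either
  \<open>l\<close> or the difference of the two increments, and is quadratic in the increments
  otherwise.\<close>

lemma Cb3_linearization_diff:
  fixes f :: "real^'e \<Rightarrow> 'b::real_normed_vector"
  assumes "Cb 3 f"
  obtains C where "C \<ge> 0" "\<And>x y \<xi> \<eta> l. norm (x - y) \<le> l \<Longrightarrow> norm ((x + \<xi>) - (y + \<eta>)) \<le> l \<Longrightarrow>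
     norm ((f (x + \<xi>) - f x - frechet_derivative f (at x) \<xi>)
         - (f (y + \<eta>) - f y - frechet_derivative f (at y) \<eta>))
       \<le> C * (l * (norm \<xi>)\<^sup>2 + norm (\<xi> - \<eta>) * (norm \<xi> + norm \<eta>))"
proof -
  have c2: "Cb (Suc 2) f" using assms by (simp add: eval_nat_numeral)
  have d: "f differentiable (at z)" for z
    using Cb_has_derivative[OF c2] by (rule differentiableI)
  have c2p: "Cb 2 (pder i f)" for i by (rule Cb_pder[OF c2])
  have c1p: "Cb (Suc 1) (pder i f)" for i using c2p[of i] by (simp only: numeral_2_eq_2 One_nat_def)
  have "\<exists>D\<ge>0. \<forall>x y. norm (pder i f x - pder i f y) \<le> D * norm (x - y)" for i
    using Cb_lipschitz[OF c1p] by metis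
  then obtain D where D: "\<And>i. D i \<ge> 0" "\<And>i x y. norm (pder i f x - pder i f y) \<le> D i * norm (x - y)"
    by metis
  have "\<exists>G\<ge>0. \<forall>x y \<xi> \<eta> l. norm (x - y) \<le> l \<longrightarrow> norm ((x + \<xi>) - (y + \<eta>)) \<le> l \<longrightarrow>
     norm (pder i f (x + \<xi>) - pder i f x - (pder i f (y + \<eta>) - pder i f y))
       \<le> G * (l * norm \<xi> + norm (\<xi> - \<eta>))" for i
    by (rule Cb2_four_point[OF c2p, of i]) blast
  then obtain G where G: "\<And>i. G i \<ge> 0" "\<And>i x y \<xi> \<eta> l. norm (x - y) \<le> l \<Longrightarrow>
     norm ((x + \<xi>) - (y + \<eta>)) \<le> l \<Longrightarrow>
     norm (pder i f (x + \<xi>) - pder i f x - (pder i f (y + \<eta>) - pder i f y))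
       \<le> G i * (l * norm \<xi> + norm (\<xi> - \<eta>))"
    by metis
  let ?D = "\<lambda>x v. frechet_derivative f (at x) v"
  define E where "E = (\<Sum>i\<in>UNIV. G i + D i)"
  have E0: "E \<ge> 0" using G D by (auto simp: E_def intro!: sum_nonneg add_nonneg_nonneg)
  have "norm ((f (x + \<xi>) - f x - ?D x \<xi>) - (f (y + \<eta>) - f y - ?D y \<eta>))
       \<le> E * (l * (norm \<xi>)\<^sup>2 + norm (\<xi> - \<eta>) * (norm \<xi> + norm \<eta>))"
    if l: "norm (x - y) \<le> l" "norm ((x + \<xi>) - (y + \<eta>)) \<le> l" for x y \<xi> \<eta> l
  proof -
    define g where "g = (\<lambda>s. f (x + s *\<^sub>R \<xi>) - s *\<^sub>R ?D x \<xi> - (f (y + s *\<^sub>R \<eta>) - s *\<^sub>R ?D y \<eta>))"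
    have l0: "l \<ge> 0" using l(1) norm_ge_zero order_trans by blast
    have "norm (g 1 - g 0) \<le> E * (l * (norm \<xi>)\<^sup>2 + norm (\<xi> - \<eta>) * (norm \<xi> + norm \<eta>))"
    proof (rule vector_derivative_bound_01)
      fix s :: real assume s: "s \<in> {0..1}"
      let ?g' = "?D (x + s *\<^sub>R \<xi>) \<xi> - ?D x \<xi> - (?D (y + s *\<^sub>R \<eta>) \<eta> - ?D y \<eta>)"
      show "(g has_vector_derivative ?g') (at s within {0..1})"
        unfolding g_def
        by (intro has_vector_derivative_diff Cb_line_derivative[OF c2])
           (auto intro!: derivative_eq_intros)
      let ?a = "\<lambda>i. pder i f (x + s *\<^sub>R \<xi>) - pder i f x - (pder i f (y + s *\<^sub>R \<eta>) - pder i f y)"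
      let ?b = "\<lambda>i. pder i f (y + s *\<^sub>R \<eta>) - pder i f y"
      \<comment> \<open>The difference of two products is split so that \<xi> multiplies a four
        point difference of a partial derivative, while \<xi> - \<eta> multiplies an increment along
        the second segment only.\<close>
      have g': "?g' = (\<Sum>i\<in>UNIV. \<xi> $ i *\<^sub>R ?a i + (\<xi> - \<eta>) $ i *\<^sub>R ?b i)"
        unfolding frechet_derivative_pder[OF d, of _ \<xi>] frechet_derivative_pder[OF d, of _ \<eta>]
          sum_subtractf[symmetric]
        by (intro sum.cong refl) (simp add: scaleR_diff_right scaleR_diff_left)
      have "norm ?g' \<le> (\<Sum>i\<in>UNIV. (G i + D i) * (l * (norm \<xi>)\<^sup>2 + norm (\<xi> - \<eta>) * (norm \<xi> + norm \<eta>)))"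
        unfolding g'
      proof (intro order_trans[OF norm_sum] sum_mono)
        fix i
        have a: "norm (?a i) \<le> G i * (l * norm \<xi> + norm (\<xi> - \<eta>))"
        proof -
          have "norm (?a i) \<le> G i * (l * norm (s *\<^sub>R \<xi>) + norm (s *\<^sub>R \<xi> - s *\<^sub>R \<eta>))"
            by (intro G l norm_line_diff_le[OF _ _ s])
          also have "norm (s *\<^sub>R \<xi> - s *\<^sub>R \<eta>) = s * norm (\<xi> - \<eta>)"
            using s by (simp flip: scaleR_diff_right)
          also have "G i * (l * norm (s *\<^sub>R \<xi>) + s * norm (\<xi> - \<eta>))
              = G i * (s * (l * norm \<xi> + norm (\<xi> - \<eta>)))"
            using s by (simp add: algebra_simps)
          also have "\<dots> \<le> G i * (l * norm \<xi> + norm (\<xi> - \<eta>))"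
            using s l0 G(1) by (intro mult_left_mono mult_left_le_one_le) auto
          finally show ?thesis .
        qed
        have b: "norm (?b i) \<le> D i * norm \<eta>"
          by (rule order_trans[OF D(2)])
            (use s D(1) in \<open>auto intro!: mult_left_mono mult_left_le_one_le\<close>)
        have "norm (\<xi> $ i *\<^sub>R ?a i + (\<xi> - \<eta>) $ i *\<^sub>R ?b i)
          \<le> norm \<xi> * (G i * (l * norm \<xi> + norm (\<xi> - \<eta>))) + norm (\<xi> - \<eta>) * (D i * norm \<eta>)"
        proof (intro order_trans[OF norm_triangle_ineq] add_mono)
          show "norm (\<xi> $ i *\<^sub>R ?a i) \<le> norm \<xi> * (G i * (l * norm \<xi> + norm (\<xi> - \<eta>)))"
            unfolding norm_scaleR by (intro mult_mono a) (auto simp: component_le_norm_cart)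
          show "norm ((\<xi> - \<eta>) $ i *\<^sub>R ?b i) \<le> norm (\<xi> - \<eta>) * (D i * norm \<eta>)"
            unfolding norm_scaleR
            using component_le_norm_cart[of "\<xi> - \<eta>" i] by (intro mult_mono b) auto
        qed
        also have "\<dots> \<le> (G i + D i) * (l * (norm \<xi>)\<^sup>2 + norm (\<xi> - \<eta>) * (norm \<xi> + norm \<eta>))"
        proof -
          have "0 \<le> D i * (l * (norm \<xi>)\<^sup>2)" "0 \<le> D i * (norm (\<xi> - \<eta>) * norm \<xi>)"
            "0 \<le> G i * (norm (\<xi> - \<eta>) * norm \<eta>)"
            using G(1)[of i] D(1)[of i] l0 by simp_all
          then show ?thesis by (simp add: algebra_simps power2_eq_square)
        qed
        finally show "norm (\<xi> $ i *\<^sub>R ?a i + (\<xi> - \<eta>) $ i *\<^sub>R ?b i)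
          \<le> (G i + D i) * (l * (norm \<xi>)\<^sup>2 + norm (\<xi> - \<eta>) * (norm \<xi> + norm \<eta>))" .
      qed
      then show "norm ?g' \<le> E * (l * (norm \<xi>)\<^sup>2 + norm (\<xi> - \<eta>) * (norm \<xi> + norm \<eta>))"
        by (simp add: E_def sum_distrib_right)
    qed
    then show ?thesis by (simp add: g_def algebra_simps)
  qed
  with E0 show ?thesis using that by blast
qed

text \<open>The second difference \<open>\<Delta>\<close> is symmetric in \<open>i\<close> and
  \<open>j\<close>, and the mean value theorem applied in each of the two directions identifies it
  with \<open>h^2\<close> times a mixed partial derivative at a point within \<open>2 * h\<close>;
  since that derivative is Lipschitz, the error is O(h^3).\<close>

lemma Cb3_pder_commute:
  fixes f :: "real^'e \<Rightarrow> real"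
  assumes "Cb 3 f"
  shows "pder i (pder j f) x = pder j (pder i f) x"
proof -
  have c: "Cb (Suc 2) f" using assms by (simp add: eval_nat_numeral)
  have c2p: "Cb (Suc 1) (pder i f)" for i using Cb_pder[OF c, of i] by (simp only: numeral_2_eq_2 One_nat_def)
  have "\<exists>L\<ge>0. \<forall>x y. norm (pder j (pder i f) x - pder j (pder i f) y) \<le> L * norm (x - y)" for i j
    using Cb_lipschitz[of 0 "pder j (pder i f)"] Cb_pder[OF c2p[of i]] by (metis One_nat_def)
  then obtain L where L: "\<And>i j. L i j \<ge> 0"
    "\<And>i j x y. norm (pder j (pder i f) x - pder j (pder i f) y) \<le> L i j * norm (x - y)"
    by metis
  define \<Delta> where "\<Delta> i j h = f (x + h *\<^sub>R axis i 1 + h *\<^sub>R axis j 1) - f (x + h *\<^sub>R axis i 1)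
     - (f (x + h *\<^sub>R axis j 1) - f x)" for i j h
  have est: "\<bar>\<Delta> i j h - h\<^sup>2 * pder j (pder i f) x\<bar> \<le> L i j * (2 * h) * h\<^sup>2" if "h > 0" for i j h
  proof -
    let ?ei = "axis i 1 :: real^'e" and ?ej = "axis j 1 :: real^'e"
    let ?g = "\<lambda>s. f ((x + h *\<^sub>R ?ej) + s *\<^sub>R ?ei) - f (x + s *\<^sub>R ?ei)"
    have "\<exists>s>0. s < h \<and> ?g h - ?g 0 = (h - 0) * (pder i f ((x + h *\<^sub>R ?ej) + s *\<^sub>R ?ei) - pder i f (x + s *\<^sub>R ?ei))"
      using that by (intro MVT2 DERIV_diff)
        (auto intro!: Cb_line_derivative[OF c] simp: has_real_derivative_iff_has_vector_derivative)
    then obtain s where s: "0 < s" "s < h"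
      "?g h - ?g 0 = h * (pder i f ((x + h *\<^sub>R ?ej) + s *\<^sub>R ?ei) - pder i f (x + s *\<^sub>R ?ei))"
      by auto
    let ?k = "\<lambda>r. pder i f ((x + s *\<^sub>R ?ei) + r *\<^sub>R ?ej)"
    have "\<exists>r>0. r < h \<and> ?k h - ?k 0 = (h - 0) * pder j (pder i f) ((x + s *\<^sub>R ?ei) + r *\<^sub>R ?ej)"
      using that by (intro MVT2)
        (auto intro!: Cb_line_derivative[OF c2p] simp: has_real_derivative_iff_has_vector_derivative)
    then obtain r where r: "0 < r" "r < h"
      "?k h - ?k 0 = h * pder j (pder i f) ((x + s *\<^sub>R ?ei) + r *\<^sub>R ?ej)" by auto
    have "\<Delta> i j h = ?g h - ?g 0" by (simp add: \<Delta>_def algebra_simps)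
    also have "\<dots> = h * (?k h - ?k 0)" unfolding s(3) by (simp add: add_ac)
    also have "\<dots> = h\<^sup>2 * pder j (pder i f) ((x + s *\<^sub>R ?ei) + r *\<^sub>R ?ej)"
      by (simp only: r(3) power2_eq_square mult.assoc)
    finally have "\<bar>\<Delta> i j h - h\<^sup>2 * pder j (pder i f) x\<bar>
      = h\<^sup>2 * norm (pder j (pder i f) ((x + s *\<^sub>R ?ei) + r *\<^sub>R ?ej) - pder j (pder i f) x)"
      by (simp add: abs_mult right_diff_distrib[symmetric])
    also have "\<dots> \<le> h\<^sup>2 * (L i j * norm (s *\<^sub>R ?ei + r *\<^sub>R ?ej))"
      using L(2)[where i=i and j=j and x="(x + s *\<^sub>R ?ei) + r *\<^sub>R ?ej" and y=x] by (intro mult_left_mono) (auto simp: algebra_simps)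
    also have "\<dots> \<le> h\<^sup>2 * (L i j * (2 * h))"
    proof (intro mult_left_mono L)
      have "norm (s *\<^sub>R ?ei + r *\<^sub>R ?ej) \<le> s + r"
        using s r by (intro order_trans[OF norm_triangle_ineq]) auto
      then show "norm (s *\<^sub>R ?ei + r *\<^sub>R ?ej) \<le> 2 * h" using s r by simp
    qed auto
    finally show ?thesis by (simp add: mult_ac)
  qed
  have sym: "\<Delta> i j h = \<Delta> j i h" for h by (simp add: \<Delta>_def algebra_simps)
  let ?d = "\<bar>pder j (pder i f) x - pder i (pder j f) x\<bar>" and ?M = "2 * (L i j + L j i)"
  have "?d \<le> ?M * h" if "h > 0" for h
  proof -
    have "h\<^sup>2 * ?d = \<bar>h\<^sup>2 * pder j (pder i f) x - h\<^sup>2 * pder i (pder j f) x\<bar>"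
      by (simp add: right_diff_distrib[symmetric] abs_mult)
    also have "\<dots> \<le> h\<^sup>2 * (?M * h)"
      using est[OF that, of i j] est[OF that, of j i] by (simp add: sym algebra_simps abs_le_iff)
    finally show ?thesis using that by simp
  qed
  then have "?d \<le> 0 + e" if "e > 0" for e
  proof -
    have M: "?M \<ge> 0" using L(1)[of i j] L(1)[of j i] by simp
    have "?d \<le> ?M * (e / (?M + 1))" using that M by (intro \<open>\<And>h. h > 0 \<Longrightarrow> ?d \<le> ?M * h\<close>) simp
    also have "\<dots> \<le> e" using M that by (simp add: field_simps)
    finally show ?thesis by simp
  qed
  then have "?d \<le> 0" by (rule field_le_epsilon)
  then show ?thesis by simp
qed

section \<open>Taylor polynomials and their remainders\<close>

text \<open>The n-th derivative at \<open>y\<close> applied n times to \<open>x - y\<close>, that is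
  n! times the homogeneous Taylor term of degree n.\<close>

primrec tay :: "nat \<Rightarrow> (real^'e \<Rightarrow> real) \<Rightarrow> real^'e \<Rightarrow> real^'e \<Rightarrow> real" where
  "tay 0 f y x = f y"
| "tay (Suc n) f y x = (\<Sum>i\<in>UNIV. (x $ i - y $ i) * tay n (pder i f) y x)"

text \<open>The polynomial has \<open>p\<close> terms, hence degree at most p - 1, so that the index
  is the order to which the remainder vanishes.\<close>

definition tay_rem :: "nat \<Rightarrow> (real^'e \<Rightarrow> real) \<Rightarrow> real^'e \<Rightarrow> real^'e \<Rightarrow> real" where
  "tay_rem p f y x = f x - (\<Sum>n<p. tay n f y x / fact n)"

lemma pder_pder_commute_fun:
  assumes "Cb (Suc (Suc (Suc n))) f"
  shows "pder i (pder j f) = pder j (pder i (f :: real^'e \<Rightarrow> real))"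
  using Cb_le[OF assms, of 3] by (intro ext Cb3_pder_commute) simp

text \<open>Symmetry of the second partial derivatives lets the direction \<open>j\<close> of
  differentiation trade places with the direction \<open>i\<close> of the expansion; summing over
  \<open>i\<close> then rebuilds a Taylor term of \<open>pder j f\<close>.\<close>

lemma tay_pder_sum:
  fixes f :: "real^'e \<Rightarrow> real"
  assumes "Cb (Suc (Suc n)) f"
  shows "(\<Sum>i\<in>UNIV. (x $ i - y $ i) * (real n * tay (n - 1) (pder j (pder i f)) y x))
    = real n * tay n (pder j f) y x"
proof (cases n)
  case (Suc k)
  have "pder j (pder i f) = pder i (pder j f)" for i
    using assms Suc by (intro pder_pder_commute_fun[where n=k]) (simp del: Cb.simps)
  then show ?thesis by (simp add: Suc sum_distrib_left mult_ac del: of_nat_Suc)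
qed simp

lemma tay_shift_sum:
  "(\<Sum>n<Suc p. real n * tay (n - 1) g y x / fact n) = (\<Sum>n<p. tay n g y x / fact n)"
  by (subst sum.lessThan_Suc_shift) (simp del: of_nat_Suc)

text \<open>Differentiating the leading linear factor gives one copy of the lower Taylor term,
  differentiating the rest gives n copies by symmetry. For n = 0 the truncated index
  \<open>n - 1\<close> is harmless because the factor \<open>real n\<close> vanishes.\<close>

lemma has_derivative_tay:
  fixes f :: "real^'e \<Rightarrow> real"
  assumes "Cb (Suc n) f"
  shows "(tay n f y has_derivative (\<lambda>v. \<Sum>j\<in>UNIV. v $ j * (real n * tay (n - 1) (pder j f) y x))) (at x)"
  using assms
proof (induction n arbitrary: f)
  case 0
  show ?case by simp
next
  case (Suc n)
  have IH: "(tay n (pder i f) y has_derivative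
      (\<lambda>v. \<Sum>j\<in>UNIV. v $ j * (real n * tay (n - 1) (pder j (pder i f)) y x))) (at x)" for i
    by (rule Suc.IH[OF Cb_pder[OF Suc.prems]])
  have lin: "((\<lambda>x. x $ i - y $ i) has_derivative (\<lambda>v. v $ i)) (at x)" for i
    using has_derivative_diff[OF bounded_linear_imp_has_derivative[OF bounded_linear_vec_nth[of i]]
        has_derivative_const[where c="y $ i" and F="at x"]] by simp
  have "((\<lambda>x. \<Sum>i\<in>UNIV. (x $ i - y $ i) * tay n (pder i f) y x) has_derivative
    (\<lambda>v. \<Sum>i\<in>UNIV. (x $ i - y $ i) * (\<Sum>j\<in>UNIV. v $ j * (real n * tay (n - 1) (pder j (pder i f)) y x))
       + v $ i * tay n (pder i f) y x)) (at x)"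
    by (intro has_derivative_sum has_derivative_mult IH lin)
  moreover have "(\<Sum>i\<in>UNIV. (x $ i - y $ i) * (\<Sum>j\<in>UNIV. v $ j * (real n * tay (n - 1) (pder j (pder i f)) y x))
       + v $ i * tay n (pder i f) y x)
     = (\<Sum>j\<in>UNIV. v $ j * (real (Suc n) * tay (Suc n - 1) (pder j f) y x))" for v
  proof -
    have "(\<Sum>i\<in>UNIV. (x $ i - y $ i) * (\<Sum>j\<in>UNIV. v $ j * (real n * tay (n - 1) (pder j (pder i f)) y x)))
        = (\<Sum>j\<in>UNIV. v $ j * (\<Sum>i\<in>UNIV. (x $ i - y $ i) * (real n * tay (n - 1) (pder j (pder i f)) y x)))"
      unfolding sum_distrib_left by (subst sum.swap) (simp only: mult.left_commute)
    also have "\<dots> = (\<Sum>j\<in>UNIV. v $ j * (real n * tay n (pder j f) y x))"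
      unfolding tay_pder_sum[OF Suc.prems] ..
    finally have eq: "(\<Sum>i\<in>UNIV. (x $ i - y $ i) * (\<Sum>j\<in>UNIV. v $ j * (real n * tay (n - 1) (pder j (pder i f)) y x)))
        = (\<Sum>j\<in>UNIV. v $ j * (real n * tay n (pder j f) y x))" .
    show ?thesis unfolding sum.distrib eq by (simp add: sum.distrib algebra_simps)
  qed
  ultimately show ?case by simp
qed

text \<open>The partial derivatives of a remainder are the remainders of the partial derivatives, of
  one order less. The class of remainders is therefore closed under differentiation, and its size
  and its controlled structure along a path come from the same bound.\<close>

lemma has_derivative_tay_rem:
  fixes f :: "real^'e \<Rightarrow> real"
  assumes "Cb (Suc p) f"
  shows "(tay_rem (Suc p) f y has_derivative (\<lambda>v. \<Sum>j\<in>UNIV. v $ j * tay_rem p (pder j f) y x)) (at x)"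
proof -
  have "((\<lambda>x. f x - (\<Sum>n<Suc p. tay n f y x / fact n)) has_derivative
     (\<lambda>v. (\<Sum>j\<in>UNIV. v $ j *\<^sub>R pder j f x)
        - (\<Sum>n<Suc p. (\<Sum>j\<in>UNIV. v $ j * (real n * tay (n - 1) (pder j f) y x)) / fact n))) (at x)"
  proof (intro has_derivative_diff has_derivative_sum bounded_linear.has_derivative[OF bounded_linear_divide]
        Cb_has_derivative_pder[OF assms])
    fix n assume "n \<in> {..<Suc p}"
    then show "(tay n f y has_derivative (\<lambda>v. \<Sum>j\<in>UNIV. v $ j * (real n * tay (n - 1) (pder j f) y x))) (at x)"
      using assms by (intro has_derivative_tay Cb_le[OF assms]) auto
  qed
  moreover have "(\<Sum>n<Suc p. (\<Sum>j\<in>UNIV. v $ j * (real n * tay (n - 1) (pder j f) y x)) / fact n)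
     = (\<Sum>j\<in>UNIV. v $ j * (\<Sum>n<p. tay n (pder j f) y x / fact n))" for v
  proof -
    have "(\<Sum>n<Suc p. (\<Sum>j\<in>UNIV. v $ j * (real n * tay (n - 1) (pder j f) y x)) / fact n)
        = (\<Sum>j\<in>UNIV. v $ j * (\<Sum>n<Suc p. real n * tay (n - 1) (pder j f) y x / fact n))"
      unfolding sum_divide_distrib sum_distrib_left by (subst sum.swap) simp
    also have "\<dots> = (\<Sum>j\<in>UNIV. v $ j * (\<Sum>n<p. tay n (pder j f) y x / fact n))"
      unfolding tay_shift_sum ..
    finally show ?thesis .
  qed
  ultimately show ?thesis
    unfolding tay_rem_def[abs_def] by (simp add: sum_subtractf right_diff_distrib)
qed

lemma tay_self: "n > 0 \<Longrightarrow> tay n f y y = 0"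
  by (cases n) auto

lemma tay_rem_self: "tay_rem (Suc p) f y y = 0"
  unfolding tay_rem_def by (subst sum.lessThan_Suc_shift) (simp add: tay_self)

text \<open>The remainder vanishes at \<open>y\<close> and its gradient consists of remainders of
  one order less, so the mean value inequality on the segment gains one power of the distance at
  each step of the induction.\<close>

lemma tay_rem_bound:
  fixes f :: "real^'e \<Rightarrow> real"
  assumes "Cb p f"
  obtains C where "C \<ge> 0" "\<And>x y. \<bar>tay_rem p f y x\<bar> \<le> C * norm (x - y) ^ p"
  using assms
proof (induction p arbitrary: f thesis)
  case 0
  then show ?case using Cb_bounded[OF 0(2)] by (auto simp: tay_rem_def)
next
  case (Suc p)
  have "\<exists>C\<ge>0. \<forall>x y. \<bar>tay_rem p (pder j f) y x\<bar> \<le> C * norm (x - y) ^ p" for j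
    using Suc.IH[OF _ Cb_pder[OF Suc.prems(2)], of j] by metis
  then obtain C where C: "\<And>j. C j \<ge> 0" "\<And>j x y. \<bar>tay_rem p (pder j f) y x\<bar> \<le> C j * norm (x - y) ^ p"
    by metis
  have "\<bar>tay_rem (Suc p) f y x\<bar> \<le> (\<Sum>j\<in>UNIV. C j) * norm (x - y) ^ Suc p" for x y
  proof -
    have "norm (tay_rem (Suc p) f y x - tay_rem (Suc p) f y y)
        \<le> ((\<Sum>j\<in>UNIV. C j) * norm (x - y) ^ p) * norm (x - y)"
    proof (rule differentiable_bound[of "closed_segment y x"])
      fix z assume z: "z \<in> closed_segment y x"
      show "(tay_rem (Suc p) f y has_derivative (\<lambda>v. \<Sum>j\<in>UNIV. v $ j * tay_rem p (pder j f) y z))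
          (at z within closed_segment y x)"
        by (rule has_derivative_at_withinI[OF has_derivative_tay_rem[OF Suc.prems(2)]])
      have zy: "norm (z - y) \<le> norm (x - y)"
        using segment_bound1[OF z] by (simp add: norm_minus_commute)
      show "onorm (\<lambda>v. \<Sum>j\<in>UNIV. v $ j * tay_rem p (pder j f) y z) \<le> (\<Sum>j\<in>UNIV. C j) * norm (x - y) ^ p"
      proof (rule onorm_bound)
        fix v
        have "norm (\<Sum>j\<in>UNIV. v $ j * tay_rem p (pder j f) y z)
            \<le> (\<Sum>j\<in>UNIV. norm v * (C j * norm (x - y) ^ p))"
        proof (intro order_trans[OF norm_sum] sum_mono)
          fix j
          have "\<bar>tay_rem p (pder j f) y z\<bar> \<le> C j * norm (x - y) ^ p"
            by (rule order_trans[OF C(2)]) (intro mult_left_mono power_mono zy C, simp)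
          then show "norm (v $ j * tay_rem p (pder j f) y z) \<le> norm v * (C j * norm (x - y) ^ p)"
            unfolding norm_mult by (intro mult_mono) (auto simp: component_le_norm_cart)
        qed
        then show "norm (\<Sum>j\<in>UNIV. v $ j * tay_rem p (pder j f) y z)
            \<le> ((\<Sum>j\<in>UNIV. C j) * norm (x - y) ^ p) * norm v"
          by (simp add: sum_distrib_left sum_distrib_right mult_ac)
      qed (simp add: C sum_nonneg)
    qed auto
    then show ?thesis by (simp add: tay_rem_self mult_ac)
  qed
  with C show ?case by (intro Suc.prems(1)[of "\<Sum>j\<in>UNIV. C j"]) (auto intro: sum_nonneg)
qed

section \<open>Expansion of fixed points over trees\<close>

text \<open>Planar trees, labelled by pairs \<open>(a, i)\<close> of a vector field and a component: one planar tree for each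
  word in the Taylor expansion of \<open>F\<^sub>a\<^sup>i\<close>, so that no symmetry factors occur. Only the labels \<open>a\<close> and the
  shape matter for the coefficient of the driver.\<close>

datatype 'l ptree = PNode (plabel: 'l) "'l ptree list"

primrec psize :: "'l ptree \<Rightarrow> nat" where
  "psize (PNode l ts) = Suc (sum_list (map psize ts))"

text \<open>The trees with at most \<open>k\<close> vertices whose vertices all have fewer than
  \<open>p\<close> children: a Taylor expansion of order \<open>p\<close> contains only words of
  length less than \<open>p\<close>. The recursion runs over the size bound, which also bounds the
  depth and makes the set finite for finitely many labels.\<close>

primrec ptrees :: "nat \<Rightarrow> nat \<Rightarrow> 'l ptree set" where
  "ptrees p 0 = {}"
| "ptrees p (Suc k) = case_prod PNode `
     (UNIV \<times> {ts. set ts \<subseteq> ptrees p k \<and> length ts < p \<and> sum_list (map psize ts) \<le> k})"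

definition pforests :: "nat \<Rightarrow> nat \<Rightarrow> 'l ptree list set" where
  "pforests p k = {ts. set ts \<subseteq> ptrees p k \<and> length ts < p \<and> sum_list (map psize ts) \<le> k}"

lemma finite_lists_length_less: "finite P \<Longrightarrow> finite {ts. set ts \<subseteq> P \<and> length ts < p}"
  by (rule finite_subset[OF _ finite_lists_length_le[of P p]]) auto

lemma finite_ptrees: "finite (ptrees p k :: 'l::finite ptree set)"
proof (induction k)
  case (Suc k)
  have "finite {ts. set ts \<subseteq> (ptrees p k :: 'l ptree set) \<and> length ts < p \<and> sum_list (map psize ts) \<le> k}"
    by (rule finite_subset[OF _ finite_lists_length_less[OF Suc, of p]]) auto
  then show ?case by simp
qed simp

lemma finite_pforests: "finite (pforests p k :: 'l::finite ptree list set)"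
  unfolding pforests_def by (rule finite_subset[OF _ finite_lists_length_less[OF finite_ptrees[of p k], of p]]) auto

lemma psize_ptrees: "\<tau> \<in> ptrees p k \<Longrightarrow> psize \<tau> \<le> k"
  by (cases k) auto

lemma ptrees_Suc: "ptrees p (Suc k) = case_prod PNode ` (UNIV \<times> pforests p k)"
  by (simp add: pforests_def)

lemma sum_ptrees_root:
  fixes f :: "('m::finite \<times> 'e::finite) ptree \<Rightarrow> 'x::comm_monoid_add"
  shows "(\<Sum>\<tau> | \<tau> \<in> ptrees p (Suc k) \<and> snd (plabel \<tau>) = i. f \<tau>)
    = (\<Sum>a\<in>UNIV. \<Sum>ts\<in>pforests p k. f (PNode (a, i) ts))"
proof -
  have "(\<Sum>a\<in>UNIV. \<Sum>ts\<in>pforests p k. f (PNode (a, i) ts))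
      = (\<Sum>(a, ts)\<in>UNIV \<times> pforests p k. f (PNode (a, i) ts))"
    by (simp add: sum.cartesian_product)
  also have "\<dots> = (\<Sum>\<tau> | \<tau> \<in> ptrees p (Suc k) \<and> snd (plabel \<tau>) = i. f \<tau>)"
    by (rule sum.reindex_bij_witness[of _ "\<lambda>\<tau>. case \<tau> of PNode l ts \<Rightarrow> (fst l, ts)" "\<lambda>(a, ts). PNode (a, i) ts"])
      (auto simp: ptrees_Suc simp del: ptrees.simps split: ptree.splits)
  finally show ?thesis by simp
qed

text \<open>Distributivity: choosing one tree for each letter of the word is the same as choosing a
  list of trees whose root labels spell the word.\<close>

lemma prod_list_sum_expand:
  fixes f :: "'t \<Rightarrow> 'x::comm_ring_1"
  assumes "finite P"
  shows "prod_list (map (\<lambda>i. \<Sum>\<tau> | \<tau> \<in> P \<and> lab \<tau> = i. f \<tau>) w)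
    = (\<Sum>ts | set ts \<subseteq> P \<and> map lab ts = w. prod_list (map f ts))"
proof (induction w)
  case Nil
  have "{ts. set ts \<subseteq> P \<and> ts = []} = {[]}" by auto
  then show ?case by simp
next
  case (Cons i w)
  have "prod_list (map (\<lambda>i. \<Sum>\<tau> | \<tau> \<in> P \<and> lab \<tau> = i. f \<tau>) (i # w))
      = (\<Sum>(\<tau>, ts)\<in>{\<tau>. \<tau> \<in> P \<and> lab \<tau> = i} \<times> {ts. set ts \<subseteq> P \<and> map lab ts = w}. f \<tau> * prod_list (map f ts))"
    by (simp add: Cons sum_product sum.cartesian_product)
  also have "\<dots> = (\<Sum>ts | set ts \<subseteq> P \<and> map lab ts = i # w. prod_list (map f ts))"
    by (rule sum.reindex_bij_witness[of _ "\<lambda>ts. (hd ts, tl ts)" "\<lambda>(\<tau>, ts). \<tau> # ts"]) auto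
  finally show ?case .
qed

text \<open>A component of the elementary differential of a B-series: each vertex contributes a
  Taylor coefficient of the field component named by its label, in the directions named by the
  components at the roots of its subtrees. The factorials are contained in \<open>c\<close>.\<close>

primrec elem_diff :: "('m \<times> 'e \<Rightarrow> 'e list \<Rightarrow> real) \<Rightarrow> ('m \<times> 'e) ptree \<Rightarrow> real" where
  "elem_diff c (PNode l ts) = c l (map (\<lambda>t. snd (plabel t)) ts) * prod_list (map (elem_diff c) ts)"

text \<open>The ring \<open>'x\<close> is instantiated by scalar controlled paths (\<open>I w a\<close> is integration against \<open>Z\<^sup>a\<close>) and by
  the stage vectors \<open>\<real>\<^sup>q\<close> with componentwise product (\<open>I w a\<close> is multiplication by \<open>\<Z>\<^sup>(\<^sup>a\<^sup>)\<close>). The relation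
  \<open>nb w x c\<close> says that \<open>x\<close> is bounded by \<open>c\<close>; \<open>nb w x 0\<close> stands for equality to \<open>0\<close> as far as visible on \<open>w\<close>.\<close>

locale tree_expansion =
  fixes Om :: "'w set" and eps :: "'w \<Rightarrow> real"
    and nb :: "'w \<Rightarrow> 'x::comm_ring_1 \<Rightarrow> real \<Rightarrow> bool"
    and cst :: "real \<Rightarrow> 'x" and K E :: real
    and I :: "'w \<Rightarrow> 'm::finite \<Rightarrow> 'x \<Rightarrow> 'x"
  assumes K0: "0 \<le> K"
    and eps: "w \<in> Om \<Longrightarrow> 0 \<le> eps w \<and> eps w \<le> E"
    and cst_1: "cst 1 = 1" and cst_add: "cst (r + s) = cst r + cst s"
    and cst_mult: "cst (r * s) = cst r * cst s"
    and nb_mono: "w \<in> Om \<Longrightarrow> nb w x c \<Longrightarrow> c \<le> d \<Longrightarrow> nb w x d"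
    and nb_cst: "w \<in> Om \<Longrightarrow> nb w (cst r) \<bar>r\<bar>"
    and nb_add: "w \<in> Om \<Longrightarrow> nb w x c \<Longrightarrow> nb w y d \<Longrightarrow> nb w (x + y) (c + d)"
    and nb_mult: "w \<in> Om \<Longrightarrow> nb w x c \<Longrightarrow> nb w y d \<Longrightarrow> 0 \<le> c \<Longrightarrow> 0 \<le> d \<Longrightarrow> nb w (x * y) (K * c * d)"
    and nb_I: "w \<in> Om \<Longrightarrow> nb w x c \<Longrightarrow> 0 \<le> c \<Longrightarrow> nb w (I w a x) (K * eps w * c)"
    and I_add: "w \<in> Om \<Longrightarrow> nb w x c \<Longrightarrow> nb w y d \<Longrightarrow> nb w (I w a (x + y) - (I w a x + I w a y)) 0"
    and I_cst: "w \<in> Om \<Longrightarrow> nb w x c \<Longrightarrow> nb w (I w a (cst r * x) - cst r * I w a x) 0"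
begin

section \<open>Calculus of orders of smallness\<close>

text \<open>A Landau symbol that is uniform over the index set. The interval, and for the method
  also the starting value, is part of the index, so every constant found here is independent of
  them.\<close>

definition small :: "nat \<Rightarrow> ('w \<Rightarrow> 'x) \<Rightarrow> bool" where
  "small k f \<longleftrightarrow> (\<exists>C\<ge>0. \<forall>w\<in>Om. nb w (f w) (C * eps w ^ k))"

primrec Phi :: "'w \<Rightarrow> ('m \<times> 'e) ptree \<Rightarrow> 'x" where
  "Phi w (PNode l ts) = I w (fst l) (prod_list (map (Phi w) ts))"

lemma cst_0: "cst 0 = 0"
  using cst_add[of 0 0] by simp

lemma cst_minus: "cst (- r) = - cst r"
  using cst_add[of r "- r"] by (simp add: cst_0 eq_neg_iff_add_eq_0 add.commute)

lemma small_le: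
  assumes "small k f" "j \<le> k" shows "small j f"
proof -
  obtain C where C: "C \<ge> 0" "\<And>w. w \<in> Om \<Longrightarrow> nb w (f w) (C * eps w ^ k)"
    using assms by (auto simp: small_def)
  have "nb w (f w) ((C * \<bar>E\<bar> ^ (k - j)) * eps w ^ j)" if w: "w \<in> Om" for w
  proof (rule nb_mono[OF w C(2)[OF w]])
    have "C * (eps w ^ (k - j) * eps w ^ j) \<le> C * (\<bar>E\<bar> ^ (k - j) * eps w ^ j)"
      using eps[OF w] C by (intro mult_left_mono mult_right_mono power_mono) auto
    then show "C * eps w ^ k \<le> C * \<bar>E\<bar> ^ (k - j) * eps w ^ j"
      using assms(2) by (simp flip: power_add)
  qed
  with C show ?thesis unfolding small_def by (intro exI[of _ "C * \<bar>E\<bar> ^ (k - j)"]) auto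
qed

lemma small_null: "(\<And>w. w \<in> Om \<Longrightarrow> nb w (f w) 0) \<Longrightarrow> small k f"
  unfolding small_def by (intro exI[of _ 0]) auto

lemma small_nullD: "small k f \<Longrightarrow> w \<in> Om \<Longrightarrow> \<exists>c\<ge>0. nb w (f w) c"
  using eps unfolding small_def by (metis mult_nonneg_nonneg zero_le_power)

lemma small_add:
  assumes "small k f" "small k g" shows "small k (\<lambda>w. f w + g w)"
proof -
  obtain C where C: "C \<ge> 0" "\<And>w. w \<in> Om \<Longrightarrow> nb w (f w) (C * eps w ^ k)"
    using assms(1) by (auto simp: small_def)
  obtain D where D: "D \<ge> 0" "\<And>w. w \<in> Om \<Longrightarrow> nb w (g w) (D * eps w ^ k)"
    using assms(2) by (auto simp: small_def)
  have "nb w (f w + g w) ((C + D) * eps w ^ k)" if "w \<in> Om" for w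
    using nb_add[OF that C(2) D(2)] that by (simp add: distrib_right)
  with C D show ?thesis unfolding small_def by (intro exI[of _ "C + D"]) auto
qed

lemma small_mult:
  assumes "small j f" "small k g" shows "small (j + k) (\<lambda>w. f w * g w)"
proof -
  obtain C where C: "C \<ge> 0" "\<And>w. w \<in> Om \<Longrightarrow> nb w (f w) (C * eps w ^ j)"
    using assms(1) by (auto simp: small_def)
  obtain D where D: "D \<ge> 0" "\<And>w. w \<in> Om \<Longrightarrow> nb w (g w) (D * eps w ^ k)"
    using assms(2) by (auto simp: small_def)
  have "nb w (f w * g w) ((K * C * D) * eps w ^ (j + k))" if "w \<in> Om" for w
    using nb_mult[OF that C(2)[OF that] D(2)[OF that]] C D eps[OF that]
    by (simp add: power_add mult_ac)
  with C D K0 show ?thesis unfolding small_def by (intro exI[of _ "K * C * D"]) auto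
qed

lemma small_cst:
  assumes "\<exists>C. \<forall>w\<in>Om. \<bar>r w\<bar> \<le> C" shows "small 0 (\<lambda>w. cst (r w))"
proof -
  obtain C where C: "\<And>w. w \<in> Om \<Longrightarrow> \<bar>r w\<bar> \<le> C" using assms by auto
  show ?thesis unfolding small_def
    by (rule exI[of _ "\<bar>C\<bar>"]) (auto intro!: nb_mono[OF _ nb_cst] order_trans[OF C])
qed

lemma small_const: "small 0 (\<lambda>w. cst r)"
  by (rule small_cst) auto

lemma small_zero: "small k (\<lambda>w. 0)"
  using nb_cst[of _ 0] by (intro small_null) (simp add: cst_0)

lemma small_minus: "small k f \<Longrightarrow> small k (\<lambda>w. - f w)"
  using small_mult[OF small_const[of "-1"], of k f] by (simp add: cst_minus cst_1)

lemma small_diff: "small k f \<Longrightarrow> small k g \<Longrightarrow> small k (\<lambda>w. f w - g w)"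
  using small_add[OF _ small_minus, of k f g] by simp

text \<open>Smallness of a difference acts as a congruence modulo O(eps^k); chains of approximations
  are composed by this rule.\<close>

lemma small_cong_trans:
  "small k (\<lambda>w. f w - g w) \<Longrightarrow> small k (\<lambda>w. g w - h w) \<Longrightarrow> small k (\<lambda>w. f w - h w)"
  using small_add[of k "\<lambda>w. f w - g w" "\<lambda>w. g w - h w"] by simp

lemma small_cong_imp: "small k (\<lambda>w. f w - g w) \<Longrightarrow> small k g \<Longrightarrow> small k f"
  using small_add[of k "\<lambda>w. f w - g w" g] by simp

lemma small_sum: "finite A \<Longrightarrow> (\<And>i. i \<in> A \<Longrightarrow> small k (f i)) \<Longrightarrow> small k (\<lambda>w. \<Sum>i\<in>A. f i w)"
  by (induction A rule: finite_induct) (auto intro: small_add small_zero)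

lemma small_sum_cong:
  "finite A \<Longrightarrow> (\<And>i. i \<in> A \<Longrightarrow> small k (\<lambda>w. f i w - g i w)) \<Longrightarrow>
    small k (\<lambda>w. (\<Sum>i\<in>A. f i w) - (\<Sum>i\<in>A. g i w))"
  unfolding sum_subtractf[symmetric] by (rule small_sum)

lemma small_cst_mult: "\<exists>C. \<forall>w\<in>Om. \<bar>r w\<bar> \<le> C \<Longrightarrow> small k f \<Longrightarrow> small k (\<lambda>w. cst (r w) * f w)"
  using small_mult[OF small_cst, of r k f] by simp

lemma small_prod_list0:
  "(\<And>i. i \<in> set is \<Longrightarrow> small 0 (f i)) \<Longrightarrow> small 0 (\<lambda>w. prod_list (map (\<lambda>i. f i w) is))"
proof (induction "is")
  case Nil
  show ?case using small_const[of 1] by (simp add: cst_1)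
next
  case (Cons i "is")
  then show ?case using small_mult[of 0 "f i" 0] by simp
qed

lemma small_prod_list_cong:
  assumes "\<And>i. i \<in> set is \<Longrightarrow> small k (\<lambda>w. f i w - g i w)"
    and "\<And>i. i \<in> set is \<Longrightarrow> small 0 (f i)" "\<And>i. i \<in> set is \<Longrightarrow> small 0 (g i)"
  shows "small k (\<lambda>w. prod_list (map (\<lambda>i. f i w) is) - prod_list (map (\<lambda>i. g i w) is))"
  using assms
proof (induction "is")
  case Nil
  show ?case by (simp add: small_zero)
next
  case (Cons i "is")
  have "small (k + 0) (\<lambda>w. (f i w - g i w) * prod_list (map (\<lambda>i. f i w) is))"
    by (rule small_mult[OF _ small_prod_list0]) (use Cons.prems in auto)
  moreover have "small (0 + k) (\<lambda>w. g i w * (prod_list (map (\<lambda>i. f i w) is) - prod_list (map (\<lambda>i. g i w) is)))"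
    by (rule small_mult[OF _ Cons.IH]) (use Cons.prems in auto)
  ultimately have "small k (\<lambda>w. (f i w - g i w) * prod_list (map (\<lambda>i. f i w) is)
      + g i w * (prod_list (map (\<lambda>i. f i w) is) - prod_list (map (\<lambda>i. g i w) is)))"
    by (intro small_add) auto
  then show ?case by (simp add: algebra_simps)
qed

lemma small_I:
  assumes "small k f" shows "small (Suc k) (\<lambda>w. I w a (f w))"
proof -
  obtain C where C: "C \<ge> 0" "\<And>w. w \<in> Om \<Longrightarrow> nb w (f w) (C * eps w ^ k)"
    using assms(1) by (auto simp: small_def)
  have "nb w (I w a (f w)) ((K * C) * eps w ^ Suc k)" if "w \<in> Om" for w
    using nb_I[OF that C(2)[OF that], of a] C eps[OF that] by (simp add: mult_ac)
  with C K0 show ?thesis unfolding small_def by (intro exI[of _ "K * C"]) auto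
qed

lemma I_add_cong:
  assumes "small j f" "small k g"
  shows "small n (\<lambda>w. I w a (f w + g w) - (I w a (f w) + I w a (g w)))"
  using small_nullD[OF assms(1)] small_nullD[OF assms(2)] I_add by (intro small_null) blast

lemma I_diff_cong:
  assumes "small j f" "small k g"
  shows "small n (\<lambda>w. I w a (f w) - I w a (g w) - I w a (f w - g w))"
proof -
  have "small 0 (\<lambda>w. f w - g w)" using assms by (auto intro: small_diff small_le)
  from I_add_cong[OF this assms(2), of n a] show ?thesis by (simp add: algebra_simps)
qed

lemma I_zero: "small n (\<lambda>w. I w a 0)"
  using nb_cst[of _ 0] I_cst[of _ 0 _ a 0] by (intro small_null) (auto simp: cst_0)

text \<open>The coefficients vary with \<open>w\<close> but are constants for each single
  \<open>I w\<close>, so linearity can be applied at one index at a time.\<close>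

lemma I_sum_cong:
  assumes "finite A" "\<And>i. i \<in> A \<Longrightarrow> small 0 (f i)" "\<And>i. i \<in> A \<Longrightarrow> \<exists>C. \<forall>w\<in>Om. \<bar>r i w\<bar> \<le> C"
  shows "small n (\<lambda>w. I w a (\<Sum>i\<in>A. cst (r i w) * f i w) - (\<Sum>i\<in>A. cst (r i w) * I w a (f i w)))"
  using assms
proof (induction A rule: finite_induct)
  case empty
  show ?case using I_zero by simp
next
  case (insert x A)
  have 1: "small 0 (\<lambda>w. cst (r x w) * f x w)"
    using insert.prems by (intro small_cst_mult) auto
  have 2: "small 0 (\<lambda>w. \<Sum>i\<in>A. cst (r i w) * f i w)"
    using insert by (intro small_sum small_cst_mult) auto
  have 3: "small n (\<lambda>w. I w a (cst (r x w) * f x w) - cst (r x w) * I w a (f x w))"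
    using small_nullD[OF insert.prems(1)] I_cst by (intro small_null) (meson insertI1)
  have 4: "small n (\<lambda>w. I w a (\<Sum>i\<in>A. cst (r i w) * f i w) - (\<Sum>i\<in>A. cst (r i w) * I w a (f i w)))"
    using insert by auto
  from small_add[OF I_add_cong[OF 1 2, of n a] small_add[OF 3 4]] insert.hyps
  show ?case by (simp add: algebra_simps)
qed

lemma small_Phi: "small (psize \<tau>) (\<lambda>w. Phi w \<tau>)"
proof (induction \<tau>)
  case (PNode l ts)
  have "small (sum_list (map psize ts)) (\<lambda>w. prod_list (map (Phi w) ts))"
    using PNode
  proof (induction ts)
    case Nil
    show ?case using small_const[of 1] by (simp add: cst_1)
  next
    case (Cons t ts)
    then show ?case using small_mult[where j="psize t" and f="\<lambda>w. Phi w t"] by simp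
  qed
  then show ?case by (auto intro: small_I)
qed

lemma small_Phi_list: "small (sum_list (map psize ts)) (\<lambda>w. prod_list (map (Phi w) ts))"
proof (induction ts)
  case Nil
  show ?case using small_const[of 1] by (simp add: cst_1)
next
  case (Cons t ts)
  then show ?case using small_mult[OF small_Phi[of t] Cons] by simp
qed

lemma bounded_elem_diff:
  assumes "\<And>l v. length v < p \<Longrightarrow> \<exists>C. \<forall>w\<in>Om. \<bar>c w l v\<bar> \<le> C" "\<tau> \<in> ptrees p k"
  shows "\<exists>C. \<forall>w\<in>Om. \<bar>elem_diff (c w) \<tau>\<bar> \<le> C"
  using assms(2)
proof (induction \<tau> arbitrary: k)
  case (PNode l ts)
  then obtain k' where k': "set ts \<subseteq> ptrees p k'" "length ts < p"
    by (cases k) auto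
  have "\<exists>C. \<forall>w\<in>Om. \<bar>prod_list (map (elem_diff (c w)) ts)\<bar> \<le> C"
    using k'(1) PNode.IH
  proof (induction ts)
    case (Cons t ts)
    obtain C where C: "\<And>w. w \<in> Om \<Longrightarrow> \<bar>elem_diff (c w) t\<bar> \<le> C"
      using Cons.prems by fastforce
    obtain D where D: "\<And>w. w \<in> Om \<Longrightarrow> \<bar>prod_list (map (elem_diff (c w)) ts)\<bar> \<le> D"
      using Cons.IH Cons.prems by fastforce
    have "\<bar>elem_diff (c w) t * prod_list (map (elem_diff (c w)) ts)\<bar> \<le> C * D" if "w \<in> Om" for w
      unfolding abs_mult using C[OF that] D[OF that] by (intro mult_mono) auto
    then show ?case by auto
  qed auto
  then obtain C where C: "\<And>w. w \<in> Om \<Longrightarrow> \<bar>prod_list (map (elem_diff (c w)) ts)\<bar> \<le> C" by auto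
  obtain D where D: "\<And>w. w \<in> Om \<Longrightarrow> \<bar>c w l (map (\<lambda>t. snd (plabel t)) ts)\<bar> \<le> D"
    using assms(1)[of "map (\<lambda>t. snd (plabel t)) ts" l] k' by auto
  have "\<bar>elem_diff (c w) (PNode l ts)\<bar> \<le> D * C" if "w \<in> Om" for w
    using C[OF that] D[OF that] by (auto simp: abs_mult intro!: mult_mono)
  then show ?case by blast
qed

lemma bounded_elem_diff_forest:
  fixes ts :: "('m \<times> 'e) ptree list"
  assumes "\<And>l v. length v < p \<Longrightarrow> \<exists>C. \<forall>w\<in>Om. \<bar>c w l v\<bar> \<le> C" "set ts \<subseteq> ptrees p k" "length ts < p"
  shows "\<exists>C. \<forall>w\<in>Om. \<bar>elem_diff (c w) (PNode l ts)\<bar> \<le> C"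
proof -
  \<comment> \<open>The forest may have more than \<open>k\<close> vertices in total, so the size
    bound is raised by its size in order to make it the set of children of an admissible
    tree.\<close>
  have "PNode l ts \<in> ptrees p (Suc (k + sum_list (map psize ts)))"
  proof -
    have mono: "ptrees p k \<subseteq> (ptrees p (Suc k) :: ('m \<times> 'e) ptree set)" for k
      by (induction k) fastforce+
    have mono': "ptrees p k \<subseteq> (ptrees p (k + j) :: ('m \<times> 'e) ptree set)" for j
      by (induction j) (use mono in \<open>auto simp del: ptrees.simps\<close>)
    have "set ts \<subseteq> ptrees p (k + sum_list (map psize ts))"
      by (rule order_trans[OF assms(2) mono'])
    with assms(3) show ?thesis by (simp add: image_iff)
  qed
  show ?thesis
    by (rule bounded_elem_diff[where c=c and p=p and k="Suc (k + sum_list (map psize ts))"])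
      (fact assms(1), fact)
qed

section \<open>Alternating expansion of the displacement \<open>W\<close> and of the fields
  \<open>G\<close> along it\<close>

context
  fixes p :: nat and W :: "'e::finite \<Rightarrow> 'w \<Rightarrow> 'x" and G :: "'m \<Rightarrow> 'e \<Rightarrow> 'w \<Rightarrow> 'x"
    and c :: "'w \<Rightarrow> 'm \<times> 'e \<Rightarrow> 'e list \<Rightarrow> real"
  assumes W: "\<And>i. small 1 (W i)"
    and fp: "\<And>i n. small n (\<lambda>w. W i w - (\<Sum>a\<in>UNIV. I w a (G a i w)))"
    and G: "\<And>a i. small p (\<lambda>w. G a i w
        - (\<Sum>v | length v < p. cst (c w (a, i) v) * prod_list (map (\<lambda>j. W j w) v)))"
    and c: "\<And>l v. length v < p \<Longrightarrow> \<exists>C. \<forall>w\<in>Om. \<bar>c w l v\<bar> \<le> C"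
begin

text \<open>An expansion of \<open>W\<close> is substituted into the Taylor expansion of the fields:
  the words are multiplied out over trees, and forests with more than \<open>k\<close> vertices are
  discarded as being of order k + 1. No order is gained here.\<close>

lemma expansion_G_step:
  assumes "k < p"
    and A: "\<And>i. small (Suc k) (\<lambda>w. W i w
      - (\<Sum>\<tau> | \<tau> \<in> ptrees p k \<and> snd (plabel \<tau>) = i. cst (elem_diff (c w) \<tau>) * Phi w \<tau>))"
  shows "small (Suc k) (\<lambda>w. G a i w
      - (\<Sum>ts\<in>pforests p k. cst (elem_diff (c w) (PNode (a, i) ts)) * prod_list (map (Phi w) ts)))"
proof -
  let ?S = "\<lambda>i w. \<Sum>\<tau> | \<tau> \<in> ptrees p k \<and> snd (plabel \<tau>) = i. cst (elem_diff (c w) \<tau>) * Phi w \<tau>"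
  let ?L = "{ts. set ts \<subseteq> (ptrees p k :: ('m \<times> 'e) ptree set) \<and> length ts < p}"
  let ?t = "\<lambda>ts w. cst (elem_diff (c w) (PNode (a, i) ts)) * prod_list (map (Phi w) ts)"
  have finV: "finite {v :: 'e list. length v < p}"
    using finite_lists_length_less[of "UNIV :: 'e set" p] by simp
  have S0: "small 0 (?S i)" for i
    by (intro small_sum small_cst_mult bounded_elem_diff[where c=c and p=p, OF c] small_le[OF small_Phi])
       (auto intro: finite_subset[OF _ finite_ptrees])
  have W0: "small 0 (W i)" for i by (rule small_le[OF W]) simp
  have s1: "small (Suc k) (\<lambda>w. G a i w
        - (\<Sum>v | length v < p. cst (c w (a, i) v) * prod_list (map (\<lambda>j. W j w) v)))"
    using small_le[OF G] assms(1) by simp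
  have s2: "small (Suc k) (\<lambda>w. (\<Sum>v | length v < p. cst (c w (a, i) v) * prod_list (map (\<lambda>j. W j w) v))
     - (\<Sum>v | length v < p. cst (c w (a, i) v) * prod_list (map (\<lambda>j. ?S j w) v)))"
  proof (rule small_sum_cong[OF finV])
    fix v :: "'e list" assume "v \<in> {v. length v < p}"
    then have "small (Suc k) (\<lambda>w. cst (c w (a, i) v) *
        (prod_list (map (\<lambda>j. W j w) v) - prod_list (map (\<lambda>j. ?S j w) v)))"
      by (intro small_cst_mult small_prod_list_cong A c S0 W0) auto
    then show "small (Suc k) (\<lambda>w. cst (c w (a, i) v) * prod_list (map (\<lambda>j. W j w) v)
        - cst (c w (a, i) v) * prod_list (map (\<lambda>j. ?S j w) v))"
      by (simp add: right_diff_distrib)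
  qed
  \<comment> \<open>A word together with a choice of trees for its letters is just a list of trees;
    the word is recovered from the root components, so the double sum regroups into one sum over
    forests.\<close>
  have eq: "(\<Sum>v | length v < p. cst (c w (a, i) v) * prod_list (map (\<lambda>j. ?S j w) v)) = (\<Sum>ts\<in>?L. ?t ts w)" for w
  proof -
    have "(\<Sum>v | length v < p. cst (c w (a, i) v) * prod_list (map (\<lambda>j. ?S j w) v))
      = (\<Sum>v | length v < p. \<Sum>ts | ts \<in> ?L \<and> map (\<lambda>t. snd (plabel t)) ts = v. ?t ts w)"
    proof (rule sum.cong[OF refl])
      fix v :: "'e list" assume v: "v \<in> {v. length v < p}"
      have "cst (c w (a, i) v) * prod_list (map (\<lambda>j. ?S j w) v)
        = (\<Sum>ts | set ts \<subseteq> ptrees p k \<and> map (\<lambda>t. snd (plabel t)) ts = v.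
            cst (c w (a, i) v) * prod_list (map (\<lambda>\<tau>. cst (elem_diff (c w) \<tau>) * Phi w \<tau>) ts))"
        by (simp add: prod_list_sum_expand[OF finite_ptrees] sum_distrib_left)
      also have "\<dots> = (\<Sum>ts | ts \<in> ?L \<and> map (\<lambda>t. snd (plabel t)) ts = v. ?t ts w)"
      proof (rule sum.cong)
        show "{ts. set ts \<subseteq> ptrees p k \<and> map (\<lambda>t. snd (plabel t)) ts = v}
          = {ts. ts \<in> ?L \<and> map (\<lambda>t. snd (plabel t)) ts = v}" using v by auto
        fix ts assume "ts \<in> {ts. ts \<in> ?L \<and> map (\<lambda>t. snd (plabel t)) ts = v}"
        moreover have "prod_list (map (\<lambda>\<tau>. cst (elem_diff (c w) \<tau>) * Phi w \<tau>) ts)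
           = cst (prod_list (map (elem_diff (c w)) ts)) * prod_list (map (Phi w) ts)"
          by (induction ts) (auto simp: cst_1 cst_mult mult_ac)
        ultimately show "cst (c w (a, i) v) * prod_list (map (\<lambda>\<tau>. cst (elem_diff (c w) \<tau>) * Phi w \<tau>) ts) = ?t ts w"
          by (auto simp: cst_mult mult_ac)
      qed
      finally show "cst (c w (a, i) v) * prod_list (map (\<lambda>j. ?S j w) v)
        = (\<Sum>ts | ts \<in> ?L \<and> map (\<lambda>t. snd (plabel t)) ts = v. ?t ts w)" .
    qed
    also have "\<dots> = (\<Sum>ts\<in>?L. ?t ts w)"
      by (rule sum.group[OF finite_lists_length_less[OF finite_ptrees] finV]) auto
    finally show ?thesis .
  qed
  \<comment> \<open>Every discarded forest has at least k + 1 vertices, and each vertex contributes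
    one factor eps.\<close>
  have s3: "small (Suc k) (\<lambda>w. (\<Sum>ts\<in>?L. ?t ts w) - (\<Sum>ts\<in>pforests p k. ?t ts w))"
  proof -
    have "(\<Sum>ts\<in>?L. ?t ts w) - (\<Sum>ts\<in>pforests p k. ?t ts w) = (\<Sum>ts\<in>?L - pforests p k. ?t ts w)" for w
      by (subst sum_diff[OF finite_lists_length_less[OF finite_ptrees]]) (auto simp: pforests_def)
    moreover have "small (Suc k) (\<lambda>w. \<Sum>ts\<in>?L - pforests p k. ?t ts w)"
    proof (rule small_sum)
      show "finite (?L - pforests p k)" using finite_lists_length_less[OF finite_ptrees] by auto
      fix ts assume ts: "ts \<in> ?L - pforests p k"
      then have "Suc k \<le> sum_list (map psize ts)" by (auto simp: pforests_def)
      then show "small (Suc k) (\<lambda>w. ?t ts w)"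
        using ts by (intro small_cst_mult bounded_elem_diff_forest[where k=k and p=p] c
            small_le[OF small_Phi_list]) auto
    qed
    ultimately show ?thesis by simp
  qed
  from small_cong_trans[OF s1 small_cong_trans[OF s2[unfolded eq] s3]] show ?thesis .
qed

text \<open>Here the order rises: \<open>I\<close> turns the error O(eps^(k+1)) of \<open>G\<close>
  into O(eps^(k+2)). The coefficients pass through \<open>I\<close> by linearity, and applying
  \<open>I w a\<close> to the product over a forest grafts its trees onto a new root labelled
  \<open>a\<close>.\<close>

lemma expansion_W_step:
  assumes B: "\<And>a. small (Suc k) (\<lambda>w. G a i w
      - (\<Sum>ts\<in>pforests p k. cst (elem_diff (c w) (PNode (a, i) ts)) * prod_list (map (Phi w) ts)))"
  shows "small (Suc (Suc k)) (\<lambda>w. W i w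
      - (\<Sum>\<tau> | \<tau> \<in> ptrees p (Suc k) \<and> snd (plabel \<tau>) = i. cst (elem_diff (c w) \<tau>) * Phi w \<tau>))"
proof -
  let ?t = "\<lambda>a ts w. cst (elem_diff (c w) (PNode (a, i) ts)) * prod_list (map (Phi w) ts)"
  have bd: "\<exists>C. \<forall>w\<in>Om. \<bar>elem_diff (c w) (PNode (a, i) ts)\<bar> \<le> C" if "ts \<in> pforests p k" for a ts
    using that by (intro bounded_elem_diff_forest[where k=k and p=p] c) (auto simp: pforests_def)
  have t0: "small 0 (\<lambda>w. \<Sum>ts\<in>pforests p k. ?t a ts w)" for a
    by (intro small_sum finite_pforests small_cst_mult bd small_le[OF small_Phi_list]) auto
  have G0: "small 0 (G a i)" for a
    by (rule small_cong_imp[OF small_le[OF B] t0]) simp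
  have "small (Suc (Suc k)) (\<lambda>w. (\<Sum>a\<in>UNIV. I w a (G a i w))
     - (\<Sum>a\<in>UNIV. I w a (\<Sum>ts\<in>pforests p k. ?t a ts w)))"
    by (intro small_sum_cong small_cong_imp[OF I_diff_cong[OF G0 t0] small_I[OF B]]) simp
  moreover have "small (Suc (Suc k)) (\<lambda>w. (\<Sum>a\<in>UNIV. I w a (\<Sum>ts\<in>pforests p k. ?t a ts w))
     - (\<Sum>a\<in>UNIV. \<Sum>ts\<in>pforests p k. cst (elem_diff (c w) (PNode (a, i) ts)) * I w a (prod_list (map (Phi w) ts))))"
    by (intro small_sum_cong I_sum_cong finite_pforests bd small_le[OF small_Phi_list]) auto
  ultimately have "small (Suc (Suc k)) (\<lambda>w. W i w
     - (\<Sum>a\<in>UNIV. \<Sum>ts\<in>pforests p k. cst (elem_diff (c w) (PNode (a, i) ts)) * I w a (prod_list (map (Phi w) ts))))"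
    by (intro small_cong_trans[OF fp small_cong_trans])
  then show ?thesis by (simp only: sum_ptrees_root Phi.simps fst_conv)
qed

lemma expansion_W:
  "k \<le> p \<Longrightarrow> small (Suc k) (\<lambda>w. W i w
      - (\<Sum>\<tau> | \<tau> \<in> ptrees p k \<and> snd (plabel \<tau>) = i. cst (elem_diff (c w) \<tau>) * Phi w \<tau>))"
proof (induction k arbitrary: i)
  case 0
  then show ?case using W by simp
next
  case (Suc k)
  then show ?case by (intro expansion_W_step expansion_G_step) auto
qed

text \<open>The update of the method applies the weights \<zeta> to the field values at the stages,
  not to the displacements; hence \<open>G\<close> is expanded to order \<open>p\<close>, and
  \<zeta> supplies the last power.\<close>

lemma expansion_G:
  "k < p \<Longrightarrow> small (Suc k) (\<lambda>w. G a i w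
      - (\<Sum>ts\<in>pforests p k. cst (elem_diff (c w) (PNode (a, i) ts)) * prod_list (map (Phi w) ts)))"
  by (intro expansion_G_step expansion_W) auto

end

end

section \<open>Sewing\<close>

text \<open>The fixed point of K = 2^(1-\<theta>) K + 2: halving an interval multiplies the bound by
  2^(1-\<theta>), and each halving costs two defects.\<close>

definition sew_const :: "real \<Rightarrow> real" where
  "sew_const \<theta> = 2 / (1 - 2 powr (1 - \<theta>))"

lemma sew_const:
  assumes "1 < \<theta>"
  shows "0 \<le> sew_const \<theta>" and "sew_const \<theta> * 2 powr (1 - \<theta>) + 2 = sew_const \<theta>"
proof -
  have "2 powr (1 - \<theta>) < (2::real) powr 0" using assms by (intro powr_less_mono) auto
  then have *: "0 < 1 - (2::real) powr (1 - \<theta>)" by simp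
  then show "0 \<le> sew_const \<theta>" by (simp add: sew_const_def)
  define x :: real where "x = 2 powr (1 - \<theta>)"
  have "2 / (1 - x) * x + 2 = 2 / (1 - x)" using * by (simp add: x_def[symmetric] field_simps)
  then show "sew_const \<theta> * 2 powr (1 - \<theta>) + 2 = sew_const \<theta>"
    by (simp add: sew_const_def x_def)
qed

text \<open>Splitting \<open>[t\<^sub>k, t\<^sub>l]\<close> at the last point before its midpoint, as in Davie's argument, leaves two
  intervals of at most half the length. The defect bound only has to hold as far as the claim is
  already known on shorter intervals, which makes the lemma applicable to nonlinear recursions.\<close>

lemma discrete_sewing:
  fixes t :: "nat \<Rightarrow> real" and r :: "nat \<Rightarrow> nat \<Rightarrow> real"
  assumes \<theta>: "1 < \<theta>" and M: "0 \<le> M" and C: "0 \<le> C"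
    and t: "\<And>n. k0 \<le> n \<Longrightarrow> n < l0 \<Longrightarrow> t n < t (Suc n)"
    and r0: "\<And>k. k0 \<le> k \<Longrightarrow> k \<le> l0 \<Longrightarrow> r k k = 0"
    and r1: "\<And>n. k0 \<le> n \<Longrightarrow> n < l0 \<Longrightarrow> r n (Suc n) \<le> C * (t (Suc n) - t n)"
    and def: "\<And>k j l. k0 \<le> k \<Longrightarrow> k \<le> j \<Longrightarrow> j < l \<Longrightarrow> l \<le> l0 \<Longrightarrow>
       r k j \<le> sew_const \<theta> * M * (t j - t k) powr \<theta> + C * (t j - t k) \<Longrightarrow>
       r k l \<le> r k j + r j l + M * (t l - t k) powr \<theta>"
    and kl: "k0 \<le> k" "k \<le> l" "l \<le> l0"
  shows "r k l \<le> sew_const \<theta> * M * (t l - t k) powr \<theta> + C * (t l - t k)"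
  using kl
proof (induction "l - k" arbitrary: k l rule: less_induct)
  case less
  note K = sew_const[OF \<theta>]
  have mono: "t i \<le> t j" if "k0 \<le> i" "i \<le> j" "j \<le> l0" for i j
    using that(2,1,3)
  proof (induction j rule: dec_induct)
    case (step n)
    then show ?case using t[of n] by simp
  qed simp
  consider "k = l" | "l = Suc k" | "Suc (Suc k) \<le> l" using less.prems by linarith
  then show ?case
  proof cases
    case 1
    then show ?thesis using r0 less.prems by simp
  next
    case 2
    have "0 \<le> sew_const \<theta> * M * (t l - t k) powr \<theta>" using K M by simp
    with r1[of k] 2 less.prems show ?thesis by simp
  next
    case 3
    let ?h = "t l - t k"
    define m where "m = (t k + t l) / 2"
    define j where "j = Max {i. k \<le> i \<and> i \<le> l \<and> t i \<le> m}"
    have "t k < t (Suc k)" "t (Suc k) \<le> t l"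
      using t[of k] mono[of "Suc k" l] less.prems 3 by auto
    then have h: "0 < ?h" by simp
    have fin: "finite {i. k \<le> i \<and> i \<le> l \<and> t i \<le> m}" by simp
    have "k \<in> {i. k \<le> i \<and> i \<le> l \<and> t i \<le> m}" using h less.prems by (auto simp: m_def)
    then have "j \<in> {i. k \<le> i \<and> i \<le> l \<and> t i \<le> m}" unfolding j_def by (intro Max_in fin) auto
    then have j: "k \<le> j" "j \<le> l" "t j \<le> m" by auto
    have "j \<noteq> l" using j(3) h by (auto simp: m_def field_simps)
    with j have jl: "j < l" by simp
    have "\<not> t (Suc j) \<le> m"
    proof
      assume "t (Suc j) \<le> m"
      then have "Suc j \<in> {i. k \<le> i \<and> i \<le> l \<and> t i \<le> m}" using j jl by auto
      then have "Suc j \<le> j" unfolding j_def by (rule Max_ge[OF fin])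
      then show False by simp
    qed
    then have Sj: "m < t (Suc j)" by simp
    have a: "r k j \<le> sew_const \<theta> * M * (t j - t k) powr \<theta> + C * (t j - t k)"
      using j jl less.prems by (intro less.hyps) auto
    have b: "r (Suc j) l \<le> sew_const \<theta> * M * (t l - t (Suc j)) powr \<theta> + C * (t l - t (Suc j))"
      using j jl less.prems by (intro less.hyps) auto
    have c: "r j (Suc j) \<le> C * (t (Suc j) - t j)"
      using j jl less.prems by (intro r1) auto
    have d: "r k l \<le> r k j + r j l + M * ?h powr \<theta>"
      using j jl less.prems a by (intro def) auto
    \<comment> \<open>The single grid interval containing the midpoint is split off too, which is
      the second defect. Its own bound meets the proviso of \<open>def\<close>; if it already ends
      at \<open>l\<close>, the remaining piece is trivial.\<close>
    have e: "r j l \<le> r j (Suc j) + r (Suc j) l + M * ?h powr \<theta>"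
    proof (cases "Suc j = l")
      case True
      then show ?thesis using r0[of l] less.prems M by simp
    next
      case False
      have "r j l \<le> r j (Suc j) + r (Suc j) l + M * (t l - t j) powr \<theta>"
      proof (rule def)
        have "0 \<le> sew_const \<theta> * M * (t (Suc j) - t j) powr \<theta>" using K M by simp
        with c show "r j (Suc j) \<le> sew_const \<theta> * M * (t (Suc j) - t j) powr \<theta> + C * (t (Suc j) - t j)"
          by simp
      qed (use j jl False less.prems in auto)
      moreover have "(t l - t j) powr \<theta> \<le> ?h powr \<theta>"
        using mono[of k j] mono[of j l] j jl less.prems \<theta> by (intro powr_mono2) auto
      ultimately show ?thesis using M by (smt (verit) mult_left_mono)
    qed
    have half: "x powr \<theta> \<le> ?h powr \<theta> * 2 powr (- \<theta>)" if "0 \<le> x" "x \<le> ?h / 2" for x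
    proof -
      have "x powr \<theta> \<le> (?h / 2) powr \<theta>" using that \<theta> by (intro powr_mono2) auto
      also have "\<dots> = ?h powr \<theta> * 2 powr (- \<theta>)"
        using h by (simp add: powr_divide powr_minus_divide)
      finally show ?thesis .
    qed
    have f: "(t j - t k) powr \<theta> + (t l - t (Suc j)) powr \<theta> \<le> 2 powr (1 - \<theta>) * ?h powr \<theta>"
    proof -
      have "t k \<le> t j" "t (Suc j) \<le> t l" using mono j jl less.prems by auto
      moreover have "t j - t k \<le> ?h / 2" "t l - t (Suc j) \<le> ?h / 2"
        using j(3) Sj by (simp_all add: m_def field_simps)
      ultimately have "(t j - t k) powr \<theta> \<le> ?h powr \<theta> * 2 powr (- \<theta>)"
        "(t l - t (Suc j)) powr \<theta> \<le> ?h powr \<theta> * 2 powr (- \<theta>)"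
        by (intro half; simp)+
      moreover have "(2::real) powr (1 - \<theta>) = 2 * 2 powr (- \<theta>)"
        by (simp add: powr_diff powr_minus_divide)
      ultimately show ?thesis by (simp add: mult_ac)
    qed
    have "r k l \<le> sew_const \<theta> * M * ((t j - t k) powr \<theta> + (t l - t (Suc j)) powr \<theta>)
        + 2 * M * ?h powr \<theta> + C * ?h"
      using a b c d e by (simp add: algebra_simps)
    also have "\<dots> \<le> sew_const \<theta> * M * (2 powr (1 - \<theta>) * ?h powr \<theta>) + 2 * M * ?h powr \<theta> + C * ?h"
      using K M by (intro add_right_mono mult_left_mono f) auto
    \<comment> \<open>The coefficient in front is the right side of the fixed point equation, so the
      constant reproduces itself.\<close>
    also have "\<dots> = (sew_const \<theta> * 2 powr (1 - \<theta>) + 2) * (M * ?h powr \<theta>) + C * ?h"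
      by (simp add: algebra_simps)
    finally show ?thesis by (simp only: K(2) mult.assoc)
  qed
qed

lemma is_partition_mono:
  assumes "is_partition s e N t" "i \<le> j" "j \<le> N"
  shows "t i \<le> t j"
  using assms(2,3)
proof (induction j rule: dec_induct)
  case (step n)
  then have "t n < t (Suc n)" using assms(1) by (simp add: is_partition_def)
  with step show ?case by simp
qed simp

lemma is_partition_range:
  assumes "is_partition s e N t" "i \<le> N"
  shows "t i \<in> {s..e}"
  using is_partition_mono[OF assms(1), of 0 i] is_partition_mono[OF assms(1), of i N] assms
  by (auto simp: is_partition_def)

lemma is_partition_sum: "is_partition s e N t \<Longrightarrow> (\<Sum>n<N. t (Suc n) - t n) = e - s"
  by (subst sum_lessThan_telescope) (auto simp: is_partition_def)

lemma fine_partition: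
  assumes "s \<le> e" "0 < \<delta>"
  obtains N t where "is_partition s e N t" "\<And>n. n < N \<Longrightarrow> t (Suc n) - t n < \<delta>"
proof (cases "s = e")
  case True
  then show ?thesis by (intro that[of 0 "\<lambda>_. s"]) (auto simp: is_partition_def)
next
  case False
  then have se: "s < e" using assms by simp
  obtain N :: nat where N: "(e - s) / \<delta> < real N" using reals_Archimedean2 by blast
  have N0: "0 < N" using N se assms by (cases N) (auto simp: field_simps)
  define q where "q = (e - s) / real N"
  have q: "0 < q" "q < \<delta>" "real N * q = e - s"
    using N N0 assms se by (auto simp: q_def field_simps)
  show ?thesis
  proof (rule that[of N "\<lambda>n. s + real n * q"])
    show "is_partition s e N (\<lambda>n. s + real n * q)"
      using q by (auto simp: is_partition_def)
    show "s + real (Suc n) * q - (s + real n * q) < \<delta>" for n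
      using q(2) by (simp add: distrib_right)
  qed
qed

section \<open>Limits of Riemann sums of an almost additive germ\<close>

definition has_sewing :: "(real \<Rightarrow> real \<Rightarrow> real) \<Rightarrow> real \<Rightarrow> real \<Rightarrow> real \<Rightarrow> bool" where
  "has_sewing \<Xi> s e J \<longleftrightarrow> (\<forall>\<epsilon>>0. \<exists>\<delta>>0. \<forall>N t. is_partition s e N t \<and> (\<forall>n<N. t (Suc n) - t n < \<delta>) \<longrightarrow>
     \<bar>(\<Sum>n<N. \<Xi> (t n) (t (Suc n))) - J\<bar> < \<epsilon>)"

lemma has_sewingD:
  assumes "has_sewing \<Xi> s e J" "0 < \<epsilon>"
  obtains \<delta> where "0 < \<delta>" "\<And>N t. is_partition s e N t \<Longrightarrow> (\<And>n. n < N \<Longrightarrow> t (Suc n) - t n < \<delta>) \<Longrightarrow>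
     \<bar>(\<Sum>n<N. \<Xi> (t n) (t (Suc n))) - J\<bar> < \<epsilon>"
  using assms unfolding has_sewing_def by metis

lemma has_sewing_unique:
  assumes "has_sewing \<Xi> s e I" "has_sewing \<Xi> s e J" "s \<le> e"
  shows "I = J"
proof (rule ccontr)
  assume "I \<noteq> J"
  then have e: "0 < \<bar>I - J\<bar> / 2" by simp
  obtain d1 where d1: "0 < d1" "\<And>N t. is_partition s e N t \<Longrightarrow> (\<And>n. n < N \<Longrightarrow> t (Suc n) - t n < d1) \<Longrightarrow>
     \<bar>(\<Sum>n<N. \<Xi> (t n) (t (Suc n))) - I\<bar> < \<bar>I - J\<bar> / 2" by (rule has_sewingD[OF assms(1) e]; blast)
  obtain d2 where d2: "0 < d2" "\<And>N t. is_partition s e N t \<Longrightarrow> (\<And>n. n < N \<Longrightarrow> t (Suc n) - t n < d2) \<Longrightarrow>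
     \<bar>(\<Sum>n<N. \<Xi> (t n) (t (Suc n))) - J\<bar> < \<bar>I - J\<bar> / 2" by (rule has_sewingD[OF assms(2) e]; blast)
  obtain N t where "is_partition s e N t" "\<And>n. n < N \<Longrightarrow> t (Suc n) - t n < min d1 d2"
    using fine_partition[OF assms(3), of "min d1 d2"] d1 d2 by auto
  with d1(2)[of N t] d2(2)[of N t] show False by (smt (verit) field_sum_of_halves)
qed

lemma has_sewing_add:
  assumes "has_sewing \<Xi> s e I" "has_sewing \<Xi>' s e J"
  shows "has_sewing (\<lambda>s t. \<Xi> s t + \<Xi>' s t) s e (I + J)"
  unfolding has_sewing_def
proof (intro allI impI)
  fix \<epsilon> :: real assume "0 < \<epsilon>"
  then have e: "0 < \<epsilon> / 2" by simp
  obtain d1 where d1: "0 < d1" "\<And>N t. is_partition s e N t \<Longrightarrow> (\<And>n. n < N \<Longrightarrow> t (Suc n) - t n < d1) \<Longrightarrow>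
     \<bar>(\<Sum>n<N. \<Xi> (t n) (t (Suc n))) - I\<bar> < \<epsilon> / 2" by (rule has_sewingD[OF assms(1) e]; blast)
  obtain d2 where d2: "0 < d2" "\<And>N t. is_partition s e N t \<Longrightarrow> (\<And>n. n < N \<Longrightarrow> t (Suc n) - t n < d2) \<Longrightarrow>
     \<bar>(\<Sum>n<N. \<Xi>' (t n) (t (Suc n))) - J\<bar> < \<epsilon> / 2" by (rule has_sewingD[OF assms(2) e]; blast)
  show "\<exists>\<delta>>0. \<forall>N t. is_partition s e N t \<and> (\<forall>n<N. t (Suc n) - t n < \<delta>) \<longrightarrow>
     \<bar>(\<Sum>n<N. \<Xi> (t n) (t (Suc n)) + \<Xi>' (t n) (t (Suc n))) - (I + J)\<bar> < \<epsilon>"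
  proof (intro exI[of _ "min d1 d2"] conjI allI impI)
    fix N t assume "is_partition s e N t \<and> (\<forall>n<N. t (Suc n) - t n < min d1 d2)"
    with d1(2)[of N t] d2(2)[of N t]
    show "\<bar>(\<Sum>n<N. \<Xi> (t n) (t (Suc n)) + \<Xi>' (t n) (t (Suc n))) - (I + J)\<bar> < \<epsilon>"
      by (simp add: sum.distrib) (smt (verit) field_sum_of_halves)
  qed (use d1 d2 in auto)
qed

lemma has_sewing_cmult:
  assumes "has_sewing \<Xi> s e I"
  shows "has_sewing (\<lambda>s t. c * \<Xi> s t) s e (c * I)"
  unfolding has_sewing_def
proof (intro allI impI)
  fix \<epsilon> :: real assume "0 < \<epsilon>"
  then have e: "0 < \<epsilon> / (\<bar>c\<bar> + 1)" by simp
  obtain d where d: "0 < d" "\<And>N t. is_partition s e N t \<Longrightarrow> (\<And>n. n < N \<Longrightarrow> t (Suc n) - t n < d) \<Longrightarrow>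
     \<bar>(\<Sum>n<N. \<Xi> (t n) (t (Suc n))) - I\<bar> < \<epsilon> / (\<bar>c\<bar> + 1)" by (rule has_sewingD[OF assms(1) e]; blast)
  show "\<exists>\<delta>>0. \<forall>N t. is_partition s e N t \<and> (\<forall>n<N. t (Suc n) - t n < \<delta>) \<longrightarrow>
     \<bar>(\<Sum>n<N. c * \<Xi> (t n) (t (Suc n))) - c * I\<bar> < \<epsilon>"
  proof (intro exI[of _ d] conjI allI impI)
    fix N t assume "is_partition s e N t \<and> (\<forall>n<N. t (Suc n) - t n < d)"
    with d(2)[of N t] have *: "\<bar>(\<Sum>n<N. \<Xi> (t n) (t (Suc n))) - I\<bar> < \<epsilon> / (\<bar>c\<bar> + 1)" by auto
    have "\<bar>(\<Sum>n<N. c * \<Xi> (t n) (t (Suc n))) - c * I\<bar> = \<bar>c\<bar> * \<bar>(\<Sum>n<N. \<Xi> (t n) (t (Suc n))) - I\<bar>"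
      by (simp add: sum_distrib_left[symmetric] right_diff_distrib[symmetric] abs_mult)
    also have "\<dots> \<le> \<bar>c\<bar> * (\<epsilon> / (\<bar>c\<bar> + 1))" using * by (intro mult_left_mono) auto
    also have "\<dots> < \<epsilon>" using \<open>0 < \<epsilon>\<close> by (simp add: field_simps)
    finally show "\<bar>(\<Sum>n<N. c * \<Xi> (t n) (t (Suc n))) - c * I\<bar> < \<epsilon>" .
  qed (use d in auto)
qed

lemma has_sewing_sum:
  "finite A \<Longrightarrow> (\<And>i. i \<in> A \<Longrightarrow> has_sewing (\<Xi> i) s e (J i)) \<Longrightarrow>
    has_sewing (\<lambda>s t. \<Sum>i\<in>A. \<Xi> i s t) s e (\<Sum>i\<in>A. J i)"
proof (induction A rule: finite_induct)
  case empty
  show ?case by (auto simp: has_sewing_def intro: exI[of _ 1])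
next
  case (insert x A)
  then show ?case using has_sewing_add[of "\<Xi> x" s e "J x"] by simp
qed

text \<open>Any two partitions have a common refinement \<open>W\<close>; the function \<open>J\<close> sums the germ along \<open>W\<close>.\<close>

lemma sewing_finite:
  assumes \<theta>: "1 < \<theta>" and M: "0 \<le> M" and W: "finite W" "W \<subseteq> {a..b}"
    and \<Xi>: "\<And>s r t. a \<le> s \<Longrightarrow> s \<le> r \<Longrightarrow> r \<le> t \<Longrightarrow> t \<le> b \<Longrightarrow>
       \<bar>\<Xi> s t - \<Xi> s r - \<Xi> r t\<bar> \<le> M * (t - s) powr \<theta>"
  obtains J :: "real \<Rightarrow> real"
  where "\<And>s t. s \<in> W \<Longrightarrow> t \<in> W \<Longrightarrow> s \<le> t \<Longrightarrow> \<bar>J t - J s - \<Xi> s t\<bar> \<le> sew_const \<theta> * M * (t - s) powr \<theta>"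
proof -
  define xs where "xs = sorted_list_of_set W"
  define t where "t n = xs ! n" for n
  define Jn where "Jn n = (\<Sum>k<n. \<Xi> (t k) (t (Suc k)))" for n
  define ix where "ix x = (SOME n. n < length xs \<and> xs ! n = x)" for x
  define r where "r k l = (if k = l then 0 else \<bar>Jn l - Jn k - \<Xi> (t k) (t l)\<bar>)" for k l
  have ix: "ix x < length xs \<and> t (ix x) = x" if "x \<in> W" for x
  proof -
    have "x \<in> set xs" using that W by (simp add: xs_def)
    then have "\<exists>n. n < length xs \<and> xs ! n = x" by (simp add: in_set_conv_nth)
    then show ?thesis unfolding ix_def t_def by (rule someI_ex)
  qed
  have tW: "t n \<in> {a..b}" if "n < length xs" for n
    using that W nth_mem[of n xs] by (auto simp: t_def xs_def)
  have sm: "t i < t j" if "i < j" "j < length xs" for i j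
    using sorted_wrt_nth_less[of "(<)" xs i j] that
    by (simp add: t_def xs_def strict_sorted_list_of_set)
  have main: "r k l \<le> sew_const \<theta> * M * (t l - t k) powr \<theta> + 0 * (t l - t k)"
    if kl: "k \<le> l" "l < length xs" for k l
  proof (rule discrete_sewing[OF \<theta> M, where ?k0.0 = 0 and ?l0.0 = l])
    fix k j l' assume *: "k \<le> j" "j < l'" "l' \<le> l"
    show "r k l' \<le> r k j + r j l' + M * (t l' - t k) powr \<theta>"
    proof (cases "k = j")
      case True
      then show ?thesis using M * by (auto simp: r_def)
    next
      case False
      have "\<bar>\<Xi> (t k) (t l') - \<Xi> (t k) (t j) - \<Xi> (t j) (t l')\<bar> \<le> M * (t l' - t k) powr \<theta>"
        using False * that tW[of k] tW[of l'] sm[of k j] sm[of j l'] by (intro \<Xi>) auto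
      then show ?thesis using False * by (auto simp: r_def)
    qed
  next
    fix n assume "n < l"
    then show "t n < t (Suc n)" using that by (intro sm) auto
  next
    \<comment> \<open>Between neighbouring points the increment of the sum is the germ itself, so
      the linear part of the sewing bound has constant 0.\<close>
    fix n assume "n < l"
    then show "r n (Suc n) \<le> 0 * (t (Suc n) - t n)" by (simp add: r_def Jn_def)
  qed (use kl in \<open>auto simp: r_def\<close>)
  have aa: "\<Xi> s s = 0" if "s \<in> W" for s
    using \<Xi>[of s s s] that W by auto
  show ?thesis
  proof (rule that[of "\<lambda>x. Jn (ix x)"])
    fix s e assume *: "s \<in> W" "e \<in> W" "s \<le> e"
    show "\<bar>Jn (ix e) - Jn (ix s) - \<Xi> s e\<bar> \<le> sew_const \<theta> * M * (e - s) powr \<theta>"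
    proof (cases "s = e")
      case True
      then show ?thesis using aa * by simp
    next
      case False
      have "ix s < ix e"
        using sm[of "ix e" "ix s"] ix[OF *(1)] ix[OF *(2)] False * by (metis linorder_neqE_nat not_less)
      then show ?thesis using main[of "ix s" "ix e"] ix[OF *(1)] ix[OF *(2)] by (simp add: r_def)
    qed
  qed
qed

text \<open>On an interval of length h < \<delta> the error M h^\<theta> is at most M
  \<delta>^(\<theta>-1) h, and the lengths add up to e - s.\<close>

lemma partition_sum_close:
  assumes \<theta>: "1 < \<theta>" and M: "0 \<le> M" and P: "is_partition s e N t"
    and mesh: "\<And>n. n < N \<Longrightarrow> t (Suc n) - t n < \<delta>"
    and J: "\<And>n. n < N \<Longrightarrow> \<bar>J (t (Suc n)) - J (t n) - \<Xi> (t n) (t (Suc n))\<bar> \<le> M * (t (Suc n) - t n) powr \<theta>"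
  shows "\<bar>(\<Sum>n<N. \<Xi> (t n) (t (Suc n))) - (J e - J s)\<bar> \<le> M * (e - s) * \<delta> powr (\<theta> - 1)"
proof -
  have "J e - J s = (\<Sum>n<N. J (t (Suc n)) - J (t n))"
    using P by (subst sum_lessThan_telescope) (auto simp: is_partition_def)
  then have "\<bar>(\<Sum>n<N. \<Xi> (t n) (t (Suc n))) - (J e - J s)\<bar>
      = \<bar>\<Sum>n<N. J (t (Suc n)) - J (t n) - \<Xi> (t n) (t (Suc n))\<bar>"
    by (simp add: sum_subtractf)
  also have "\<dots> \<le> (\<Sum>n<N. M * \<delta> powr (\<theta> - 1) * (t (Suc n) - t n))"
  proof (intro order_trans[OF sum_abs] sum_mono)
    fix n assume "n \<in> {..<N}"
    then have n: "n < N" by simp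
    then have h: "0 < t (Suc n) - t n" using P by (auto simp: is_partition_def)
    have "(t (Suc n) - t n) powr \<theta> = (t (Suc n) - t n) powr (\<theta> - 1) * (t (Suc n) - t n)"
      using h by (simp add: powr_diff)
    also have "\<dots> \<le> \<delta> powr (\<theta> - 1) * (t (Suc n) - t n)"
      using h \<theta> mesh[OF n] by (intro mult_right_mono powr_mono2) auto
    finally show "\<bar>J (t (Suc n)) - J (t n) - \<Xi> (t n) (t (Suc n))\<bar> \<le> M * \<delta> powr (\<theta> - 1) * (t (Suc n) - t n)"
      using J[OF n] M by (smt (verit, best) mult.assoc mult_left_mono)
  qed
  also have "\<dots> = M * (e - s) * \<delta> powr (\<theta> - 1)"
    by (simp add: sum_distrib_left[symmetric] is_partition_sum[OF P])
  finally show ?thesis .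
qed

lemma small_powr:
  assumes "0 < \<epsilon>" "0 < \<kappa>" "0 \<le> (B::real)"
  obtains \<delta> where "0 < \<delta>" "B * \<delta> powr \<kappa> < \<epsilon>"
proof (rule that[of "(\<epsilon> / (B + 1)) powr (1 / \<kappa>)"])
  show "0 < (\<epsilon> / (B + 1)) powr (1 / \<kappa>)" using assms by simp
  have *: "((\<epsilon> / (B + 1)) powr (1 / \<kappa>)) powr \<kappa> = \<epsilon> / (B + 1)"
    using assms by (simp add: powr_powr)
  show "B * ((\<epsilon> / (B + 1)) powr (1 / \<kappa>)) powr \<kappa> < \<epsilon>"
    unfolding * using assms by (simp add: field_simps)
qed

text \<open>A function whose increments match the germ up to an order \<theta> > 1 is its integral.
  This recognizes integrals over subintervals from increment estimates, without a separate
  additivity statement.\<close>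

lemma has_sewingI:
  assumes \<theta>: "1 < \<theta>" and M: "0 \<le> M" and "s \<le> e"
    and J: "\<And>r t. s \<le> r \<Longrightarrow> r \<le> t \<Longrightarrow> t \<le> e \<Longrightarrow> \<bar>J t - J r - \<Xi> r t\<bar> \<le> M * (t - r) powr \<theta>"
  shows "has_sewing \<Xi> s e (J e - J s)"
  unfolding has_sewing_def
proof (intro allI impI)
  fix \<epsilon> :: real assume "0 < \<epsilon>"
  then obtain \<delta> where \<delta>: "0 < \<delta>" "M * (e - s) * \<delta> powr (\<theta> - 1) < \<epsilon>"
    using small_powr[of \<epsilon> "\<theta> - 1" "M * (e - s)"] assms by auto
  show "\<exists>\<delta>>0. \<forall>N t. is_partition s e N t \<and> (\<forall>n<N. t (Suc n) - t n < \<delta>) \<longrightarrow>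
     \<bar>(\<Sum>n<N. \<Xi> (t n) (t (Suc n))) - (J e - J s)\<bar> < \<epsilon>"
  proof (intro exI[of _ \<delta>] conjI allI impI \<delta>(1))
    fix N t assume P: "is_partition s e N t \<and> (\<forall>n<N. t (Suc n) - t n < \<delta>)"
    have "\<bar>(\<Sum>n<N. \<Xi> (t n) (t (Suc n))) - (J e - J s)\<bar> \<le> M * (e - s) * \<delta> powr (\<theta> - 1)"
    proof (rule partition_sum_close[OF \<theta> M, where J=J and \<Xi>=\<Xi>])
      fix n assume "n < N"
      then show "\<bar>J (t (Suc n)) - J (t n) - \<Xi> (t n) (t (Suc n))\<bar> \<le> M * (t (Suc n) - t n) powr \<theta>"
        using is_partition_range[of s e N t n] is_partition_range[of s e N t "Suc n"]
          is_partition_mono[of s e N t n "Suc n"] P by (intro J) auto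
    qed (use P in auto)
    with \<delta> show "\<bar>(\<Sum>n<N. \<Xi> (t n) (t (Suc n))) - (J e - J s)\<bar> < \<epsilon>" by simp
  qed
qed

context
  fixes \<theta> M a b :: real and \<Xi> :: "real \<Rightarrow> real \<Rightarrow> real"
  assumes \<theta>: "1 < \<theta>" and M: "0 \<le> M"
    and \<Xi>: "\<And>s r t. a \<le> s \<Longrightarrow> s \<le> r \<Longrightarrow> r \<le> t \<Longrightarrow> t \<le> b \<Longrightarrow>
       \<bar>\<Xi> s t - \<Xi> s r - \<Xi> r t\<bar> \<le> M * (t - s) powr \<theta>"
begin

lemma sewing_sum_bound:
  assumes P: "is_partition s e N t" and "a \<le> s" "e \<le> b"
  shows "\<bar>(\<Sum>n<N. \<Xi> (t n) (t (Suc n))) - \<Xi> s e\<bar> \<le> sew_const \<theta> * M * (e - s) powr \<theta>"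
proof -
  let ?r = "\<lambda>k l. if k = l then 0 else \<bar>(\<Sum>n=k..<l. \<Xi> (t n) (t (Suc n))) - \<Xi> (t k) (t l)\<bar>"
  have rg: "s \<le> t i \<and> t i \<le> e" if "i \<le> N" for i using is_partition_range[OF P that] by auto
  have aa: "\<Xi> s s = 0" if "s = e" using \<Xi>[of s s s] that assms rg[of 0] by auto
  have "?r 0 N \<le> sew_const \<theta> * M * (t N - t 0) powr \<theta> + 0 * (t N - t 0)"
  proof (rule discrete_sewing[OF \<theta> M, where ?k0.0 = 0 and ?l0.0 = N])
    fix k j l assume *: "k \<le> j" "j < l" "l \<le> N"
    show "?r k l \<le> ?r k j + ?r j l + M * (t l - t k) powr \<theta>"
    proof (cases "k = j")
      case True
      then show ?thesis using M by auto
    next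
      case False
      have "\<bar>\<Xi> (t k) (t l) - \<Xi> (t k) (t j) - \<Xi> (t j) (t l)\<bar> \<le> M * (t l - t k) powr \<theta>"
        using * is_partition_mono[OF P, of k j] is_partition_mono[OF P, of j l] rg[of k] rg[of l] assms
        by (intro \<Xi>) auto
      moreover have "(\<Sum>n=k..<l. \<Xi> (t n) (t (Suc n)))
        = (\<Sum>n=k..<j. \<Xi> (t n) (t (Suc n))) + (\<Sum>n=j..<l. \<Xi> (t n) (t (Suc n)))"
        using * by (simp add: sum.atLeastLessThan_concat)
      ultimately show ?thesis using False * by auto
    qed
  qed (use P in \<open>auto simp: is_partition_def\<close>)
  then show ?thesis using P aa by (cases "N = 0") (auto simp: is_partition_def atLeast0LessThan)
qed

text \<open>Two partitions are compared through a function on the union of their points, so the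
  Riemann sums satisfy a Cauchy condition as the mesh shrinks. A sequence with meshes below 1/(k+1)
  yields the limit, and the same comparison shows that every fine partition is close to it.\<close>

lemma has_sewing_exists:
  assumes "a \<le> s" "s \<le> e" "e \<le> b"
  obtains J where "has_sewing \<Xi> s e J"
proof -
  define K where "K = sew_const \<theta> * M"
  have K: "0 \<le> K" using sew_const[OF \<theta>] M by (simp add: K_def)
  let ?S = "\<lambda>N t. \<Sum>n<N. \<Xi> (t n) (t (Suc n))"
  have cmp: "\<bar>?S N t - ?S N' t'\<bar> \<le> K * (e - s) * \<delta> powr (\<theta> - 1) + K * (e - s) * \<delta>' powr (\<theta> - 1)"
    if P: "is_partition s e N t" "\<And>n. n < N \<Longrightarrow> t (Suc n) - t n < \<delta>"
      and P': "is_partition s e N' t'" "\<And>n. n < N' \<Longrightarrow> t' (Suc n) - t' n < \<delta>'" for N N' t t' \<delta> \<delta>'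
  proof -
    let ?W = "t ` {..N} \<union> t' ` {..N'}"
    have sub: "?W \<subseteq> {a..b}"
      using is_partition_range[OF P(1)] is_partition_range[OF P'(1)] assms by fastforce
    obtain J where J: "\<And>s t. s \<in> ?W \<Longrightarrow> t \<in> ?W \<Longrightarrow> s \<le> t \<Longrightarrow> \<bar>J t - J s - \<Xi> s t\<bar> \<le> K * (t - s) powr \<theta>"
      unfolding K_def by (rule sewing_finite[OF \<theta> M _ sub \<Xi>]) auto
    have "\<bar>?S N t - (J e - J s)\<bar> \<le> K * (e - s) * \<delta> powr (\<theta> - 1)"
      using is_partition_mono[OF P(1)] by (intro partition_sum_close[OF \<theta> K P] J) auto
    moreover have "\<bar>?S N' t' - (J e - J s)\<bar> \<le> K * (e - s) * \<delta>' powr (\<theta> - 1)"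
      using is_partition_mono[OF P'(1)] by (intro partition_sum_close[OF \<theta> K P'] J) auto
    ultimately show ?thesis by linarith
  qed
  have "\<exists>N t. is_partition s e N t \<and> (\<forall>n<N. t (Suc n) - t n < 1 / real (Suc k))" for k
    using fine_partition[OF assms(2), of "1 / real (Suc k)"] by (metis of_nat_0_less_iff zero_less_Suc zero_less_divide_1_iff)
  then obtain N t where Nt: "\<And>k. is_partition s e (N k) (t k)"
    "\<And>k n. n < N k \<Longrightarrow> t k (Suc n) - t k n < 1 / real (Suc k)" by metis
  let ?u = "\<lambda>k. ?S (N k) (t k)"
  have KE: "0 \<le> K * (e - s)" using K assms by simp
  have small: "(\<lambda>k. K * (e - s) * (1 / real (Suc k)) powr (\<theta> - 1)) \<longlonglongrightarrow> 0"
  proof -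
    have "(\<lambda>k. (1 / real (Suc k)) powr (\<theta> - 1)) \<longlonglongrightarrow> 0"
      using \<theta> LIMSEQ_inverse_real_of_nat
      by (intro tendsto_zero_powrI[where b="\<theta> - 1"]) (auto simp: inverse_eq_divide)
    from tendsto_mult_left[OF this, of "K * (e - s)"] show ?thesis by simp
  qed
  have "Cauchy ?u"
  proof (rule metric_CauchyI)
    fix \<epsilon> :: real assume "0 < \<epsilon>"
    then have "\<forall>\<^sub>F k in sequentially. K * (e - s) * (1 / real (Suc k)) powr (\<theta> - 1) < \<epsilon> / 2"
      using small by (intro order_tendstoD) auto
    then obtain k0 where k0: "\<And>k. k \<ge> k0 \<Longrightarrow> K * (e - s) * (1 / real (Suc k)) powr (\<theta> - 1) < \<epsilon> / 2"
      by (auto simp: eventually_sequentially)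
    show "\<exists>M. \<forall>m\<ge>M. \<forall>n\<ge>M. dist (?u m) (?u n) < \<epsilon>"
    proof (intro exI[of _ k0] allI impI)
      fix m n assume "m \<ge> k0" "n \<ge> k0"
      from cmp[OF Nt(1)[of m] Nt(2)[of _ m] Nt(1)[of n] Nt(2)[of _ n]] k0[OF this(1)] k0[OF this(2)]
      show "dist (?u m) (?u n) < \<epsilon>" unfolding dist_real_def by linarith
    qed
  qed
  then obtain J where J: "?u \<longlonglongrightarrow> J" using Cauchy_convergent unfolding convergent_def by blast
  have "has_sewing \<Xi> s e J"
    unfolding has_sewing_def
  proof (intro allI impI)
    fix \<epsilon> :: real assume "0 < \<epsilon>"
    then obtain \<delta> where \<delta>: "0 < \<delta>" "K * (e - s) * \<delta> powr (\<theta> - 1) < \<epsilon>"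
      using small_powr[of \<epsilon> "\<theta> - 1" "K * (e - s)"] \<theta> KE by auto
    show "\<exists>\<delta>>0. \<forall>N t. is_partition s e N t \<and> (\<forall>n<N. t (Suc n) - t n < \<delta>) \<longrightarrow> \<bar>?S N t - J\<bar> < \<epsilon>"
    proof (intro exI[of _ \<delta>] conjI allI impI \<delta>(1))
      fix N' t' assume P: "is_partition s e N' t' \<and> (\<forall>n<N'. t' (Suc n) - t' n < \<delta>)"
      have "(\<lambda>k. \<bar>?S N' t' - ?u k\<bar>) \<longlonglongrightarrow> \<bar>?S N' t' - J\<bar>"
        by (intro tendsto_intros J)
      moreover have "(\<lambda>k. K * (e - s) * \<delta> powr (\<theta> - 1) + K * (e - s) * (1 / real (Suc k)) powr (\<theta> - 1))
          \<longlonglongrightarrow> K * (e - s) * \<delta> powr (\<theta> - 1) + 0"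
        by (intro tendsto_intros small)
      moreover have "\<bar>?S N' t' - ?u k\<bar> \<le> K * (e - s) * \<delta> powr (\<theta> - 1) + K * (e - s) * (1 / real (Suc k)) powr (\<theta> - 1)" for k
        using P by (intro cmp Nt) auto
      ultimately have "\<bar>?S N' t' - J\<bar> \<le> K * (e - s) * \<delta> powr (\<theta> - 1) + 0"
        by (intro LIMSEQ_le) auto
      with \<delta> show "\<bar>?S N' t' - J\<bar> < \<epsilon>" by simp
    qed
  qed
  then show ?thesis by (rule that)
qed

lemma is_partition_append:
  assumes "is_partition s r N t" "is_partition r e N' t'"
  shows "is_partition s e (N + N') (\<lambda>n. if n < N then t n else t' (n - N))"
proof -
  have "(if n < N then t n else t' (n - N)) < (if Suc n < N then t (Suc n) else t' (Suc n - N))"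
    if n: "n < N + N'" for n
  proof -
    consider "Suc n < N" | "Suc n = N" | "N \<le> n" by linarith
    then show ?thesis
    proof cases
      case 2
      then have "t n < t N" using assms by (auto simp: is_partition_def)
      with 2 assms show ?thesis by (auto simp: is_partition_def)
    next
      case 3
      with n assms show ?thesis by (auto simp: is_partition_def Suc_diff_le)
    qed (use assms in \<open>auto simp: is_partition_def\<close>)
  qed
  then show ?thesis using assms by (auto simp: is_partition_def)
qed

text \<open>Fine partitions of [u, s] and [s, e] concatenate to one of [u, e]. Thus
  \<open>J - I\<close> is a Riemann sum over [s, e] up to \<epsilon>, and such sums are within the
  sewing bound of the germ for any mesh.\<close>

lemma has_sewing_increment_bound:
  assumes u: "a \<le> u" and us: "u \<le> s" and se: "s \<le> e" and e: "e \<le> b"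
    and I: "has_sewing \<Xi> u s I" and J: "has_sewing \<Xi> u e J"
  shows "\<bar>J - I - \<Xi> s e\<bar> \<le> sew_const \<theta> * M * (e - s) powr \<theta>"
proof (rule field_le_epsilon)
  fix \<epsilon> :: real assume "0 < \<epsilon>"
  then have \<epsilon>: "0 < \<epsilon> / 2" by simp
  obtain d1 where d1: "0 < d1" "\<And>N t. is_partition u s N t \<Longrightarrow> (\<And>n. n < N \<Longrightarrow> t (Suc n) - t n < d1) \<Longrightarrow>
     \<bar>(\<Sum>n<N. \<Xi> (t n) (t (Suc n))) - I\<bar> < \<epsilon> / 2" by (rule has_sewingD[OF I \<epsilon>]; blast)
  obtain d2 where d2: "0 < d2" "\<And>N t. is_partition u e N t \<Longrightarrow> (\<And>n. n < N \<Longrightarrow> t (Suc n) - t n < d2) \<Longrightarrow>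
     \<bar>(\<Sum>n<N. \<Xi> (t n) (t (Suc n))) - J\<bar> < \<epsilon> / 2" by (rule has_sewingD[OF J \<epsilon>]; blast)
  have d: "0 < min d1 d2" using d1 d2 by simp
  obtain N t where P: "is_partition u s N t" "\<And>n. n < N \<Longrightarrow> t (Suc n) - t n < min d1 d2"
    using fine_partition[OF us d] by metis
  obtain N' t' where P': "is_partition s e N' t'" "\<And>n. n < N' \<Longrightarrow> t' (Suc n) - t' n < min d1 d2"
    using fine_partition[OF se d] by metis
  let ?t = "\<lambda>n. if n < N then t n else t' (n - N)"
  have tN: "t N = t' 0" using P(1) P'(1) by (simp add: is_partition_def)
  have A: "\<bar>(\<Sum>n<N. \<Xi> (t n) (t (Suc n))) - I\<bar> < \<epsilon> / 2"
    using P by (intro d1) auto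
  have "?t (Suc n) - ?t n < min d1 d2" if "n < N + N'" for n
  proof (cases "n < N")
    case True
    then show ?thesis using P(2)[OF True] tN by (cases "Suc n = N") auto
  next
    case False
    then show ?thesis using P'(2)[of "n - N"] that by (auto simp: Suc_diff_le)
  qed
  then have B: "\<bar>(\<Sum>n<N+N'. \<Xi> (?t n) (?t (Suc n))) - J\<bar> < \<epsilon> / 2"
    by (intro d2 is_partition_append[OF P(1) P'(1)]) auto
  have split: "(\<Sum>n<N+k. f n) = (\<Sum>n<N. f n) + (\<Sum>n<k. f (N + n))" for f :: "nat \<Rightarrow> real" and k
    by (induction k) auto
  have "(\<Sum>n<N+N'. \<Xi> (?t n) (?t (Suc n)))
      = (\<Sum>n<N. \<Xi> (?t n) (?t (Suc n))) + (\<Sum>n<N'. \<Xi> (?t (N + n)) (?t (Suc (N + n))))"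
    by (rule split)
  also have "(\<Sum>n<N. \<Xi> (?t n) (?t (Suc n))) = (\<Sum>n<N. \<Xi> (t n) (t (Suc n)))"
  proof (rule sum.cong[OF refl])
    fix n assume "n \<in> {..<N}"
    then show "\<Xi> (?t n) (?t (Suc n)) = \<Xi> (t n) (t (Suc n))"
      using tN by (cases "Suc n = N") auto
  qed
  also have "(\<Sum>n<N'. \<Xi> (?t (N + n)) (?t (Suc (N + n)))) = (\<Sum>n<N'. \<Xi> (t' n) (t' (Suc n)))"
    by (simp add: Suc_diff_le)
  finally have C: "(\<Sum>n<N+N'. \<Xi> (?t n) (?t (Suc n)))
     = (\<Sum>n<N. \<Xi> (t n) (t (Suc n))) + (\<Sum>n<N'. \<Xi> (t' n) (t' (Suc n)))" .
  have "\<bar>(\<Sum>n<N'. \<Xi> (t' n) (t' (Suc n))) - \<Xi> s e\<bar> \<le> sew_const \<theta> * M * (e - s) powr \<theta>"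
    using u us e by (intro sewing_sum_bound[OF P'(1)]) auto
  with A B show "\<bar>J - I - \<Xi> s e\<bar> \<le> sew_const \<theta> * M * (e - s) powr \<theta> + \<epsilon>"
    unfolding C by linarith
qed

end

lemma has_sewing_refl: "has_sewing \<Xi> s s 0"
proof -
  have *: "N = 0" if "is_partition s s N t" for N t
    using is_partition_mono[OF that, of 1 N] that by (cases N) (auto simp: is_partition_def)
  show ?thesis unfolding has_sewing_def
  proof (intro allI impI exI[of _ 1] conjI)
    fix \<epsilon> :: real and N t
    assume "0 < \<epsilon>" "is_partition s s N t \<and> (\<forall>n<N. t (Suc n) - t n < 1)"
    then show "\<bar>(\<Sum>n<N. \<Xi> (t n) (t (Suc n))) - 0\<bar> < \<epsilon>" using *[of N t] by simp
  qed simp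
qed

section \<open>Scalar controlled paths\<close>

text \<open>No regularity is built in: arbitrary pairs form a commutative ring with the Leibniz rule
  in the second component, as the abstract expansion demands. Regularity on an interval is expressed
  by the predicates \<open>ctl\<close> and \<open>bdd\<close>.\<close>

datatype ('d::finite) cpath =
  CPath (cval: "real \<Rightarrow> real") (cder: "real \<Rightarrow> (real^'d) \<Rightarrow>\<^sub>L real")

instantiation cpath :: (finite) comm_ring_1
begin

definition "0 = CPath (\<lambda>_. 0) (\<lambda>_. 0)"
definition "1 = CPath (\<lambda>_. 1) (\<lambda>_. 0)"
definition "f + g = CPath (\<lambda>r. cval f r + cval g r) (\<lambda>r. cder f r + cder g r)"
definition "f - g = CPath (\<lambda>r. cval f r - cval g r) (\<lambda>r. cder f r - cder g r)"
definition "- f = CPath (\<lambda>r. - cval f r) (\<lambda>r. - cder f r)"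
definition "f * g = CPath (\<lambda>r. cval f r * cval g r) (\<lambda>r. cval f r *\<^sub>R cder g r + cval g r *\<^sub>R cder f r)"

instance
proof
  show "(0 :: 'a cpath) \<noteq> 1"
    by (simp add: zero_cpath_def one_cpath_def fun_eq_iff)
qed (auto simp: zero_cpath_def one_cpath_def plus_cpath_def minus_cpath_def uminus_cpath_def
    times_cpath_def fun_eq_iff algebra_simps)

end

lemma cval_simps [simp]:
  "cval 0 r = 0" "cval 1 r = 1" "cval (f + g) r = cval f r + cval g r"
  "cval (f - g) r = cval f r - cval g r" "cval (- f) r = - cval f r" "cval (f * g) r = cval f r * cval g r"
  by (simp_all add: zero_cpath_def one_cpath_def plus_cpath_def minus_cpath_def uminus_cpath_def
    times_cpath_def)

lemma cder_simps [simp]: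
  "cder 0 r = 0" "cder 1 r = 0" "cder (f + g) r = cder f r + cder g r"
  "cder (f - g) r = cder f r - cder g r" "cder (- f) r = - cder f r"
  "cder (f * g) r = cval f r *\<^sub>R cder g r + cval g r *\<^sub>R cder f r"
  by (simp_all add: zero_cpath_def one_cpath_def plus_cpath_def minus_cpath_def uminus_cpath_def
    times_cpath_def)

lemma cpath_eqI: "(\<And>r. cval f r = cval g r) \<Longrightarrow> (\<And>r. cder f r = cder g r) \<Longrightarrow> f = g"
  by (cases f; cases g) (auto simp: fun_eq_iff)

lemma cval_sum [simp]: "cval (\<Sum>i\<in>A. f i) r = (\<Sum>i\<in>A. cval (f i) r)"
  by (induction A rule: infinite_finite_induct) auto

lemma cder_sum [simp]: "cder (\<Sum>i\<in>A. f i) r = (\<Sum>i\<in>A. cder (f i) r)"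
  by (induction A rule: infinite_finite_induct) auto

abbreviation cconst :: "real \<Rightarrow> 'd::finite cpath" where
  "cconst r \<equiv> CPath (\<lambda>_. r) (\<lambda>_. 0)"

text \<open>The Leibniz sum over a multiset in recursive form; in this form it agrees with
  multiplication by one more factor in the ring.\<close>

lemma forest_deriv_add:
  "forest_deriv (add_mset p M) r = fst p r *\<^sub>R forest_deriv M r + forest_val M r *\<^sub>R snd p r"
proof -
  have scale: "(\<Sum>x\<in>#N. c *\<^sub>R f x) = c *\<^sub>R (\<Sum>x\<in>#N. f x)"
    for c :: real and N :: "'x multiset" and f :: "'x \<Rightarrow> (real^'c) \<Rightarrow>\<^sub>L real"
    by (induction N) (auto simp: scaleR_add_right)
  have "(\<Sum>p'\<in>#M. (\<Prod>q\<in>#add_mset p M - {#p'#}. fst q r) *\<^sub>R snd p' r)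
      = (\<Sum>p'\<in>#M. fst p r *\<^sub>R ((\<Prod>q\<in>#M - {#p'#}. fst q r) *\<^sub>R snd p' r))"
    by (intro arg_cong[of _ _ sum_mset] image_mset_cong) (auto simp: add_mset_diff_bothsides)
  also have "\<dots> = fst p r *\<^sub>R forest_deriv M r"
    unfolding forest_deriv_def by (rule scale)
  finally show ?thesis
    by (simp add: forest_deriv_def forest_val_def add.commute)
qed

lemma prod_list_cpath:
  "prod_list (map f ts) = CPath (forest_val (mset (map (\<lambda>t. (cval (f t), cder (f t))) ts)))
     (forest_deriv (mset (map (\<lambda>t. (cval (f t), cder (f t))) ts)))"
proof (induction ts)
  case Nil
  show ?case by (rule cpath_eqI) (auto simp: forest_val_def forest_deriv_def)
next
  case (Cons t ts)
  show ?case
    by (rule cpath_eqI) (auto simp: Cons forest_deriv_add, auto simp: forest_val_def)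
qed

lemma norm_comp_deriv: "norm (comp_deriv Z' a r) \<le> norm (Z' r)"
proof (rule norm_blinfun_bound)
  fix x
  have "norm (blinfun_apply (comp_deriv Z' a r) x) = \<bar>blinfun_apply (Z' r) x $ a\<bar>"
    by (simp add: comp_deriv_def inner_axis)
  also have "\<dots> \<le> norm (blinfun_apply (Z' r) x)" by (rule component_le_norm_cart)
  also have "\<dots> \<le> norm (Z' r) * norm x" by (rule norm_blinfun)
  finally show "norm (blinfun_apply (comp_deriv Z' a r) x) \<le> norm (Z' r) * norm x" .
qed simp

lemma comp_deriv_apply: "blinfun_apply (comp_deriv Z' a r) x = blinfun_apply (Z' r) x $ a"
  by (simp add: comp_deriv_def inner_axis)

lemma norm_comp_deriv_diff: "norm (comp_deriv Z' a r - comp_deriv Z' a s) \<le> norm (Z' r - Z' s)"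
proof -
  have "comp_deriv Z' a r - comp_deriv Z' a s = comp_deriv (\<lambda>_. Z' r - Z' s) a r"
    by (rule blinfun_eqI) (simp add: comp_deriv_apply blinfun.diff_left)
  then show ?thesis using norm_comp_deriv[of "\<lambda>_. Z' r - Z' s" a r] by simp
qed

lemma abs_blinfun_axis: "\<bar>blinfun_apply (A :: (real^'d::finite) \<Rightarrow>\<^sub>L real) (axis i 1)\<bar> \<le> norm A"
  using norm_blinfun[of A "axis i 1"] by simp

lemma blinfun_eq_sum_axis:
  "blinfun_apply (A :: (real^'d::finite) \<Rightarrow>\<^sub>L real) x = (\<Sum>i\<in>UNIV. x $ i * blinfun_apply A (axis i 1))"
  by (subst vec_eq_sum_axis[of x]) (simp add: blinfun.sum_right blinfun.scaleR_right)

lemma double_sum_bound: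
  fixes Q :: "real^'d^'d::finite"
  assumes "\<And>i j. \<bar>m i j\<bar> \<le> B"
  shows "\<bar>\<Sum>i\<in>UNIV. \<Sum>j\<in>UNIV. Q $ i $ j * m i j\<bar> \<le> real (CARD('d) * CARD('d)) * (norm Q * B)"
proof -
  have "\<bar>Q $ i $ j * m i j\<bar> \<le> norm Q * B" for i j
    unfolding abs_mult using order_trans[OF component_le_norm_cart Finite_Cartesian_Product.norm_nth_le]
    by (intro mult_mono assms) auto
  then have "\<bar>\<Sum>i\<in>UNIV. \<Sum>j\<in>UNIV. Q $ i $ j * m i j\<bar> \<le> (\<Sum>i\<in>(UNIV::'d set). \<Sum>j\<in>(UNIV::'d set). norm Q * B)"
    by (intro order_trans[OF sum_abs] sum_mono) auto
  also have "\<dots> = real (CARD('d) * CARD('d)) * (norm Q * B)" by simp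
  finally show ?thesis .
qed

section \<open>The scalar rough integral and the defect of its germ\<close>

text \<open>The summand of the controlled rough integral of \<open>h\<close> against the component
  Z^a, with the pairing of Gubinelli derivatives written in coordinates.\<close>

definition sgerm :: "(real \<Rightarrow> real \<Rightarrow> real^'d^'d) \<Rightarrow> (real \<Rightarrow> real^'m) \<Rightarrow> (real \<Rightarrow> (real^'d) \<Rightarrow>\<^sub>L (real^'m)) \<Rightarrow>
    'm::finite \<Rightarrow> 'd::finite cpath \<Rightarrow> real \<Rightarrow> real \<Rightarrow> real" where
  "sgerm XX Z Z' a h s t = cval h s * (Z t $ a - Z s $ a)
     + (\<Sum>i\<in>UNIV. \<Sum>j\<in>UNIV. XX s t $ i $ j * (cder h s (axis i 1) * comp_deriv Z' a s (axis j 1)))"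

text \<open>When a real number acts by multiplication, \<open>diamond\<close> collapses to the
  product of the two Gubinelli derivatives; the integrals in \<open>tree_path\<close> are therefore
  limits of sums of \<open>sgerm\<close>.\<close>

lemma has_rough_integral_scalar:
  "has_rough_integral XX (\<lambda>r. blinfun_scaleR_left (cval h r)) (\<lambda>r. Blinfun blinfun_scaleR_left o\<^sub>L cder h r)
     (\<lambda>r. Z r $ a) (comp_deriv Z' a) s t I \<longleftrightarrow> has_sewing (sgerm XX Z Z' a h) s t I"
  unfolding has_rough_integral_def has_sewing_def sgerm_def diamond_def
  by (simp add: bounded_linear_Blinfun_apply bounded_linear_blinfun_scaleR_left mult_ac)

lemma sgerm_add: "sgerm XX Z Z' a (f + g) s t = sgerm XX Z Z' a f s t + sgerm XX Z Z' a g s t"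
  by (simp add: sgerm_def algebra_simps blinfun.add_left sum.distrib)

lemma sgerm_cmult: "sgerm XX Z Z' a (cconst c * g) s t = c * sgerm XX Z Z' a g s t"
  by (simp add: sgerm_def algebra_simps blinfun.scaleR_left sum_distrib_left)

text \<open>The description operator makes integration total on the ring. The value carries
  information only where the limit exists, so linearity will hold on an interval for controlled
  integrands and not as an identity of the ring.\<close>

definition cint :: "(real \<Rightarrow> real \<Rightarrow> real^'d^'d) \<Rightarrow> (real \<Rightarrow> real^'m) \<Rightarrow> (real \<Rightarrow> (real^'d) \<Rightarrow>\<^sub>L (real^'m)) \<Rightarrow>
    real \<Rightarrow> 'm::finite \<Rightarrow> 'd::finite cpath \<Rightarrow> 'd cpath" where
  "cint XX Z Z' u a h = CPath (\<lambda>t. THE I. has_sewing (sgerm XX Z Z' a h) u t I)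
     (\<lambda>r. cval h r *\<^sub>R comp_deriv Z' a r)"

text \<open>All constants of the rough path and of the driver are merged into one M0 \<ge> 1, which
  also bounds T^\<alpha>. The estimates include s = t, and second order quantities are measured by
  the square of |t - s|^\<alpha>, so that orders can be counted in powers of
  \<open>w\<close>.\<close>

locale rough_driver =
  fixes \<alpha> T M0 :: real
    and X :: "real \<Rightarrow> real^'d::finite" and XX :: "real \<Rightarrow> real \<Rightarrow> real^'d^'d"
    and Z :: "real \<Rightarrow> real^'m::finite" and Z' :: "real \<Rightarrow> (real^'d) \<Rightarrow>\<^sub>L (real^'m)"
  assumes \<alpha>: "1 / 3 < \<alpha>" "\<alpha> \<le> 1 / 2" and T0: "0 < T" and M0: "1 \<le> M0" and T_le: "T powr \<alpha> \<le> M0"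
    and X_holder: "\<And>s t. 0 \<le> s \<Longrightarrow> s \<le> t \<Longrightarrow> t \<le> T \<Longrightarrow> norm (X t - X s) \<le> M0 * (t - s) powr \<alpha>"
    and XX_bound: "\<And>s t. 0 \<le> s \<Longrightarrow> s \<le> t \<Longrightarrow> t \<le> T \<Longrightarrow> norm (XX s t) \<le> M0 * ((t - s) powr \<alpha>)\<^sup>2"
    and chen: "\<And>s r t. 0 \<le> s \<Longrightarrow> s \<le> r \<Longrightarrow> r \<le> t \<Longrightarrow> t \<le> T \<Longrightarrow>
        XX s t = XX s r + XX r t + tensor (X r - X s) (X t - X r)"
    and Z_holder: "\<And>s t. 0 \<le> s \<Longrightarrow> s \<le> t \<Longrightarrow> t \<le> T \<Longrightarrow> norm (Z t - Z s) \<le> M0 * (t - s) powr \<alpha>"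
    and Z'_bound: "\<And>t. 0 \<le> t \<Longrightarrow> t \<le> T \<Longrightarrow> norm (Z' t) \<le> M0"
    and Z'_holder: "\<And>s t. 0 \<le> s \<Longrightarrow> s \<le> t \<Longrightarrow> t \<le> T \<Longrightarrow> norm (Z' t - Z' s) \<le> M0 * (t - s) powr \<alpha>"
    and Z_rem: "\<And>s t. 0 \<le> s \<Longrightarrow> s \<le> t \<Longrightarrow> t \<le> T \<Longrightarrow>
        norm (Z t - Z s - Z' s (X t - X s)) \<le> M0 * ((t - s) powr \<alpha>)\<^sup>2"
begin

abbreviation w :: "real \<Rightarrow> real \<Rightarrow> real" where "w s t \<equiv> (t - s) powr \<alpha>"

lemma w_mono: "s \<le> s' \<Longrightarrow> s' \<le> t' \<Longrightarrow> t' \<le> t \<Longrightarrow> w s' t' \<le> w s t"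
  using \<alpha> by (intro powr_mono2) auto

lemma w_M0: "0 \<le> s \<Longrightarrow> s \<le> t \<Longrightarrow> t \<le> T \<Longrightarrow> w s t \<le> M0"
  using w_mono[of 0 s t T] T_le by simp

lemma w_cube: "(t - s) powr (3 * \<alpha>) = w s t ^ 3"
  using powr_power[of "t - s" \<alpha> 3] by (cases "t = s") auto

lemma \<theta>: "1 < 3 * \<alpha>" using \<alpha> by simp

definition cD :: real where "cD = real (CARD('d) * CARD('d))"

lemma cD: "0 \<le> cD" by (simp add: cD_def)

lemma Z_comp:
  assumes "0 \<le> s" "s \<le> t" "t \<le> T"
  shows "\<bar>Z t $ a - Z s $ a\<bar> \<le> M0 * w s t"
    "norm (comp_deriv Z' a s) \<le> M0" "norm (comp_deriv Z' a t) \<le> M0"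
    "norm (comp_deriv Z' a t - comp_deriv Z' a s) \<le> M0 * w s t"
    "\<bar>Z t $ a - Z s $ a - comp_deriv Z' a s (X t - X s)\<bar> \<le> M0 * (w s t)\<^sup>2"
proof -
  show "\<bar>Z t $ a - Z s $ a\<bar> \<le> M0 * w s t"
    using order_trans[OF component_le_norm_cart[of "Z t - Z s" a] Z_holder[OF assms]] by simp
  show "\<bar>Z t $ a - Z s $ a - comp_deriv Z' a s (X t - X s)\<bar> \<le> M0 * (w s t)\<^sup>2"
    using order_trans[OF component_le_norm_cart[of "Z t - Z s - Z' s (X t - X s)" a] Z_rem[OF assms]]
    by (simp add: comp_deriv_apply)
  show "norm (comp_deriv Z' a s) \<le> M0" "norm (comp_deriv Z' a t) \<le> M0"
    using norm_comp_deriv order_trans Z'_bound assms by (meson order_trans)+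
  show "norm (comp_deriv Z' a t - comp_deriv Z' a s) \<le> M0 * w s t"
    using norm_comp_deriv_diff Z'_holder[OF assms] order_trans by blast
qed

definition ctl :: "real \<Rightarrow> real \<Rightarrow> real \<Rightarrow> real \<Rightarrow> 'd cpath \<Rightarrow> bool" where
  "ctl u v A k h \<longleftrightarrow> (\<forall>s t. u \<le> s \<and> s \<le> t \<and> t \<le> v \<longrightarrow>
     norm (cder h s) \<le> A \<and> norm (cder h t - cder h s) \<le> k * w s t \<and>
     \<bar>cval h t - cval h s - cder h s (X t - X s)\<bar> \<le> k * (w s t)\<^sup>2)"

lemma ctlD:
  assumes "ctl u v A k h" "u \<le> s" "s \<le> t" "t \<le> v"
  shows "norm (cder h s) \<le> A" "norm (cder h t) \<le> A" "norm (cder h t - cder h s) \<le> k * w s t"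
    "\<bar>cval h t - cval h s - cder h s (X t - X s)\<bar> \<le> k * (w s t)\<^sup>2"
  using assms unfolding ctl_def by (blast intro: order_trans)+

definition defect_const :: real where
  "defect_const = 2 * M0 + cD * M0\<^sup>2 + M0 * (M0 + M0\<^sup>2) + cD * M0\<^sup>2"

lemma defect_const: "0 \<le> defect_const"
  using M0 cD by (auto simp: defect_const_def intro!: add_nonneg_nonneg mult_nonneg_nonneg)

text \<open>By Chen's relation the defect consists of three products: remainder of \<open>h\<close>
  times increment of Z, \<open>h'\<close> applied to an increment of X times remainder of Z, and XX
  times an increment of the product of the Gubinelli derivatives. Each is of third order in
  \<open>w\<close>.\<close>

lemma sgerm_defect:
  assumes h: "ctl u v A k h" and u: "0 \<le> u" and v: "v \<le> T"
    and s: "u \<le> s" "s \<le> r" "r \<le> t" "t \<le> v"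
  shows "\<bar>sgerm XX Z Z' a h s t - sgerm XX Z Z' a h s r - sgerm XX Z Z' a h r t\<bar>
    \<le> (defect_const * (A + k)) * (t - s) powr (3 * \<alpha>)"
proof -
  let ?x = "w s t" and ?z = "comp_deriv Z' a"
  let ?p = "\<lambda>s i. cder h s (axis i 1)" and ?q = "\<lambda>s j. ?z s (axis j 1)"
  have A0: "0 \<le> A" using ctlD(1)[OF h, of s t] s norm_ge_zero order_trans by (metis order.trans)
  have x0: "0 \<le> ?x" by simp
  have xs: "w s r \<le> ?x" "w r t \<le> ?x" using s by (auto intro!: w_mono)
  have k0: "0 \<le> k * w s r" using ctlD(3)[OF h, of s r] s norm_ge_zero order_trans by (metis order.trans)
  have "0 \<le> k * ?x" using ctlD(3)[OF h, of s t] s norm_ge_zero order_trans by (metis order.trans)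
  \<comment> \<open>The predicate \<open>ctl\<close> bounds only products of \<open>k\<close> with
    powers of \<open>w\<close>, so on a degenerate interval the sign of \<open>k\<close> is open;
    there all three germs vanish.\<close>
  then consider "?x = 0" | "0 \<le> k" using x0 by (auto simp: zero_le_mult_iff)
  then show ?thesis
  proof cases
    case 1
    then have "t = s" using s \<alpha> by auto
    then have st: "r = s" "t = s" using s by auto
    have "XX s s = 0"
      using XX_bound[of s s] s u v st by simp
    then show ?thesis unfolding st by (simp add: sgerm_def)
  next
    case 2
    have X1: "norm (X r - X s) \<le> M0 * ?x" "norm (X t - X r) \<le> M0 * ?x"
      using X_holder[of s r] X_holder[of r t] s u v xs M0 by (smt (verit) mult_left_mono)+
    \<comment> \<open>The tensor in Chen's relation factorizes under the pairing; this product of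
      two first order terms completes the increments of \<open>h\<close> and of Z to
      remainders.\<close>
    have tr: "(\<Sum>i\<in>UNIV. \<Sum>j\<in>UNIV. tensor (X r - X s) (X t - X r) $ i $ j * (?p s i * ?q s j))
        = cder h s (X r - X s) * ?z s (X t - X r)"
      unfolding blinfun_eq_sum_axis[of "cder h s" "X r - X s"] blinfun_eq_sum_axis[of "?z s" "X t - X r"]
      by (simp add: tensor_def sum_product mult_ac)
    have XXst: "XX s t = XX s r + XX r t + tensor (X r - X s) (X t - X r)"
      using s u v by (intro chen) auto
    have eq: "sgerm XX Z Z' a h s t - sgerm XX Z Z' a h s r - sgerm XX Z Z' a h r t
      = - ((cval h r - cval h s - cder h s (X r - X s)) * (Z t $ a - Z r $ a))
        - cder h s (X r - X s) * (Z t $ a - Z r $ a - ?z s (X t - X r))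
        - (\<Sum>i\<in>UNIV. \<Sum>j\<in>UNIV. XX r t $ i $ j * (?p r i * ?q r j - ?p s i * ?q s j))"
      unfolding sgerm_def XXst
      by (simp add: distrib_right sum.distrib tr right_diff_distrib sum_subtractf)
         (simp add: algebra_simps)
    have T1: "\<bar>(cval h r - cval h s - cder h s (X r - X s)) * (Z t $ a - Z r $ a)\<bar> \<le> (k * ?x\<^sup>2) * (M0 * ?x)"
      unfolding abs_mult
    proof (intro mult_mono)
      have "\<bar>cval h r - cval h s - cder h s (X r - X s)\<bar> \<le> k * (w s r)\<^sup>2"
        using s by (intro ctlD(4)[OF h]) auto
      also have "\<dots> \<le> k * ?x\<^sup>2" using 2 xs by (intro mult_left_mono power_mono) auto
      finally show "\<bar>cval h r - cval h s - cder h s (X r - X s)\<bar> \<le> k * ?x\<^sup>2" .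
      have "\<bar>Z t $ a - Z r $ a\<bar> \<le> M0 * w r t" using s u v by (intro Z_comp) auto
      also have "\<dots> \<le> M0 * ?x" using M0 xs by (intro mult_left_mono) auto
      finally show "\<bar>Z t $ a - Z r $ a\<bar> \<le> M0 * ?x" .
    qed (use 2 in auto)
    have T2: "\<bar>cder h s (X r - X s) * (Z t $ a - Z r $ a - ?z s (X t - X r))\<bar>
        \<le> (A * (M0 * ?x)) * ((M0 + M0\<^sup>2) * ?x\<^sup>2)"
      unfolding abs_mult
    proof (intro mult_mono)
      have "\<bar>cder h s (X r - X s)\<bar> \<le> norm (cder h s) * norm (X r - X s)"
        using norm_blinfun[of "cder h s"] by simp
      also have "\<dots> \<le> A * (M0 * ?x)"
        using s by (intro mult_mono X1 ctlD(1)[OF h, of s t] A0) auto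
      finally show "\<bar>cder h s (X r - X s)\<bar> \<le> A * (M0 * ?x)" .
      have "Z t $ a - Z r $ a - ?z s (X t - X r)
        = (Z t $ a - Z r $ a - ?z r (X t - X r)) + (?z r - ?z s) (X t - X r)"
        by (simp add: blinfun.diff_left)
      also have "\<bar>\<dots>\<bar> \<le> M0 * (w r t)\<^sup>2 + norm (?z r - ?z s) * norm (X t - X r)"
        using s u v norm_blinfun[of "?z r - ?z s" "X t - X r"]
        by (intro order_trans[OF abs_triangle_ineq] add_mono Z_comp) auto
      also have "\<dots> \<le> M0 * ?x\<^sup>2 + (M0 * ?x) * (M0 * ?x)"
      proof (intro add_mono mult_mono X1)
        have "norm (?z r - ?z s) \<le> M0 * w s r" using s u v by (intro Z_comp) auto
        also have "\<dots> \<le> M0 * ?x" using M0 xs by (intro mult_left_mono) auto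
        finally show "norm (?z r - ?z s) \<le> M0 * ?x" .
      qed (use M0 xs in \<open>auto intro: power_mono\<close>)
      finally show "\<bar>Z t $ a - Z r $ a - ?z s (X t - X r)\<bar> \<le> (M0 + M0\<^sup>2) * ?x\<^sup>2"
        by (simp add: algebra_simps power2_eq_square)
    qed (use A0 M0 in auto)
    have T3: "\<bar>\<Sum>i\<in>UNIV. \<Sum>j\<in>UNIV. XX r t $ i $ j * (?p r i * ?q r j - ?p s i * ?q s j)\<bar>
        \<le> cD * ((M0 * ?x\<^sup>2) * ((k * ?x) * M0 + A * (M0 * ?x)))"
    proof -
      have "\<bar>?p r i * ?q r j - ?p s i * ?q s j\<bar> \<le> (k * ?x) * M0 + A * (M0 * ?x)" for i j
      proof -
        have "?p r i * ?q r j - ?p s i * ?q s j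
          = (cder h r - cder h s) (axis i 1) * ?q r j + ?p s i * (?z r - ?z s) (axis j 1)"
          by (simp add: blinfun.diff_left algebra_simps)
        also have "\<bar>\<dots>\<bar> \<le> norm (cder h r - cder h s) * norm (?z r) + norm (cder h s) * norm (?z r - ?z s)"
          by (intro order_trans[OF abs_triangle_ineq] add_mono)
             (auto simp: abs_mult intro!: mult_mono abs_blinfun_axis)
        also have "\<dots> \<le> (k * ?x) * M0 + A * (M0 * ?x)"
        proof (intro add_mono mult_mono)
          have "norm (cder h r - cder h s) \<le> k * w s r" using s by (intro ctlD[OF h]) auto
          also have "\<dots> \<le> k * ?x" using 2 xs by (intro mult_left_mono) auto
          finally show "norm (cder h r - cder h s) \<le> k * ?x" .
          show "norm (?z r) \<le> M0" using s u v by (intro Z_comp(3)[of s]) auto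
          show "norm (cder h s) \<le> A" using s by (intro ctlD(1)[OF h, of s t]) auto
          have "norm (?z r - ?z s) \<le> M0 * w s r" using s u v by (intro Z_comp) auto
          also have "\<dots> \<le> M0 * ?x" using M0 xs by (intro mult_left_mono) auto
          finally show "norm (?z r - ?z s) \<le> M0 * ?x" .
        qed (use 2 A0 in auto)
        finally show ?thesis .
      qed
      then have "\<bar>\<Sum>i\<in>UNIV. \<Sum>j\<in>UNIV. XX r t $ i $ j * (?p r i * ?q r j - ?p s i * ?q s j)\<bar>
          \<le> cD * (norm (XX r t) * ((k * ?x) * M0 + A * (M0 * ?x)))"
        unfolding cD_def by (rule double_sum_bound)
      also have "\<dots> \<le> cD * ((M0 * ?x\<^sup>2) * ((k * ?x) * M0 + A * (M0 * ?x)))"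
      proof (intro mult_left_mono mult_right_mono)
        have "norm (XX r t) \<le> M0 * (w r t)\<^sup>2" using s u v by (intro XX_bound) auto
        also have "\<dots> \<le> M0 * ?x\<^sup>2" using M0 xs by (intro mult_left_mono power_mono) auto
        finally show "norm (XX r t) \<le> M0 * ?x\<^sup>2" .
      qed (use A0 2 M0 cD in auto)
      finally show ?thesis .
    qed
    have "\<bar>sgerm XX Z Z' a h s t - sgerm XX Z Z' a h s r - sgerm XX Z Z' a h r t\<bar>
       \<le> (k * ?x\<^sup>2) * (M0 * ?x) + (A * (M0 * ?x)) * ((M0 + M0\<^sup>2) * ?x\<^sup>2)
         + cD * ((M0 * ?x\<^sup>2) * ((k * ?x) * M0 + A * (M0 * ?x)))"
      using T1 T2 T3 unfolding eq by linarith
    also have "\<dots> = (k * (M0 + cD * M0\<^sup>2) + A * (M0 * (M0 + M0\<^sup>2) + cD * M0\<^sup>2)) * ?x ^ 3"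
      by (simp add: algebra_simps power2_eq_square power3_eq_cube)
    also have "\<dots> \<le> (k * defect_const + A * defect_const) * ?x ^ 3"
      using 2 A0 M0 cD by (intro mult_right_mono add_mono mult_left_mono) (auto simp: defect_const_def)
    finally show ?thesis unfolding w_cube by (simp add: algebra_simps)
  qed
qed

end

section \<open>Products and integrals in the scaling of the interval length\<close>

context rough_driver
begin

lemma cval_cintI:
  assumes "has_sewing (sgerm XX Z Z' a h) u t J" "u \<le> t"
  shows "cval (cint XX Z Z' u a h) t = J"
  using assms by (auto simp: cint_def intro: has_sewing_unique)

lemma ctl_mono:
  assumes "ctl u v A k h" "u \<le> u'" "v' \<le> v" "A \<le> A'" "k \<le> k'"
  shows "ctl u' v' A' k' h"
proof -
  have "k * y \<le> k' * y" if "0 \<le> y" for y using assms(5) that by (rule mult_right_mono)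
  then have "k * w s t \<le> k' * w s t" "k * (w s t)\<^sup>2 \<le> k' * (w s t)\<^sup>2" for s t by auto
  with assms show ?thesis unfolding ctl_def by (smt (verit))
qed

context
  fixes u v A k h
  assumes h: "ctl u v A k h" and u: "0 \<le> u" and v: "v \<le> T" and A: "0 \<le> A" and k: "0 \<le> k"
begin

lemma defect_nonneg: "0 \<le> defect_const * (A + k)"
  using defect_const A k by simp

lemma has_sewing_cint:
  assumes "u \<le> s" "s \<le> v"
  shows "has_sewing (sgerm XX Z Z' a h) u s (cval (cint XX Z Z' u a h) s)"
proof -
  obtain J where "has_sewing (sgerm XX Z Z' a h) u s J"
    using has_sewing_exists[OF \<theta> defect_nonneg sgerm_defect[OF h u v] order_refl assms] by blast
  then show ?thesis using cval_cintI[OF _ assms(1)] by metis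
qed

lemma cint_increment:
  assumes "u \<le> s" "s \<le> t" "t \<le> v"
  shows "\<bar>cval (cint XX Z Z' u a h) t - cval (cint XX Z Z' u a h) s - sgerm XX Z Z' a h s t\<bar>
    \<le> sew_const (3 * \<alpha>) * (defect_const * (A + k)) * w s t ^ 3"
  unfolding w_cube[symmetric]
  by (rule has_sewing_increment_bound[OF \<theta> defect_nonneg sgerm_defect[OF h u v]])
     (use assms has_sewing_cint in auto)

end

lemma cval_cint_start: "cval (cint XX Z Z' u a h) u = 0"
  by (rule cval_cintI[OF has_sewing_refl order_refl])

lemma cder_cint: "cder (cint XX Z Z' u a h) r = cval h r *\<^sub>R comp_deriv Z' a r"
  by (simp add: cint_def)

text \<open>A path on \<open>[u, v]\<close> that is small of order \<open>k\<close> has values, Gubinelli derivative, and Hoelder and remainder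
  constants of orders \<open>w\<^sup>k\<close>, \<open>w\<^sup>k\<^sup>-\<^sup>1\<close> and \<open>w\<^sup>k\<^sup>-\<^sup>2\<close>, where \<open>w = (v - u)\<^sup>\<alpha>\<close>: this is the scaling that integration
  improves by one power of \<open>w\<close>.\<close>

definition bdd :: "real \<Rightarrow> real \<Rightarrow> real \<Rightarrow> 'd cpath \<Rightarrow> bool" where
  "bdd u v k h \<longleftrightarrow> (\<forall>s\<in>{u..v}. \<bar>cval h s\<bar> \<le> k * (w u v)\<^sup>2) \<and> ctl u v (k * w u v) k h"

lemma bddI:
  assumes "\<And>s. u \<le> s \<Longrightarrow> s \<le> v \<Longrightarrow> \<bar>cval h s\<bar> \<le> k * (w u v)\<^sup>2"
    and "\<And>s. u \<le> s \<Longrightarrow> s \<le> v \<Longrightarrow> norm (cder h s) \<le> k * w u v"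
    and "\<And>s t. u \<le> s \<Longrightarrow> s \<le> t \<Longrightarrow> t \<le> v \<Longrightarrow> norm (cder h t - cder h s) \<le> k * w s t"
    and "\<And>s t. u \<le> s \<Longrightarrow> s \<le> t \<Longrightarrow> t \<le> v \<Longrightarrow>
      \<bar>cval h t - cval h s - cder h s (X t - X s)\<bar> \<le> k * (w s t)\<^sup>2"
  shows "bdd u v k h"
  using assms by (auto simp: bdd_def ctl_def)

lemma bddD:
  assumes "bdd u v k h" "u \<le> s" "s \<le> t" "t \<le> v"
  shows "\<bar>cval h s\<bar> \<le> k * (w u v)\<^sup>2" "\<bar>cval h t\<bar> \<le> k * (w u v)\<^sup>2"
    "norm (cder h s) \<le> k * w u v" "norm (cder h t) \<le> k * w u v"
    "norm (cder h t - cder h s) \<le> k * w s t"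
    "\<bar>cval h t - cval h s - cder h s (X t - X s)\<bar> \<le> k * (w s t)\<^sup>2"
  using assms ctlD[of u v "k * w u v" k h s t] unfolding bdd_def by auto

lemma bdd_mono:
  assumes "bdd u v k h" "k \<le> k'"
  shows "bdd u v k' h"
proof -
  have "k * y \<le> k' * y" if "0 \<le> y" for y using assms(2) that by (rule mult_right_mono)
  then have "k * (w u v)\<^sup>2 \<le> k' * (w u v)\<^sup>2" "k * w u v \<le> k' * w u v" by auto
  with assms show ?thesis
    unfolding bdd_def by (auto intro: ctl_mono order_trans)
qed

lemma bdd_zero:
  assumes "\<And>r. u \<le> r \<Longrightarrow> r \<le> v \<Longrightarrow> cval h r = 0" "\<And>r. u \<le> r \<Longrightarrow> r \<le> v \<Longrightarrow> cder h r = 0"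
  shows "bdd u v 0 h"
  using assms by (intro bddI) auto

lemma bdd_add:
  assumes "bdd u v k h" "bdd u v l g"
  shows "bdd u v (k + l) (h + g)"
proof (rule bddI)
  fix s assume s: "u \<le> s" "s \<le> v"
  note H = bddD[OF assms(1) s(1) order_refl s(2)] and G = bddD[OF assms(2) s(1) order_refl s(2)]
  show "\<bar>cval (h + g) s\<bar> \<le> (k + l) * (w u v)\<^sup>2"
    using H(1) G(1) by (simp add: distrib_right)
  show "norm (cder (h + g) s) \<le> (k + l) * w u v"
    using order_trans[OF norm_triangle_ineq add_mono[OF H(3) G(3)]] by (simp add: distrib_right)
next
  fix s t assume s: "u \<le> s" "s \<le> t" "t \<le> v"
  note H = bddD[OF assms(1) s] and G = bddD[OF assms(2) s]
  have "norm ((cder h t - cder h s) + (cder g t - cder g s)) \<le> k * w s t + l * w s t"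
    by (intro order_trans[OF norm_triangle_ineq] add_mono H G)
  then show "norm (cder (h + g) t - cder (h + g) s) \<le> (k + l) * w s t"
    by (simp add: algebra_simps)
  show "\<bar>cval (h + g) t - cval (h + g) s - cder (h + g) s (X t - X s)\<bar> \<le> (k + l) * (w s t)\<^sup>2"
    using H(6) G(6) unfolding cval_simps cder_simps blinfun.add_left distrib_right by linarith
qed

lemma bdd_holder:
  assumes h: "bdd u v k h" and k: "0 \<le> k" and u: "0 \<le> u" and v: "v \<le> T" and s: "u \<le> s" "s \<le> t" "t \<le> v"
  shows "\<bar>cval h t - cval h s\<bar> \<le> k * w u v * w s t * (1 + M0)"
proof -
  note H = bddD[OF h s]
  have le: "w s t \<le> w u v" using s by (intro w_mono) auto
  have "\<bar>cval h t - cval h s\<bar> \<le> \<bar>cval h t - cval h s - cder h s (X t - X s)\<bar> + \<bar>cder h s (X t - X s)\<bar>"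
    by linarith
  also have "\<dots> \<le> k * (w s t * w u v) + (k * w u v) * (M0 * w s t)"
  proof (intro add_mono)
    show "\<bar>cval h t - cval h s - cder h s (X t - X s)\<bar> \<le> k * (w s t * w u v)"
      by (rule order_trans[OF H(6)]) (unfold power2_eq_square, intro mult_left_mono le k, auto)
    have "\<bar>cder h s (X t - X s)\<bar> \<le> norm (cder h s) * norm (X t - X s)"
      using norm_blinfun[of "cder h s"] by simp
    also have "\<dots> \<le> (k * w u v) * (M0 * w s t)"
      using s u v k by (intro mult_mono H X_holder) auto
    finally show "\<bar>cder h s (X t - X s)\<bar> \<le> (k * w u v) * (M0 * w s t)" .
  qed
  also have "\<dots> = k * w u v * w s t * (1 + M0)" by (simp add: algebra_simps)
  finally show ?thesis .
qed

text \<open>It dominates each constant occurring for a product: 1 for the value, 2 for the Gubinelli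
  derivative, \<open>2 * (2 + M0)\<close> for its increments and \<open>2 + (1 + M0)^2\<close> for
  the remainder.\<close>

definition mult_const :: real where
  "mult_const = 2 * (2 + M0) + 2 + (1 + M0)\<^sup>2"

text \<open>In terms of the value bounds c = k w^2 and d = l w^2 this is c d = (k l w^2) w^2. The
  remainder of a product is made of the two remainders and the product of the two increments, and
  \<open>bdd_holder\<close> bounds the latter.\<close>

lemma bdd_mult:
  assumes h: "bdd u v k h" and g: "bdd u v l g" and k: "0 \<le> k" and l: "0 \<le> l"
    and u: "0 \<le> u" and v: "v \<le> T"
  shows "bdd u v (mult_const * (k * l * (w u v)\<^sup>2)) (h * g)"
proof -
  let ?n = "w u v"
  have K: "1 \<le> mult_const" "2 \<le> mult_const" "2 * (2 + M0) \<le> mult_const" "2 + (1 + M0)\<^sup>2 \<le> mult_const"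
    using M0 by (auto simp: mult_const_def)
  have m: "c * y \<le> mult_const * y" if "c \<le> mult_const" "0 \<le> y" for c y
    using that by (rule mult_right_mono)
  show ?thesis
  proof (rule bddI)
    fix s assume s: "u \<le> s" "s \<le> v"
    note H = bddD[OF h s(1) order_refl s(2)] and G = bddD[OF g s(1) order_refl s(2)]
    have "\<bar>cval (h * g) s\<bar> \<le> (k * ?n\<^sup>2) * (l * ?n\<^sup>2)"
      unfolding cval_simps abs_mult by (intro mult_mono H G) (use k in auto)
    also have "\<dots> = 1 * (k * l * ?n\<^sup>2 * ?n\<^sup>2)" by simp
    also have "\<dots> \<le> mult_const * (k * l * ?n\<^sup>2 * ?n\<^sup>2)" using k l by (intro m K) auto
    finally show "\<bar>cval (h * g) s\<bar> \<le> mult_const * (k * l * ?n\<^sup>2) * ?n\<^sup>2" by (simp add: mult_ac)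
    have "norm (cder (h * g) s) \<le> \<bar>cval h s\<bar> * norm (cder g s) + \<bar>cval g s\<bar> * norm (cder h s)"
      unfolding cder_simps by (rule order_trans[OF norm_triangle_ineq]) simp
    also have "\<dots> \<le> (k * ?n\<^sup>2) * (l * ?n) + (l * ?n\<^sup>2) * (k * ?n)"
      by (intro add_mono mult_mono H G) (use k l in auto)
    also have "\<dots> = 2 * (k * l * ?n\<^sup>2 * ?n)" by (simp add: mult_ac)
    also have "\<dots> \<le> mult_const * (k * l * ?n\<^sup>2 * ?n)" using k l by (intro m K) auto
    finally show "norm (cder (h * g) s) \<le> mult_const * (k * l * ?n\<^sup>2) * ?n" by (simp add: mult_ac)
  next
    fix s t assume s: "u \<le> s" "s \<le> t" "t \<le> v"
    let ?x = "w s t"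
    note H = bddD[OF h s] and G = bddD[OF g s]
    note Hd = bdd_holder[OF h k u v s] and Gd = bdd_holder[OF g l u v s]
    have "cder (h * g) t - cder (h * g) s
       = (cval h t *\<^sub>R (cder g t - cder g s) + (cval h t - cval h s) *\<^sub>R cder g s)
       + (cval g t *\<^sub>R (cder h t - cder h s) + (cval g t - cval g s) *\<^sub>R cder h s)"
      by (simp add: algebra_simps)
    also have "norm \<dots> \<le> ((k * ?n\<^sup>2) * (l * ?x) + (k * ?n * ?x * (1 + M0)) * (l * ?n))
        + ((l * ?n\<^sup>2) * (k * ?x) + (l * ?n * ?x * (1 + M0)) * (k * ?n))"
      by (intro order_trans[OF norm_triangle_ineq] add_mono; simp only: norm_scaleR;
          intro mult_mono H G Hd Gd) (use k l M0 in auto)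
    also have "\<dots> = (2 * (2 + M0)) * (k * l * ?n\<^sup>2 * ?x)"
      by (simp add: algebra_simps power2_eq_square)
    also have "\<dots> \<le> mult_const * (k * l * ?n\<^sup>2 * ?x)" using k l by (intro m K) auto
    finally show "norm (cder (h * g) t - cder (h * g) s) \<le> mult_const * (k * l * ?n\<^sup>2) * ?x"
      by (simp add: mult_ac)
    have "cval (h * g) t - cval (h * g) s - cder (h * g) s (X t - X s)
      = cval h s * (cval g t - cval g s - cder g s (X t - X s))
      + cval g s * (cval h t - cval h s - cder h s (X t - X s))
      + (cval h t - cval h s) * (cval g t - cval g s)"
      by (simp add: algebra_simps blinfun.add_left blinfun.scaleR_left)
    also have "\<bar>\<dots>\<bar> \<le> (k * ?n\<^sup>2) * (l * ?x\<^sup>2) + (l * ?n\<^sup>2) * (k * ?x\<^sup>2)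
        + (k * ?n * ?x * (1 + M0)) * (l * ?n * ?x * (1 + M0))"
      by (intro order_trans[OF abs_triangle_ineq] add_mono; simp only: abs_mult;
          intro mult_mono H G Hd Gd) (use k l M0 in auto)
    also have "\<dots> = (2 + (1 + M0)\<^sup>2) * (k * l * ?n\<^sup>2 * ?x\<^sup>2)"
      by (simp add: algebra_simps power2_eq_square)
    also have "\<dots> \<le> mult_const * (k * l * ?n\<^sup>2 * ?x\<^sup>2)" using k l by (intro m K) auto
    finally show "\<bar>cval (h * g) t - cval (h * g) s - cder (h * g) s (X t - X s)\<bar>
        \<le> mult_const * (k * l * ?n\<^sup>2) * ?x\<^sup>2" by (simp add: mult_ac)
  qed
qed

text \<open>The first summand is the sewing constant for A + k = k w + k \<le> (M0 + 1) k. The rest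
  covers the terms of the germ and the Gubinelli derivative of the integral, using w \<le>
  M0.\<close>

definition int_const :: real where
  "int_const = sew_const (3 * \<alpha>) * (defect_const * (M0 + 1)) + 2 * M0 + 2 * M0\<^sup>2 + cD * M0\<^sup>2"

lemma int_const: "0 \<le> sew_const (3 * \<alpha>) * (defect_const * (M0 + 1))" "0 \<le> int_const"
  using sew_const(1)[OF \<theta>] defect_const M0 cD
  by (auto simp: int_const_def intro!: add_nonneg_nonneg mult_nonneg_nonneg)

text \<open>The Gubinelli derivative of the integral is the integrand times that of Z: its size k
  w^2 is (k w) w, and its Hoelder constant is of order k w by \<open>bdd_holder\<close>. Its value
  starts at 0, and the germ and the sewing error are of order k w^3. So the constant k improves to a
  multiple of k w at every level.\<close>

lemma bdd_cint:
  assumes h: "bdd u v k h" and k: "0 \<le> k" and u: "0 \<le> u" "u \<le> v" and v: "v \<le> T"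
  shows "bdd u v (int_const * (k * w u v)) (cint XX Z Z' u a h)"
proof -
  let ?n = "w u v" and ?J = "cint XX Z Z' u a h" and ?z = "comp_deriv Z' a"
  let ?S = "sew_const (3 * \<alpha>) * (defect_const * (M0 + 1))"
  have n: "0 \<le> ?n" "?n \<le> M0" using w_M0[OF u v] by auto
  have ctl: "ctl u v (k * ?n) k h" using h by (simp add: bdd_def)
  have m: "c * y \<le> int_const * y" if "c \<le> int_const" "0 \<le> y" for c y
    using that by (rule mult_right_mono)
  have M2: "0 \<le> M0" "0 \<le> M0\<^sup>2" "0 \<le> cD * M0\<^sup>2" "M0 \<le> M0\<^sup>2" using M0 cD by (auto simp: power2_eq_square)
  have inc: "\<bar>cval ?J t - cval ?J s - sgerm XX Z Z' a h s t\<bar> \<le> ?S * (k * (?n * (w s t)\<^sup>2))"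
    if s: "u \<le> s" "s \<le> t" "t \<le> v" for s t
  proof -
    have "\<bar>cval ?J t - cval ?J s - sgerm XX Z Z' a h s t\<bar>
        \<le> sew_const (3 * \<alpha>) * (defect_const * (k * ?n + k)) * w s t ^ 3"
      using s k n by (intro cint_increment[OF ctl u(1) v]) auto
    also have "\<dots> \<le> sew_const (3 * \<alpha>) * (defect_const * (k * (M0 + 1))) * (?n * (w s t)\<^sup>2)"
    proof (intro mult_mono mult_left_mono)
      show "k * ?n + k \<le> k * (M0 + 1)" using n k by (simp add: distrib_left mult_left_mono)
      have "w s t * (w s t)\<^sup>2 \<le> ?n * (w s t)\<^sup>2" using s by (intro mult_right_mono w_mono) auto
      then show "w s t ^ 3 \<le> ?n * (w s t)\<^sup>2" by (simp add: power3_eq_cube power2_eq_square)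
    qed (use sew_const(1)[OF \<theta>] defect_const k M0 in auto)
    also have "\<dots> = ?S * (k * (?n * (w s t)\<^sup>2))" by (simp add: algebra_simps)
    finally show ?thesis .
  qed
  have dbl: "\<bar>\<Sum>i\<in>UNIV. \<Sum>j\<in>UNIV. XX s t $ i $ j * (cder h s (axis i 1) * ?z s (axis j 1))\<bar>
      \<le> cD * M0\<^sup>2 * (k * (?n * (w s t)\<^sup>2))" if s: "u \<le> s" "s \<le> t" "t \<le> v" for s t
  proof -
    have "\<bar>cder h s (axis i 1) * ?z s (axis j 1)\<bar> \<le> (k * ?n) * M0" for i j
      unfolding abs_mult
    proof (intro mult_mono)
      show "\<bar>cder h s (axis i 1)\<bar> \<le> k * ?n"
        using abs_blinfun_axis bddD(3)[OF h s] by (rule order_trans)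
      have "norm (?z s) \<le> M0" using Z_comp(2)[of s t] s u v by auto
      then show "\<bar>?z s (axis j 1)\<bar> \<le> M0" by (rule order_trans[OF abs_blinfun_axis])
    qed (use k in auto)
    then have "\<bar>\<Sum>i\<in>UNIV. \<Sum>j\<in>UNIV. XX s t $ i $ j * (cder h s (axis i 1) * ?z s (axis j 1))\<bar>
        \<le> cD * (norm (XX s t) * ((k * ?n) * M0))"
      unfolding cD_def by (rule double_sum_bound)
    also have "\<dots> \<le> cD * ((M0 * (w s t)\<^sup>2) * ((k * ?n) * M0))"
      using s u v k n M0 cD by (intro mult_left_mono mult_right_mono XX_bound) auto
    finally show ?thesis by (simp add: power2_eq_square mult_ac)
  qed
  show ?thesis
  proof (rule bddI)
    fix s assume s: "u \<le> s" "s \<le> v"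
    note H = bddD[OF h s(1) order_refl s(2)]
    have wn: "w u s \<le> ?n" using s by (intro w_mono) auto
    have sq: "?n * (w u s)\<^sup>2 \<le> ?n * ?n\<^sup>2" using wn by (intro mult_left_mono power_mono) auto
    have "\<bar>cval ?J s\<bar> \<le> \<bar>cval ?J s - cval ?J u - sgerm XX Z Z' a h u s\<bar> + \<bar>cval h u * (Z s $ a - Z u $ a)\<bar>
       + \<bar>\<Sum>i\<in>UNIV. \<Sum>j\<in>UNIV. XX u s $ i $ j * (cder h u (axis i 1) * ?z u (axis j 1))\<bar>"
      unfolding sgerm_def cval_cint_start by linarith
    also have "\<dots> \<le> ?S * (k * (?n * ?n\<^sup>2)) + (k * ?n\<^sup>2) * (M0 * ?n) + cD * M0\<^sup>2 * (k * (?n * ?n\<^sup>2))"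
    proof (intro add_mono)
      show "\<bar>cval ?J s - cval ?J u - sgerm XX Z Z' a h u s\<bar> \<le> ?S * (k * (?n * ?n\<^sup>2))"
        by (rule order_trans[OF inc]) (use s k sq int_const in \<open>auto intro!: mult_left_mono\<close>)
      have "\<bar>Z s $ a - Z u $ a\<bar> \<le> M0 * w u s" using s u v by (intro Z_comp) auto
      also have "\<dots> \<le> M0 * ?n" using wn M0 by (intro mult_left_mono) auto
      finally have "\<bar>Z s $ a - Z u $ a\<bar> \<le> M0 * ?n" .
      then show "\<bar>cval h u * (Z s $ a - Z u $ a)\<bar> \<le> (k * ?n\<^sup>2) * (M0 * ?n)"
        unfolding abs_mult using bddD(1)[OF h _ s(1) s(2)] k by (intro mult_mono) auto
      show "\<bar>\<Sum>i\<in>UNIV. \<Sum>j\<in>UNIV. XX u s $ i $ j * (cder h u (axis i 1) * ?z u (axis j 1))\<bar>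
          \<le> cD * M0\<^sup>2 * (k * (?n * ?n\<^sup>2))"
        by (rule order_trans[OF dbl]) (use s k sq cD in \<open>auto intro!: mult_left_mono\<close>)
    qed
    also have "\<dots> = (?S + M0 + cD * M0\<^sup>2) * (k * ?n * ?n\<^sup>2)"
      by (simp add: algebra_simps)
    also have "\<dots> \<le> int_const * (k * ?n * ?n\<^sup>2)"
      using k n M2 by (intro m) (auto simp: int_const_def)
    finally show "\<bar>cval ?J s\<bar> \<le> int_const * (k * ?n) * ?n\<^sup>2" by (simp add: mult_ac)
    have zb: "norm (?z s) \<le> M0" using Z_comp(2)[of s s] s u v by auto
    have "norm (cder ?J s) \<le> (k * ?n\<^sup>2) * M0"
      unfolding cder_cint norm_scaleR real_norm_def using H(1) zb k by (intro mult_mono) auto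
    also have "\<dots> = M0 * (k * ?n * ?n)" by (simp add: power2_eq_square)
    also have "\<dots> \<le> int_const * (k * ?n * ?n)"
      using k n M2 int_const by (intro m) (auto simp: int_const_def)
    finally show "norm (cder ?J s) \<le> int_const * (k * ?n) * ?n" by (simp add: mult_ac)
  next
    fix s t assume s: "u \<le> s" "s \<le> t" "t \<le> v"
    let ?x = "w s t"
    note H = bddD[OF h s] and Hd = bdd_holder[OF h k u(1) v s]
    have su: "0 \<le> s" "t \<le> T" using s u v by auto
    note ZZ = Z_comp[OF su(1) s(2) su(2), of a]
    have "cder ?J t - cder ?J s = (cval h t - cval h s) *\<^sub>R ?z t + cval h s *\<^sub>R (?z t - ?z s)"
      unfolding cder_cint by (simp add: algebra_simps)
    also have "norm \<dots> \<le> (k * ?n * ?x * (1 + M0)) * M0 + (k * ?n\<^sup>2) * (M0 * ?x)"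
      by (intro order_trans[OF norm_triangle_ineq] add_mono; simp only: norm_scaleR real_norm_def;
          intro mult_mono H Hd ZZ) (use k M0 in auto)
    also have "\<dots> = ((1 + M0) * M0 + ?n * M0) * (k * ?n * ?x)"
      by (simp add: algebra_simps power2_eq_square)
    also have "\<dots> \<le> int_const * (k * ?n * ?x)"
    proof (rule m)
      have "?n * M0 \<le> M0 * M0" using n M0 by (intro mult_right_mono) auto
      then show "(1 + M0) * M0 + ?n * M0 \<le> int_const"
        using M2 int_const by (simp add: int_const_def power2_eq_square algebra_simps)
    qed (use k in auto)
    finally show "norm (cder ?J t - cder ?J s) \<le> int_const * (k * ?n) * ?x" by (simp add: mult_ac)
    have "\<bar>cval ?J t - cval ?J s - cder ?J s (X t - X s)\<bar>
      \<le> \<bar>cval ?J t - cval ?J s - sgerm XX Z Z' a h s t\<bar>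
       + \<bar>cval h s * (Z t $ a - Z s $ a - ?z s (X t - X s))\<bar>
       + \<bar>\<Sum>i\<in>UNIV. \<Sum>j\<in>UNIV. XX s t $ i $ j * (cder h s (axis i 1) * ?z s (axis j 1))\<bar>"
      unfolding sgerm_def cder_cint blinfun.scaleR_left real_scaleR_def right_diff_distrib by linarith
    also have "\<dots> \<le> ?S * (k * (?n * ?x\<^sup>2)) + (k * ?n\<^sup>2) * (M0 * ?x\<^sup>2) + cD * M0\<^sup>2 * (k * (?n * ?x\<^sup>2))"
      by (intro add_mono inc[OF s] dbl[OF s]; simp only: abs_mult; intro mult_mono H ZZ) (use k in auto)
    also have "\<dots> = (?S + ?n * M0 + cD * M0\<^sup>2) * (k * ?n * ?x\<^sup>2)"
      by (simp add: algebra_simps power2_eq_square)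
    also have "\<dots> \<le> int_const * (k * ?n * ?x\<^sup>2)"
    proof (rule m)
      have "?n * M0 \<le> M0 * M0" using n M0 by (intro mult_right_mono) auto
      then show "?S + ?n * M0 + cD * M0\<^sup>2 \<le> int_const"
        using M2 by (simp add: int_const_def power2_eq_square algebra_simps)
    qed (use k in auto)
    finally show "\<bar>cval ?J t - cval ?J s - cder ?J s (X t - X s)\<bar> \<le> int_const * (k * ?n) * ?x\<^sup>2"
      by (simp add: mult_ac)
  qed
qed

text \<open>Degenerate intervals are excluded because the normalization below divides by a power of
  the length.\<close>

definition itv :: "(real \<times> real) set" where
  "itv = {(u, v). 0 \<le> u \<and> u < v \<and> v \<le> T}"

text \<open>The same scaling normalized by the bound \<open>c\<close> of the value, so that
  constants have their absolute value as bound and products and integrals get the bounds required by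
  \<open>tree_expansion\<close>.\<close>

definition cnb :: "real \<times> real \<Rightarrow> 'd cpath \<Rightarrow> real \<Rightarrow> bool" where
  "cnb = (\<lambda>(u, v) h c. bdd u v (c / (w u v)\<^sup>2) h)"

lemma bdd_imp_cnb: "u < v \<Longrightarrow> bdd u v k h \<Longrightarrow> c = k * (w u v)\<^sup>2 \<Longrightarrow> cnb (u, v) h c"
  by (simp add: cnb_def)

text \<open>Linearity of integration comes from linearity of the germ, existence of the limits for
  controlled paths and uniqueness of limits. This determines the integrals on [u, v] only, which is
  what a bound 0 expresses.\<close>

sublocale ctree: tree_expansion itv "\<lambda>(u, v). w u v" cnb cconst "max mult_const int_const" M0
  "\<lambda>(u, v). cint XX Z Z' u"
proof
  show "0 \<le> max mult_const int_const" using int_const by (simp add: le_max_iff_disj)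
  show "cconst 1 = (1 :: 'd cpath)" by (simp add: one_cpath_def)
  fix r s
  show "cconst (r + s) = (cconst r + cconst s :: 'd cpath)" by (rule cpath_eqI) auto
  show "cconst (r * s) = (cconst r * cconst s :: 'd cpath)" by (rule cpath_eqI) auto
next
  fix uv x y c d r a assume "uv \<in> itv"
  then obtain u v where uv: "uv = (u, v)" "0 \<le> u" "u < v" "v \<le> T" by (auto simp: itv_def)
  let ?n = "w u v"
  have n: "0 < ?n" using uv by simp
  show "0 \<le> (case uv of (u, v) \<Rightarrow> w u v) \<and> (case uv of (u, v) \<Rightarrow> w u v) \<le> M0"
    using w_M0[of u v] uv by auto
  show "cnb uv (cconst r) \<bar>r\<bar>"
    unfolding uv cnb_def prod.case using n by (intro bddI) auto
  assume x: "cnb uv x c"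
  then have bx: "bdd u v (c / ?n\<^sup>2) x" by (simp add: uv cnb_def)
  have ctlx: "ctl u v (c / ?n\<^sup>2 * ?n) (c / ?n\<^sup>2) x" using bx by (simp add: bdd_def)
  have c0: "0 \<le> c" using bddD(1)[OF bx order_refl] uv n by (force intro: order_trans[OF abs_ge_zero])
  show "cnb uv x d" if "c \<le> d"
    unfolding uv cnb_def prod.case by (rule bdd_mono[OF bx]) (use that in \<open>auto intro: divide_right_mono\<close>)
  show "cnb uv ((case uv of (u, v) \<Rightarrow> cint XX Z Z' u) a x)
      (max mult_const int_const * (case uv of (u, v) \<Rightarrow> w u v) * c)"
  proof -
    have "bdd u v (int_const * (c / ?n\<^sup>2 * ?n)) (cint XX Z Z' u a x)"
      using uv c0 by (intro bdd_cint bx) auto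
    then have "bdd u v (max mult_const int_const * ?n * c / ?n\<^sup>2) (cint XX Z Z' u a x)"
    proof (rule bdd_mono)
      have "int_const * (c / ?n\<^sup>2 * ?n) \<le> max mult_const int_const * (c / ?n\<^sup>2 * ?n)"
        using c0 n by (intro mult_right_mono) auto
      then show "int_const * (c / ?n\<^sup>2 * ?n) \<le> max mult_const int_const * ?n * c / ?n\<^sup>2"
        by (simp add: mult_ac)
    qed
    then show ?thesis by (simp add: uv cnb_def)
  qed
  show "cnb uv ((case uv of (u, v) \<Rightarrow> cint XX Z Z' u) a (cconst r * x)
      - cconst r * (case uv of (u, v) \<Rightarrow> cint XX Z Z' u) a x) 0"
    unfolding uv cnb_def prod.case div_0
  proof (rule bdd_zero)
    fix t assume t: "u \<le> t" "t \<le> v"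
    have "has_sewing (sgerm XX Z Z' a x) u t (cval (cint XX Z Z' u a x) t)"
      using t uv c0 by (intro has_sewing_cint[OF ctlx]) auto
    from has_sewing_cmult[OF this, of r]
    have J: "has_sewing (sgerm XX Z Z' a (cconst r * x)) u t (r * cval (cint XX Z Z' u a x) t)"
      by (simp add: sgerm_cmult[abs_def])
    then have "cval (cint XX Z Z' u a (cconst r * x)) t = r * cval (cint XX Z Z' u a x) t"
      by (rule cval_cintI[OF _ t(1)])
    then show "cval (cint XX Z Z' u a (cconst r * x) - cconst r * cint XX Z Z' u a x) t = 0" by simp
  qed (simp add: cder_cint)
  assume y: "cnb uv y d"
  then have by': "bdd u v (d / ?n\<^sup>2) y" by (simp add: uv cnb_def)
  have ctly: "ctl u v (d / ?n\<^sup>2 * ?n) (d / ?n\<^sup>2) y" using by' by (simp add: bdd_def)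
  have d0: "0 \<le> d" using bddD(1)[OF by' order_refl] uv n by (force intro: order_trans[OF abs_ge_zero])
  show "cnb uv (x + y) (c + d)"
    using bdd_add[OF bx by'] by (simp add: uv cnb_def add_divide_distrib)
  show "cnb uv (x * y) (max mult_const int_const * c * d)"
  proof -
    have "bdd u v (mult_const * (c / ?n\<^sup>2 * (d / ?n\<^sup>2) * ?n\<^sup>2)) (x * y)"
      using uv c0 d0 by (intro bdd_mult bx by') auto
    then have "bdd u v (max mult_const int_const * c * d / ?n\<^sup>2) (x * y)"
    proof (rule bdd_mono)
      have e: "c / ?n\<^sup>2 * (d / ?n\<^sup>2) * ?n\<^sup>2 = c * d / ?n\<^sup>2"
      proof -
        have "c / N * (d / N) * N = c * d / N" if "N \<noteq> 0" for N :: real using that by simp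
        from this[of "?n\<^sup>2"] show ?thesis using n by (metis less_numeral_extra(3) zero_less_power)
      qed
      have "mult_const * (c * d / ?n\<^sup>2) \<le> max mult_const int_const * (c * d / ?n\<^sup>2)"
        using c0 d0 by (intro mult_right_mono) auto
      then show "mult_const * (c / ?n\<^sup>2 * (d / ?n\<^sup>2) * ?n\<^sup>2) \<le> max mult_const int_const * c * d / ?n\<^sup>2"
        unfolding e by (simp add: mult.assoc)
    qed
    then show ?thesis by (simp add: uv cnb_def)
  qed
  show "cnb uv ((case uv of (u, v) \<Rightarrow> cint XX Z Z' u) a (x + y)
      - ((case uv of (u, v) \<Rightarrow> cint XX Z Z' u) a x + (case uv of (u, v) \<Rightarrow> cint XX Z Z' u) a y)) 0"
    unfolding uv cnb_def prod.case div_0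
  proof (rule bdd_zero)
    fix t assume t: "u \<le> t" "t \<le> v"
    have "has_sewing (sgerm XX Z Z' a x) u t (cval (cint XX Z Z' u a x) t)"
      using t uv c0 by (intro has_sewing_cint[OF ctlx]) auto
    moreover have "has_sewing (sgerm XX Z Z' a y) u t (cval (cint XX Z Z' u a y) t)"
      using t uv d0 by (intro has_sewing_cint[OF ctly]) auto
    ultimately have J: "has_sewing (sgerm XX Z Z' a (x + y)) u t
        (cval (cint XX Z Z' u a x) t + cval (cint XX Z Z' u a y) t)"
      using has_sewing_add by (simp add: sgerm_add[abs_def])
    then have "cval (cint XX Z Z' u a (x + y)) t = cval (cint XX Z Z' u a x) t + cval (cint XX Z Z' u a y) t"
      by (rule cval_cintI[OF _ t(1)])
    then show "cval (cint XX Z Z' u a (x + y) - (cint XX Z Z' u a x + cint XX Z Z' u a y)) t = 0" by simp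
  qed (simp add: cder_cint scaleR_add_left)
qed

end

section \<open>From planar to nonplanar trees; Taylor coefficients as sums over words\<close>

primrec forget :: "('m \<times> 'e) ptree \<Rightarrow> 'm rtree" where
  "forget (PNode l ts) = Node (fst l) (mset (map forget ts))"

lemma vertices_forget: "vertices (forget \<tau>) = psize \<tau>"
proof (induction \<tau>)
  case (PNode l ts)
  then have e1: "map (\<lambda>t. vertices (forget t)) ts = map psize ts" by simp
  have e2: "(\<Sum>\<^sub># (image_mset vertices (mset (map forget ts)))) = sum_list (map (\<lambda>t. vertices (forget t)) ts)"
    by (simp add: mset_map[symmetric] sum_mset_sum_list comp_def del: mset_map)
  show ?case unfolding forget.simps vertices.simps psize.simps e2 e1 ..
qed

primrec pd :: "'e list \<Rightarrow> (real^'e \<Rightarrow> real) \<Rightarrow> real^'e \<Rightarrow> real" where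
  "pd [] f = f"
| "pd (i # v) f = pd v (pder i f)"

lemma Cb_pd: "Cb (length v + k) f \<Longrightarrow> Cb k (pd v f)"
  by (induction v arbitrary: f) (auto simp del: Cb.simps dest: Cb_pder)

lemma sum_lists_Suc:
  fixes g :: "'e::finite list \<Rightarrow> 'x::comm_monoid_add"
  shows "(\<Sum>v | length v = Suc n. g v) = (\<Sum>i\<in>UNIV. \<Sum>v | length v = n. g (i # v))"
proof -
  have fin: "finite {v :: 'e list. length v = n}"
    using finite_lists_length_eq[of "UNIV :: 'e set" n] by simp
  have "(\<Sum>i\<in>UNIV. \<Sum>v | length v = n. g (i # v)) = (\<Sum>(i, v)\<in>UNIV \<times> {v. length v = n}. g (i # v))"
    by (simp add: sum.cartesian_product)
  also have "\<dots> = (\<Sum>v | length v = Suc n. g v)"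
    by (rule sum.reindex_bij_witness[of _ "\<lambda>v. (hd v, tl v)" "\<lambda>(i, v). i # v"])
       (auto simp: length_Suc_conv)
  finally show ?thesis by simp
qed

lemma sum_lists_less:
  fixes g :: "'e::finite list \<Rightarrow> 'x::comm_monoid_add"
  shows "(\<Sum>v | length v < p. g v) = (\<Sum>n<p. \<Sum>v | length v = n. g v)"
proof -
  have "finite {v :: 'e list. length v < p}"
    using finite_lists_length_less[of "UNIV :: 'e set" p] by simp
  then have "(\<Sum>n<p. \<Sum>v | v \<in> {v. length v < p} \<and> length v = n. g v) = (\<Sum>v | length v < p. g v)"
    by (intro sum.group) auto
  moreover have "{v. v \<in> {v :: 'e list. length v < p} \<and> length v = n} = {v. length v = n}" if "n < p" for n
    using that by auto
  ultimately show ?thesis by simp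
qed

text \<open>Unfolding the recursion yields one summand for every ordered word of directions, so no
  multinomial coefficients appear.\<close>

lemma tay_eq_sum:
  "(\<Sum>v | length v = n. pd v f y * prod_list (map (\<lambda>j. x $ j - y $ j) v)) = tay n f y x"
proof (induction n arbitrary: f)
  case (Suc n)
  have "(\<Sum>v | length v = Suc n. pd v f y * prod_list (map (\<lambda>j. x $ j - y $ j) v))
    = (\<Sum>i\<in>UNIV. (x $ i - y $ i) * (\<Sum>v | length v = n. pd v (pder i f) y * prod_list (map (\<lambda>j. x $ j - y $ j) v)))"
    unfolding sum_lists_Suc sum_distrib_left by (simp add: mult_ac)
  then show ?case by (simp only: Suc tay.simps)
qed simp

lemma tay_rem_eq_sum:
  "f x - (\<Sum>v | length v < p. pd v f y / fact (length v) * prod_list (map (\<lambda>j. x $ j - y $ j) v)) = tay_rem p f y x"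
proof -
  have "(\<Sum>v | length v = n. pd v f y / fact (length v) * prod_list (map (\<lambda>j. x $ j - y $ j) v)) = tay n f y x / fact n" for n
    unfolding tay_eq_sum[symmetric] sum_divide_distrib by (intro sum.cong) auto
  then show ?thesis by (simp add: sum_lists_less tay_rem_def)
qed

text \<open>The coefficient of one ordered word in the Taylor expansion of the component
  \<open>snd l\<close> of the field \<open>fst l\<close>; the factorial is that of Taylor's formula,
  the sum running over all words.\<close>

definition tcoef :: "('m \<Rightarrow> real^'e \<Rightarrow> real^'e) \<Rightarrow> real^'e \<Rightarrow> 'm \<times> 'e \<Rightarrow> 'e list \<Rightarrow> real" where
  "tcoef F y l v = pd v (\<lambda>x. F (fst l) x $ snd l) y / fact (length v)"

lemma Cb_comp: "Cb k f \<Longrightarrow> Cb k (\<lambda>x. f x $ i)"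
  by (rule Cb_bounded_linear[OF bounded_linear_vec_nth])

text \<open>A word has at most p - 1 letters, so two of the p + 1 derivatives are left; they make
  the coefficients bounded and Lipschitz in the starting point.\<close>

lemma Cb_tcoef:
  assumes "\<And>a. Cb (p + 1) (F a)" "length v < p"
  shows "Cb 2 (\<lambda>y. tcoef F y l v)"
proof -
  have "Cb 2 (pd v (\<lambda>x. F (fst l) x $ snd l))"
    by (rule Cb_pd, rule Cb_le[OF Cb_comp[OF assms(1)]]) (use assms(2) in simp)
  from Cb_mult[OF this Cb_const[of 2 "1 / fact (length v)"]]
  show ?thesis by (simp add: tcoef_def[abs_def])
qed

lemma Cb_elem_diff:
  assumes "\<And>a. Cb (p + 1) (F a)" "\<tau> \<in> ptrees p k"
  shows "Cb 2 (\<lambda>y. elem_diff (tcoef F y) \<tau>)"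
  using assms(2)
proof (induction \<tau> arbitrary: k)
  case (PNode l ts)
  then obtain k' where k': "set ts \<subseteq> ptrees p k'" "length ts < p" by (cases k) auto
  have "Cb 2 (\<lambda>y. prod_list (map (\<lambda>t. elem_diff (tcoef F y) t) ts))"
    using PNode.IH k' by (intro Cb_prod_list) auto
  then show ?case
    using k' Cb_mult[OF Cb_tcoef[of p F "map (\<lambda>t. snd (plabel t)) ts" l, OF assms(1)]] by simp
qed

section \<open>Coefficients of the driver and composition with smooth functions\<close>

context rough_driver
begin

lemma cnb_cval:
  assumes "cnb (u, v) h c" "u < v" "u \<le> s" "s \<le> v"
  shows "\<bar>cval h s\<bar> \<le> c"
  using assms bddD(1)[of u v "c / (w u v)\<^sup>2" h s s] by (simp add: cnb_def)

text \<open>The abstract recursion in the ring reproduces the defining recursion of the driver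
  coefficients, because products in the ring are the forest values with their Leibniz
  derivatives.\<close>

lemma Phi_eq_tree_path:
  "ctree.Phi (u, v) \<tau> = CPath (fst (tree_path XX Z Z' u (forget \<tau>))) (snd (tree_path XX Z Z' u (forget \<tau>)))"
proof (induction \<tau>)
  case (PNode l ts)
  let ?M = "image_mset (tree_path XX Z Z' u) (mset (map forget ts))"
  have e1: "map (\<lambda>t. (cval (ctree.Phi (u, v) t), cder (ctree.Phi (u, v) t))) ts
      = map (\<lambda>t. tree_path XX Z Z' u (forget t)) ts"
    using PNode by simp
  have e2: "mset (map (\<lambda>t. tree_path XX Z Z' u (forget t)) ts) = ?M"
    by (simp add: multiset.map_comp comp_def)
  have "prod_list (map (ctree.Phi (u, v)) ts) = CPath (forest_val ?M) (forest_deriv ?M)"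
    unfolding prod_list_cpath e1 e2 ..
  then have Phi: "ctree.Phi (u, v) (PNode l ts) = cint XX Z Z' u (fst l) (CPath (forest_val ?M) (forest_deriv ?M))"
    by simp
  have "has_rough_integral XX (\<lambda>r. blinfun_scaleR_left (forest_val ?M r))
      (\<lambda>r. Blinfun blinfun_scaleR_left o\<^sub>L forest_deriv ?M r) (\<lambda>r. Z r $ fst l) (comp_deriv Z' (fst l)) u t
    = has_sewing (sgerm XX Z Z' (fst l) (CPath (forest_val ?M) (forest_deriv ?M))) u t" for t
    using has_rough_integral_scalar[of XX "CPath (forest_val ?M) (forest_deriv ?M)" Z "fst l" Z' u]
    by (intro ext) simp
  then show ?case unfolding Phi by (simp add: cint_def Let_def rough_integral_def)
qed

lemma cval_Phi: "cval (ctree.Phi (u, v) \<tau>) v = tree_coeff XX Z Z' u v (forget \<tau>)"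
  by (simp add: Phi_eq_tree_path tree_coeff_def)

lemma tree_coeff_bound:
  "\<exists>C\<ge>0. \<forall>u v. 0 \<le> u \<and> u < v \<and> v \<le> T \<longrightarrow>
     \<bar>tree_coeff XX Z Z' u v (forget \<tau>)\<bar> \<le> C * w u v ^ psize \<tau>"
proof -
  obtain C where C: "C \<ge> 0" "\<And>uv. uv \<in> itv \<Longrightarrow> cnb uv (ctree.Phi uv \<tau>) (C * (case uv of (u, v) \<Rightarrow> w u v) ^ psize \<tau>)"
    using ctree.small_Phi[of \<tau>] unfolding ctree.small_def by blast
  show ?thesis
  proof (intro exI[of _ C] conjI C allI impI)
    fix u v assume uv: "0 \<le> u \<and> u < v \<and> v \<le> T"
    then have "cnb (u, v) (ctree.Phi (u, v) \<tau>) (C * w u v ^ psize \<tau>)"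
      using C(2)[of "(u, v)"] by (auto simp: itv_def)
    from cnb_cval[OF this, of v] uv show "\<bar>tree_coeff XX Z Z' u v (forget \<tau>)\<bar> \<le> C * w u v ^ psize \<tau>"
      by (simp add: cval_Phi)
  qed
qed

lemma cval_cint_1: "u \<le> t \<Longrightarrow> cval (cint XX Z Z' u a 1) t = Z t $ a - Z u $ a"
  by (rule cval_cintI, rule has_sewingI[OF \<theta> order_refl]) (auto simp: sgerm_def)

lemma tree_coeff_single: "u \<le> v \<Longrightarrow> tree_coeff XX Z Z' u v (Node a {#}) = Z v $ a - Z u $ a"
  \<comment> \<open>The component label is erased by \<open>forget\<close>, so an arbitrary one may
    be inserted.\<close>
  using cval_Phi[of u v "PNode (a, undefined) []"] by (simp add: cval_cint_1)

text \<open>The second level of the driver: the leading term of the iterated integral of Z^b against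
  Z^a, obtained by freezing the two Gubinelli derivatives at the left endpoint.\<close>

definition ZZ :: "'m \<Rightarrow> 'm \<Rightarrow> real \<Rightarrow> real \<Rightarrow> real" where
  "ZZ b a s t = (\<Sum>i\<in>UNIV. \<Sum>j\<in>UNIV. XX s t $ i $ j *
     (comp_deriv Z' b s (axis i 1) * comp_deriv Z' a s (axis j 1)))"

lemma ctl_driver:
  assumes "0 \<le> u" "v \<le> T" "\<And>r. u \<le> r \<Longrightarrow> r \<le> v \<Longrightarrow> cval h r = Z r $ b - Z u $ b"
    "\<And>r. cder h r = comp_deriv Z' b r"
  shows "ctl u v M0 M0 h"
  unfolding ctl_def assms(4)
proof (intro allI impI conjI)
  fix s t assume s: "u \<le> s \<and> s \<le> t \<and> t \<le> v"
  then have st: "0 \<le> s" "s \<le> t" "t \<le> T" using assms by auto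
  note Z_comp[OF st, of b]
  then show "norm (comp_deriv Z' b s) \<le> M0" "norm (comp_deriv Z' b t - comp_deriv Z' b s) \<le> M0 * w s t"
    "\<bar>cval h t - cval h s - comp_deriv Z' b s (X t - X s)\<bar> \<le> M0 * (w s t)\<^sup>2"
    using s assms(3) by auto
qed

text \<open>The inner path Z^b - Z^b_u vanishes at \<open>u\<close>, so the germ of the outer
  integral on [u, v] reduces to \<open>ZZ b a u v\<close>; the sewing error is of third
  order.\<close>

lemma tree_coeff_double:
  "\<exists>C\<ge>0. \<forall>u v. 0 \<le> u \<and> u < v \<and> v \<le> T \<longrightarrow>
     \<bar>tree_coeff XX Z Z' u v (Node a {#Node b {#}#}) - ZZ b a u v\<bar> \<le> C * w u v ^ 3"
proof (intro exI conjI allI impI)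
  show "0 \<le> sew_const (3 * \<alpha>) * (defect_const * (M0 + M0))"
    using sew_const(1)[OF \<theta>] defect_const M0 by simp
  fix u v assume uv: "0 \<le> u \<and> u < v \<and> v \<le> T"
  let ?h = "cint XX Z Z' u b 1"
  have "ctl u v M0 M0 ?h"
    using uv by (intro ctl_driver) (auto simp: cval_cint_1 cder_cint)
  then have "\<bar>cval (cint XX Z Z' u a ?h) v - cval (cint XX Z Z' u a ?h) u - sgerm XX Z Z' a ?h u v\<bar>
     \<le> sew_const (3 * \<alpha>) * (defect_const * (M0 + M0)) * w u v ^ 3"
    using uv M0 by (intro cint_increment) auto
  moreover have "sgerm XX Z Z' a ?h u v = ZZ b a u v"
    by (simp add: sgerm_def ZZ_def cval_cint_start cder_cint)
  moreover have "cval (cint XX Z Z' u a ?h) v = tree_coeff XX Z Z' u v (Node a {#Node b {#}#})"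
    using cval_Phi[of u v "PNode (a, undefined) [PNode (b, undefined) []]"] by simp
  ultimately show "\<bar>tree_coeff XX Z Z' u v (Node a {#Node b {#}#}) - ZZ b a u v\<bar>
      \<le> sew_const (3 * \<alpha>) * (defect_const * (M0 + M0)) * w u v ^ 3"
    by (simp add: cval_cint_start)
qed

lemma ZZ_chen:
  assumes "0 \<le> s" "s \<le> r" "r \<le> t" "t \<le> T"
  shows "\<bar>ZZ b a s t - ZZ b a s r - ZZ b a r t - (Z r $ b - Z s $ b) * (Z t $ a - Z r $ a)\<bar>
    \<le> defect_const * (M0 + M0) * w s t ^ 3"
proof -
  let ?h = "CPath (\<lambda>r. Z r $ b - Z s $ b) (comp_deriv Z' b)"
  have "ctl s t M0 M0 ?h" using assms by (intro ctl_driver) auto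
  from sgerm_defect[OF this assms(1,4) order_refl assms(2,3) order_refl, of a]
  show ?thesis unfolding w_cube[symmetric] by (simp add: sgerm_def ZZ_def algebra_simps)
qed

lemma ZZ_bound:
  assumes "0 \<le> s" "s \<le> t" "t \<le> T"
  shows "\<bar>ZZ b a s t\<bar> \<le> cD * M0 ^ 3 * (w s t)\<^sup>2"
proof -
  have "\<bar>comp_deriv Z' b s (axis i 1) * comp_deriv Z' a s (axis j 1)\<bar> \<le> M0 * M0" for i j
    unfolding abs_mult using M0 Z_comp(2)[OF assms]
    by (intro mult_mono order_trans[OF abs_blinfun_axis]) auto
  then have "\<bar>ZZ b a s t\<bar> \<le> cD * (norm (XX s t) * (M0 * M0))"
    unfolding ZZ_def cD_def by (rule double_sum_bound)
  also have "\<dots> \<le> cD * ((M0 * (w s t)\<^sup>2) * (M0 * M0))"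
    using M0 cD assms by (intro mult_left_mono mult_right_mono XX_bound) auto
  finally show ?thesis by (simp add: power3_eq_cube mult_ac)
qed

text \<open>The chain rule for controlled paths in the scaling of \<open>bdd\<close>. The
  derivatives \<open>g1\<close> and \<open>g2\<close> are parameters because for a Taylor remainder
  they are again remainders, of one and two orders less. Their bounds are asked for only on a ball
  around the starting value, where remainders are small; its convexity justifies the mean value
  estimates.\<close>

lemma bdd_compose:
  fixes g :: "real^'e::finite \<Rightarrow> real" and Y :: "real \<Rightarrow> real^'e" and Y' :: "real \<Rightarrow> (real^'d) \<Rightarrow>\<^sub>L (real^'e)"
  assumes d1: "\<And>x. (g has_derivative (\<lambda>h. \<Sum>j\<in>UNIV. h $ j * g1 j x)) (at x)"
    and d2: "\<And>j x. (g1 j has_derivative (\<lambda>h. \<Sum>k\<in>UNIV. h $ k * g2 j k x)) (at x)"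
    and b: "0 \<le> b" "\<And>x. x \<in> cball y0 \<rho> \<Longrightarrow> \<bar>g x\<bar> \<le> b * (w u v)\<^sup>2"
      "\<And>j x. x \<in> cball y0 \<rho> \<Longrightarrow> \<bar>g1 j x\<bar> \<le> b * w u v" "\<And>j k x. x \<in> cball y0 \<rho> \<Longrightarrow> \<bar>g2 j k x\<bar> \<le> b"
    and n: "w u v \<le> M0" and M1: "0 \<le> M1"
    and Yb: "\<And>s. u \<le> s \<Longrightarrow> s \<le> v \<Longrightarrow> Y s \<in> cball y0 \<rho>"
    and Yh: "\<And>s t. u \<le> s \<Longrightarrow> s \<le> t \<Longrightarrow> t \<le> v \<Longrightarrow> norm (Y t - Y s) \<le> M1 * w s t"
    and Y'b: "\<And>s. u \<le> s \<Longrightarrow> s \<le> v \<Longrightarrow> norm (Y' s) \<le> M1"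
    and Y'h: "\<And>s t. u \<le> s \<Longrightarrow> s \<le> t \<Longrightarrow> t \<le> v \<Longrightarrow> norm (Y' t - Y' s) \<le> M1 * w s t"
    and Yr: "\<And>s t. u \<le> s \<Longrightarrow> s \<le> t \<Longrightarrow> t \<le> v \<Longrightarrow> norm (Y t - Y s - Y' s (X t - X s)) \<le> M1 * (w s t)\<^sup>2"
  defines "E \<equiv> real CARD('e)"
  shows "bdd u v ((1 + E * M1 + (E * E * M1\<^sup>2 + E * M0 * M1)) * b)
    (CPath (\<lambda>r. g (Y r)) (\<lambda>r. \<Sum>j\<in>UNIV. g1 j (Y r) *\<^sub>R comp_deriv Y' j r))"
proof -
  let ?n = "w u v" and ?K = "1 + E * M1 + (E * E * M1\<^sup>2 + E * M0 * M1)"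
  have E: "0 \<le> E" by (simp add: E_def)
  have K: "1 \<le> ?K" "E * M1 \<le> ?K" "E * E * M1\<^sup>2 + E * M0 * M1 \<le> ?K"
    using E M1 M0 by (auto intro!: add_nonneg_nonneg mult_nonneg_nonneg)
  have m: "c * y \<le> ?K * y" if "c \<le> ?K" "0 \<le> y" for c y
    using that by (rule mult_right_mono)
  have lip: "\<bar>g1 j x - g1 j y\<bar> \<le> (E * b) * norm (x - y)" if x: "x \<in> cball y0 \<rho>" "y \<in> cball y0 \<rho>" for j x y
  proof -
    have "norm (g1 j x - g1 j y) \<le> (E * b) * norm (x - y)"
    proof (rule differentiable_bound[OF convex_cball _ _ x])
      fix z assume z: "z \<in> cball y0 \<rho>"
      show "(g1 j has_derivative (\<lambda>h. \<Sum>k\<in>UNIV. h $ k * g2 j k z)) (at z within cball y0 \<rho>)"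
        by (rule has_derivative_at_withinI[OF d2])
      show "onorm (\<lambda>h. \<Sum>k\<in>UNIV. h $ k * g2 j k z) \<le> E * b"
      proof (rule onorm_bound)
        fix h :: "real^'e"
        have "norm (\<Sum>k\<in>UNIV. h $ k * g2 j k z) \<le> (\<Sum>k\<in>(UNIV::'e set). norm h * b)"
          by (intro order_trans[OF norm_sum] sum_mono)
             (auto simp: abs_mult intro!: mult_mono component_le_norm_cart b z)
        then show "norm (\<Sum>k\<in>UNIV. h $ k * g2 j k z) \<le> E * b * norm h"
          by (simp add: E_def mult_ac)
      qed (use E b in simp)
    qed
    then show ?thesis by simp
  qed
  have lin: "\<bar>g y - g x - (\<Sum>j\<in>UNIV. (y - x) $ j * g1 j x)\<bar> \<le> E * (E * b) * (norm (y - x))\<^sup>2"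
    if x: "x \<in> cball y0 \<rho>" "y \<in> cball y0 \<rho>" for x y
  proof -
    define \<psi> where "\<psi> = (\<lambda>s. g (x + s *\<^sub>R (y - x)) - s * (\<Sum>j\<in>UNIV. (y - x) $ j * g1 j x))"
    have "norm (\<psi> 1 - \<psi> 0) \<le> E * (E * b) * (norm (y - x))\<^sup>2"
    proof (rule vector_derivative_bound_01)
      fix s :: real assume s: "s \<in> {0..1}"
      let ?z = "x + s *\<^sub>R (y - x)"
      have id_mult: "((\<lambda>s. s * c) has_vector_derivative c) (at s within {0..1})" for c :: real
        unfolding has_real_derivative_iff_has_vector_derivative[symmetric]
        by (auto intro!: derivative_eq_intros)
      have "((\<lambda>s. x + s *\<^sub>R (y - x)) has_derivative (\<lambda>h. h *\<^sub>R (y - x))) (at s within {0..1})"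
        by (auto intro!: derivative_eq_intros)
      from has_derivative_compose[OF this d1]
      have "((\<lambda>s. g (x + s *\<^sub>R (y - x))) has_vector_derivative (\<Sum>j\<in>UNIV. (y - x) $ j * g1 j ?z)) (at s within {0..1})"
        by (simp add: has_vector_derivative_def sum_distrib_left mult_ac)
      moreover have "((\<lambda>s. s * (\<Sum>j\<in>UNIV. (y - x) $ j * g1 j x)) has_vector_derivative
          (\<Sum>j\<in>UNIV. (y - x) $ j * g1 j x)) (at s within {0..1})"
        by (rule id_mult)
      ultimately show "(\<psi> has_vector_derivative ((\<Sum>j\<in>UNIV. (y - x) $ j * g1 j ?z)
           - (\<Sum>j\<in>UNIV. (y - x) $ j * g1 j x))) (at s within {0..1})"
        unfolding \<psi>_def by (rule has_vector_derivative_diff)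
      have "(1 - s) *\<^sub>R x + s *\<^sub>R y \<in> cball y0 \<rho>"
        using s x by (intro convexD[OF convex_cball]) auto
      then have z: "?z \<in> cball y0 \<rho>" by (simp add: algebra_simps)
      have "norm ((\<Sum>j\<in>UNIV. (y - x) $ j * g1 j ?z) - (\<Sum>j\<in>UNIV. (y - x) $ j * g1 j x))
          = norm (\<Sum>j\<in>UNIV. (y - x) $ j * (g1 j ?z - g1 j x))"
        by (simp only: sum_subtractf right_diff_distrib)
      also have "\<dots> \<le> (\<Sum>j\<in>(UNIV::'e set). norm (y - x) * ((E * b) * norm (y - x)))"
      proof (intro order_trans[OF norm_sum] sum_mono)
        fix j
        have "\<bar>g1 j ?z - g1 j x\<bar> \<le> (E * b) * norm (?z - x)" by (rule lip[OF z x(1)])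
        also have "\<dots> \<le> (E * b) * norm (y - x)"
          using s E b by (auto intro!: mult_left_mono mult_left_le_one_le)
        finally show "norm ((y - x) $ j * (g1 j ?z - g1 j x)) \<le> norm (y - x) * ((E * b) * norm (y - x))"
          unfolding real_norm_def abs_mult by (intro mult_mono component_le_norm_cart) auto
      qed
      also have "\<dots> = E * (E * b) * (norm (y - x))\<^sup>2"
        by (simp add: E_def power2_eq_square mult_ac)
      finally show "norm ((\<Sum>j\<in>UNIV. (y - x) $ j * g1 j ?z) - (\<Sum>j\<in>UNIV. (y - x) $ j * g1 j x))
        \<le> E * (E * b) * (norm (y - x))\<^sup>2" .
    qed
    then show ?thesis by (simp add: \<psi>_def algebra_simps)
  qed
  show ?thesis
  proof (rule bddI; simp only: cpath.sel)
    fix s assume s: "u \<le> s" "s \<le> v"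
    have "\<bar>g (Y s)\<bar> \<le> 1 * (b * ?n\<^sup>2)" using b(2)[OF Yb[OF s]] by simp
    also have "\<dots> \<le> ?K * (b * ?n\<^sup>2)" using b K by (intro m) auto
    finally show "\<bar>g (Y s)\<bar> \<le> ?K * b * ?n\<^sup>2" by (simp add: mult_ac)
    have "norm (\<Sum>j\<in>UNIV. g1 j (Y s) *\<^sub>R comp_deriv Y' j s) \<le> (\<Sum>j\<in>(UNIV::'e set). (b * ?n) * M1)"
      by (intro order_trans[OF norm_sum] sum_mono; simp only: norm_scaleR real_norm_def;
          intro mult_mono b Yb s order_trans[OF norm_comp_deriv] Y'b) (use b in auto)
    also have "\<dots> = E * M1 * (b * ?n)" by (simp add: E_def)
    also have "\<dots> \<le> ?K * (b * ?n)" using b K by (intro m) auto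
    finally show "norm (\<Sum>j\<in>UNIV. g1 j (Y s) *\<^sub>R comp_deriv Y' j s) \<le> ?K * b * ?n" by (simp add: mult_ac)
  next
    fix s t assume s: "u \<le> s" "s \<le> t" "t \<le> v"
    let ?x = "w s t"
    have Ys: "Y s \<in> cball y0 \<rho>" "Y t \<in> cball y0 \<rho>" using s by (auto intro!: Yb simp del: mem_cball)
    have n': "b * ?n \<le> b * M0" using n b by (intro mult_left_mono)
    have "norm ((\<Sum>j\<in>UNIV. g1 j (Y t) *\<^sub>R comp_deriv Y' j t) - (\<Sum>j\<in>UNIV. g1 j (Y s) *\<^sub>R comp_deriv Y' j s))
      = norm (\<Sum>j\<in>UNIV. (g1 j (Y t) - g1 j (Y s)) *\<^sub>R comp_deriv Y' j t
          + g1 j (Y s) *\<^sub>R (comp_deriv Y' j t - comp_deriv Y' j s))"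
      unfolding sum_subtractf[symmetric] by (intro arg_cong[of _ _ norm] sum.cong) (auto simp: algebra_simps)
    also have "\<dots> \<le> (\<Sum>j\<in>(UNIV::'e set). ((E * b) * (M1 * ?x)) * M1 + (b * M0) * (M1 * ?x))"
    proof (intro order_trans[OF norm_sum] sum_mono order_trans[OF norm_triangle_ineq] add_mono;
        simp only: norm_scaleR real_norm_def; intro mult_mono)
      fix j
      show "\<bar>g1 j (Y t) - g1 j (Y s)\<bar> \<le> (E * b) * (M1 * ?x)"
        by (rule order_trans[OF lip[OF Ys(2,1)]]) (use E b Yh[OF s] in \<open>auto intro: mult_left_mono\<close>)
      show "norm (comp_deriv Y' j t) \<le> M1"
        using s by (intro order_trans[OF norm_comp_deriv] Y'b) auto
      show "\<bar>g1 j (Y s)\<bar> \<le> b * M0" by (rule order_trans[OF b(3)[OF Ys(1)] n'])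
      show "norm (comp_deriv Y' j t - comp_deriv Y' j s) \<le> M1 * ?x"
        by (rule order_trans[OF norm_comp_deriv_diff Y'h[OF s]])
    qed (use E b M1 M0 in auto)
    also have "\<dots> = (E * E * M1\<^sup>2 + E * M0 * M1) * (b * ?x)"
      by (simp add: E_def algebra_simps power2_eq_square)
    also have "\<dots> \<le> ?K * (b * ?x)" using b K by (intro m) auto
    finally show "norm ((\<Sum>j\<in>UNIV. g1 j (Y t) *\<^sub>R comp_deriv Y' j t) - (\<Sum>j\<in>UNIV. g1 j (Y s) *\<^sub>R comp_deriv Y' j s))
       \<le> ?K * b * ?x" by (simp add: mult_ac)
    have "g (Y t) - g (Y s) - blinfun_apply (\<Sum>j\<in>UNIV. g1 j (Y s) *\<^sub>R comp_deriv Y' j s) (X t - X s)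
      = (g (Y t) - g (Y s) - (\<Sum>j\<in>UNIV. (Y t - Y s) $ j * g1 j (Y s)))
        + (\<Sum>j\<in>UNIV. g1 j (Y s) * (Y t - Y s - Y' s (X t - X s)) $ j)"
      by (simp add: blinfun.sum_left blinfun.scaleR_left comp_deriv_apply sum_subtractf sum.distrib algebra_simps)
    also have "\<bar>\<dots>\<bar> \<le> E * (E * b) * (M1 * ?x)\<^sup>2 + E * ((b * M0) * (M1 * ?x\<^sup>2))"
    proof (intro order_trans[OF abs_triangle_ineq] add_mono)
      show "\<bar>g (Y t) - g (Y s) - (\<Sum>j\<in>UNIV. (Y t - Y s) $ j * g1 j (Y s))\<bar> \<le> E * (E * b) * (M1 * ?x)\<^sup>2"
        by (rule order_trans[OF lin[OF Ys]]) (use E b Yh[OF s] in \<open>auto intro!: mult_left_mono power_mono\<close>)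
      have "\<bar>\<Sum>j\<in>UNIV. g1 j (Y s) * (Y t - Y s - Y' s (X t - X s)) $ j\<bar>
          \<le> (\<Sum>j\<in>(UNIV::'e set). (b * M0) * (M1 * ?x\<^sup>2))"
        by (intro order_trans[OF sum_abs] sum_mono; simp only: abs_mult;
            intro mult_mono order_trans[OF component_le_norm_cart Yr[OF s]] order_trans[OF b(3)[OF Ys(1)] n'])
           (use b M0 in auto)
      then show "\<bar>\<Sum>j\<in>UNIV. g1 j (Y s) * (Y t - Y s - Y' s (X t - X s)) $ j\<bar> \<le> E * ((b * M0) * (M1 * ?x\<^sup>2))"
        by (simp add: E_def)
    qed
    also have "\<dots> = (E * E * M1\<^sup>2 + E * M0 * M1) * (b * ?x\<^sup>2)"
      by (simp add: algebra_simps power2_eq_square)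
    also have "\<dots> \<le> ?K * (b * ?x\<^sup>2)" using b K by (intro m) auto
    finally show "\<bar>g (Y t) - g (Y s) - blinfun_apply (\<Sum>j\<in>UNIV. g1 j (Y s) *\<^sub>R comp_deriv Y' j s) (X t - X s)\<bar>
        \<le> ?K * b * ?x\<^sup>2" by (simp add: mult_ac)
  qed
qed

end

section \<open>Expansion of the solution\<close>

text \<open>This form exhibits bounded linearity, so \<open>Blinfun\<close> is inverted, and shows
  the dependence on \<open>y\<close> as a sum of bounded linear images of the fields, from which
  \<open>vf F\<close> is differentiated in operator norm.\<close>

lemma vf_eq: "vf F y = (\<Sum>a\<in>UNIV. blinfun_scaleR_left (F a y) o\<^sub>L blinfun_inner_left (axis a 1))"
  (is "_ = ?R")
proof -
  have "(\<lambda>z. \<Sum>a\<in>UNIV. (z $ a) *\<^sub>R F a y) = blinfun_apply ?R"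
    by (simp add: fun_eq_iff blinfun.sum_left inner_axis)
  then show ?thesis by (simp add: vf_def blinfun_apply_inverse)
qed

lemma vf_apply: "blinfun_apply (vf F y) z = (\<Sum>a\<in>UNIV. (z $ a) *\<^sub>R F a y)"
  by (simp add: vf_eq blinfun.sum_left inner_axis)

lemma vf_deriv_apply:
  fixes F :: "'m::finite \<Rightarrow> real^'e \<Rightarrow> real^'e"
  assumes "\<And>a. F a differentiable (at y)"
  shows "blinfun_apply (blinfun_apply (vf_deriv F y) v) z
    = (\<Sum>a\<in>UNIV. (z $ a) *\<^sub>R frechet_derivative (F a) (at y) v)"
proof -
  have bl: "bounded_linear (\<lambda>x :: real^'e. blinfun_scaleR_left x o\<^sub>L blinfun_inner_left (axis a (1 :: real)))" for a :: 'm
    by (intro bounded_linear_intros bounded_linear_blinfun_scaleR_left)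
  let ?D = "\<lambda>v. (\<Sum>a\<in>UNIV. blinfun_scaleR_left (frechet_derivative (F a) (at y) v) o\<^sub>L blinfun_inner_left (axis a 1))
      :: (real^'m) \<Rightarrow>\<^sub>L (real^'e)"
  have d: "(vf F has_derivative ?D) (at y)"
    unfolding vf_eq[abs_def]
    by (intro has_derivative_sum bounded_linear.has_derivative[OF bl])
       (use assms in \<open>auto simp: frechet_derivative_works\<close>)
  then have "frechet_derivative (vf F) (at y) = ?D"
    by (rule frechet_derivative_at[symmetric])
  moreover from d have "bounded_linear ?D"
    by (rule has_derivative_bounded_linear)
  ultimately show ?thesis
    by (simp add: vf_deriv_def bounded_linear_Blinfun_apply blinfun.sum_left inner_axis)
qed

lemma frechet_derivative_comp:
  fixes f :: "'a::real_normed_vector \<Rightarrow> real^'e"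
  assumes "f differentiable (at x)"
  shows "frechet_derivative (\<lambda>x. f x $ i) (at x) v = frechet_derivative f (at x) v $ i"
proof -
  have "((\<lambda>x. f x $ i) has_derivative (\<lambda>v. frechet_derivative f (at x) v $ i)) (at x)"
    using assms by (intro bounded_linear.has_derivative[OF bounded_linear_vec_nth])
      (simp add: frechet_derivative_works)
  from frechet_derivative_at[OF this] show ?thesis by metis
qed

definition comp_path :: "(real \<Rightarrow> real^'e) \<Rightarrow> (real \<Rightarrow> (real^'d::finite) \<Rightarrow>\<^sub>L (real^'e)) \<Rightarrow> real^'e \<Rightarrow> 'e \<Rightarrow> 'd cpath" where
  "comp_path Y Y' y0 j = CPath (\<lambda>r. Y r $ j - y0 $ j) (comp_deriv Y' j)"

definition fun_path :: "(real \<Rightarrow> real^'e::finite) \<Rightarrow> (real \<Rightarrow> (real^'d::finite) \<Rightarrow>\<^sub>L (real^'e)) \<Rightarrow>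
    (real^'e \<Rightarrow> real) \<Rightarrow> 'd cpath" where
  "fun_path Y Y' f = CPath (\<lambda>r. f (Y r)) (\<lambda>r. \<Sum>j\<in>UNIV. pder j f (Y r) *\<^sub>R comp_deriv Y' j r)"

text \<open>The Leibniz rule of the ring computes the same derivative as the product rule in
  \<open>has_derivative_tay\<close>: the sum over words, formed in the ring, is the Taylor term
  composed with the path, Gubinelli derivative included.\<close>

lemma tay_cpath:
  fixes f :: "real^'e::finite \<Rightarrow> real" and Y' :: "real \<Rightarrow> (real^'d::finite) \<Rightarrow>\<^sub>L (real^'e)"
  assumes "Cb (Suc n) f"
  shows "(\<Sum>v | length v = n. cconst (pd v f y0) * prod_list (map (comp_path Y Y' y0) v))
    = CPath (\<lambda>r. tay n f y0 (Y r))
        (\<lambda>r. \<Sum>j\<in>UNIV. (real n * tay (n - 1) (pder j f) y0 (Y r)) *\<^sub>R comp_deriv Y' j r)"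
  using assms
proof (induction n arbitrary: f)
  case 0
  show ?case by (rule cpath_eqI) simp_all
next
  case (Suc n)
  let ?q = "\<lambda>i j r. real n * tay (n - 1) (pder j (pder i f)) y0 (Y r)"
  have IH: "(\<Sum>v | length v = n. cconst (pd v (pder i f) y0) * prod_list (map (comp_path Y Y' y0) v))
    = CPath (\<lambda>r. tay n (pder i f) y0 (Y r)) (\<lambda>r. \<Sum>j\<in>UNIV. ?q i j r *\<^sub>R comp_deriv Y' j r)" for i
    by (rule Suc.IH[OF Cb_pder[OF Suc.prems]])
  have eq: "(\<Sum>v | length v = Suc n. cconst (pd v f y0) * prod_list (map (comp_path Y Y' y0) v))
    = (\<Sum>i\<in>UNIV. comp_path Y Y' y0 i *
        (\<Sum>v | length v = n. cconst (pd v (pder i f) y0) * prod_list (map (comp_path Y Y' y0) v)))"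
    unfolding sum_lists_Suc sum_distrib_left by (simp add: mult.left_commute)
  show ?case
    unfolding eq IH
  proof (rule cpath_eqI)
    fix r
    have "(\<Sum>i\<in>UNIV. (Y r $ i - y0 $ i) *\<^sub>R (\<Sum>j\<in>UNIV. ?q i j r *\<^sub>R comp_deriv Y' j r))
      = (\<Sum>j\<in>UNIV. (\<Sum>i\<in>UNIV. (Y r $ i - y0 $ i) * ?q i j r) *\<^sub>R comp_deriv Y' j r)"
      unfolding scaleR_sum_right scaleR_sum_left scaleR_scaleR by (rule sum.swap)
    also have "\<dots> = (\<Sum>j\<in>UNIV. (real n * tay n (pder j f) y0 (Y r)) *\<^sub>R comp_deriv Y' j r)"
      unfolding tay_pder_sum[OF Suc.prems] ..
    finally have *: "(\<Sum>i\<in>UNIV. (Y r $ i - y0 $ i) *\<^sub>R (\<Sum>j\<in>UNIV. ?q i j r *\<^sub>R comp_deriv Y' j r))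
      = (\<Sum>j\<in>UNIV. (real n * tay n (pder j f) y0 (Y r)) *\<^sub>R comp_deriv Y' j r)" .
    show "cder (\<Sum>i\<in>UNIV. comp_path Y Y' y0 i * CPath (\<lambda>r. tay n (pder i f) y0 (Y r))
        (\<lambda>r. \<Sum>j\<in>UNIV. ?q i j r *\<^sub>R comp_deriv Y' j r)) r
      = cder (CPath (\<lambda>r. tay (Suc n) f y0 (Y r))
        (\<lambda>r. \<Sum>j\<in>UNIV. (real (Suc n) * tay (Suc n - 1) (pder j f) y0 (Y r)) *\<^sub>R comp_deriv Y' j r)) r"
      by (simp only: cder_sum cder_simps comp_path_def cpath.sel sum.distrib *)
         (simp add: sum.distrib[symmetric] algebra_simps)
  qed (simp add: comp_path_def)
qed

text \<open>The error of the Taylor expansion in the ring is the remainder function composed with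
  the path, also in its Gubinelli derivative; hence \<open>bdd_compose\<close> can measure
  it.\<close>

lemma fun_path_tay_rem:
  fixes f :: "real^'e::finite \<Rightarrow> real" and Y' :: "real \<Rightarrow> (real^'d::finite) \<Rightarrow>\<^sub>L (real^'e)"
  assumes "Cb (Suc p) f"
  shows "fun_path Y Y' f - (\<Sum>v | length v < Suc p. cconst (pd v f y0 / fact (length v)) * prod_list (map (comp_path Y Y' y0) v))
    = CPath (\<lambda>r. tay_rem (Suc p) f y0 (Y r)) (\<lambda>r. \<Sum>j\<in>UNIV. tay_rem p (pder j f) y0 (Y r) *\<^sub>R comp_deriv Y' j r)"
proof -
  let ?T = "\<lambda>n. CPath (\<lambda>r. tay n f y0 (Y r))
        (\<lambda>r. \<Sum>j\<in>UNIV. (real n * tay (n - 1) (pder j f) y0 (Y r)) *\<^sub>R comp_deriv Y' j r)"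
  have "(\<Sum>v | length v < Suc p. cconst (pd v f y0 / fact (length v)) * prod_list (map (comp_path Y Y' y0) v))
    = (\<Sum>n<Suc p. cconst (1 / fact n) * (\<Sum>v | length v = n. cconst (pd v f y0) * prod_list (map (comp_path Y Y' y0) v)))"
    unfolding sum_lists_less sum_distrib_left
  proof (intro sum.cong refl)
    fix n v assume "v \<in> {v :: 'e list. length v = n}"
    then have "cconst (pd v f y0 / fact (length v)) = cconst (1 / fact n) * (cconst (pd v f y0) :: 'd cpath)"
      by (intro cpath_eqI) auto
    then show "cconst (pd v f y0 / fact (length v)) * prod_list (map (comp_path Y Y' y0) v)
      = cconst (1 / fact n) * (cconst (pd v f y0) * prod_list (map (comp_path Y Y' y0) v))"
      by (simp only: mult.assoc)
  qed
  also have "\<dots> = (\<Sum>n<Suc p. cconst (1 / fact n) * ?T n)"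
  proof (intro sum.cong refl arg_cong2[of _ _ _ _ "(*)"] tay_cpath)
    fix n assume "n \<in> {..<Suc p}"
    then show "Cb (Suc n) f" by (intro Cb_le[OF assms]) auto
  qed
  finally have eq: "(\<Sum>v | length v < Suc p. cconst (pd v f y0 / fact (length v)) * prod_list (map (comp_path Y Y' y0) v))
    = (\<Sum>n<Suc p. cconst (1 / fact n) * ?T n)" .
  show ?thesis
    unfolding eq
  proof (rule cpath_eqI)
    fix r
    have "cder (\<Sum>n<Suc p. cconst (1 / fact n) * ?T n) r
      = (\<Sum>n<Suc p. \<Sum>j\<in>UNIV. (real n * tay (n - 1) (pder j f) y0 (Y r) / fact n) *\<^sub>R comp_deriv Y' j r)"
      unfolding cder_sum cder_simps cpath.sel scaleR_zero_right add_0_right scaleR_sum_right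
      by (intro sum.cong refl) simp
    also have "\<dots> = (\<Sum>j\<in>UNIV. (\<Sum>n<Suc p. real n * tay (n - 1) (pder j f) y0 (Y r) / fact n) *\<^sub>R comp_deriv Y' j r)"
      unfolding scaleR_sum_left by (rule sum.swap)
    also have "\<dots> = (\<Sum>j\<in>UNIV. (\<Sum>n<p. tay n (pder j f) y0 (Y r) / fact n) *\<^sub>R comp_deriv Y' j r)"
      unfolding tay_shift_sum ..
    finally show "cder (fun_path Y Y' f - (\<Sum>n<Suc p. cconst (1 / fact n) * ?T n)) r
      = cder (CPath (\<lambda>r. tay_rem (Suc p) f y0 (Y r)) (\<lambda>r. \<Sum>j\<in>UNIV. tay_rem p (pder j f) y0 (Y r) *\<^sub>R comp_deriv Y' j r)) r"
      unfolding cder_simps(4) fun_path_def cpath.sel tay_rem_def scaleR_diff_left sum_subtractf by (simp only:)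
  next
    fix r
    show "cval (fun_path Y Y' f - (\<Sum>n<Suc p. cconst (1 / fact n) * ?T n)) r
      = cval (CPath (\<lambda>r. tay_rem (Suc p) f y0 (Y r)) (\<lambda>r. \<Sum>j\<in>UNIV. tay_rem p (pder j f) y0 (Y r) *\<^sub>R comp_deriv Y' j r)) r"
      unfolding cval_simps(4) cval_sum fun_path_def cpath.sel tay_rem_def by simp
  qed
qed

text \<open>A component of the vector valued integral is the limit of the sums of the scalar germs
  added over all fields. Limits for the single fields do not follow from this and come from
  sewing.\<close>

lemma has_rough_integral_comp:
  fixes F :: "'m::finite \<Rightarrow> real^'e::finite \<Rightarrow> real^'e" and Y' :: "real \<Rightarrow> (real^'d::finite) \<Rightarrow>\<^sub>L (real^'e)"
  assumes d: "\<And>a y. F a differentiable (at y)"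
    and I: "has_rough_integral XX (\<lambda>r. vf F (Y r)) (\<lambda>r. vf_deriv F (Y r) o\<^sub>L Y' r) Z Z' s e J"
  shows "has_sewing (\<lambda>s t. \<Sum>a\<in>UNIV. sgerm XX Z Z' a (fun_path Y Y' (\<lambda>x. F a x $ i)) s t) s e (J $ i)"
proof -
  let ?V = "\<lambda>u v. blinfun_apply (vf F (Y u)) (Z v - Z u) + diamond (vf_deriv F (Y u) o\<^sub>L Y' u) (Z' u) (XX u v)"
  have eq: "?V u v $ i = (\<Sum>a\<in>UNIV. sgerm XX Z Z' a (fun_path Y Y' (\<lambda>x. F a x $ i)) u v)" for u v
  proof -
    let ?m = "\<lambda>a k l. XX u v $ k $ l *
      (frechet_derivative (F a) (at (Y u)) (Y' u (axis k 1)) $ i * comp_deriv Z' a u (axis l 1))"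
    have D: "frechet_derivative (F a) (at (Y u)) h $ i = (\<Sum>j\<in>UNIV. h $ j * pder j (\<lambda>x. F a x $ i) (Y u))" for a h
      by (subst frechet_derivative_pder[OF d]) (simp add: frechet_derivative_comp[OF d])
    have c: "cder (fun_path Y Y' (\<lambda>x. F a x $ i)) u (axis k 1)
        = frechet_derivative (F a) (at (Y u)) (Y' u (axis k 1)) $ i" for a k
      unfolding D by (simp add: fun_path_def blinfun.sum_left blinfun.scaleR_left comp_deriv_apply mult.commute)
    have "diamond (vf_deriv F (Y u) o\<^sub>L Y' u) (Z' u) (XX u v) $ i
        = (\<Sum>k\<in>UNIV. \<Sum>l\<in>UNIV. \<Sum>a\<in>UNIV. ?m a k l)"
      by (simp add: diamond_def vf_deriv_apply[OF d] sum_distrib_left comp_deriv_apply mult_ac)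
    also have "\<dots> = (\<Sum>k\<in>UNIV. \<Sum>a\<in>UNIV. \<Sum>l\<in>UNIV. ?m a k l)"
      by (intro sum.cong refl sum.swap)
    also have "\<dots> = (\<Sum>a\<in>UNIV. \<Sum>k\<in>UNIV. \<Sum>l\<in>UNIV. ?m a k l)"
      by (rule sum.swap)
    finally show ?thesis
      by (simp add: sgerm_def c sum.distrib vf_apply) (simp add: fun_path_def mult.commute)
  qed
  show ?thesis
    unfolding has_sewing_def
  proof (intro allI impI)
    fix \<epsilon> :: real assume "0 < \<epsilon>"
    then obtain \<delta> where \<delta>: "0 < \<delta>" "\<forall>N t. is_partition s e N t \<and> (\<forall>n<N. t (Suc n) - t n < \<delta>) \<longrightarrow>
        norm ((\<Sum>n<N. ?V (t n) (t (Suc n))) - J) < \<epsilon>"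
      using I[unfolded has_rough_integral_def, rule_format, OF \<open>0 < \<epsilon>\<close>] by auto
    show "\<exists>\<delta>>0. \<forall>N t. is_partition s e N t \<and> (\<forall>n<N. t (Suc n) - t n < \<delta>) \<longrightarrow>
        \<bar>(\<Sum>n<N. \<Sum>a\<in>UNIV. sgerm XX Z Z' a (fun_path Y Y' (\<lambda>x. F a x $ i)) (t n) (t (Suc n))) - J $ i\<bar> < \<epsilon>"
    proof (intro exI[of _ \<delta>] conjI \<delta>(1) allI impI)
      fix N t assume "is_partition s e N t \<and> (\<forall>n<N. t (Suc n) - t n < \<delta>)"
      then have "norm ((\<Sum>n<N. ?V (t n) (t (Suc n))) - J) < \<epsilon>"
        by (rule \<delta>(2)[rule_format])
      then have "\<bar>((\<Sum>n<N. ?V (t n) (t (Suc n))) - J) $ i\<bar> < \<epsilon>"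
        by (rule le_less_trans[OF component_le_norm_cart])
      then show "\<bar>(\<Sum>n<N. \<Sum>a\<in>UNIV. sgerm XX Z Z' a (fun_path Y Y' (\<lambda>x. F a x $ i)) (t n) (t (Suc n))) - J $ i\<bar> < \<epsilon>"
        by (simp only: eq[symmetric] vector_minus_component sum_component)
    qed
  qed
qed

section \<open>The solution as a fixed point in the ring of controlled paths\<close>

context rough_driver
begin

context
  fixes F :: "'m \<Rightarrow> real^'e::finite \<Rightarrow> real^'e" and p :: nat and M1 :: real
    and Y :: "real \<Rightarrow> real^'e" and Y' :: "real \<Rightarrow> (real^'d) \<Rightarrow>\<^sub>L (real^'e)"
  assumes p: "2 \<le> p" and F: "\<And>a. Cb (p + 1) (F a)" and M1: "0 \<le> M1"
    and Yh: "\<And>s t. 0 \<le> s \<Longrightarrow> s \<le> t \<Longrightarrow> t \<le> T \<Longrightarrow> norm (Y t - Y s) \<le> M1 * w s t"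
    and Y'b: "\<And>s. 0 \<le> s \<Longrightarrow> s \<le> T \<Longrightarrow> norm (Y' s) \<le> M1"
    and Y'h: "\<And>s t. 0 \<le> s \<Longrightarrow> s \<le> t \<Longrightarrow> t \<le> T \<Longrightarrow> norm (Y' t - Y' s) \<le> M1 * w s t"
    and Yr: "\<And>s t. 0 \<le> s \<Longrightarrow> s \<le> t \<Longrightarrow> t \<le> T \<Longrightarrow> norm (Y t - Y s - Y' s (X t - X s)) \<le> M1 * (w s t)\<^sup>2"
    and Yi: "\<And>t. t \<in> {0..T} \<Longrightarrow>
      has_rough_integral XX (\<lambda>r. vf F (Y r)) (\<lambda>r. vf_deriv F (Y r) o\<^sub>L Y' r) Z Z' 0 t (Y t - Y 0)"
    and Y'eq: "\<And>t. t \<in> {0..T} \<Longrightarrow> Y' t = vf F (Y t) o\<^sub>L Z' t"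
begin

text \<open>On [u, v] the path stays in a ball of radius M1 w around Y_u, where the remainder and
  its first two derivatives are of orders p, p - 1 and p - 2 in \<open>w\<close>. This is the
  scaling of \<open>bdd\<close> with constant proportional to w^(p-2).\<close>

lemma fun_path_rem_small:
  assumes f: "Cb (p + 1) (f :: real^'e \<Rightarrow> real)"
  shows "ctree.small p (\<lambda>uv. fun_path Y Y' f - (\<Sum>v | length v < p.
     cconst (pd v f (Y (fst uv)) / fact (length v)) * prod_list (map (comp_path Y Y' (Y (fst uv))) v)))"
proof -
  \<comment> \<open>The exponent q = p - 2 is that of the second derivative of the remainder, and
    sets the constant of the scaling.\<close>
  obtain q where q: "p = Suc (Suc q)" using p by (metis add_2_eq_Suc le_Suc_ex)
  have cf: "Cb (Suc (Suc q)) f" by (rule Cb_le[OF f]) (simp add: q)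
  have cf1: "Cb (Suc q) (pder j f)" for j by (rule Cb_pder[OF cf])
  have cf2: "Cb q (pder k (pder j f))" for j k by (rule Cb_pder[OF cf1])
  obtain C0 where C0: "C0 \<ge> 0" "\<And>x y. \<bar>tay_rem p f y x\<bar> \<le> C0 * norm (x - y) ^ p"
    using tay_rem_bound[of p f] cf q by metis
  have "\<exists>C\<ge>0. \<forall>x y. \<bar>tay_rem (Suc q) (pder j f) y x\<bar> \<le> C * norm (x - y) ^ Suc q" for j
    using tay_rem_bound[OF cf1] by metis
  then obtain C1 where C1: "\<And>j. C1 j \<ge> 0" "\<And>j x y. \<bar>tay_rem (Suc q) (pder j f) y x\<bar> \<le> C1 j * norm (x - y) ^ Suc q"
    by metis
  have "\<exists>C\<ge>0. \<forall>x y. \<bar>tay_rem q (pder k (pder j f)) y x\<bar> \<le> C * norm (x - y) ^ q" for j k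
    using tay_rem_bound[OF cf2] by metis
  then obtain C2 where C2: "\<And>j k. C2 j k \<ge> 0" "\<And>j k x y. \<bar>tay_rem q (pder k (pder j f)) y x\<bar> \<le> C2 j k * norm (x - y) ^ q"
    by metis
  \<comment> \<open>The powers of M1 come from the radius M1 w of the ball in the three remainder
    bounds.\<close>
  define B where "B = C0 * M1 ^ p + ((\<Sum>j\<in>UNIV. C1 j) * M1 ^ Suc q + (\<Sum>j\<in>UNIV. \<Sum>k\<in>UNIV. C2 j k) * M1 ^ q)"
  have s1: "C1 j \<le> (\<Sum>j\<in>UNIV. C1 j)" for j using C1(1) by (intro member_le_sum) auto
  have s2: "C2 j k \<le> (\<Sum>j\<in>UNIV. \<Sum>k\<in>UNIV. C2 j k)" for j k
    using C2(1) by (intro order_trans[OF member_le_sum[of k UNIV "C2 j"] member_le_sum[of j UNIV "\<lambda>j. \<Sum>k\<in>UNIV. C2 j k"]])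
      (auto intro: sum_nonneg)
  have pos: "0 \<le> (\<Sum>j\<in>UNIV. C1 j) * M1 ^ Suc q" "0 \<le> (\<Sum>j\<in>UNIV. \<Sum>k\<in>UNIV. C2 j k) * M1 ^ q" "0 \<le> C0 * M1 ^ p"
    using C0(1) C1(1) C2(1) M1 by (auto intro!: mult_nonneg_nonneg sum_nonneg)
  have B: "C0 * M1 ^ p \<le> B" "C1 j * M1 ^ Suc q \<le> B" "C2 j k * M1 ^ q \<le> B" "0 \<le> B" for j k
  proof -
    show "C0 * M1 ^ p \<le> B" "0 \<le> B" using pos unfolding B_def by linarith+
    have "C1 j * M1 ^ Suc q \<le> (\<Sum>j\<in>UNIV. C1 j) * M1 ^ Suc q" using M1 s1 by (intro mult_right_mono) auto
    then show "C1 j * M1 ^ Suc q \<le> B" using pos unfolding B_def by linarith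
    have "C2 j k * M1 ^ q \<le> (\<Sum>j\<in>UNIV. \<Sum>k\<in>UNIV. C2 j k) * M1 ^ q" using M1 s2 by (intro mult_right_mono) auto
    then show "C2 j k * M1 ^ q \<le> B" using pos unfolding B_def by linarith
  qed
  let ?E = "real CARD('e)"
  let ?K = "1 + ?E * M1 + (?E * ?E * M1\<^sup>2 + ?E * M0 * M1)"
  have K0: "0 \<le> ?K" using M1 M0 by (intro add_nonneg_nonneg mult_nonneg_nonneg) auto
  show ?thesis
    unfolding ctree.small_def
  proof (intro exI[of _ "?K * B"] conjI ballI)
    show "0 \<le> ?K * B" using K0 B by (intro mult_nonneg_nonneg)
    fix uv assume "uv \<in> itv"
    then obtain u v where uv: "uv = (u, v)" "0 \<le> u" "u < v" "v \<le> T" by (auto simp: itv_def)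
    let ?n = "w u v" and ?y = "Y u"
    have le: "c * norm (x - ?y) ^ m \<le> B * ?n ^ m"
      if x: "x \<in> cball ?y (M1 * ?n)" and c: "0 \<le> c" "c * M1 ^ m \<le> B" for x m c
    proof -
      have "c * norm (x - ?y) ^ m \<le> c * (M1 * ?n) ^ m"
        using x c by (intro mult_left_mono power_mono) (auto simp: dist_norm norm_minus_commute)
      also have "\<dots> = c * M1 ^ m * ?n ^ m" by (simp add: power_mult_distrib)
      also have "\<dots> \<le> B * ?n ^ m" using c by (intro mult_right_mono) auto
      finally show ?thesis .
    qed
    have "bdd u v (?K * (B * ?n ^ q)) (CPath (\<lambda>r. tay_rem p f ?y (Y r))
        (\<lambda>r. \<Sum>j\<in>UNIV. tay_rem (Suc q) (pder j f) ?y (Y r) *\<^sub>R comp_deriv Y' j r))"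
    proof (rule bdd_compose[where \<rho> = "M1 * ?n" and ?y0.0 = ?y and ?g2.0 = "\<lambda>j k. tay_rem q (pder k (pder j f)) ?y"])
      show "(tay_rem p f ?y has_derivative (\<lambda>h. \<Sum>j\<in>UNIV. h $ j * tay_rem (Suc q) (pder j f) ?y x)) (at x)" for x
        unfolding q by (rule has_derivative_tay_rem[OF cf])
      show "(tay_rem (Suc q) (pder j f) ?y has_derivative
          (\<lambda>h. \<Sum>k\<in>UNIV. h $ k * tay_rem q (pder k (pder j f)) ?y x)) (at x)" for j x
        by (rule has_derivative_tay_rem[OF cf1])
      fix x assume x: "x \<in> cball ?y (M1 * ?n)"
      show "\<bar>tay_rem p f ?y x\<bar> \<le> B * ?n ^ q * ?n\<^sup>2"
        using order_trans[OF C0(2) le[OF x C0(1) B(1)]] by (simp add: q power2_eq_square mult_ac)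
      show "\<bar>tay_rem (Suc q) (pder j f) ?y x\<bar> \<le> B * ?n ^ q * ?n" for j
        using order_trans[OF C1(2) le[OF x C1(1) B(2)]] by (simp add: mult_ac)
      show "\<bar>tay_rem q (pder k (pder j f)) ?y x\<bar> \<le> B * ?n ^ q" for j k
        by (rule order_trans[OF C2(2) le[OF x C2(1) B(3)]])
    next
      show "Y s \<in> cball (Y u) (M1 * w u v)" if "u \<le> s" "s \<le> v" for s
      proof -
        have "norm (Y s - Y u) \<le> M1 * w u s" using that uv by (intro Yh) auto
        also have "\<dots> \<le> M1 * w u v" using that M1 by (intro mult_left_mono w_mono) auto
        finally show ?thesis by (simp add: dist_norm norm_minus_commute)
      qed
    qed (use uv B M1 w_M0[of u v] in \<open>auto intro: Yh Y'b Y'h Yr\<close>)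
    then have "cnb (u, v) (CPath (\<lambda>r. tay_rem p f ?y (Y r))
        (\<lambda>r. \<Sum>j\<in>UNIV. tay_rem (Suc q) (pder j f) ?y (Y r) *\<^sub>R comp_deriv Y' j r)) (?K * B * ?n ^ p)"
      by (rule bdd_imp_cnb[OF uv(3)]) (simp add: q power2_eq_square mult_ac)
    then show "cnb uv (fun_path Y Y' f - (\<Sum>v | length v < p.
       cconst (pd v f (Y (fst uv)) / fact (length v)) * prod_list (map (comp_path Y Y' (Y (fst uv))) v)))
       (?K * B * (case uv of (u, v) \<Rightarrow> w u v) ^ p)"
      using fun_path_tay_rem[OF cf, of Y Y' ?y] by (simp add: uv q)
  qed
qed

lemma comp_path_small: "ctree.small 1 (\<lambda>uv. comp_path Y Y' (Y (fst uv)) i)"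
  unfolding ctree.small_def
proof (intro exI[of _ "M1 * (1 + M0)"] conjI ballI)
  show "0 \<le> M1 * (1 + M0)" using M1 M0 by simp
  fix uv assume "uv \<in> itv"
  then obtain u v where uv: "uv = (u, v)" "0 \<le> u" "u < v" "v \<le> T" by (auto simp: itv_def)
  let ?n = "w u v"
  have n: "0 < ?n" "?n \<le> M0" using uv w_M0[of u v] by auto
  \<comment> \<open>A displacement of order 1 has a Gubinelli derivative that is merely bounded, so
    the constant of the scaling is of order 1/w. The factor 1 + M0 secures M1 \<le> k, because w
    \<le> M0.\<close>
  define k where "k = M1 * (1 + M0) / ?n"
  have "k * ?n = M1 * (1 + M0)" using n by (simp add: k_def)
  then have k1: "M1 \<le> k * ?n" using M1 M0 by (simp add: algebra_simps)
  have k2: "M1 \<le> k"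
  proof -
    have "M1 * ?n \<le> M1 * (1 + M0)" using n M1 by (intro mult_left_mono) auto
    then show ?thesis using n by (simp add: k_def field_simps)
  qed
  have "bdd u v k (comp_path Y Y' (Y u) i)"
  proof (rule bddI; simp only: comp_path_def cpath.sel)
    fix s assume s: "u \<le> s" "s \<le> v"
    have "\<bar>Y s $ i - Y u $ i\<bar> \<le> norm (Y s - Y u)" using component_le_norm_cart[of "Y s - Y u" i] by simp
    also have "\<dots> \<le> M1 * w u s" using s uv by (intro Yh) auto
    also have "\<dots> \<le> M1 * ?n" using s M1 by (intro mult_left_mono w_mono) auto
    also have "\<dots> \<le> k * ?n * ?n" using k1 n by (intro mult_right_mono) auto
    finally show "\<bar>Y s $ i - Y u $ i\<bar> \<le> k * ?n\<^sup>2" by (simp add: power2_eq_square mult_ac)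
    have "norm (comp_deriv Y' i s) \<le> M1" using s uv by (intro order_trans[OF norm_comp_deriv Y'b]) auto
    then show "norm (comp_deriv Y' i s) \<le> k * ?n" using k1 by simp
  next
    fix s t assume s: "u \<le> s" "s \<le> t" "t \<le> v"
    have "norm (comp_deriv Y' i t - comp_deriv Y' i s) \<le> M1 * w s t"
      using s uv by (intro order_trans[OF norm_comp_deriv_diff Y'h]) auto
    also have "\<dots> \<le> k * w s t" using k2 by (intro mult_right_mono) auto
    finally show "norm (comp_deriv Y' i t - comp_deriv Y' i s) \<le> k * w s t" .
    have "\<bar>Y t $ i - Y u $ i - (Y s $ i - Y u $ i) - comp_deriv Y' i s (X t - X s)\<bar>
        = \<bar>(Y t - Y s - Y' s (X t - X s)) $ i\<bar>" by (simp add: comp_deriv_apply)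
    also have "\<dots> \<le> M1 * (w s t)\<^sup>2"
      using s uv by (intro order_trans[OF component_le_norm_cart Yr]) auto
    also have "\<dots> \<le> k * (w s t)\<^sup>2" using k2 by (intro mult_right_mono) auto
    finally show "\<bar>Y t $ i - Y u $ i - (Y s $ i - Y u $ i) - comp_deriv Y' i s (X t - X s)\<bar> \<le> k * (w s t)\<^sup>2" .
  qed
  then have "cnb (u, v) (comp_path Y Y' (Y u) i) (M1 * (1 + M0) * ?n)"
    by (rule bdd_imp_cnb[OF uv(3)]) (use n in \<open>simp add: k_def power2_eq_square\<close>)
  then show "cnb uv (comp_path Y Y' (Y (fst uv)) i) (M1 * (1 + M0) * (case uv of (u, v) \<Rightarrow> w u v) ^ 1)"
    by (simp add: uv)
qed

lemma tcoef_bounded: "length v < p \<Longrightarrow> \<exists>C. \<forall>uv\<in>itv. \<bar>tcoef F (Y (fst uv)) l v\<bar> \<le> C"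
  using Cb_bounded[OF Cb_tcoef[of p F v l, OF F]] by (auto simp: real_norm_def)

text \<open>Boundedness as a controlled path is read off the expansion itself: a polynomial in the
  small displacement with bounded coefficients, plus the small remainder.\<close>

lemma fun_path_small0:
  assumes "Cb (p + 1) (f :: real^'e \<Rightarrow> real)"
  shows "ctree.small 0 (\<lambda>uv. fun_path Y Y' f)"
proof (rule ctree.small_cong_imp[OF ctree.small_le[OF fun_path_rem_small[OF assms]]])
  have fin: "finite {v :: 'e list. length v < p}"
    using finite_lists_length_less[of "UNIV :: 'e set" p] by simp
  show "ctree.small 0 (\<lambda>uv. \<Sum>v | length v < p.
     cconst (pd v f (Y (fst uv)) / fact (length v)) * prod_list (map (comp_path Y Y' (Y (fst uv))) v))"
  proof (intro ctree.small_sum[OF fin] ctree.small_cst_mult)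
    fix v :: "'e list" assume v: "v \<in> {v. length v < p}"
    have "Cb 0 (pd v f)" by (rule Cb_pd, rule Cb_le[OF assms]) (use v in auto)
    from Cb_bounded[OF this] obtain C where C: "\<And>x. \<bar>pd v f x\<bar> \<le> C" by auto
    have "\<bar>pd v f x / fact (length v)\<bar> \<le> C / fact (length v)" for x
      using C[of x] by (simp add: divide_right_mono)
    then show "\<exists>C. \<forall>uv\<in>itv. \<bar>pd v f (Y (fst uv)) / fact (length v)\<bar> \<le> C" by blast
    show "ctree.small 0 (\<lambda>uv. prod_list (map (comp_path Y Y' (Y (fst uv))) v))"
      by (intro ctree.small_prod_list0 ctree.small_le[OF comp_path_small]) simp
  qed
qed simp

text \<open>The equation is given through integrals from 0, whereas the expansion integrates from
  \<open>u\<close>. Sewing converts the former into a germ estimate for the increments of Y, hence Y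
  - Y_u is the integral of the summed germs from \<open>u\<close>; uniqueness of limits identifies
  it with the sum of the scalar integrals.\<close>

lemma fixed_point_small:
  "ctree.small n (\<lambda>uv. comp_path Y Y' (Y (fst uv)) i
     - (\<Sum>a\<in>UNIV. (case uv of (u, v) \<Rightarrow> cint XX Z Z' u) a (fun_path Y Y' (\<lambda>x. F a x $ i))))"
proof (rule ctree.small_null)
  let ?G = "\<lambda>a. fun_path Y Y' (\<lambda>x. F a x $ i)"
  let ?\<Xi> = "\<lambda>s t. \<Sum>a\<in>UNIV. sgerm XX Z Z' a (?G a) s t"
  have d: "F a differentiable (at y)" for a y
    using Cb_has_derivative[of p "F a"] F[of a] by (auto intro: differentiableI simp del: Cb.simps)
  \<comment> \<open>The whole interval [0, T] is itself an index, so smallness at that index gives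
    control of the integrands up to T.\<close>
  have "\<exists>A k. 0 \<le> A \<and> 0 \<le> k \<and> ctl 0 T A k (?G a)" for a
  proof -
    have "(0, T) \<in> itv" using T0 by (simp add: itv_def)
    then obtain c where c: "0 \<le> c" "cnb (0, T) (?G a) c"
      using ctree.small_nullD[OF fun_path_small0[OF Cb_comp[OF F]]] by blast
    then have "ctl 0 T (c / (w 0 T)\<^sup>2 * w 0 T) (c / (w 0 T)\<^sup>2) (?G a)"
      by (simp add: cnb_def bdd_def)
    moreover have "0 \<le> c / (w 0 T)\<^sup>2 * w 0 T" "0 \<le> c / (w 0 T)\<^sup>2" using c by simp_all
    ultimately show ?thesis by blast
  qed
  then obtain A k where Ak: "\<And>a. 0 \<le> A a" "\<And>a. 0 \<le> k a" "\<And>a. ctl 0 T (A a) (k a) (?G a)" by metis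
  define M where "M = (\<Sum>a\<in>UNIV. defect_const * (A a + k a))"
  have M: "0 \<le> M" unfolding M_def using Ak defect_const by (intro sum_nonneg mult_nonneg_nonneg) auto
  have def: "\<bar>?\<Xi> s t - ?\<Xi> s r - ?\<Xi> r t\<bar> \<le> M * (t - s) powr (3 * \<alpha>)" if s: "0 \<le> s" "s \<le> r" "r \<le> t" "t \<le> T" for s r t
  proof -
    have "\<bar>?\<Xi> s t - ?\<Xi> s r - ?\<Xi> r t\<bar>
        = \<bar>\<Sum>a\<in>UNIV. sgerm XX Z Z' a (?G a) s t - sgerm XX Z Z' a (?G a) s r - sgerm XX Z Z' a (?G a) r t\<bar>"
      by (simp add: sum_subtractf)
    also have "\<dots> \<le> (\<Sum>a\<in>UNIV. (defect_const * (A a + k a)) * (t - s) powr (3 * \<alpha>))"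
      using s by (intro order_trans[OF sum_abs] sum_mono sgerm_defect[OF Ak(3)]) auto
    finally show ?thesis by (simp add: M_def sum_distrib_right)
  qed
  have S: "has_sewing ?\<Xi> 0 t (Y t $ i - Y 0 $ i)" if "t \<in> {0..T}" for t
    using has_rough_integral_comp[OF d Yi[OF that]] by simp
  have inc: "\<bar>Y t $ i - Y s $ i - ?\<Xi> s t\<bar> \<le> (sew_const (3 * \<alpha>) * M) * (t - s) powr (3 * \<alpha>)"
    if "0 \<le> s" "s \<le> t" "t \<le> T" for s t
    using has_sewing_increment_bound[OF \<theta> M def order_refl that S S] that by simp
  have SM: "0 \<le> sew_const (3 * \<alpha>) * M" using M sew_const(1)[OF \<theta>] by simp
  fix uv assume "uv \<in> itv"
  then obtain u v where uv: "uv = (u, v)" "0 \<le> u" "u < v" "v \<le> T" by (auto simp: itv_def)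
  show "cnb uv (comp_path Y Y' (Y (fst uv)) i
     - (\<Sum>a\<in>UNIV. (case uv of (u, v) \<Rightarrow> cint XX Z Z' u) a (?G a))) 0"
    unfolding uv cnb_def prod.case div_0 fst_conv
  proof (rule bdd_zero)
    fix r assume r: "u \<le> r" "r \<le> v"
    have "has_sewing ?\<Xi> u r (Y r $ i - Y u $ i)"
      using r uv by (intro has_sewingI[OF \<theta> SM]) (auto intro: inc)
    moreover have "has_sewing ?\<Xi> u r (\<Sum>a\<in>UNIV. cval (cint XX Z Z' u a (?G a)) r)"
    proof (rule has_sewing_sum)
      fix a
      have "ctl u v (A a) (k a) (?G a)" by (rule ctl_mono[OF Ak(3)]) (use uv in auto)
      then show "has_sewing (sgerm XX Z Z' a (?G a)) u r (cval (cint XX Z Z' u a (?G a)) r)"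
        by (rule has_sewing_cint) (use r uv Ak in auto)
    qed simp
    ultimately have "Y r $ i - Y u $ i = (\<Sum>a\<in>UNIV. cval (cint XX Z Z' u a (?G a)) r)"
      by (rule has_sewing_unique) fact
    then show "cval (comp_path Y Y' (Y u) i - (\<Sum>a\<in>UNIV. cint XX Z Z' u a (?G a))) r = 0"
      by (simp add: comp_path_def)
    have "comp_deriv Y' i r = (\<Sum>a\<in>UNIV. (F a (Y r) $ i) *\<^sub>R comp_deriv Z' a r)"
      using r uv by (intro blinfun_eqI)
        (simp add: comp_deriv_apply Y'eq vf_apply blinfun.sum_left blinfun.scaleR_left mult.commute)
    then show "cder (comp_path Y Y' (Y u) i - (\<Sum>a\<in>UNIV. cint XX Z Z' u a (?G a))) r = 0"
      by (simp add: comp_path_def cder_cint fun_path_def)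
  qed
qed

lemma solution_expansion:
  "\<exists>C\<ge>0. \<forall>u v. 0 \<le> u \<and> u < v \<and> v \<le> T \<longrightarrow>
     \<bar>Y v $ i - Y u $ i - (\<Sum>\<tau> | \<tau> \<in> ptrees p p \<and> snd (plabel \<tau>) = i.
        elem_diff (tcoef F (Y u)) \<tau> * tree_coeff XX Z Z' u v (forget \<tau>))\<bar> \<le> C * w u v ^ (p + 1)"
proof -
  have "ctree.small (Suc p) (\<lambda>uv. comp_path Y Y' (Y (fst uv)) i
      - (\<Sum>\<tau> | \<tau> \<in> ptrees p p \<and> snd (plabel \<tau>) = i.
          cconst (elem_diff (tcoef F (Y (fst uv))) \<tau>) * ctree.Phi uv \<tau>))"
  proof (rule ctree.expansion_W[where G = "\<lambda>a i uv. fun_path Y Y' (\<lambda>x. F a x $ i)"])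
    show "ctree.small p (\<lambda>uv. fun_path Y Y' (\<lambda>x. F a x $ i) - (\<Sum>v | length v < p.
        cconst (tcoef F (Y (fst uv)) (a, i) v) * prod_list (map (\<lambda>j. comp_path Y Y' (Y (fst uv)) j) v)))" for a i
      using fun_path_rem_small[OF Cb_comp[OF F]] by (simp add: tcoef_def)
    show "ctree.small 1 (\<lambda>uv. comp_path Y Y' (Y (fst uv)) i)" for i
      by (rule comp_path_small)
  qed (auto intro: fixed_point_small tcoef_bounded)
  then obtain C where C: "C \<ge> 0" "\<And>uv. uv \<in> itv \<Longrightarrow> cnb uv (comp_path Y Y' (Y (fst uv)) i
      - (\<Sum>\<tau> | \<tau> \<in> ptrees p p \<and> snd (plabel \<tau>) = i.
          cconst (elem_diff (tcoef F (Y (fst uv))) \<tau>) * ctree.Phi uv \<tau>)) (C * (case uv of (u, v) \<Rightarrow> w u v) ^ Suc p)"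
    unfolding ctree.small_def by blast
  show ?thesis
  proof (intro exI[of _ C] conjI C(1) allI impI)
    fix u v assume uv: "0 \<le> u \<and> u < v \<and> v \<le> T"
    then have "(u, v) \<in> itv" by (simp add: itv_def)
    from cnb_cval[OF C(2)[OF this], of v] uv
    show "\<bar>Y v $ i - Y u $ i - (\<Sum>\<tau> | \<tau> \<in> ptrees p p \<and> snd (plabel \<tau>) = i.
        elem_diff (tcoef F (Y u)) \<tau> * tree_coeff XX Z Z' u v (forget \<tau>))\<bar> \<le> C * w u v ^ (p + 1)"
      by (simp add: comp_path_def cval_Phi)
  qed
qed

end

end

section \<open>Expansion of the method\<close>

instance vec :: (comm_ring_1, finite) comm_ring_1 ..

lemma infnorm_le_cart: "(\<And>i. \<bar>x $ i\<bar> \<le> c) \<Longrightarrow> infnorm (x :: real^'n) \<le> c"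
  unfolding infnorm_cart by (rule cSup_least) auto

text \<open>The supremum in \<open>mat_infnorm\<close> is over a set that is bounded by equivalence
  of norms, so it dominates the value at the normalized vector.\<close>

lemma infnorm_matrix_vector_le: "infnorm (M *v x) \<le> mat_infnorm M * infnorm (x :: real^'q)"
proof (cases "x = 0")
  case True
  then show ?thesis by (simp add: infnorm_0)
next
  case False
  then have pos: "0 < infnorm x" by (simp add: infnorm_pos_lt)
  have bl: "bounded_linear ((*v) M)" by (rule matrix_vector_mul_bounded_linear)
  have bd: "infnorm (M *v y) \<le> onorm ((*v) M) * sqrt DIM(real^'q)" if "infnorm y \<le> 1" for y
  proof -
    have "norm y \<le> sqrt DIM(real^'q) * infnorm y" by (rule norm_le_infnorm)
    also have "\<dots> \<le> sqrt DIM(real^'q) * 1" using that by (intro mult_left_mono) auto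
    finally have "norm y \<le> sqrt DIM(real^'q)" by simp
    then have "onorm ((*v) M) * norm y \<le> onorm ((*v) M) * sqrt DIM(real^'q)"
      by (intro mult_left_mono onorm_pos_le bl)
    then show ?thesis using infnorm_le_norm[of "M *v y"] onorm[OF bl, of y] by linarith
  qed
  let ?y = "(1 / infnorm x) *\<^sub>R x"
  have "infnorm ?y \<le> 1" using pos by (simp add: infnorm_mul)
  then have "infnorm (M *v ?y) \<le> mat_infnorm M"
    unfolding mat_infnorm_def using bd by (intro cSup_upper) (auto intro!: bdd_aboveI2)
  then show ?thesis
    using pos by (simp add: matrix_vector_mult_scaleR infnorm_mul field_simps)
qed

lemma prod_list_nth_vec: "prod_list xs $ j = prod_list (map (\<lambda>x. x $ j) (xs :: ('a::comm_ring_1^'n) list))"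
  by (induction xs) auto

text \<open>Indices are intervals together with starting values for which the stages solve their
  system. The constants of the abstract expansion are then automatically uniform in the starting
  value.\<close>

lemma crk_expansion:
  fixes A :: "real \<Rightarrow> real \<Rightarrow> 'm::finite \<Rightarrow> real^'q^'q" and \<zeta> :: "real \<Rightarrow> real \<Rightarrow> 'm \<Rightarrow> real^'q"
    and F :: "'m \<Rightarrow> real^'e \<Rightarrow> real^'e"
  assumes p: "1 \<le> p" and F: "\<And>a. Cb (p + 1) (F a)" and \<alpha>: "0 < \<alpha>" and CRK: "0 \<le> CRK"
    and bnd: "\<And>u v a. 0 \<le> u \<Longrightarrow> u \<le> v \<Longrightarrow> v \<le> T \<Longrightarrow>
           mat_infnorm (A u v a) + infnorm (\<zeta> u v a) \<le> CRK * \<bar>v - u\<bar> powr \<alpha>"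
  shows "\<exists>C\<ge>0. \<forall>u v y. 0 \<le> u \<and> u < v \<and> v \<le> T \<and> rk_stages (A u v) F y (S u v y) \<longrightarrow>
     \<bar>crk_map \<zeta> F S u v y $ i - y $ i - (\<Sum>\<tau> | \<tau> \<in> ptrees p p \<and> snd (plabel \<tau>) = i.
        elem_diff (tcoef F y) \<tau> * rk_weight (A u v) (\<zeta> u v) (forget \<tau>))\<bar> \<le> C * ((v - u) powr \<alpha>) ^ (p + 1)"
proof -
  define Om where "Om = {(u, v, y). 0 \<le> u \<and> u < v \<and> v \<le> T \<and> rk_stages (A u v) F y (S u v y)}"
  define eps where "eps = (\<lambda>(u, v, y :: real^'e). (v - u) powr \<alpha> :: real)"
  define nb where "nb = (\<lambda>(uvy :: real \<times> real \<times> (real^'e)) (x :: real^'q) c. \<forall>j. \<bar>x $ j\<bar> \<le> c)"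
  define I where "I = (\<lambda>(u, v, y :: real^'e) a x. A u v a *v x)"
  have inf0: "0 \<le> infnorm x" for x :: "real^'q" by (rule infnorm_pos_le)
  \<comment> \<open>Nonnegativity, tested on the vector of ones, lets the bound on the sum of the
    two coefficient norms be used for each of them.\<close>
  have mi0: "0 \<le> mat_infnorm M" for M :: "real^'q^'q"
    using infnorm_matrix_vector_le[of M 1] inf0[of "M *v 1"] infnorm_pos_lt[of "1 :: real^'q"]
    by (metis order_trans zero_le_mult_iff linorder_not_le zero_neq_one)
  have bA: "mat_infnorm (A u v a) \<le> CRK * (v - u) powr \<alpha>" "infnorm (\<zeta> u v a) \<le> CRK * (v - u) powr \<alpha>"
    if "0 \<le> u" "u < v" "v \<le> T" for u v a
    using bnd[of u v a] that inf0[of "\<zeta> u v a"] mi0[of "A u v a"] by auto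
  interpret N: tree_expansion Om eps nb vec "max 1 CRK" "(\<bar>T\<bar>) powr \<alpha>" I
  proof
    show "0 \<le> max 1 CRK" by simp
    show "vec 1 = (1 :: real^'q)" "vec (r + s) = (vec r + vec s :: real^'q)"
      "vec (r * s) = (vec r * vec s :: real^'q)" for r s
      by (simp_all add: vec_eq_iff)
    fix w x y c d r a assume "w \<in> Om"
    then obtain u v z where w: "w = (u, v, z)" "0 \<le> u" "u < v" "v \<le> T" by (auto simp: Om_def)
    show "0 \<le> eps w \<and> eps w \<le> \<bar>T\<bar> powr \<alpha>"
      using w \<alpha> by (auto simp: eps_def intro!: powr_mono2)
    show "nb w (vec r) \<bar>r\<bar>" by (auto simp: w nb_def)
    assume x: "nb w x c"
    then have c0: "0 \<le> c" by (auto simp: w nb_def intro: order_trans[OF abs_ge_zero])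
    show "nb w x d" if "c \<le> d" using x that by (auto simp: w nb_def intro: order_trans)
    show "nb w (I w a x) (max 1 CRK * eps w * c)"
    proof -
      have "\<bar>(A u v a *v x) $ j\<bar> \<le> max 1 CRK * (v - u) powr \<alpha> * c" for j
      proof -
        have "\<bar>(A u v a *v x) $ j\<bar> \<le> infnorm (A u v a *v x)" by (rule component_le_infnorm_cart)
        also have "\<dots> \<le> mat_infnorm (A u v a) * infnorm x" by (rule infnorm_matrix_vector_le)
        also have "\<dots> \<le> (CRK * (v - u) powr \<alpha>) * c"
          using x CRK w by (intro mult_mono bA infnorm_le_cart inf0) (auto simp: nb_def)
        also have "\<dots> \<le> max 1 CRK * (v - u) powr \<alpha> * c"
          using c0 by (intro mult_right_mono) auto
        finally show ?thesis .
      qed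
      then show ?thesis by (simp add: w nb_def I_def eps_def)
    qed
    show "nb w (I w a (vec r * x) - vec r * I w a x) 0"
      by (simp add: w nb_def I_def matrix_vector_mult_def sum_distrib_left mult_ac)
    assume y: "nb w y d"
    then have d0: "0 \<le> d" by (auto simp: w nb_def intro: order_trans[OF abs_ge_zero])
    show "nb w (x + y) (c + d)"
      using x y by (auto simp: w nb_def intro!: order_trans[OF abs_triangle_ineq] add_mono)
    show "nb w (x * y) (max 1 CRK * c * d)"
    proof -
      have "\<bar>x $ j * y $ j\<bar> \<le> 1 * c * d" for j
        unfolding abs_mult using x y c0 by (auto simp: w nb_def intro!: mult_mono)
      also have "1 * c * d \<le> max 1 CRK * c * d" using c0 d0 by (intro mult_right_mono) auto
      finally show ?thesis by (simp add: w nb_def)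
    qed
    show "nb w (I w a (x + y) - (I w a x + I w a y)) 0"
      by (simp add: w nb_def I_def matrix_vector_right_distrib)
  qed
  \<comment> \<open>One element of R^q collects the i-th component of the displacements of all
    stages; the componentwise product treats the stages in parallel while the matrix in
    \<open>I\<close> couples them.\<close>
  define W where "W = (\<lambda>i (u, v, y). (\<chi> j. S u v y j $ i - y $ i) :: real^'q)"
  define G where "G = (\<lambda>a i (u, v, y). (\<chi> j. F a (S u v y j) $ i) :: real^'q)"
  define c where "c = (\<lambda>(u :: real, v :: real, y). tcoef F y)"
  have Phi: "N.Phi (u, v, y) \<tau> = rk_Phi (A u v) (forget \<tau>)" for u v y and \<tau> :: "('m \<times> 'e) ptree"
  proof (induction \<tau>)
    case (PNode l ts)
    then have e1: "map (N.Phi (u, v, y)) ts = map (\<lambda>t. rk_Phi (A u v) (forget t)) ts" by simp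
    have e2: "\<Prod>\<^sub># (image_mset (rk_Phi (A u v)) (mset (map forget ts)))
        = prod_list (map (\<lambda>t. rk_Phi (A u v) (forget t)) ts)"
      by (simp add: mset_map[symmetric] prod_mset_prod_list comp_def del: mset_map)
    show ?case unfolding N.Phi.simps forget.simps rk_Phi.simps e1 e2 by (simp add: I_def)
  qed
  have eq: "W i w = (\<Sum>a\<in>UNIV. I w a (G a i w))" if wO: "w \<in> Om" for i w
  proof -
    obtain u v y where w: "w = (u, v, y)" "rk_stages (A u v) F y (S u v y)" using wO by (auto simp: Om_def)
    have H: "S u v y j = y + (\<Sum>a\<in>UNIV. \<Sum>l\<in>UNIV. (A u v a $ j $ l) *\<^sub>R F a (S u v y l))" for j
      using w(2) unfolding rk_stages_def by blast
    have "S u v y j $ i = y $ i + (\<Sum>a\<in>UNIV. \<Sum>l\<in>UNIV. (A u v a $ j $ l) * F a (S u v y l) $ i)" for j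
      using arg_cong[OF H[of j], of "\<lambda>x. x $ i"]
      by (simp only: sum_component vector_add_component vector_scaleR_component real_scaleR_def)
    then show ?thesis
      by (simp add: w vec_eq_iff W_def G_def I_def matrix_vector_mult_def)
  qed
  have fp: "N.small n (\<lambda>w. W i w - (\<Sum>a\<in>UNIV. I w a (G a i w)))" for n i
    by (rule N.small_null) (simp add: eq nb_def split: prod.split)
  have G0: "N.small 0 (G a i)" for a i
  proof -
    obtain C where C: "C \<ge> 0" "\<And>x. \<bar>F a x $ i\<bar> \<le> C"
      using Cb_bounded[OF Cb_comp[OF F]] by (metis real_norm_def)
    then show ?thesis unfolding N.small_def
      by (intro exI[of _ C]) (auto simp: nb_def G_def)
  qed
  \<comment> \<open>Bounded fields make \<open>G\<close> of order 0; the stage equation then gives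
    the displacement its first power of eps.\<close>
  have W1: "N.small 1 (W i)" for i
  proof -
    have "N.small (Suc 0) (\<lambda>w. \<Sum>a\<in>UNIV. I w a (G a i w))"
      by (intro N.small_sum N.small_I G0) simp
    from N.small_cong_imp[OF fp this] show ?thesis by simp
  qed
  have cb: "\<exists>C. \<forall>w\<in>Om. \<bar>c w l v\<bar> \<le> C" if "length v < p" for l v
    using Cb_bounded[OF Cb_tcoef[of p F v l, OF F that]] by (auto simp: c_def)
  have G: "N.small p (\<lambda>w. G a i w - (\<Sum>v | length v < p. vec (c w (a, i) v) * prod_list (map (\<lambda>j. W j w) v)))" for a i
  proof -
    have "\<exists>D\<ge>0. \<forall>w\<in>Om. nb w (W j w) (D * eps w ^ 1)" for j
      using W1[of j] unfolding N.small_def .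
    then obtain D where D: "\<And>j. D j \<ge> 0" "\<And>j w. w \<in> Om \<Longrightarrow> nb w (W j w) (D j * eps w ^ 1)" by metis
    obtain C where C: "C \<ge> 0" "\<And>x y. \<bar>tay_rem p (\<lambda>x. F a x $ i) y x\<bar> \<le> C * norm (x - y) ^ p"
      using tay_rem_bound[OF Cb_le[OF Cb_comp[OF F], of p]] by (metis le_add1)
    show ?thesis unfolding N.small_def
    proof (intro exI[of _ "C * (\<Sum>j\<in>UNIV. D j) ^ p"] conjI ballI)
      show "0 \<le> C * (\<Sum>j\<in>UNIV. D j) ^ p" using C D by (simp add: sum_nonneg)
      fix w assume wO: "w \<in> Om"
      then obtain u v y where w: "w = (u, v, y)" by (cases w) auto
      have "\<bar>(G a i w - (\<Sum>v | length v < p. vec (c w (a, i) v) * prod_list (map (\<lambda>j. W j w) v))) $ j\<bar>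
          \<le> (C * (\<Sum>j\<in>UNIV. D j) ^ p) * eps w ^ p" for j
      proof -
        have "(G a i w - (\<Sum>v | length v < p. vec (c w (a, i) v) * prod_list (map (\<lambda>j. W j w) v))) $ j
           = tay_rem p (\<lambda>x. F a x $ i) y (S u v y j)"
          unfolding tay_rem_eq_sum[symmetric]
          by (simp add: w G_def W_def c_def tcoef_def prod_list_nth_vec comp_def)
        also have "\<bar>\<dots>\<bar> \<le> C * norm (S u v y j - y) ^ p" by (rule C(2))
        also have "\<dots> \<le> C * ((\<Sum>k\<in>UNIV. D k) * eps w) ^ p"
        proof (intro mult_left_mono power_mono C(1))
          have "norm (S u v y j - y) \<le> (\<Sum>k\<in>UNIV. \<bar>(S u v y j - y) $ k\<bar>)" by (rule norm_le_l1_cart)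
          also have "\<dots> \<le> (\<Sum>k\<in>UNIV. D k * eps w)"
            using D(2)[OF wO] by (intro sum_mono) (auto simp: nb_def W_def w)
          finally show "norm (S u v y j - y) \<le> (\<Sum>k\<in>UNIV. D k) * eps w" by (simp add: sum_distrib_right)
        qed simp
        finally show ?thesis by (simp add: power_mult_distrib)
      qed
      then show "nb w (G a i w - (\<Sum>v | length v < p. vec (c w (a, i) v) * prod_list (map (\<lambda>j. W j w) v)))
          (C * (\<Sum>j\<in>UNIV. D j) ^ p * eps w ^ p)"
        unfolding nb_def by (simp only: w prod.case) blast
    qed
  qed
  \<comment> \<open>Forests with at most p - 1 vertices determine \<open>G\<close> up to order p;
    with the root added by \<zeta> they are the trees with at most p vertices.\<close>
  obtain k where k: "p = Suc k" using p by (cases p) auto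
  have "\<forall>a. \<exists>C. 0 \<le> C \<and> (\<forall>w\<in>Om. nb w (G a i w - (\<Sum>ts\<in>pforests p k. vec (elem_diff (c w) (PNode (a, i) ts)) * prod_list (map (N.Phi w) ts)))
      (C * eps w ^ p))"
    using N.expansion_G[of W G p c k _ i, OF W1 fp G cb] unfolding N.small_def k by blast
  from choice[OF this] obtain C where C': "\<forall>a. 0 \<le> C a \<and> (\<forall>w\<in>Om. nb w (G a i w
      - (\<Sum>ts\<in>pforests p k. vec (elem_diff (c w) (PNode (a, i) ts)) * prod_list (map (N.Phi w) ts))) (C a * eps w ^ p))" ..
  then have C: "\<And>a. C a \<ge> 0" "\<And>a w. w \<in> Om \<Longrightarrow>
      nb w (G a i w - (\<Sum>ts\<in>pforests p k. vec (elem_diff (c w) (PNode (a, i) ts)) * prod_list (map (N.Phi w) ts))) (C a * eps w ^ p)"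
    by blast+
  let ?q = "real CARD('q)"
  show ?thesis
  proof (intro exI[of _ "\<Sum>a\<in>UNIV. ?q * (CRK * C a)"] conjI allI impI)
    show "0 \<le> (\<Sum>a\<in>UNIV. ?q * (CRK * C a))" using C CRK by (intro sum_nonneg mult_nonneg_nonneg) auto
    fix u v y assume uvy: "0 \<le> u \<and> u < v \<and> v \<le> T \<and> rk_stages (A u v) F y (S u v y)"
    let ?w = "(u, v, y)" and ?e = "(v - u) powr \<alpha>"
    have wO: "?w \<in> Om" using uvy by (simp add: Om_def)
    let ?P = "\<lambda>ts. prod_list (map (N.Phi ?w) ts)"
    let ?R = "\<lambda>a. G a i ?w - (\<Sum>ts\<in>pforests p k. vec (elem_diff (tcoef F y) (PNode (a, i) ts)) * ?P ts)"
    have w: "rk_weight (A u v) (\<zeta> u v) (forget (PNode (a, i) ts)) = \<zeta> u v a \<bullet> ?P ts" for a ts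
    proof -
      have "\<Prod>\<^sub># (image_mset (rk_Phi (A u v)) (mset (map forget ts))) = ?P ts"
        unfolding Phi by (simp add: mset_map[symmetric] prod_mset_prod_list comp_def del: mset_map)
      then show ?thesis by (simp del: mset_map)
    qed
    have vm: "\<zeta> u v a \<bullet> (vec r * x) = r * (\<zeta> u v a \<bullet> x)" for a r x
      by (simp add: inner_vec_def sum_distrib_left mult_ac)
    have "(\<Sum>\<tau> | \<tau> \<in> ptrees p p \<and> snd (plabel \<tau>) = i. elem_diff (tcoef F y) \<tau> * rk_weight (A u v) (\<zeta> u v) (forget \<tau>))
      = (\<Sum>a\<in>UNIV. \<Sum>ts\<in>pforests p k. elem_diff (tcoef F y) (PNode (a, i) ts) * (\<zeta> u v a \<bullet> ?P ts))"
      unfolding w[symmetric] using sum_ptrees_root[of _ p k i] by (simp only: k[symmetric])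
    also have "\<dots> = (\<Sum>a\<in>UNIV. \<zeta> u v a \<bullet> (\<Sum>ts\<in>pforests p k. vec (elem_diff (tcoef F y) (PNode (a, i) ts)) * ?P ts))"
      by (simp only: inner_sum_right vm)
    finally have s: "(\<Sum>\<tau> | \<tau> \<in> ptrees p p \<and> snd (plabel \<tau>) = i. elem_diff (tcoef F y) \<tau> * rk_weight (A u v) (\<zeta> u v) (forget \<tau>))
      = (\<Sum>a\<in>UNIV. \<zeta> u v a \<bullet> (\<Sum>ts\<in>pforests p k. vec (elem_diff (tcoef F y) (PNode (a, i) ts)) * ?P ts))" .
    have "crk_map \<zeta> F S u v y $ i - y $ i = (\<Sum>a\<in>UNIV. \<zeta> u v a \<bullet> G a i ?w)"
      by (simp add: crk_map_def rk_step_def G_def inner_vec_def)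
    then have "\<bar>crk_map \<zeta> F S u v y $ i - y $ i - (\<Sum>\<tau> | \<tau> \<in> ptrees p p \<and> snd (plabel \<tau>) = i.
        elem_diff (tcoef F y) \<tau> * rk_weight (A u v) (\<zeta> u v) (forget \<tau>))\<bar> = \<bar>\<Sum>a\<in>UNIV. \<zeta> u v a \<bullet> ?R a\<bar>"
      unfolding s by (simp add: sum_subtractf inner_diff_right)
    also have "\<dots> \<le> (\<Sum>a\<in>UNIV. ?q * ((CRK * ?e) * (C a * ?e ^ p)))"
    proof (intro order_trans[OF sum_abs] sum_mono)
      fix a
      have "\<bar>\<zeta> u v a \<bullet> ?R a\<bar> \<le> (\<Sum>j\<in>(UNIV::'q set). (CRK * ?e) * (C a * ?e ^ p))"
        unfolding inner_vec_def inner_real_def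
      proof (intro order_trans[OF sum_abs] sum_mono; simp only: abs_mult; intro mult_mono)
        fix j
        show "\<bar>\<zeta> u v a $ j\<bar> \<le> CRK * ?e"
          using uvy by (intro order_trans[OF component_le_infnorm_cart bA(2)]) auto
        show "\<bar>?R a $ j\<bar> \<le> C a * ?e ^ p"
          using C(2)[OF wO, of a] by (simp add: nb_def c_def eps_def)
      qed (use CRK in auto)
      then show "\<bar>\<zeta> u v a \<bullet> ?R a\<bar> \<le> ?q * ((CRK * ?e) * (C a * ?e ^ p))" by simp
    qed
    also have "\<dots> = (\<Sum>a\<in>UNIV. ?q * (CRK * C a)) * ?e ^ (p + 1)"
      unfolding sum_distrib_right by (intro sum.cong refl) (simp add: mult_ac)
    finally show "\<bar>crk_map \<zeta> F S u v y $ i - y $ i - (\<Sum>\<tau> | \<tau> \<in> ptrees p p \<and> snd (plabel \<tau>) = i.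
        elem_diff (tcoef F y) \<tau> * rk_weight (A u v) (\<zeta> u v) (forget \<tau>))\<bar>
        \<le> (\<Sum>a\<in>UNIV. ?q * (CRK * C a)) * ?e ^ (p + 1)" .
  qed
qed

lemma Cb_cart:
  fixes f :: "'a::euclidean_space \<Rightarrow> real^'n"
  assumes "\<And>i. Cb k (\<lambda>x. f x $ i)"
  shows "Cb k f"
proof -
  have "Cb k (\<lambda>x. \<Sum>i\<in>UNIV. (f x $ i) *\<^sub>R axis i (1::real))"
    by (intro Cb_sum Cb_bounded_linear[OF bounded_linear_scaleR_left] assms) simp
  moreover have "(\<lambda>x. \<Sum>i\<in>UNIV. (f x $ i) *\<^sub>R axis i (1::real)) = f"
    by (rule ext) (rule vec_eq_sum_axis[symmetric])
  ultimately show ?thesis by (simp only:)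
qed

lemma Cb_lie:
  fixes f g :: "real^'e \<Rightarrow> real^'e"
  assumes "Cb (Suc k) f" "Cb k g"
  shows "Cb k (\<lambda>x. frechet_derivative f (at x) (g x))"
proof (rule Cb_cart)
  fix i
  have d: "f differentiable (at x)" for x
    using Cb_has_derivative[OF assms(1)] by (rule differentiableI)
  have "Cb k (\<lambda>x. \<Sum>j\<in>UNIV. g x $ j * pder j f x $ i)"
    by (intro Cb_sum Cb_mult Cb_comp assms(2) Cb_pder[OF assms(1)]) simp
  moreover have "(\<Sum>j\<in>UNIV. g x $ j * pder j f x $ i) = frechet_derivative f (at x) (g x) $ i" for x
    by (simp add: frechet_derivative_pder[OF d, of x "g x"])
  ultimately show "Cb k (\<lambda>x. frechet_derivative f (at x) (g x) $ i)" by simp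
qed

section \<open>Discrete stability\<close>

text \<open>Since \<open>3\<alpha> > 1\<close>, the increments of \<open>P\<close> are almost additive up to the level of the second order germ \<open>g\<close>.
  The norm is arbitrary because \<open>P\<close> will be a pair of sequences, measured by a norm that depends on their distance.\<close>

lemma discrete_apriori:
  fixes \<alpha> B \<delta> :: real and t :: "nat \<Rightarrow> real" and nrm :: "'p::real_vector \<Rightarrow> real" and P :: "nat \<Rightarrow> 'p"
    and f :: "'m::finite \<Rightarrow> 'p \<Rightarrow> 'p" and V :: "'m \<Rightarrow> 'm \<Rightarrow> 'p \<Rightarrow> 'p" and L :: "'m \<Rightarrow> 'p \<Rightarrow> 'p \<Rightarrow> 'p"
    and z :: "'m \<Rightarrow> nat \<Rightarrow> nat \<Rightarrow> real" and zz :: "'m \<Rightarrow> 'm \<Rightarrow> nat \<Rightarrow> nat \<Rightarrow> real"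
  defines "w \<equiv> \<lambda>t k l. (t l - t k) powr \<alpha>"
    and "g \<equiv> \<lambda>k l x. (\<Sum>a\<in>UNIV. z a k l *\<^sub>R f a x) + (\<Sum>a\<in>UNIV. \<Sum>b\<in>UNIV. zz b a k l *\<^sub>R V a b x)"
    and "m \<equiv> real CARD('m)"
  defines "c1 \<equiv> 1 + B + m\<^sup>2 * B\<^sup>2"
  defines "c2 \<equiv> c1 + m * B\<^sup>2"
  defines "M \<equiv> m * B\<^sup>2 * c2\<^sup>2 + m * B\<^sup>2 * c1 + m\<^sup>2 * B\<^sup>2 * c2 + m\<^sup>2 * B\<^sup>2"
  assumes \<alpha>: "1 / 3 < \<alpha>" "\<alpha> \<le> 1 / 2" and B: "0 \<le> B"
    and nrm_tri: "\<And>x y. nrm (x + y) \<le> nrm x + nrm y" and nrm_scale: "\<And>c x. nrm (c *\<^sub>R x) = \<bar>c\<bar> * nrm x"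
    and nrm0: "\<And>x. 0 \<le> nrm x"
    and t: "\<And>n. k0 \<le> n \<Longrightarrow> n < l0 \<Longrightarrow> t n < t (Suc n)"
    and f: "\<And>a k. k \<in> {k0..l0} \<Longrightarrow> nrm (f a (P k)) \<le> B"
    and V: "\<And>a b k. k \<in> {k0..l0} \<Longrightarrow> nrm (V a b (P k)) \<le> B"
    and f_lin: "\<And>a j k. k \<in> {k0..l0} \<Longrightarrow> j \<in> {k0..l0} \<Longrightarrow>
       nrm (f a (P j) - f a (P k) - L a (P k) (P j - P k)) \<le> B * (nrm (P j - P k))\<^sup>2"
    and V_lip: "\<And>a b j k. k \<in> {k0..l0} \<Longrightarrow> j \<in> {k0..l0} \<Longrightarrow>
       nrm (V a b (P j) - V a b (P k)) \<le> B * nrm (P j - P k)"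
    and L_bound: "\<And>a k x. k \<in> {k0..l0} \<Longrightarrow> nrm (L a (P k) x) \<le> B * nrm x"
    and L_linear: "\<And>a k. linear (L a (P k))"
    and L_f: "\<And>a b k. L a (P k) (f b (P k)) = V a b (P k)"
    and z: "\<And>a k l. k0 \<le> k \<Longrightarrow> k \<le> l \<Longrightarrow> l \<le> l0 \<Longrightarrow> \<bar>z a k l\<bar> \<le> B * w t k l"
    and z_add: "\<And>a k j l. z a k l = z a k j + z a j l"
    and zz: "\<And>a b k l. k0 \<le> k \<Longrightarrow> k \<le> l \<Longrightarrow> l \<le> l0 \<Longrightarrow> \<bar>zz b a k l\<bar> \<le> B * (w t k l)\<^sup>2"
    and zz_chen: "\<And>a b k j l. k0 \<le> k \<Longrightarrow> k \<le> j \<Longrightarrow> j \<le> l \<Longrightarrow> l \<le> l0 \<Longrightarrow>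
       \<bar>zz b a k l - zz b a k j - zz b a j l - z b k j * z a j l\<bar> \<le> B * w t k l ^ 3"
    and step: "\<And>n. k0 \<le> n \<Longrightarrow> n < l0 \<Longrightarrow>
       nrm (P (Suc n) - P n - g n (Suc n) (P n)) \<le> B * (t (Suc n) - t n)"
    and \<delta>: "t l0 - t k0 \<le> \<delta>" "\<delta> \<le> 1" "sew_const (3 * \<alpha>) * M * \<delta> powr \<alpha> \<le> 1"
    and kl: "k0 \<le> k" "k \<le> l" "l \<le> l0"
  shows "nrm (P l - P k) \<le> c2 * w t k l"
proof -
  have \<theta>: "1 < 3 * \<alpha>" using \<alpha> by simp
  have m: "0 \<le> m" by (simp add: m_def)
  have c: "0 \<le> c1" "0 \<le> c2" "0 \<le> M"
    using m B by (auto simp: c1_def c2_def M_def intro!: add_nonneg_nonneg mult_nonneg_nonneg)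
  have mono: "t i \<le> t j" if "k0 \<le> i" "i \<le> j" "j \<le> l0" for i j
    using that(2,1,3)
  proof (induction j rule: dec_induct)
    case (step n)
    then show ?case using t[of n] by simp
  qed simp
  have nrm_z: "nrm 0 = 0" using nrm_scale[of 0 0] by simp
  have nrm_split: "nrm x \<le> nrm y + nrm y'" if "x = y + y'" for x y y'
    using nrm_tri[of y y'] that by simp
  have nrm_sum: "nrm (\<Sum>i\<in>A. x i) \<le> (\<Sum>i\<in>A. nrm (x i))" for A and x :: "'m \<Rightarrow> 'p"
    by (induction A rule: infinite_finite_induct) (auto simp: nrm_z intro: order_trans[OF nrm_tri])
  have nrm_sumb: "nrm (\<Sum>a\<in>UNIV. x a) \<le> m * b" if "\<And>a. nrm (x a) \<le> b" for x :: "'m \<Rightarrow> 'p" and b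
    using order_trans[OF nrm_sum sum_bounded_above[of UNIV "\<lambda>a. nrm (x a)" b]] that by (auto simp: m_def)
  have w0: "0 \<le> w t k l" for k l by (simp add: w_def)
  have w1: "w t k l \<le> 1" "w t k j \<le> w t k l" "w t j l \<le> w t k l"
    if "k0 \<le> k" "k \<le> j" "j \<le> l" "l \<le> l0" for k j l
  proof -
    have *: "t k0 \<le> t k" "t k \<le> t j" "t j \<le> t l" "t l \<le> t l0" using that by (auto intro!: mono)
    have "w t k l \<le> 1 powr \<alpha>" unfolding w_def using * \<delta> \<alpha> by (intro powr_mono2) auto
    then show "w t k l \<le> 1" by simp
    show "w t k j \<le> w t k l" "w t j l \<le> w t k l" unfolding w_def using * \<alpha> by (auto intro!: powr_mono2)
  qed
  have gb: "nrm (\<Sum>a\<in>UNIV. \<Sum>b\<in>UNIV. zz b a k l *\<^sub>R V a b (P k)) \<le> m\<^sup>2 * B\<^sup>2 * (w t k l)\<^sup>2"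
    "nrm (\<Sum>a\<in>UNIV. z a k l *\<^sub>R f a (P k)) \<le> m * B\<^sup>2 * w t k l"
    if "k0 \<le> k" "k \<le> l" "l \<le> l0" for k l
  proof -
    have "nrm (zz b a k l *\<^sub>R V a b (P k)) \<le> (B * (w t k l)\<^sup>2) * B" for a b
      unfolding nrm_scale using that B by (intro mult_mono zz V nrm0) auto
    then have "nrm (\<Sum>a\<in>UNIV. \<Sum>b\<in>UNIV. zz b a k l *\<^sub>R V a b (P k)) \<le> m * (m * ((B * (w t k l)\<^sup>2) * B))"
      by (intro nrm_sumb)
    then show "nrm (\<Sum>a\<in>UNIV. \<Sum>b\<in>UNIV. zz b a k l *\<^sub>R V a b (P k)) \<le> m\<^sup>2 * B\<^sup>2 * (w t k l)\<^sup>2"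
      by (simp add: power2_eq_square mult_ac)
    have "nrm (z a k l *\<^sub>R f a (P k)) \<le> (B * w t k l) * B" for a
      unfolding nrm_scale using that B w0 by (intro mult_mono z f nrm0) auto
    then have "nrm (\<Sum>a\<in>UNIV. z a k l *\<^sub>R f a (P k)) \<le> m * ((B * w t k l) * B)"
      by (intro nrm_sumb)
    then show "nrm (\<Sum>a\<in>UNIV. z a k l *\<^sub>R f a (P k)) \<le> m * B\<^sup>2 * w t k l"
      by (simp add: power2_eq_square mult_ac)
  qed
  define r where "r k l = nrm (P l - P k - g k l (P k))" for k l
  \<comment> \<open>The smallness of \<delta> enters here: h^(3\<alpha>) = h^\<alpha> w^2 with a
    coefficient at most 1 after multiplication by the sewing constant, and h \<le> w^2 because h
    \<le> 1 and 2\<alpha> \<le> 1. The sewing bound on a shorter interval thus becomes a quadratic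
    one with a constant free of M, which breaks the circularity.\<close>
  have rb: "r k j \<le> (1 + B) * (w t k j)\<^sup>2"
    if "k0 \<le> k" "k \<le> j" "j \<le> l0"
      and rk: "r k j \<le> sew_const (3 * \<alpha>) * M * (t j - t k) powr (3 * \<alpha>) + B * (t j - t k)" for k j
  proof -
    let ?h = "t j - t k"
    have h: "0 \<le> ?h" "?h \<le> \<delta>" "?h \<le> 1"
      using mono[of k0 k] mono[of k j] mono[of j l0] that \<delta> by auto
    have e: "?h powr (3 * \<alpha>) = ?h powr \<alpha> * (w t k j)\<^sup>2"
      using powr_add[of ?h \<alpha> "2 * \<alpha>"] powr_add[of ?h \<alpha> \<alpha>] by (simp add: w_def power2_eq_square)
    have "?h powr \<alpha> \<le> \<delta> powr \<alpha>" using h \<alpha> by (intro powr_mono2) auto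
    then have "sew_const (3 * \<alpha>) * M * ?h powr \<alpha> \<le> sew_const (3 * \<alpha>) * M * \<delta> powr \<alpha>"
      using sew_const(1)[OF \<theta>] c by (intro mult_left_mono) auto
    also have "\<dots> \<le> 1" by (rule \<delta>)
    finally have "sew_const (3 * \<alpha>) * M * ?h powr \<alpha> * (w t k j)\<^sup>2 \<le> 1 * (w t k j)\<^sup>2"
      by (intro mult_right_mono) auto
    moreover have "?h \<le> (w t k j)\<^sup>2"
    proof (cases "?h = 0")
      case False
      then have "?h powr 1 \<le> ?h powr (2 * \<alpha>)" using h \<alpha> by (intro powr_mono') auto
      also have "\<dots> = (w t k j)\<^sup>2" using powr_add[of ?h \<alpha> \<alpha>] by (simp add: w_def power2_eq_square)
      finally show ?thesis using h by simp
    qed (simp add: w_def)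
    then have "B * ?h \<le> B * (w t k j)\<^sup>2" using B by (rule mult_left_mono)
    ultimately show ?thesis using rk unfolding e by (simp add: distrib_right mult.assoc)
  qed
  have main: "nrm (P j - P k - (\<Sum>a\<in>UNIV. z a k j *\<^sub>R f a (P k))) \<le> c1 * (w t k j)\<^sup>2"
     "nrm (P j - P k) \<le> c2 * w t k j"
    if kj: "k0 \<le> k" "k \<le> j" "j \<le> l0"
      and rk: "r k j \<le> sew_const (3 * \<alpha>) * M * (t j - t k) powr (3 * \<alpha>) + B * (t j - t k)" for k j
  proof -
    have "P j - P k - (\<Sum>a\<in>UNIV. z a k j *\<^sub>R f a (P k))
        = (P j - P k - g k j (P k)) + (\<Sum>a\<in>UNIV. \<Sum>b\<in>UNIV. zz b a k j *\<^sub>R V a b (P k))"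
      by (simp add: g_def)
    then have "nrm (P j - P k - (\<Sum>a\<in>UNIV. z a k j *\<^sub>R f a (P k)))
        \<le> r k j + nrm (\<Sum>a\<in>UNIV. \<Sum>b\<in>UNIV. zz b a k j *\<^sub>R V a b (P k))"
      unfolding r_def by (rule nrm_split)
    also have "\<dots> \<le> (1 + B) * (w t k j)\<^sup>2 + m\<^sup>2 * B\<^sup>2 * (w t k j)\<^sup>2"
      using kj rk by (intro add_mono rb gb)
    also have "\<dots> = c1 * (w t k j)\<^sup>2" by (simp add: c1_def algebra_simps)
    finally show 1: "nrm (P j - P k - (\<Sum>a\<in>UNIV. z a k j *\<^sub>R f a (P k))) \<le> c1 * (w t k j)\<^sup>2" .
    have "P j - P k = (P j - P k - (\<Sum>a\<in>UNIV. z a k j *\<^sub>R f a (P k))) + (\<Sum>a\<in>UNIV. z a k j *\<^sub>R f a (P k))"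
      by simp
    then have "nrm (P j - P k) \<le> nrm (P j - P k - (\<Sum>a\<in>UNIV. z a k j *\<^sub>R f a (P k)))
       + nrm (\<Sum>a\<in>UNIV. z a k j *\<^sub>R f a (P k))"
      by (rule nrm_split)
    also have "\<dots> \<le> c1 * (w t k j)\<^sup>2 + m * B\<^sup>2 * w t k j" using kj by (intro add_mono 1 gb)
    also have "c1 * (w t k j)\<^sup>2 \<le> c1 * w t k j"
      unfolding power2_eq_square using c w0 w1[of k j j] kj by (intro mult_left_mono mult_left_le_one_le) auto
    finally show "nrm (P j - P k) \<le> c2 * w t k j" by (simp add: c2_def distrib_right)
  qed
  have "r k l \<le> sew_const (3 * \<alpha>) * M * (t l - t k) powr (3 * \<alpha>) + B * (t l - t k)"
  proof (rule discrete_sewing[OF \<theta> c(3) B, where t = t and ?k0.0 = k0 and ?l0.0 = l0])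
    show "r k k = 0" if "k0 \<le> k" "k \<le> l0" for k
    proof -
      have "z a k k = 0" for a using z_add[of a k k k] by simp
      moreover have "zz b a k k = 0" for a b using zz[of k k b a] that by (simp add: w_def)
      ultimately show ?thesis by (simp add: r_def g_def nrm_z)
    qed
    show "r n (Suc n) \<le> B * (t (Suc n) - t n)" if "k0 \<le> n" "n < l0" for n
      using step[OF that] by (simp add: r_def)
    fix k j l assume kjl: "k0 \<le> k" "k \<le> j" "j < l" "l \<le> l0"
      and rk: "r k j \<le> sew_const (3 * \<alpha>) * M * (t j - t k) powr (3 * \<alpha>) + B * (t j - t k)"
    let ?w = "w t k l"
    have wle: "w t k j \<le> ?w" "w t j l \<le> ?w" "?w \<le> 1" using w1[of k j l] kjl by auto
    have kI: "k \<in> {k0..l0}" "j \<in> {k0..l0}" using kjl by auto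
    define E where "E = P j - P k - (\<Sum>b\<in>UNIV. z b k j *\<^sub>R f b (P k))"
    have E1: "nrm E \<le> c1 * ?w\<^sup>2"
      unfolding E_def
      by (rule order_trans[OF main(1)]) (use kjl rk wle c w0 in \<open>auto intro!: mult_left_mono power_mono\<close>)
    have E2: "nrm (P j - P k) \<le> c2 * ?w"
      by (rule order_trans[OF main(2)]) (use kjl rk wle c w0 in \<open>auto intro!: mult_left_mono\<close>)
    \<comment> \<open>Applying the linearization to the first order germ produces the fields
      \<open>V\<close>; these terms are what the product in the approximate Chen relation
      absorbs.\<close>
    have LE: "L a (P k) E = L a (P k) (P j - P k) - (\<Sum>b\<in>UNIV. z b k j *\<^sub>R V a b (P k))" for a
      unfolding E_def by (simp add: linear_diff[OF L_linear, of a k "P j - P k"] linear_sum[OF L_linear] linear_scale[OF L_linear] L_f)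
    define ch where "ch b a = zz b a k l - zz b a k j - zz b a j l - z b k j * z a j l" for a b
    \<comment> \<open>The defect of the second order germ in four parts: the quadratic error of
      linearizing the fields, the linearization of what exceeds the first order germ, the variation
      of the second order fields, and the failure of Chen's relation. All are of third
      order.\<close>
    let ?T1 = "\<lambda>a. z a j l *\<^sub>R (f a (P j) - f a (P k) - L a (P k) (P j - P k))"
    let ?T2 = "\<lambda>a. z a j l *\<^sub>R L a (P k) E"
    let ?T3 = "\<lambda>a. \<Sum>b\<in>UNIV. zz b a j l *\<^sub>R (V a b (P j) - V a b (P k))"
    let ?T4 = "\<lambda>a. \<Sum>b\<in>UNIV. (- ch b a) *\<^sub>R V a b (P k)"
    have per: "z a k j *\<^sub>R f a (P k) + z a j l *\<^sub>R f a (P j) - z a k l *\<^sub>R f a (P k)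
       + ((\<Sum>b\<in>UNIV. zz b a k j *\<^sub>R V a b (P k)) + (\<Sum>b\<in>UNIV. zz b a j l *\<^sub>R V a b (P j)) - (\<Sum>b\<in>UNIV. zz b a k l *\<^sub>R V a b (P k)))
       = ?T1 a + ?T2 a + ?T3 a + ?T4 a" for a
      unfolding LE ch_def z_add[of a k l j]
      by (simp add: scaleR_sum_right sum.distrib sum_subtractf sum_negf algebra_simps)
    have "g k j (P k) + g j l (P j) - g k l (P k)
      = (\<Sum>a\<in>UNIV. z a k j *\<^sub>R f a (P k) + z a j l *\<^sub>R f a (P j) - z a k l *\<^sub>R f a (P k)
       + ((\<Sum>b\<in>UNIV. zz b a k j *\<^sub>R V a b (P k)) + (\<Sum>b\<in>UNIV. zz b a j l *\<^sub>R V a b (P j)) - (\<Sum>b\<in>UNIV. zz b a k l *\<^sub>R V a b (P k))))"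
      unfolding g_def sum.distrib sum_subtractf by (simp add: algebra_simps)
    also have "\<dots> = (\<Sum>a\<in>UNIV. ?T1 a + ?T2 a + ?T3 a + ?T4 a)" unfolding per ..
    finally have geq: "g k j (P k) + g j l (P j) - g k l (P k) = (\<Sum>a\<in>UNIV. ?T1 a + ?T2 a + ?T3 a + ?T4 a)" .
    have "nrm (?T1 a + ?T2 a + ?T3 a + ?T4 a)
       \<le> (B * ?w) * (B * (c2 * ?w)\<^sup>2) + (B * ?w) * (B * (c1 * ?w\<^sup>2))
        + m * ((B * ?w\<^sup>2) * (B * (c2 * ?w))) + m * ((B * ?w ^ 3) * B)" for a
    proof (intro order_trans[OF nrm_tri] add_mono nrm_sumb; unfold nrm_scale; intro mult_mono nrm0)
      show zb: "\<bar>z a j l\<bar> \<le> B * ?w"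
        by (rule order_trans[OF z]) (use kjl wle B in \<open>auto intro!: mult_left_mono\<close>)
      show "\<bar>z a j l\<bar> \<le> B * ?w" by (rule zb)
      show "nrm (f a (P j) - f a (P k) - L a (P k) (P j - P k)) \<le> B * (c2 * ?w)\<^sup>2"
        by (rule order_trans[OF f_lin[OF kI]]) (use E2 B nrm0 in \<open>auto intro!: mult_left_mono power_mono\<close>)
      show "nrm (L a (P k) E) \<le> B * (c1 * ?w\<^sup>2)"
        by (rule order_trans[OF L_bound[OF kI(1)]]) (use E1 B in \<open>auto intro!: mult_left_mono\<close>)
      fix b
      show "\<bar>zz b a j l\<bar> \<le> B * ?w\<^sup>2"
        by (rule order_trans[OF zz]) (use kjl wle B w0 in \<open>auto intro!: mult_left_mono power_mono\<close>)
      show "nrm (V a b (P j) - V a b (P k)) \<le> B * (c2 * ?w)"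
        by (rule order_trans[OF V_lip[OF kI]]) (use E2 B in \<open>auto intro!: mult_left_mono\<close>)
      show "\<bar>- ch b a\<bar> \<le> B * ?w ^ 3" unfolding ch_def abs_minus_cancel using kjl by (intro zz_chen) auto
      show "nrm (V a b (P k)) \<le> B" by (rule V[OF kI(1)])
    qed (use B w0 c in auto)
    then have "nrm (g k j (P k) + g j l (P j) - g k l (P k)) \<le> m * ((B * ?w) * (B * (c2 * ?w)\<^sup>2) + (B * ?w) * (B * (c1 * ?w\<^sup>2))
        + m * ((B * ?w\<^sup>2) * (B * (c2 * ?w))) + m * ((B * ?w ^ 3) * B))"
      unfolding geq by (rule nrm_sumb)
    also have "\<dots> = M * ?w ^ 3"
      by (simp add: M_def algebra_simps power2_eq_square power3_eq_cube)
    also have "?w ^ 3 = (t l - t k) powr (3 * \<alpha>)"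
      using powr_power[of "t l - t k" \<alpha> 3] by (cases "t l = t k") (auto simp: w_def)
    finally have G: "nrm (g k j (P k) + g j l (P j) - g k l (P k)) \<le> M * (t l - t k) powr (3 * \<alpha>)" .
    have "P l - P k - g k l (P k) = ((P j - P k - g k j (P k)) + (P l - P j - g j l (P j)))
        + (g k j (P k) + g j l (P j) - g k l (P k))" by simp
    then have "r k l \<le> nrm ((P j - P k - g k j (P k)) + (P l - P j - g j l (P j)))
        + nrm (g k j (P k) + g j l (P j) - g k l (P k))" unfolding r_def by (rule nrm_split)
    with G nrm_tri[of "P j - P k - g k j (P k)" "P l - P j - g j l (P j)"]
    show "r k l \<le> r k j + r j l + M * (t l - t k) powr (3 * \<alpha>)" unfolding r_def by linarith
  qed (use kl t in auto)
  with kl show ?thesis by (intro main(2))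
qed

text \<open>In this norm a pair of points at distance at most \<open>l\<close> has rescaled difference of size \<open>1\<close>, so that
  a Hoelder bound for the pair controls the increments of the difference by a multiple of \<open>l\<close>.\<close>

definition pair_norm :: "real \<Rightarrow> ('a::real_normed_vector \<times> 'a) \<Rightarrow> real" where
  "pair_norm l p = norm (fst p) + norm (fst p - snd p) / l"

lemma pair_norm_triangle: "0 < l \<Longrightarrow> pair_norm l (p + q) \<le> pair_norm l p + pair_norm l q"
proof -
  assume l: "0 < l"
  have "fst (p + q) - snd (p + q) = (fst p - snd p) + (fst q - snd q)" by (simp add: algebra_simps)
  then have "norm (fst (p + q) - snd (p + q)) / l \<le> (norm (fst p - snd p) + norm (fst q - snd q)) / l"
    using l norm_triangle_ineq by (metis divide_right_mono less_imp_le)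
  moreover have "norm (fst (p + q)) \<le> norm (fst p) + norm (fst q)" by (simp add: norm_triangle_ineq)
  ultimately show ?thesis by (simp add: pair_norm_def add_divide_distrib)
qed

lemma pair_norm_scaleR: "pair_norm l (c *\<^sub>R p) = \<bar>c\<bar> * pair_norm l p"
  by (simp add: pair_norm_def scaleR_diff_right[symmetric] distrib_left)

lemma pair_norm_ge0: "0 < l \<Longrightarrow> 0 \<le> pair_norm l p"
  by (simp add: pair_norm_def)

lemma pair_norm_le:
  assumes "0 < l" "norm x \<le> a" "norm (x - y) \<le> l * b"
  shows "pair_norm l (x, y) \<le> a + b"
proof -
  have "norm (x - y) / l \<le> b" using assms by (simp add: pos_divide_le_eq mult.commute)
  with assms show ?thesis by (simp add: pair_norm_def)
qed

lemma pair_norm_parts: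
  assumes "0 < l"
  shows "norm x \<le> pair_norm l (x, y)" "norm (x - y) \<le> l * pair_norm l (x, y)"
  using assms by (auto simp: pair_norm_def distrib_left)

section \<open>Smooth fields acting on pairs of points\<close>

text \<open>The four point estimate, divided by \<open>l\<close>, bounds the difference component of
  the increment; the constant does not depend on \<open>l\<close>, so arbitrarily close pairs are
  treated alike.\<close>

lemma pair_lipschitz:
  fixes V :: "real^'e \<Rightarrow> real^'e"
  assumes V: "Cb 2 V"
  shows "\<exists>C\<ge>0. \<forall>l x y x' y'. 0 < l \<and> norm (x - y) \<le> l \<and> norm (x' - y') \<le> l \<longrightarrow>
     pair_norm l (V x, V y) \<le> C \<and>
     pair_norm l ((V x', V y') - (V x, V y)) \<le> C * pair_norm l ((x', y') - (x, y))"
proof -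
  obtain C1 where C1: "C1 \<ge> 0" "\<And>x. norm (V x) \<le> C1" using Cb_bounded[OF V] by auto
  have V1: "Cb (Suc 1) V" using V by (simp add: numeral_2_eq_2)
  obtain C2 where C2: "C2 \<ge> 0" "\<And>x y. norm (V x - V y) \<le> C2 * norm (x - y)"
    by (rule Cb_lipschitz[OF V1]; blast)
  obtain C3 where C3: "C3 \<ge> 0" "\<And>x y \<xi> \<eta> l. norm (x - y) \<le> l \<Longrightarrow> norm ((x + \<xi>) - (y + \<eta>)) \<le> l \<Longrightarrow>
     norm (V (x + \<xi>) - V x - (V (y + \<eta>) - V y)) \<le> C3 * (l * norm \<xi> + norm (\<xi> - \<eta>))"
    by (rule Cb2_four_point[OF V]; blast)
  show ?thesis
  proof (intro exI[of _ "C1 + C2 + C3"] conjI allI impI)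
    show "0 \<le> C1 + C2 + C3" using C1 C2 C3 by simp
    fix l :: real and x y x' y' :: "real^'e" assume H: "0 < l \<and> norm (x - y) \<le> l \<and> norm (x' - y') \<le> l"
    then have l: "0 < l" "norm (x - y) \<le> l" "norm (x' - y') \<le> l" by auto
    have "norm (V x - V y) \<le> l * C2"
      by (rule order_trans[OF C2(2)]) (use l C2 in \<open>simp add: mult.commute mult_left_mono\<close>)
    then have "pair_norm l (V x, V y) \<le> C1 + C2" by (intro pair_norm_le l C1)
    then show "pair_norm l (V x, V y) \<le> C1 + C2 + C3" using C3 by simp
    let ?\<xi> = "x' - x" and ?\<eta> = "y' - y"
    let ?n = "pair_norm l (?\<xi>, ?\<eta>)"
    note parts = pair_norm_parts[OF l(1), of ?\<xi> ?\<eta>]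
    have "norm (V x' - V x) \<le> C2 * ?n"
      by (rule order_trans[OF C2(2)]) (intro mult_left_mono parts C2)
    moreover have "norm ((V x' - V x) - (V y' - V y)) \<le> l * (C3 * ?n)"
    proof -
      have "norm ((V x' - V x) - (V y' - V y)) \<le> C3 * (l * norm ?\<xi> + norm (?\<xi> - ?\<eta>))"
        using C3(2)[of x y l ?\<xi> ?\<eta>] l by simp
      also have "l * norm ?\<xi> + norm (?\<xi> - ?\<eta>) = l * ?n"
        using l by (simp add: pair_norm_def distrib_left)
      finally show ?thesis by (simp add: mult_ac)
    qed
    ultimately have "pair_norm l (V x' - V x, V y' - V y) \<le> C2 * ?n + C3 * ?n"
      by (rule pair_norm_le[OF l(1)])
    also have "\<dots> \<le> (C1 + C2 + C3) * ?n"
      using C1 pair_norm_ge0[OF l(1), of "(?\<xi>, ?\<eta>)"] by (simp add: distrib_right)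
    finally show "pair_norm l ((V x', V y') - (V x, V y)) \<le> (C1 + C2 + C3) * pair_norm l ((x', y') - (x, y))"
      by simp
  qed
qed

text \<open>The difference component is \<open>Cb3_linearization_diff\<close> divided by
  \<open>l\<close>. There the second increment also appears by itself; since the pair norm measures
  only the first one and the difference, it is bounded through l \<le> l1.\<close>

lemma pair_linearization:
  fixes f :: "real^'e \<Rightarrow> real^'e"
  assumes f: "Cb 3 f"
  shows "\<exists>C\<ge>0. \<forall>l x y x' y'. 0 < l \<and> l \<le> l1 \<and> norm (x - y) \<le> l \<and> norm (x' - y') \<le> l \<longrightarrow>
     pair_norm l ((f x', f y') - (f x, f y)
        - (frechet_derivative f (at x) (x' - x), frechet_derivative f (at y) (y' - y)))
       \<le> C * (pair_norm l ((x', y') - (x, y)))\<^sup>2 \<and>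
     (\<forall>\<xi> \<eta>. pair_norm l (frechet_derivative f (at x) \<xi>, frechet_derivative f (at y) \<eta>) \<le> C * pair_norm l (\<xi>, \<eta>))"
proof -
  let ?D = "\<lambda>x v. frechet_derivative f (at x) v"
  have f2: "Cb 2 f" by (rule Cb_le[OF f]) simp
  have f1: "Cb (Suc 0) f" by (rule Cb_le[OF f]) simp
  obtain C1 where C1: "C1 \<ge> 0" "\<And>x v. norm (?D x v) \<le> C1 * norm v"
    by (rule Cb_frechet_bound[OF f1]; blast)
  obtain C2 where C2: "C2 \<ge> 0" "\<And>x y v. norm (?D x v - ?D y v) \<le> C2 * (norm (x - y) * norm v)"
    by (rule Cb2_frechet_lipschitz[OF f2]; blast)
  obtain C3 where C3: "C3 \<ge> 0" "\<And>x \<xi>. norm (f (x + \<xi>) - f x - ?D x \<xi>) \<le> C3 * (norm \<xi>)\<^sup>2"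
    by (rule Cb2_linearization[OF f2]; blast)
  obtain C4 where C4: "C4 \<ge> 0" "\<And>x y \<xi> \<eta> l. norm (x - y) \<le> l \<Longrightarrow> norm ((x + \<xi>) - (y + \<eta>)) \<le> l \<Longrightarrow>
     norm ((f (x + \<xi>) - f x - ?D x \<xi>) - (f (y + \<eta>) - f y - ?D y \<eta>))
       \<le> C4 * (l * (norm \<xi>)\<^sup>2 + norm (\<xi> - \<eta>) * (norm \<xi> + norm \<eta>))"
    by (rule Cb3_linearization_diff[OF f]; blast)
  let ?C = "C3 + C4 * (3 + \<bar>l1\<bar>) + (C1 + (C2 + C1))"
  have p4: "0 \<le> C4 * (3 + \<bar>l1\<bar>)" using C4 by simp
  show ?thesis
  proof (intro exI[of _ ?C] conjI allI impI)
    show "0 \<le> ?C" using C1 C2 C3 p4 by simp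
    fix l :: real and x y x' y' :: "real^'e" assume "0 < l \<and> l \<le> l1 \<and> norm (x - y) \<le> l \<and> norm (x' - y') \<le> l"
    then have l: "0 < l" "l \<le> l1" "norm (x - y) \<le> l" "norm (x' - y') \<le> l" by auto
    let ?\<xi> = "x' - x" and ?\<eta> = "y' - y"
    let ?n = "pair_norm l (?\<xi>, ?\<eta>)"
    note parts = pair_norm_parts[OF l(1), of ?\<xi> ?\<eta>] and n0 = pair_norm_ge0[OF l(1), of "(?\<xi>, ?\<eta>)"]
    have "norm (f x' - f x - ?D x ?\<xi>) \<le> C3 * (norm ?\<xi>)\<^sup>2"
      using C3(2)[of x ?\<xi>] by simp
    also have "\<dots> \<le> C3 * ?n\<^sup>2" by (intro mult_left_mono power_mono parts C3) simp
    finally have "norm (f x' - f x - ?D x ?\<xi>) \<le> C3 * ?n\<^sup>2" .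
    moreover have "norm ((f x' - f x - ?D x ?\<xi>) - (f y' - f y - ?D y ?\<eta>)) \<le> l * (C4 * (3 + \<bar>l1\<bar>) * ?n\<^sup>2)"
    proof -
      have e: "norm ?\<eta> \<le> (1 + \<bar>l1\<bar>) * ?n"
      proof -
        have "norm ?\<eta> \<le> norm ?\<xi> + norm (?\<xi> - ?\<eta>)"
          using norm_triangle_ineq4[of ?\<xi> "?\<xi> - ?\<eta>"] by simp
        also have "\<dots> \<le> ?n + l * ?n" by (intro add_mono parts)
        also have "\<dots> \<le> ?n + \<bar>l1\<bar> * ?n" using l n0 by (intro add_left_mono mult_right_mono) auto
        finally show ?thesis by (simp add: distrib_right)
      qed
      have "norm ((f x' - f x - ?D x ?\<xi>) - (f y' - f y - ?D y ?\<eta>))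
          \<le> C4 * (l * (norm ?\<xi>)\<^sup>2 + norm (?\<xi> - ?\<eta>) * (norm ?\<xi> + norm ?\<eta>))"
        using C4(2)[of x y l ?\<xi> ?\<eta>] l by simp
      also have "\<dots> \<le> C4 * (l * ?n\<^sup>2 + (l * ?n) * (?n + (1 + \<bar>l1\<bar>) * ?n))"
        using l n0 by (intro mult_left_mono add_mono mult_mono power_mono parts e C4) auto
      also have "\<dots> = l * (C4 * (3 + \<bar>l1\<bar>) * ?n\<^sup>2)"
        by (simp add: algebra_simps power2_eq_square)
      finally show ?thesis .
    qed
    ultimately have "pair_norm l (f x' - f x - ?D x ?\<xi>, f y' - f y - ?D y ?\<eta>)
        \<le> C3 * ?n\<^sup>2 + C4 * (3 + \<bar>l1\<bar>) * ?n\<^sup>2"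
      by (rule pair_norm_le[OF l(1)])
    also have "\<dots> = (C3 + C4 * (3 + \<bar>l1\<bar>)) * ?n\<^sup>2" by (simp only: distrib_right)
    also have "\<dots> \<le> ?C * ?n\<^sup>2" using C1 C2 by (intro mult_right_mono) auto
    finally show "pair_norm l ((f x', f y') - (f x, f y) - (?D x ?\<xi>, ?D y ?\<eta>))
       \<le> ?C * (pair_norm l ((x', y') - (x, y)))\<^sup>2" by simp
    fix \<xi> \<eta> :: "real^'e"
    let ?m = "pair_norm l (\<xi>, \<eta>)"
    note parts = pair_norm_parts[OF l(1), of \<xi> \<eta>] and m0 = pair_norm_ge0[OF l(1), of "(\<xi>, \<eta>)"]
    have lin: "linear (?D y)" by (rule has_derivative_linear[OF Cb_has_derivative[OF f1]])
    have "norm (?D x \<xi>) \<le> C1 * ?m"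
      by (rule order_trans[OF C1(2)]) (intro mult_left_mono parts C1)
    moreover have "norm (?D x \<xi> - ?D y \<eta>) \<le> l * ((C2 + C1) * ?m)"
    proof -
      have "?D x \<xi> - ?D y \<eta> = (?D x \<xi> - ?D y \<xi>) + ?D y (\<xi> - \<eta>)" by (simp add: linear_diff[OF lin])
      also have "norm \<dots> \<le> C2 * (l * ?m) + C1 * (l * ?m)"
      proof (intro order_trans[OF norm_triangle_ineq] add_mono)
        show "norm (?D x \<xi> - ?D y \<xi>) \<le> C2 * (l * ?m)"
          using l by (intro order_trans[OF C2(2)] mult_left_mono C2 mult_mono parts) auto
        show "norm (?D y (\<xi> - \<eta>)) \<le> C1 * (l * ?m)"
          by (intro order_trans[OF C1(2)] mult_left_mono C1 parts)
      qed
      finally show ?thesis by (simp add: algebra_simps)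
    qed
    ultimately have "pair_norm l (?D x \<xi>, ?D y \<eta>) \<le> C1 * ?m + (C2 + C1) * ?m"
      by (rule pair_norm_le[OF l(1)])
    also have "\<dots> = (C1 + (C2 + C1)) * ?m" by (simp only: distrib_right)
    also have "\<dots> \<le> ?C * ?m" using m0 C3 p4 by (intro mult_right_mono) auto
    finally show "pair_norm l (?D x \<xi>, ?D y \<eta>) \<le> ?C * ?m" .
  qed
qed

section \<open>Davie's second order germ as the leading part of the tree series\<close>

context rough_driver
begin

text \<open>The derivative of F_a along F_b; no commutator is formed.\<close>

definition lie :: "('m \<Rightarrow> real^'e \<Rightarrow> real^'e) \<Rightarrow> 'm \<Rightarrow> 'm \<Rightarrow> real^'e \<Rightarrow> real^'e" where
  "lie F a b x = frechet_derivative (F a) (at x) (F b x)"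

definition davie :: "('m \<Rightarrow> real^'e \<Rightarrow> real^'e) \<Rightarrow> real \<Rightarrow> real \<Rightarrow> real^'e \<Rightarrow> real^'e" where
  "davie F u v y = (\<Sum>a\<in>UNIV. (Z v $ a - Z u $ a) *\<^sub>R F a y)
     + (\<Sum>a\<in>UNIV. \<Sum>b\<in>UNIV. ZZ b a u v *\<^sub>R lie F a b y)"

text \<open>The one-step map common to solution and scheme: the B-series truncated at
  \<open>p\<close> vertices, with the coefficients of the driver.\<close>

definition series :: "('m \<Rightarrow> real^'e::finite \<Rightarrow> real^'e) \<Rightarrow> nat \<Rightarrow> real \<Rightarrow> real \<Rightarrow> real^'e \<Rightarrow> real^'e" where
  "series F p u v y = (\<chi> i. \<Sum>\<tau> | \<tau> \<in> ptrees p p \<and> snd (plabel \<tau>) = i.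
     elem_diff (tcoef F y) \<tau> * tree_coeff XX Z Z' u v (forget \<tau>))"

text \<open>What the coefficients of \<open>series\<close> amount to modulo \<open>w\<^sup>3\<close>.\<close>

definition low_coeff :: "real \<Rightarrow> real \<Rightarrow> ('m \<times> 'e) ptree \<Rightarrow> real" where
  "low_coeff u v \<tau> = (case \<tau> of PNode l ts \<Rightarrow> (case ts of [] \<Rightarrow> Z v $ fst l - Z u $ fst l
     | t # ts' \<Rightarrow> (case t of PNode l' us \<Rightarrow> if ts' = [] \<and> us = [] then ZZ (fst l') (fst l) u v else 0)))"

text \<open>One vertex gives the increment of the driver exactly, two vertices give
  \<open>ZZ\<close> up to third order, and a tree with at least three vertices is itself of third
  order, its further powers of \<open>w\<close> being bounded by powers of M0.\<close>

lemma tree_coeff_low: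
  fixes \<tau> :: "('m \<times> 'e) ptree"
  shows "\<exists>C\<ge>0. \<forall>u v. 0 \<le> u \<and> u < v \<and> v \<le> T \<longrightarrow>
     \<bar>tree_coeff XX Z Z' u v (forget \<tau>) - low_coeff u v \<tau>\<bar> \<le> C * w u v ^ 3"
proof -
  obtain l ts where \<tau>: "\<tau> = PNode l ts" by (cases \<tau>)
  consider "ts = []" | l' where "ts = [PNode l' []]" | "3 \<le> psize \<tau>" "\<And>u v. low_coeff u v \<tau> = 0"
  proof (cases ts)
    case (Cons t ts')
    obtain l' us where t: "t = PNode l' us" by (cases t)
    have ps: "0 < psize s" for s :: "('m \<times> 'e) ptree" by (cases s) auto
    show ?thesis
    proof (cases "ts' = [] \<and> us = []")
      case True
      with Cons t that(2) show ?thesis by auto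
    next
      case False
      then have "3 \<le> psize \<tau>"
      proof (cases us)
        case Nil
        with False obtain s ss where "ts' = s # ss" by (cases ts') auto
        then show ?thesis using ps[of s] by (simp add: \<tau> Cons t)
      next
        case (Cons s ss)
        then show ?thesis using ps[of s] by (simp add: \<tau> \<open>ts = t # ts'\<close> t)
      qed
      moreover have "low_coeff u v \<tau> = 0" for u v
        using False by (auto simp: low_coeff_def \<tau> Cons t)
      ultimately show ?thesis by (rule that(3))
    qed
  qed (use that in auto)
  then show ?thesis
  proof cases
    case 1
    then show ?thesis
      by (intro exI[of _ 0]) (auto simp: low_coeff_def \<tau> tree_coeff_single)
  next
    case 2
    then show ?thesis
      using tree_coeff_double[of "fst l" "fst l'"] by (simp add: low_coeff_def \<tau>)
  next
    case 3
    obtain C where C: "C \<ge> 0" "\<And>u v. 0 \<le> u \<Longrightarrow> u < v \<Longrightarrow> v \<le> T \<Longrightarrow>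
       \<bar>tree_coeff XX Z Z' u v (forget \<tau>)\<bar> \<le> C * w u v ^ psize \<tau>"
      using tree_coeff_bound[of \<tau>] by blast
    show ?thesis
    proof (intro exI[of _ "C * M0 ^ (psize \<tau> - 3)"] conjI allI impI)
      show "0 \<le> C * M0 ^ (psize \<tau> - 3)" using C M0 by simp
      fix u v assume uv: "0 \<le> u \<and> u < v \<and> v \<le> T"
      have "C * w u v ^ psize \<tau> = C * (w u v ^ (psize \<tau> - 3) * w u v ^ 3)"
        using 3(1) by (simp flip: power_add)
      also have "\<dots> \<le> C * (M0 ^ (psize \<tau> - 3) * w u v ^ 3)"
        using C uv w_M0[of u v] by (intro mult_left_mono mult_right_mono power_mono) auto
      finally show "\<bar>tree_coeff XX Z Z' u v (forget \<tau>) - low_coeff u v \<tau>\<bar> \<le> C * M0 ^ (psize \<tau> - 3) * w u v ^ 3"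
        using C(2)[of u v] uv 3(2) by (simp add: mult.assoc)
    qed
  qed
qed

context
  fixes F :: "'m \<Rightarrow> real^'e::finite \<Rightarrow> real^'e" and p :: nat
  assumes p: "2 \<le> p" and F: "\<And>a. Cb (p + 1) (F a)"
begin

text \<open>Only trees with one or two vertices have nonzero low coefficients; for two vertices the
  sum over the component of the child assembles DF_a F_b.\<close>

lemma davie_low:
  "davie F u v y $ i = (\<Sum>\<tau> | \<tau> \<in> ptrees p p \<and> snd (plabel \<tau>) = i. elem_diff (tcoef F y) \<tau> * low_coeff u v \<tau>)"
proof -
  obtain k where k: "p = Suc (Suc k)" using p by (metis add_2_eq_Suc le_Suc_ex)
  have d: "F a differentiable (at y)" for a
    using Cb_has_derivative[of p "F a" y] F[of a] by (auto intro: differentiableI simp del: Cb.simps)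
  let ?c = "\<lambda>bj. [PNode bj []] :: ('m \<times> 'e) ptree list"
  let ?h = "\<lambda>a ts. elem_diff (tcoef F y) (PNode (a, i) ts) * low_coeff u v (PNode (a, i) ts)"
  have "(\<Sum>ts\<in>pforests p (Suc k). ?h a ts) = (Z v $ a - Z u $ a) * F a y $ i + (\<Sum>b\<in>UNIV. ZZ b a u v * lie F a b y $ i)" for a
  proof -
    \<comment> \<open>The trees with two vertices are admissible because p \<ge> 2: one child is
      fewer than p children, and two vertices do not exceed the size bound.\<close>
    have sub: "insert [] (range ?c) \<subseteq> pforests p (Suc k)"
      by (auto simp: pforests_def k image_iff)
    have "(\<Sum>ts\<in>pforests p (Suc k). ?h a ts) = (\<Sum>ts\<in>insert [] (range ?c). ?h a ts)"
    proof (rule sum.mono_neutral_right[OF finite_pforests sub], rule ballI)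
      fix ts assume ts: "ts \<in> pforests p (Suc k) - insert [] (range ?c)"
      then obtain t ts' where "ts = t # ts'" by (cases ts) auto
      moreover obtain l' us where "t = PNode l' us" by (cases t)
      ultimately have "low_coeff u v (PNode (a, i) ts) = 0" using ts by (auto simp: low_coeff_def)
      then show "?h a ts = 0" by simp
    qed
    also have "\<dots> = ?h a [] + (\<Sum>ts\<in>range ?c. ?h a ts)" by (rule sum.insert) auto
    also have "(\<Sum>ts\<in>range ?c. ?h a ts) = (\<Sum>bj\<in>UNIV. ?h a (?c bj))"
      by (rule sum.reindex[unfolded comp_def]) (auto simp: inj_on_def)
    also have "\<dots> = (\<Sum>b\<in>UNIV. \<Sum>j\<in>UNIV. ?h a (?c (b, j)))"
      by (simp add: sum.cartesian_product split_def)
    also have "\<dots> = (\<Sum>b\<in>UNIV. ZZ b a u v * lie F a b y $ i)"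
    proof (rule sum.cong[OF refl])
      fix b
      have "lie F a b y $ i = (\<Sum>j\<in>UNIV. F b y $ j * pder j (F a) y $ i)"
        by (simp add: lie_def frechet_derivative_pder[OF d, of a "F b y"])
      also have "\<dots> = (\<Sum>j\<in>UNIV. pder j (\<lambda>x. F a x $ i) y * F b y $ j)"
        by (simp add: frechet_derivative_comp[OF d] mult.commute)
      finally show "(\<Sum>j\<in>UNIV. ?h a (?c (b, j))) = ZZ b a u v * lie F a b y $ i"
        by (simp add: tcoef_def low_coeff_def sum_distrib_left mult_ac)
    qed
    also have "?h a [] = (Z v $ a - Z u $ a) * F a y $ i"
      by (simp add: tcoef_def low_coeff_def)
    finally show ?thesis .
  qed
  then show ?thesis
    unfolding k sum_ptrees_root unfolding k[symmetric]
    by (simp add: davie_def sum.distrib)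
qed

text \<open>The second estimate serves the pair norm: the third order discrepancy is Lipschitz in
  the starting point, so that at two points at distance at most \<open>l\<close> it differs by
  O(w^3) times \<open>l\<close>. It rests on Lipschitz elementary differentials.\<close>

lemma series_davie:
  "\<exists>C\<ge>0. \<forall>u v x y. 0 \<le> u \<and> u < v \<and> v \<le> T \<longrightarrow>
     norm (series F p u v x - davie F u v x) \<le> C * w u v ^ 3 \<and>
     norm ((series F p u v x - davie F u v x) - (series F p u v y - davie F u v y)) \<le> C * w u v ^ 3 * norm (x - y)"
proof -
  let ?P = "ptrees p p :: ('m \<times> 'e) ptree set"
  obtain C where C: "\<And>\<tau> :: ('m \<times> 'e) ptree. C \<tau> \<ge> 0" "\<And>(\<tau> :: ('m \<times> 'e) ptree) u v. 0 \<le> u \<Longrightarrow> u < v \<Longrightarrow> v \<le> T \<Longrightarrow>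
     \<bar>tree_coeff XX Z Z' u v (forget \<tau>) - low_coeff u v \<tau>\<bar> \<le> C \<tau> * w u v ^ 3"
    using tree_coeff_low by metis
  have "\<exists>D\<ge>0. \<forall>x y. \<bar>elem_diff (tcoef F x) \<tau>\<bar> \<le> D \<and> \<bar>elem_diff (tcoef F x) \<tau> - elem_diff (tcoef F y) \<tau>\<bar> \<le> D * norm (x - y)"
    if "\<tau> \<in> ?P" for \<tau>
  proof -
    have c2: "Cb 2 (\<lambda>y. elem_diff (tcoef F y) \<tau>)" by (rule Cb_elem_diff[OF F that])
    then have c1: "Cb (Suc 1) (\<lambda>y. elem_diff (tcoef F y) \<tau>)" by (simp only: numeral_2_eq_2 One_nat_def)
    obtain D1 where D1: "D1 \<ge> 0" "\<And>x. \<bar>elem_diff (tcoef F x) \<tau>\<bar> \<le> D1"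
      using Cb_bounded[OF c2] by (auto simp: real_norm_def)
    obtain D2 where D2: "D2 \<ge> 0" "\<And>x y. \<bar>elem_diff (tcoef F x) \<tau> - elem_diff (tcoef F y) \<tau>\<bar> \<le> D2 * norm (x - y)"
      by (rule Cb_lipschitz[OF c1]) (unfold real_norm_def, blast)
    have m: "D2 * norm (x - y) \<le> max D1 D2 * norm (x - y)" for x y :: "real^'e"
      by (intro mult_right_mono) auto
    show ?thesis
      using D1 order_trans[OF D2(2) m]
      by (intro exI[of _ "max D1 D2"]) (auto simp: le_max_iff_disj)
  qed
  then obtain D where D: "\<And>\<tau>. \<tau> \<in> ?P \<Longrightarrow> D \<tau> \<ge> 0" "\<And>\<tau> x. \<tau> \<in> ?P \<Longrightarrow> \<bar>elem_diff (tcoef F x) \<tau>\<bar> \<le> D \<tau>"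
    "\<And>\<tau> x y. \<tau> \<in> ?P \<Longrightarrow> \<bar>elem_diff (tcoef F x) \<tau> - elem_diff (tcoef F y) \<tau>\<bar> \<le> D \<tau> * norm (x - y)"
    by metis
  let ?P' = "\<lambda>i. {\<tau> \<in> ?P. snd (plabel \<tau>) = i}"
  let ?k = "\<lambda>u v \<tau>. tree_coeff XX Z Z' u v (forget \<tau>) - low_coeff u v \<tau>"
  have eq: "(series F p u v x - davie F u v x) $ i = (\<Sum>\<tau>\<in>?P' i. elem_diff (tcoef F x) \<tau> * ?k u v \<tau>)" for u v x i
    by (simp add: series_def davie_low sum_subtractf right_diff_distrib)
  define K where "K = (\<Sum>i\<in>UNIV. \<Sum>\<tau>\<in>?P' i. D \<tau> * C \<tau>)"
  show ?thesis
  proof (intro exI[of _ K] conjI allI impI)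
    show "0 \<le> K" unfolding K_def using C D by (intro sum_nonneg mult_nonneg_nonneg) auto
    fix u v x y assume uv: "0 \<le> u \<and> u < v \<and> v \<le> T"
    have "norm (series F p u v x - davie F u v x) \<le> (\<Sum>i\<in>UNIV. \<bar>(series F p u v x - davie F u v x) $ i\<bar>)"
      by (rule norm_le_l1_cart)
    also have "\<dots> \<le> (\<Sum>i\<in>UNIV. \<Sum>\<tau>\<in>?P' i. D \<tau> * (C \<tau> * w u v ^ 3))"
      unfolding eq
      by (intro sum_mono order_trans[OF sum_abs]; simp only: abs_mult; intro mult_mono) (use C D uv in auto)
    also have "\<dots> = K * w u v ^ 3" by (simp add: K_def sum_distrib_right mult.assoc)
    finally show "norm (series F p u v x - davie F u v x) \<le> K * w u v ^ 3" .
    have "norm ((series F p u v x - davie F u v x) - (series F p u v y - davie F u v y))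
       \<le> (\<Sum>i\<in>UNIV. \<bar>((series F p u v x - davie F u v x) - (series F p u v y - davie F u v y)) $ i\<bar>)"
      by (rule norm_le_l1_cart)
    also have "\<dots> = (\<Sum>i\<in>UNIV. \<bar>\<Sum>\<tau>\<in>?P' i. (elem_diff (tcoef F x) \<tau> - elem_diff (tcoef F y) \<tau>) * ?k u v \<tau>\<bar>)"
      unfolding vector_minus_component[of "_ - _" "_ - _"] eq by (simp add: sum_subtractf left_diff_distrib)
    also have "\<dots> \<le> (\<Sum>i\<in>UNIV. \<Sum>\<tau>\<in>?P' i. (D \<tau> * norm (x - y)) * (C \<tau> * w u v ^ 3))"
      by (intro sum_mono order_trans[OF sum_abs]; simp only: abs_mult; intro mult_mono) (use C D uv in auto)
    also have "\<dots> = K * w u v ^ 3 * norm (x - y)"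
      unfolding K_def sum_distrib_right by (intro sum.cong refl) (simp add: mult_ac)
    finally show "norm ((series F p u v x - davie F u v x) - (series F p u v y - davie F u v y)) \<le> K * w u v ^ 3 * norm (x - y)" .
  qed
qed

end

end

lemma sum_pair: "(\<Sum>i\<in>A. (f i, g i)) = (\<Sum>i\<in>A. f i, \<Sum>i\<in>A. g i)"
  by (induction A rule: infinite_finite_induct) (auto simp: zero_prod_def)

section \<open>Stability over blocks and over the whole interval\<close>

context rough_driver
begin

text \<open>The conditions on the fields in \<open>discrete_apriori\<close>, for pairs in the pair
  norm, with one constant for every scale up to \<open>l1\<close>. The scale is chosen only later,
  as the actual distance of the sequences on a block.\<close>

definition field_bound :: "('m \<Rightarrow> real^'e::finite \<Rightarrow> real^'e) \<Rightarrow> real \<Rightarrow> real \<Rightarrow> bool" where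
  "field_bound F l1 B \<longleftrightarrow> (\<forall>l x y. 0 < l \<longrightarrow> l \<le> l1 \<longrightarrow> norm (x - y) \<le> l \<longrightarrow>
     (\<forall>a. pair_norm l (F a x, F a y) \<le> B) \<and>
     (\<forall>a b. pair_norm l (lie F a b x, lie F a b y) \<le> B) \<and>
     (\<forall>a \<xi> \<eta>. pair_norm l (frechet_derivative (F a) (at x) \<xi>, frechet_derivative (F a) (at y) \<eta>)
        \<le> B * pair_norm l (\<xi>, \<eta>)) \<and>
     (\<forall>x' y'. norm (x' - y') \<le> l \<longrightarrow>
        (\<forall>a b. pair_norm l ((lie F a b x', lie F a b y') - (lie F a b x, lie F a b y))
           \<le> B * pair_norm l ((x', y') - (x, y))) \<and>
        (\<forall>a. pair_norm l ((F a x', F a y') - (F a x, F a y)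
             - (frechet_derivative (F a) (at x) (x' - x), frechet_derivative (F a) (at y) (y' - y)))
           \<le> B * (pair_norm l ((x', y') - (x, y)))\<^sup>2)))"

lemma field_boundD:
  assumes "field_bound F l1 B" "0 < l" "l \<le> l1" "norm (x - y) \<le> l"
  shows "pair_norm l (F a x, F a y) \<le> B"
    "pair_norm l (lie F a b x, lie F a b y) \<le> B"
    "pair_norm l (frechet_derivative (F a) (at x) \<xi>, frechet_derivative (F a) (at y) \<eta>) \<le> B * pair_norm l (\<xi>, \<eta>)"
    "norm (x' - y') \<le> l \<Longrightarrow> pair_norm l ((lie F a b x', lie F a b y') - (lie F a b x, lie F a b y))
       \<le> B * pair_norm l ((x', y') - (x, y))"
    "norm (x' - y') \<le> l \<Longrightarrow> pair_norm l ((F a x', F a y') - (F a x, F a y)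
         - (frechet_derivative (F a) (at x) (x' - x), frechet_derivative (F a) (at y) (y' - y)))
       \<le> B * (pair_norm l ((x', y') - (x, y)))\<^sup>2"
  using assms(1)[unfolded field_bound_def, rule_format, OF assms(2-4)] by blast+

text \<open>On a block of fixed length \<open>\<delta>\<close>, the difference of two sequences cannot move by more than half of its own
  maximum \<open>l\<close>, unless \<open>l\<close> is below the target accuracy; hence it at most doubles over a block.\<close>

definition stable_blocks :: "('m \<Rightarrow> real^'e::finite \<Rightarrow> real^'e) \<Rightarrow> nat \<Rightarrow> real \<Rightarrow> real \<Rightarrow> real \<Rightarrow> bool" where
  "stable_blocks F p Ce l1 \<delta> \<longleftrightarrow> (\<forall>k0 l0 t x y H l i. k0 \<le> l0 \<longrightarrow>
     (\<forall>n. k0 \<le> n \<longrightarrow> n < l0 \<longrightarrow> t n < t (Suc n) \<and> t (Suc n) - t n \<le> H) \<longrightarrow>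
     0 \<le> t k0 \<longrightarrow> t l0 \<le> T \<longrightarrow> t l0 - t k0 \<le> \<delta> \<longrightarrow>
     (\<forall>n. k0 \<le> n \<longrightarrow> n < l0 \<longrightarrow>
        norm (x (Suc n) - x n - series F p (t n) (t (Suc n)) (x n)) \<le> Ce * w (t n) (t (Suc n)) ^ (p + 1) \<and>
        norm (y (Suc n) - y n - series F p (t n) (t (Suc n)) (y n)) \<le> Ce * w (t n) (t (Suc n)) ^ (p + 1)) \<longrightarrow>
     (\<forall>n. n \<in> {k0..l0} \<longrightarrow> norm (x n - y n) \<le> l) \<longrightarrow> 0 < l \<longrightarrow> l \<le> l1 \<longrightarrow>
     H powr (real (p + 1) * \<alpha> - 1) \<le> l \<longrightarrow> i \<in> {k0..l0} \<longrightarrow>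
     norm ((x i - y i) - (x k0 - y k0)) \<le> l / 2)"

context
  fixes F :: "'m \<Rightarrow> real^'e::finite \<Rightarrow> real^'e" and p :: nat
  assumes p: "2 \<le> p" and F: "\<And>a. Cb (p + 1) (F a)"
begin

lemma field_bound_exists: "\<exists>B\<ge>0. field_bound F l1 B"
proof -
  have F3: "Cb 3 (F a)" for a by (rule Cb_le[OF F]) (use p in simp)
  have F2: "Cb 2 (F a)" for a by (rule Cb_le[OF F]) (use p in simp)
  have lie2: "Cb 2 (lie F a b)" for a b
    unfolding lie_def[abs_def] by (intro Cb_lie F2 Cb_le[OF F3]) simp
  let ?Q1 = "\<lambda>V C. 0 \<le> C \<and> (\<forall>l (x :: real^'e) y x' y'. 0 < l \<and> norm (x - y) \<le> l \<and> norm (x' - y') \<le> l \<longrightarrow>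
     pair_norm l (V x :: real^'e, V y) \<le> C \<and>
     pair_norm l ((V x', V y') - (V x, V y)) \<le> C * pair_norm l ((x', y') - (x, y)))"
  let ?Q2 = "\<lambda>f C. 0 \<le> C \<and> (\<forall>l x y x' y'. 0 < l \<and> l \<le> l1 \<and> norm (x - y) \<le> l \<and> norm (x' - y') \<le> l \<longrightarrow>
     pair_norm l ((f x' :: real^'e, f y') - (f x, f y)
        - (frechet_derivative f (at x) (x' - x), frechet_derivative f (at y) (y' - y)))
       \<le> C * (pair_norm l ((x' :: real^'e, y') - (x, y)))\<^sup>2 \<and>
     (\<forall>\<xi> \<eta>. pair_norm l (frechet_derivative f (at x) \<xi>, frechet_derivative f (at y) \<eta>) \<le> C * pair_norm l (\<xi>, \<eta>)))"
  have "\<forall>a. \<exists>C. ?Q1 (F a) C" using pair_lipschitz[OF F2] by blast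
  from choice[OF this] obtain C1 where C1: "\<forall>a. ?Q1 (F a) (C1 a)" ..
  have "\<forall>ab. \<exists>C. ?Q1 (lie F (fst ab) (snd ab)) C" using pair_lipschitz[OF lie2] by blast
  from choice[OF this] obtain C2 where C2: "\<forall>ab. ?Q1 (lie F (fst ab) (snd ab)) (C2 ab)" ..
  have "\<forall>a. \<exists>C. ?Q2 (F a) C" using pair_linearization[OF F3] by blast
  from choice[OF this] obtain C3 where C3: "\<forall>a. ?Q2 (F a) (C3 a)" ..
  define B where "B = (\<Sum>a\<in>UNIV. C1 a) + ((\<Sum>ab\<in>UNIV. C2 ab) + (\<Sum>a\<in>UNIV. C3 a))"
  have nn: "0 \<le> C1 a" "0 \<le> C2 ab" "0 \<le> C3 a" for a ab
    using C1[THEN spec, of a] C2[THEN spec, of ab] C3[THEN spec, of a] by blast+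
  have s0: "0 \<le> (\<Sum>a\<in>UNIV. C1 a)" "0 \<le> (\<Sum>ab\<in>UNIV. C2 ab)" "0 \<le> (\<Sum>a\<in>UNIV. C3 a)"
    using nn by (simp_all add: sum_nonneg)
  have le: "C1 a \<le> B" "C2 ab \<le> B" "C3 a \<le> B" for a ab
  proof -
    have "C1 a \<le> (\<Sum>a\<in>UNIV. C1 a)" using nn by (intro member_le_sum) auto
    then show "C1 a \<le> B" using s0 unfolding B_def by linarith
    have "C2 ab \<le> (\<Sum>ab\<in>UNIV. C2 ab)" using nn by (intro member_le_sum) auto
    then show "C2 ab \<le> B" using s0 unfolding B_def by linarith
    have "C3 a \<le> (\<Sum>a\<in>UNIV. C3 a)" using nn by (intro member_le_sum) auto
    then show "C3 a \<le> B" using s0 unfolding B_def by linarith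
  qed
  have "0 \<le> B" using s0 by (simp add: B_def)
  moreover have "field_bound F l1 B"
    unfolding field_bound_def
  proof (intro allI impI conjI)
    fix l :: real and x y :: "real^'e" and a b assume l: "0 < l" "l \<le> l1" "norm (x - y) \<le> l"
    show "pair_norm l (F a x, F a y) \<le> B"
      using C1[THEN spec, of a] l le(1)[of a] by (meson order_trans)
    show "pair_norm l (lie F a b x, lie F a b y) \<le> B"
      using C2[THEN spec, of "(a, b)"] l le(2)[of "(a, b)"] unfolding fst_conv snd_conv by (meson order_trans)
    fix \<xi> \<eta> :: "real^'e"
    have "pair_norm l (frechet_derivative (F a) (at x) \<xi>, frechet_derivative (F a) (at y) \<eta>) \<le> C3 a * pair_norm l (\<xi>, \<eta>)"
      using C3[THEN spec, of a] l by blast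
    also have "\<dots> \<le> B * pair_norm l (\<xi>, \<eta>)"
      by (intro mult_right_mono le pair_norm_ge0 l)
    finally show "pair_norm l (frechet_derivative (F a) (at x) \<xi>, frechet_derivative (F a) (at y) \<eta>) \<le> B * pair_norm l (\<xi>, \<eta>)" .
  next
    fix l :: real and x y x' y' :: "real^'e" and a b
    assume l: "0 < l" "l \<le> l1" "norm (x - y) \<le> l" "norm (x' - y') \<le> l"
    have "pair_norm l ((lie F a b x', lie F a b y') - (lie F a b x, lie F a b y)) \<le> C2 (a, b) * pair_norm l ((x', y') - (x, y))"
      using C2[THEN spec, of "(a, b)"] l unfolding fst_conv snd_conv by blast
    also have "\<dots> \<le> B * pair_norm l ((x', y') - (x, y))"
      by (intro mult_right_mono le pair_norm_ge0 l)
    finally show "pair_norm l ((lie F a b x', lie F a b y') - (lie F a b x, lie F a b y)) \<le> B * pair_norm l ((x', y') - (x, y))" .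
    have "pair_norm l ((F a x', F a y') - (F a x, F a y)
       - (frechet_derivative (F a) (at x) (x' - x), frechet_derivative (F a) (at y) (y' - y)))
       \<le> C3 a * (pair_norm l ((x', y') - (x, y)))\<^sup>2"
      using C3[THEN spec, of a] l by blast
    also have "\<dots> \<le> B * (pair_norm l ((x', y') - (x, y)))\<^sup>2"
      by (intro mult_right_mono le) simp
    finally show "pair_norm l ((F a x', F a y') - (F a x, F a y)
       - (frechet_derivative (F a) (at x) (x' - x), frechet_derivative (F a) (at y) (y' - y)))
       \<le> B * (pair_norm l ((x', y') - (x, y)))\<^sup>2" .
  qed
  ultimately show ?thesis by blast
qed

text \<open>The pair of sequences moves by at most \<open>c2\<close> times \<delta>^\<alpha> in the
  pair norm, and \<delta> is chosen to make this at most 1/2. All constants are free of the scale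
  \<open>l\<close> and of the partition, hence so is \<delta>.\<close>

lemma block_stability:
  assumes \<rho>: "1 < real (p + 1) * \<alpha>" and Ce: "0 \<le> Ce"
  shows "\<exists>\<delta>>0. stable_blocks F p Ce l1 \<delta>"
proof -
  let ?\<kappa> = "real (p + 1) * \<alpha> - 1"
  obtain B1 where B1: "0 \<le> B1" "field_bound F l1 B1" using field_bound_exists by blast
  obtain Cs where Cs': "0 \<le> Cs \<and> (\<forall>u v x y. 0 \<le> u \<and> u < v \<and> v \<le> T \<longrightarrow>
     norm (series F p u v x - davie F u v x) \<le> Cs * w u v ^ 3 \<and>
     norm ((series F p u v x - davie F u v x) - (series F p u v y - davie F u v y)) \<le> Cs * w u v ^ 3 * norm (x - y))"
    using series_davie[OF p F] ..
  have Cs: "Cs \<ge> 0"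
    "\<And>u v x. 0 \<le> u \<Longrightarrow> u < v \<Longrightarrow> v \<le> T \<Longrightarrow> norm (series F p u v x - davie F u v x) \<le> Cs * w u v ^ 3"
    "\<And>u v x y. 0 \<le> u \<Longrightarrow> u < v \<Longrightarrow> v \<le> T \<Longrightarrow>
     norm ((series F p u v x - davie F u v x) - (series F p u v y - davie F u v y)) \<le> Cs * w u v ^ 3 * norm (x - y)"
    using Cs' by simp_all
  define T1 where "T1 = T powr (3 * \<alpha> - 1)"
  define T2 where "T2 = T powr ?\<kappa>"
  \<comment> \<open>Per unit of step length, \<open>Ce * T2 + Cs * T1\<close> bounds the deviation
    of one sequence from the germ, and \<open>2 * Ce + Cs * T1\<close> the difference of the two
    deviations divided by \<open>l\<close>.\<close>
  define B2 where "B2 = Ce * T2 + 2 * (Cs * T1) + 2 * Ce"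
  define B where "B = B1 + M0 + cD * M0 ^ 3 + defect_const * (M0 + M0) + B2"
  have pos: "0 \<le> cD * M0 ^ 3" "0 \<le> defect_const * (M0 + M0)" "0 \<le> B2"
    using cD M0 defect_const Ce Cs(1) by (auto simp: B2_def T1_def T2_def)
  have BB: "B1 \<le> B" "M0 \<le> B" "cD * M0 ^ 3 \<le> B" "defect_const * (M0 + M0) \<le> B" "B2 \<le> B" "0 \<le> B"
    using pos B1(1) M0 by (auto simp: B_def)
  define m where "m = real CARD('m)"
  define c1 where "c1 = 1 + B + m\<^sup>2 * B\<^sup>2"
  define c2 where "c2 = c1 + m * B\<^sup>2"
  define M where "M = m * B\<^sup>2 * c2\<^sup>2 + m * B\<^sup>2 * c1 + m\<^sup>2 * B\<^sup>2 * c2 + m\<^sup>2 * B\<^sup>2"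
  have c: "0 \<le> c2" "0 \<le> M"
    using BB by (auto simp: c1_def c2_def M_def m_def intro!: add_nonneg_nonneg mult_nonneg_nonneg)
  have K: "0 \<le> sew_const (3 * \<alpha>) * M + 2 * c2" using c sew_const(1)[OF \<theta>] by simp
  \<comment> \<open>A single choice meets both demands: the smallness required by the a priori
    bound, and \<open>c2\<close> times \<delta>^\<alpha> at most 1/2.\<close>
  obtain \<delta>0 where \<delta>0: "0 < \<delta>0" "(sew_const (3 * \<alpha>) * M + 2 * c2) * \<delta>0 powr \<alpha> < 1"
    using small_powr[of 1 \<alpha>, OF _ _ K] \<alpha> by auto
  define \<delta> where "\<delta> = min 1 \<delta>0"
  have \<delta>: "0 < \<delta>" "\<delta> \<le> 1" using \<delta>0 by (auto simp: \<delta>_def)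
  have "(sew_const (3 * \<alpha>) * M + 2 * c2) * \<delta> powr \<alpha> \<le> (sew_const (3 * \<alpha>) * M + 2 * c2) * \<delta>0 powr \<alpha>"
    using \<alpha> \<delta> K by (intro mult_left_mono powr_mono2) (auto simp: \<delta>_def)
  then have "sew_const (3 * \<alpha>) * M * \<delta> powr \<alpha> + 2 * c2 * \<delta> powr \<alpha> \<le> 1" using \<delta>0 by (simp add: distrib_right)
  moreover have "0 \<le> sew_const (3 * \<alpha>) * M * \<delta> powr \<alpha>" "0 \<le> 2 * c2 * \<delta> powr \<alpha>"
    using c sew_const(1)[OF \<theta>] by simp_all
  ultimately have \<delta>2: "sew_const (3 * \<alpha>) * M * \<delta> powr \<alpha> \<le> 1" "c2 * \<delta> powr \<alpha> \<le> 1 / 2" by linarith+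
  have "stable_blocks F p Ce l1 \<delta>"
    unfolding stable_blocks_def
  proof (intro allI impI)
    fix k0 l0 i :: nat and t :: "nat \<Rightarrow> real" and x y :: "nat \<Rightarrow> real^'e" and H l :: real
    assume kl: "k0 \<le> l0"
      and t': "\<forall>n. k0 \<le> n \<longrightarrow> n < l0 \<longrightarrow> t n < t (Suc n) \<and> t (Suc n) - t n \<le> H"
      and t0: "0 \<le> t k0" and tT: "t l0 \<le> T" and tl: "t l0 - t k0 \<le> \<delta>"
      and xy': "\<forall>n. k0 \<le> n \<longrightarrow> n < l0 \<longrightarrow>
          norm (x (Suc n) - x n - series F p (t n) (t (Suc n)) (x n)) \<le> Ce * w (t n) (t (Suc n)) ^ (p + 1) \<and>
          norm (y (Suc n) - y n - series F p (t n) (t (Suc n)) (y n)) \<le> Ce * w (t n) (t (Suc n)) ^ (p + 1)"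
      and e': "\<forall>n. n \<in> {k0..l0} \<longrightarrow> norm (x n - y n) \<le> l" and l: "0 < l" "l \<le> l1"
      and Hl: "H powr ?\<kappa> \<le> l" and i: "i \<in> {k0..l0}"
    note t = t'[rule_format] and xy = xy'[rule_format] and e = e'[rule_format]
    have mono: "t i \<le> t j" if "k0 \<le> i" "i \<le> j" "j \<le> l0" for i j
      using that(2,1,3)
    proof (induction j rule: dec_induct)
      case (step n)
      then show ?case using t[of n] by simp
    qed simp
    have rng: "0 \<le> t j" "t j \<le> T" if "k0 \<le> j" "j \<le> l0" for j
      using mono[of k0 j] mono[of j l0] that t0 tT by auto
    have one_step: "pair_norm l ((x (Suc n), y (Suc n)) - (x n, y n) - (davie F (t n) (t (Suc n)) (x n), davie F (t n) (t (Suc n)) (y n)))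
        \<le> B * (t (Suc n) - t n)" if n: "k0 \<le> n" "n < l0" for n
    proof -
      let ?u = "t n" and ?v = "t (Suc n)"
      let ?h = "?v - ?u" and ?w = "w ?u ?v"
      have uv: "0 \<le> ?u" "?u < ?v" "?v \<le> T" using n t[of n] rng by auto
      have h: "0 < ?h" "?h \<le> T" "?h \<le> H" using uv t[OF n] by auto
      have w3: "?w ^ 3 \<le> ?h * T1"
      proof -
        have "?w ^ 3 = ?h powr (1 + (3 * \<alpha> - 1))" by (simp flip: w_cube)
        also have "\<dots> = ?h * ?h powr (3 * \<alpha> - 1)" unfolding powr_add using h by simp
        also have "\<dots> \<le> ?h * T1" unfolding T1_def using h \<alpha> by (intro mult_left_mono powr_mono2) auto
        finally show ?thesis .
      qed
      have wp: "?w ^ (p + 1) = ?h * ?h powr ?\<kappa>"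
      proof -
        have "?w ^ (p + 1) = ?h powr (1 + ?\<kappa>)" using powr_power[of ?h \<alpha> "p + 1"] h by simp
        also have "\<dots> = ?h * ?h powr ?\<kappa>" unfolding powr_add using h by simp
        finally show ?thesis .
      qed
      have "?h powr ?\<kappa> \<le> T2" unfolding T2_def using h \<rho> by (intro powr_mono2) auto
      then have wp1: "?w ^ (p + 1) \<le> ?h * T2" unfolding wp using h by (intro mult_left_mono) auto
      have "?h powr ?\<kappa> \<le> H powr ?\<kappa>" using h \<rho> by (intro powr_mono2) auto
      \<comment> \<open>The condition that \<open>l\<close> is at least the target accuracy is used
        here: the local error is at most the step length times \<open>l\<close>, so it stays bounded
        per unit of step length after division by \<open>l\<close>.\<close>
      then have wp2: "?w ^ (p + 1) \<le> ?h * l" unfolding wp using h Hl by (intro mult_left_mono) auto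
      let ?ex = "x (Suc n) - x n - series F p ?u ?v (x n)" and ?ey = "y (Suc n) - y n - series F p ?u ?v (y n)"
      let ?rx = "series F p ?u ?v (x n) - davie F ?u ?v (x n)" and ?ry = "series F p ?u ?v (y n) - davie F ?u ?v (y n)"
      have "norm (?ex + ?rx) \<le> Ce * (?h * T2) + Cs * (?h * T1)"
      proof (intro order_trans[OF norm_triangle_ineq] add_mono)
        show "norm ?ex \<le> Ce * (?h * T2)"
          using xy[OF n] mult_left_mono[OF wp1 Ce] by linarith
        show "norm ?rx \<le> Cs * (?h * T1)"
          using Cs(2)[OF uv] mult_left_mono[OF w3 Cs(1)] by (rule order_trans)
      qed
      moreover have "norm ((?ex + ?rx) - (?ey + ?ry)) \<le> l * (2 * Ce * ?h + Cs * (?h * T1))"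
      proof -
        have eq: "(?ex + ?rx) - (?ey + ?ry) = (?ex - ?ey) + (?rx - ?ry)" by (simp only: add_diff_add)
        have "norm ((?ex - ?ey) + (?rx - ?ry)) \<le> (Ce * (?h * l) + Ce * (?h * l)) + Cs * (?h * T1) * l"
        proof (intro order_trans[OF norm_triangle_ineq] add_mono)
          show "norm (?ex - ?ey) \<le> Ce * (?h * l) + Ce * (?h * l)"
            using xy[OF n] mult_left_mono[OF wp2 Ce] norm_triangle_ineq4[of ?ex ?ey] by linarith
          have "norm (?rx - ?ry) \<le> Cs * ?w ^ 3 * norm (x n - y n)" by (rule Cs(3)[OF uv])
          moreover have "Cs * ?w ^ 3 * norm (x n - y n) \<le> Cs * (?h * T1) * l"
            using Cs(1) w3 e[of n] n h by (intro mult_mono mult_left_mono) (auto simp: T1_def)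
          ultimately show "norm (?rx - ?ry) \<le> Cs * (?h * T1) * l" by (rule order_trans)
        qed
        then have "norm ((?ex + ?rx) - (?ey + ?ry)) \<le> (Ce * (?h * l) + Ce * (?h * l)) + Cs * (?h * T1) * l"
          by (simp only: eq)
        also have "\<dots> = l * (2 * Ce * ?h + Cs * (?h * T1))" by (simp add: algebra_simps)
        finally show ?thesis .
      qed
      ultimately have "pair_norm l (?ex + ?rx, ?ey + ?ry) \<le> (Ce * (?h * T2) + Cs * (?h * T1)) + (2 * Ce * ?h + Cs * (?h * T1))"
        by (rule pair_norm_le[OF l(1)])
      also have "\<dots> = B2 * ?h" by (simp add: B2_def algebra_simps)
      also have "\<dots> \<le> B * ?h" using h BB by (intro mult_right_mono) auto
      finally have le: "pair_norm l (?ex + ?rx, ?ey + ?ry) \<le> B * ?h" .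
      have "?ex + ?rx = x (Suc n) - x n - davie F ?u ?v (x n)" "?ey + ?ry = y (Suc n) - y n - davie F ?u ?v (y n)"
        by simp_all
      with le show ?thesis by (simp only: diff_Pair)
    qed
    let ?P = "\<lambda>n. (x n, y n)"
    let ?f = "\<lambda>a q. (F a (fst q), F a (snd q))" and ?V = "\<lambda>a b q. (lie F a b (fst q), lie F a b (snd q))"
    let ?L = "\<lambda>a q r. (frechet_derivative (F a) (at (fst q)) (fst r), frechet_derivative (F a) (at (snd q)) (snd r))"
    let ?z = "\<lambda>a k l. Z (t l) $ a - Z (t k) $ a" and ?zz = "\<lambda>b a k l. ZZ b a (t k) (t l)"
    have gd: "(\<Sum>a\<in>UNIV. ?z a k l *\<^sub>R ?f a q) + (\<Sum>a\<in>UNIV. \<Sum>b\<in>UNIV. ?zz b a k l *\<^sub>R ?V a b q)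
        = (davie F (t k) (t l) (fst q), davie F (t k) (t l) (snd q))" for k l q
      by (simp add: davie_def sum_pair)
    have apr: "pair_norm l (?P i - ?P k0) \<le> c2 * (t i - t k0) powr \<alpha>"
      unfolding c2_def c1_def m_def
    proof (rule discrete_apriori[where nrm = "pair_norm l" and P = ?P and f = ?f and V = ?V and L = ?L and z = ?z
          and zz = ?zz and B = B and \<delta> = \<delta> and ?k0.0 = k0 and ?l0.0 = l0])
      show "pair_norm l (q + r) \<le> pair_norm l q + pair_norm l r" for q r
        by (rule pair_norm_triangle[OF l(1)])
      show "pair_norm l (c *\<^sub>R q) = \<bar>c\<bar> * pair_norm l q" for c q
        by (rule pair_norm_scaleR)
      show "0 \<le> pair_norm l q" for q by (rule pair_norm_ge0[OF l(1)])
      show "pair_norm l (?f a (?P k)) \<le> B" if "k \<in> {k0..l0}" for a k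
        using order_trans[OF field_boundD(1)[OF B1(2) l e[OF that]] BB(1)] by simp
      show "pair_norm l (?V a b (?P k)) \<le> B" if "k \<in> {k0..l0}" for a b k
        using order_trans[OF field_boundD(2)[OF B1(2) l e[OF that]] BB(1)] by simp
      show "pair_norm l (?f a (?P j) - ?f a (?P k) - ?L a (?P k) (?P j - ?P k)) \<le> B * (pair_norm l (?P j - ?P k))\<^sup>2"
        if "k \<in> {k0..l0}" "j \<in> {k0..l0}" for a j k
      proof -
        have "pair_norm l (?f a (?P j) - ?f a (?P k) - ?L a (?P k) (?P j - ?P k)) \<le> B1 * (pair_norm l (?P j - ?P k))\<^sup>2"
          using field_boundD(5)[OF B1(2) l e[OF that(1)] e[OF that(2)], of a] by simp
        also have "\<dots> \<le> B * (pair_norm l (?P j - ?P k))\<^sup>2" by (intro mult_right_mono BB) simp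
        finally show ?thesis .
      qed
      show "pair_norm l (?V a b (?P j) - ?V a b (?P k)) \<le> B * pair_norm l (?P j - ?P k)"
        if "k \<in> {k0..l0}" "j \<in> {k0..l0}" for a b j k
      proof -
        have "pair_norm l (?V a b (?P j) - ?V a b (?P k)) \<le> B1 * pair_norm l (?P j - ?P k)"
          using field_boundD(4)[OF B1(2) l e[OF that(1)] e[OF that(2)], of a b] by simp
        also have "\<dots> \<le> B * pair_norm l (?P j - ?P k)" by (intro mult_right_mono BB pair_norm_ge0 l)
        finally show ?thesis .
      qed
      show "pair_norm l (?L a (?P k) q) \<le> B * pair_norm l q" if "k \<in> {k0..l0}" for a k q
      proof -
        have "pair_norm l (?L a (?P k) q) \<le> B1 * pair_norm l q"
          using field_boundD(3)[OF B1(2) l e[OF that(1)], of a "fst q" "snd q"] by simp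
        also have "\<dots> \<le> B * pair_norm l q" by (intro mult_right_mono BB pair_norm_ge0 l)
        finally show ?thesis .
      qed
      show "linear (?L a (?P k))" for a k
      proof -
        have F1: "Cb (Suc p) (F a)" using F[of a] by (simp only: Suc_eq_plus1)
        have lin: "linear (frechet_derivative (F a) (at z))" for z
          by (rule has_derivative_linear[OF Cb_has_derivative[OF F1]])
        show ?thesis by (rule linearI) (simp_all add: linear_add[OF lin] linear_scale[OF lin])
      qed
      show "?L a (?P k) (?f b (?P k)) = ?V a b (?P k)" for a b k by (simp add: lie_def)
      show "\<bar>?z a k j\<bar> \<le> B * (t j - t k) powr \<alpha>" if "k0 \<le> k" "k \<le> j" "j \<le> l0" for a k j
        by (rule order_trans[OF Z_comp(1)])
          (use that rng mono BB in \<open>auto intro!: mult_right_mono\<close>)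
      show "\<bar>?zz b a k j\<bar> \<le> B * ((t j - t k) powr \<alpha>)\<^sup>2" if "k0 \<le> k" "k \<le> j" "j \<le> l0" for a b k j
        by (rule order_trans[OF ZZ_bound])
          (use that rng mono BB in \<open>auto intro!: mult_right_mono\<close>)
      show "\<bar>?zz b a k n - ?zz b a k j - ?zz b a j n - ?z b k j * ?z a j n\<bar> \<le> B * ((t n - t k) powr \<alpha>) ^ 3"
        if "k0 \<le> k" "k \<le> j" "j \<le> n" "n \<le> l0" for a b k j n
        by (rule order_trans[OF ZZ_chen])
          (use that rng mono BB in \<open>auto intro!: mult_right_mono\<close>)
      show "pair_norm l (?P (Suc n) - ?P n - ((\<Sum>a\<in>UNIV. ?z a n (Suc n) *\<^sub>R ?f a (?P n))
          + (\<Sum>a\<in>UNIV. \<Sum>b\<in>UNIV. ?zz b a n (Suc n) *\<^sub>R ?V a b (?P n)))) \<le> B * (t (Suc n) - t n)"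
        if "k0 \<le> n" "n < l0" for n
        using one_step[OF that] by (simp only: gd fst_conv snd_conv gd[of _ _ "(x n, y n)", unfolded fst_conv snd_conv])
    qed (use \<alpha> BB t tl \<delta> \<delta>2 i in \<open>auto simp: M_def c1_def c2_def m_def\<close>)
    have "(t i - t k0) powr \<alpha> \<le> \<delta> powr \<alpha>"
      using i mono[of k0 i] mono[of i l0] tl \<alpha> by (intro powr_mono2) auto
    then have "c2 * (t i - t k0) powr \<alpha> \<le> c2 * \<delta> powr \<alpha>" using c by (intro mult_left_mono) auto
    with apr \<delta>2 have "pair_norm l (x i - x k0, y i - y k0) \<le> 1 / 2" by simp
    then have "l * pair_norm l (x i - x k0, y i - y k0) \<le> l * (1 / 2)" using l by (intro mult_left_mono) auto
    with pair_norm_parts(2)[OF l(1), of "x i - x k0" "y i - y k0"]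
    show "norm ((x i - y i) - (x k0 - y k0)) \<le> l / 2" by (simp add: algebra_simps)
  qed
  with \<delta>(1) show ?thesis by blast
qed

text \<open>Time is cut into windows of length \<delta>/2, and the error up to the j-th one is at
  most 2^j times the target accuracy. Grid blocks reach back to the last point of the earlier
  windows and so have length at most \<delta>, provided that the mesh is below \<delta>/2.\<close>

lemma global_stability:
  assumes \<rho>: "1 < real (p + 1) * \<alpha>" and Ce: "0 \<le> Ce" and Rb: "0 \<le> Rb"
  shows "\<exists>C>0. \<forall>N t x y H. is_partition 0 T N t \<and> (\<forall>n<N. t (Suc n) - t n \<le> H) \<and> 0 < H \<and> x 0 = y 0 \<and>
     (\<forall>n\<le>N. norm (x n) \<le> Rb \<and> norm (y n) \<le> Rb) \<and>
     (\<forall>n<N. norm (x (Suc n) - x n - series F p (t n) (t (Suc n)) (x n)) \<le> Ce * w (t n) (t (Suc n)) ^ (p + 1) \<and>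
            norm (y (Suc n) - y n - series F p (t n) (t (Suc n)) (y n)) \<le> Ce * w (t n) (t (Suc n)) ^ (p + 1)) \<longrightarrow>
     (\<forall>n\<le>N. norm (x n - y n) \<le> C * H powr (real (p + 1) * \<alpha> - 1))"
proof -
  let ?\<kappa> = "real (p + 1) * \<alpha> - 1"
  obtain \<delta> where \<delta>: "0 < \<delta>" and blocks: "stable_blocks F p Ce (2 * Rb) \<delta>"
    using block_stability[OF \<rho> Ce] by blast
  note block = blocks[unfolded stable_blocks_def, rule_format]
  obtain J :: nat where J: "T / (\<delta> / 2) \<le> real J" using real_arch_simple by blast
  \<comment> \<open>The power of 2 counts the doublings over [0, T]; the second summand serves
    meshes of at least \<delta>/2, for which the a priori bound on both sequences suffices.\<close>
  define C where "C = 2 ^ J + 2 * Rb / (\<delta> / 2) powr ?\<kappa>"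
  have C0: "0 \<le> 2 * Rb / (\<delta> / 2) powr ?\<kappa>" using Rb by simp
  show ?thesis
  proof (intro exI[of _ C] conjI allI impI)
    show "0 < C" unfolding C_def by (intro add_pos_nonneg C0) simp
    fix N t x y H n
    assume asm: "is_partition 0 T N t \<and> (\<forall>n<N. t (Suc n) - t n \<le> H) \<and> 0 < H \<and> x 0 = y 0 \<and>
     (\<forall>n\<le>N. norm (x n) \<le> Rb \<and> norm (y n) \<le> Rb) \<and>
     (\<forall>n<N. norm (x (Suc n) - x n - series F p (t n) (t (Suc n)) (x n)) \<le> Ce * w (t n) (t (Suc n)) ^ (p + 1) \<and>
            norm (y (Suc n) - y n - series F p (t n) (t (Suc n)) (y n)) \<le> Ce * w (t n) (t (Suc n)) ^ (p + 1))"
      and nN: "n \<le> N"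
    have P: "is_partition 0 T N t" and H: "\<And>n. n < N \<Longrightarrow> t (Suc n) - t n \<le> H" "0 < H" and xy0: "x 0 = y 0"
      and R: "\<And>n. n \<le> N \<Longrightarrow> norm (x n) \<le> Rb \<and> norm (y n) \<le> Rb"
      and st: "\<And>n. n < N \<Longrightarrow> norm (x (Suc n) - x n - series F p (t n) (t (Suc n)) (x n)) \<le> Ce * w (t n) (t (Suc n)) ^ (p + 1) \<and>
            norm (y (Suc n) - y n - series F p (t n) (t (Suc n)) (y n)) \<le> Ce * w (t n) (t (Suc n)) ^ (p + 1)"
      using asm by auto
    have e2: "norm (x n - y n) \<le> 2 * Rb" if "n \<le> N" for n
      using R[OF that] norm_triangle_ineq4[of "x n" "y n"] by linarith
    let ?\<eta> = "H powr ?\<kappa>"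
    have \<eta>: "0 < ?\<eta>" using H by simp
    show "norm (x n - y n) \<le> C * ?\<eta>"
    proof (cases "\<delta> / 2 \<le> H")
      case True
      then have "(\<delta> / 2) powr ?\<kappa> \<le> ?\<eta>" using \<delta> \<rho> by (intro powr_mono2) auto
      then have "2 * Rb * (\<delta> / 2) powr ?\<kappa> \<le> 2 * Rb * ?\<eta>" using Rb by (intro mult_left_mono) auto
      then have "2 * Rb \<le> 2 * Rb / (\<delta> / 2) powr ?\<kappa> * ?\<eta>" using \<delta> by (simp add: pos_le_divide_eq)
      also have "\<dots> \<le> C * ?\<eta>" using \<eta> by (intro mult_right_mono) (auto simp: C_def)
      finally show ?thesis using e2[OF nN] by linarith
    next
      case False
      then have H2: "H < \<delta> / 2" by simp
      have claim: "norm (x n - y n) \<le> 2 ^ j * ?\<eta>" if "n \<le> N" "t n \<le> real j * (\<delta> / 2)" for n j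
        using that
      proof (induction j arbitrary: n)
        case 0
        have "n = 0"
        proof (rule ccontr)
          assume "n \<noteq> 0"
          then have "t 0 < t (Suc 0)" "t (Suc 0) \<le> t n"
            using P 0 is_partition_mono[OF P, of "Suc 0" n] by (auto simp: is_partition_def)
          then show False using 0 P by (simp add: is_partition_def)
        qed
        then show ?case using xy0 by simp
      next
        case (Suc j)
        let ?c = "real j * (\<delta> / 2)"
        \<comment> \<open>The block starts at the last grid point not beyond the earlier windows,
          where the induction hypothesis applies. The next grid point is already beyond them, so
          this one lies less than \<delta>/2 before their end.\<close>
        define k where "k = Max {i. i \<le> n \<and> t i \<le> ?c}"
        have fin: "finite {i. i \<le> n \<and> t i \<le> ?c}" by simp
        have "0 \<in> {i. i \<le> n \<and> t i \<le> ?c}" using P \<delta> by (simp add: is_partition_def)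
        then have "k \<in> {i. i \<le> n \<and> t i \<le> ?c}" unfolding k_def by (intro Max_in fin) auto
        then have k: "k \<le> n" "t k \<le> ?c" by auto
        have ek: "norm (x k - y k) \<le> 2 ^ j * ?\<eta>" using k Suc.prems by (intro Suc.IH) auto
        have pj: "2 ^ j * ?\<eta> \<le> 2 ^ Suc j * ?\<eta>" using \<eta> by (intro mult_right_mono) auto
        show ?case
        proof (cases "k = n")
          case True
          with order_trans[OF ek pj] show ?thesis by (simp only:)
        next
          case False
          with k have kn: "k < n" by simp
          have "\<not> t (Suc k) \<le> ?c"
          proof
            assume "t (Suc k) \<le> ?c"
            then have "Suc k \<le> k" unfolding k_def[symmetric] using kn
              by (subst k_def) (intro Max_ge fin, auto)
            then show False by simp
          qed
          then have tk: "?c - \<delta> / 2 < t k" using H(1)[of k] kn Suc.prems H2 by linarith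
          have tn: "t n - t k \<le> \<delta>"
          proof -
            have "t n \<le> ?c + \<delta> / 2" using Suc.prems(2) by (simp add: distrib_right add_divide_distrib)
            then show ?thesis using tk by (simp add: field_simps)
          qed
          define l where "l = Max ((\<lambda>i. norm (x i - y i)) ` {k..n})"
          have li: "norm (x i - y i) \<le> l" if "i \<in> {k..n}" for i
            unfolding l_def using that by (intro Max_ge) auto
          have "l \<in> (\<lambda>i. norm (x i - y i)) ` {k..n}" unfolding l_def using kn by (intro Max_in) auto
          then obtain i where i: "i \<in> {k..n}" "l = norm (x i - y i)" by auto
          have "l \<le> 2 ^ Suc j * ?\<eta>"
          \<comment> \<open>Either the maximum on the block is below the target accuracy, or the
            block estimate applies at the scale \<open>l\<close>; it gives l \<le> |x_k - y_k| +
            l/2, hence at most a doubling.\<close>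
          proof (cases "l \<le> ?\<eta>")
            case True
            moreover have "1 * ?\<eta> \<le> 2 ^ Suc j * ?\<eta>" using \<eta> by (intro mult_right_mono one_le_power) auto
            ultimately show ?thesis by simp
          next
            case False
            have "norm ((x i - y i) - (x k - y k)) \<le> l / 2"
            proof (rule block[where ?l0.0 = n and t = t and H = H])
              show "t m < t (Suc m) \<and> t (Suc m) - t m \<le> H" if "k \<le> m" "m < n" for m
                using that Suc.prems P H(1)[of m] by (auto simp: is_partition_def)
              show "0 \<le> t k" "t n \<le> T"
                using is_partition_range[OF P, of k] is_partition_range[OF P, of n] kn Suc.prems by auto
              show "l \<le> 2 * Rb" using i e2[of i] Suc.prems by auto
              show "norm (x (Suc m) - x m - series F p (t m) (t (Suc m)) (x m)) \<le> Ce * w (t m) (t (Suc m)) ^ (p + 1) \<and>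
                norm (y (Suc m) - y m - series F p (t m) (t (Suc m)) (y m)) \<le> Ce * w (t m) (t (Suc m)) ^ (p + 1)"
                if "k \<le> m" "m < n" for m
                using that Suc.prems by (intro st) auto
            qed (use kn tn li i False \<eta> in auto)
            then have "l \<le> norm (x k - y k) + l / 2"
              using norm_triangle_ineq2[of "x i - y i" "x k - y k"] i(2) by linarith
            with ek show ?thesis by simp
          qed
          with li[of n] kn show ?thesis by auto
        qed
      qed
      have "t n \<le> T" using is_partition_range[OF P nN] by simp
      also have "T \<le> real J * (\<delta> / 2)" using J \<delta> by (simp add: field_simps)
      finally have "norm (x n - y n) \<le> 2 ^ J * ?\<eta>" by (rule claim[OF nN])
      also have "\<dots> \<le> C * ?\<eta>" using \<eta> C0 by (intro mult_right_mono) (auto simp: C_def)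
      finally show ?thesis .
    qed
  qed
qed

end

end

section \<open>Constants of the data and the conclusion\<close>

lemma holder_on_bound:
  assumes "holder_on \<alpha> a b f"
  shows "\<exists>C\<ge>0. \<forall>s t. a \<le> s \<and> s \<le> t \<and> t \<le> b \<longrightarrow> norm (f t - f s) \<le> C * (t - s) powr \<alpha>"
proof -
  obtain C where C: "\<And>s t. s \<in> {a..b} \<Longrightarrow> t \<in> {a..b} \<Longrightarrow> norm (f t - f s) \<le> C * \<bar>t - s\<bar> powr \<alpha>"
    using assms unfolding holder_on_def by blast
  have "norm (f t - f s) \<le> max C 0 * (t - s) powr \<alpha>" if "a \<le> s" "s \<le> t" "t \<le> b" for s t
  proof -
    have "norm (f t - f s) \<le> C * (t - s) powr \<alpha>" using C[of s t] that by simp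
    also have "\<dots> \<le> max C 0 * (t - s) powr \<alpha>" by (intro mult_right_mono) auto
    finally show ?thesis .
  qed
  then show ?thesis by (intro exI[of _ "max C 0"]) auto
qed

lemma powr_two_bound:
  assumes "\<exists>C. \<forall>s t. a \<le> s \<and> s < t \<and> t \<le> b \<longrightarrow> norm (g s t) \<le> C * \<bar>t - s\<bar> powr (2 * \<alpha>)"
    and "\<And>s. a \<le> s \<Longrightarrow> s \<le> b \<Longrightarrow> g s s = 0"
  shows "\<exists>C\<ge>0. \<forall>s t. a \<le> s \<and> s \<le> t \<and> t \<le> b \<longrightarrow> norm (g s t) \<le> C * ((t - s) powr \<alpha>)\<^sup>2"
proof -
  obtain C where C: "\<And>s t. a \<le> s \<Longrightarrow> s < t \<Longrightarrow> t \<le> b \<Longrightarrow> norm (g s t) \<le> C * \<bar>t - s\<bar> powr (2 * \<alpha>)"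
    using assms(1) by blast
  have "norm (g s t) \<le> max C 0 * ((t - s) powr \<alpha>)\<^sup>2" if "a \<le> s" "s \<le> t" "t \<le> b" for s t
  proof (cases "s = t")
    case True
    then show ?thesis using assms(2)[of s] that by simp
  next
    case False
    then have "norm (g s t) \<le> C * ((t - s) powr \<alpha>)\<^sup>2"
      using C[of s t] that by (simp add: power2_eq_square powr_add[symmetric])
    also have "\<dots> \<le> max C 0 * ((t - s) powr \<alpha>)\<^sup>2" by (intro mult_right_mono) auto
    finally show ?thesis .
  qed
  then show ?thesis by (intro exI[of _ "max C 0"]) auto
qed

lemma controlled_bounds:
  assumes "controlled \<alpha> X 0 T Y Y'" "0 \<le> \<alpha>"
  shows "\<exists>M\<ge>0. \<forall>s t. 0 \<le> s \<and> s \<le> t \<and> t \<le> T \<longrightarrow>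
     norm (Y t - Y s) \<le> M * (t - s) powr \<alpha> \<and> norm (Y t) \<le> M \<and> norm (Y' t) \<le> M \<and>
     norm (Y' t - Y' s) \<le> M * (t - s) powr \<alpha> \<and>
     norm (Y t - Y s - Y' s (X t - X s)) \<le> M * ((t - s) powr \<alpha>)\<^sup>2"
proof -
  have hY: "holder_on \<alpha> 0 T Y" "holder_on \<alpha> 0 T Y'" using assms(1) by (auto simp: controlled_def)
  obtain C1 where C1: "0 \<le> C1" "\<And>s t. 0 \<le> s \<Longrightarrow> s \<le> t \<Longrightarrow> t \<le> T \<Longrightarrow> norm (Y t - Y s) \<le> C1 * (t - s) powr \<alpha>"
    using holder_on_bound[OF hY(1)] by blast
  obtain C2 where C2: "0 \<le> C2" "\<And>s t. 0 \<le> s \<Longrightarrow> s \<le> t \<Longrightarrow> t \<le> T \<Longrightarrow> norm (Y' t - Y' s) \<le> C2 * (t - s) powr \<alpha>"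
    using holder_on_bound[OF hY(2)] by blast
  obtain C3 where C3: "0 \<le> C3" "\<And>s t. 0 \<le> s \<Longrightarrow> s \<le> t \<Longrightarrow> t \<le> T \<Longrightarrow>
      norm (Y t - Y s - Y' s (X t - X s)) \<le> C3 * ((t - s) powr \<alpha>)\<^sup>2"
    using powr_two_bound[where g = "\<lambda>s t. Y t - Y s - Y' s (X t - X s)" and a = 0 and b = T and \<alpha> = \<alpha>] assms(1)
    unfolding controlled_def by (auto simp: blinfun.bilinear_simps)
  define S1 S2 where "S1 = norm (Y 0) + C1 * T powr \<alpha>" and "S2 = norm (Y' 0) + C2 * T powr \<alpha>"
  define M where "M = C1 + C2 + C3 + S1 + S2"
  have S0: "0 \<le> S1" "0 \<le> S2" using C1 C2 by (auto simp: S1_def S2_def)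
  have le: "C1 \<le> M" "C2 \<le> M" "C3 \<le> M" using C1 C2 C3 S0 by (auto simp: M_def)
  show ?thesis
  proof (intro exI[of _ M] conjI allI impI; (elim conjE)?)
    show "0 \<le> M" using C1 C2 C3 S0 by (simp add: M_def)
    fix s t :: real assume st: "0 \<le> s" "s \<le> t" "t \<le> T"
    then have t: "0 \<le> t" "t \<le> T" by auto
    have tT: "t powr \<alpha> \<le> T powr \<alpha>" using t assms(2) by (intro powr_mono2) auto
    have "norm (Y t) \<le> norm (Y 0) + norm (Y t - Y 0)" using norm_triangle_ineq[of "Y 0" "Y t - Y 0"] by simp
    also have "\<dots> \<le> S1" using C1(2)[of 0 t] t mult_left_mono[OF tT C1(1)] by (simp add: S1_def)
    finally show "norm (Y t) \<le> M" using C1 C2 C3 S0 by (simp add: M_def)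
    have "norm (Y' t) \<le> norm (Y' 0) + norm (Y' t - Y' 0)" using norm_triangle_ineq[of "Y' 0" "Y' t - Y' 0"] by simp
    also have "\<dots> \<le> S2" using C2(2)[of 0 t] t mult_left_mono[OF tT C2(1)] by (simp add: S2_def)
    finally show "norm (Y' t) \<le> M" using C1 C2 C3 S0 by (simp add: M_def)
    show "norm (Y t - Y s) \<le> M * (t - s) powr \<alpha>"
      by (rule order_trans[OF C1(2)[OF st] mult_right_mono[OF le(1)]]) simp
    show "norm (Y' t - Y' s) \<le> M * (t - s) powr \<alpha>"
      by (rule order_trans[OF C2(2)[OF st] mult_right_mono[OF le(2)]]) simp
    show "norm (Y t - Y s - Y' s (X t - X s)) \<le> M * ((t - s) powr \<alpha>)\<^sup>2"
      by (rule order_trans[OF C3(2)[OF st] mult_right_mono[OF le(3)]]) simp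
  qed
qed

lemma rough_driver_exists:
  fixes X :: "real \<Rightarrow> real^'d::finite" and Z :: "real \<Rightarrow> real^'m::finite"
  assumes \<alpha>: "1 / 3 < \<alpha>" "\<alpha> \<le> 1 / 2" and T: "0 < T"
    and X: "rough_path \<alpha> T X XX" and Z: "controlled \<alpha> X 0 T Z Z'"
  shows "\<exists>M0. rough_driver \<alpha> T M0 X XX Z Z'"
proof -
  have chen: "XX s t = XX s u + XX u t + tensor (X u - X s) (X t - X u)"
    if "0 \<le> s" "s \<le> u" "u \<le> t" "t \<le> T" for s u t
    using X that unfolding rough_path_def by blast
  \<comment> \<open>Chen's relation with three equal times extends the bound on the second level to
    the diagonal, which the definition of a rough path leaves out.\<close>
  have XX0: "XX s s = 0" if "0 \<le> s" "s \<le> T" for s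
    using chen[of s s s] that by (simp add: tensor_def vec_eq_iff)
  have hX: "holder_on \<alpha> 0 T X" and XXb: "\<exists>C. \<forall>s t. 0 \<le> s \<and> s < t \<and> t \<le> T \<longrightarrow> norm (XX s t) \<le> C * \<bar>t - s\<bar> powr (2 * \<alpha>)"
    using X by (simp_all add: rough_path_def)
  obtain C1 where C1: "0 \<le> C1" "\<And>s t. 0 \<le> s \<Longrightarrow> s \<le> t \<Longrightarrow> t \<le> T \<Longrightarrow> norm (X t - X s) \<le> C1 * (t - s) powr \<alpha>"
    using holder_on_bound[OF hX] by blast
  obtain C2 where C2: "0 \<le> C2" "\<And>s t. 0 \<le> s \<Longrightarrow> s \<le> t \<Longrightarrow> t \<le> T \<Longrightarrow> norm (XX s t) \<le> C2 * ((t - s) powr \<alpha>)\<^sup>2"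
    using powr_two_bound[where g = XX, OF XXb XX0] by blast
  have \<alpha>0: "0 \<le> \<alpha>" using \<alpha> by simp
  obtain C3 where C3: "0 \<le> C3" and C3': "\<forall>s t. 0 \<le> s \<and> s \<le> t \<and> t \<le> T \<longrightarrow>
     norm (Z t - Z s) \<le> C3 * (t - s) powr \<alpha> \<and> norm (Z t) \<le> C3 \<and> norm (Z' t) \<le> C3 \<and>
     norm (Z' t - Z' s) \<le> C3 * (t - s) powr \<alpha> \<and>
     norm (Z t - Z s - Z' s (X t - X s)) \<le> C3 * ((t - s) powr \<alpha>)\<^sup>2"
    using controlled_bounds[OF Z \<alpha>0] by blast
  define M where "M = 1 + T powr \<alpha> + C1 + C2 + C3"
  have Tp: "0 \<le> T powr \<alpha>" by simp
  have le: "C1 \<le> M" "C2 \<le> M" "C3 \<le> M" "1 \<le> M" "T powr \<alpha> \<le> M"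
    unfolding M_def using C1(1) C2(1) C3 Tp by linarith+
  have "rough_driver \<alpha> T M X XX Z Z'"
  proof
    fix s r t :: real assume st: "0 \<le> s" "s \<le> t" "t \<le> T"
    show "norm (X t - X s) \<le> M * (t - s) powr \<alpha>"
      by (rule order_trans[OF C1(2)[OF st] mult_right_mono[OF le(1)]]) simp
    show "norm (XX s t) \<le> M * ((t - s) powr \<alpha>)\<^sup>2"
      by (rule order_trans[OF C2(2)[OF st] mult_right_mono[OF le(2)]]) simp
    have c: "norm (Z t - Z s) \<le> C3 * (t - s) powr \<alpha>" "norm (Z' t - Z' s) \<le> C3 * (t - s) powr \<alpha>"
      "norm (Z t - Z s - Z' s (X t - X s)) \<le> C3 * ((t - s) powr \<alpha>)\<^sup>2"
      using C3' st by auto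
    show "norm (Z t - Z s) \<le> M * (t - s) powr \<alpha>"
      by (rule order_trans[OF c(1) mult_right_mono[OF le(3)]]) simp
    show "norm (Z' t - Z' s) \<le> M * (t - s) powr \<alpha>"
      by (rule order_trans[OF c(2) mult_right_mono[OF le(3)]]) simp
    show "norm (Z t - Z s - Z' s (X t - X s)) \<le> M * ((t - s) powr \<alpha>)\<^sup>2"
      by (rule order_trans[OF c(3) mult_right_mono[OF le(3)]]) simp
  next
    show "norm (Z' t) \<le> M" if "0 \<le> t" "t \<le> T" for t
    proof -
      have "norm (Z' t) \<le> C3" using C3'[rule_format, of t t] that by simp
      then show ?thesis using le(3) by simp
    qed
  qed (fact \<alpha> T le(4,5) | rule chen; assumption)+
  then show ?thesis by blast
qed

text \<open>Joins the estimates for the single components, each with its own constant, into one for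
  the sum of absolute values, which dominates the Euclidean norm.\<close>

lemma uniform_bound:
  fixes f :: "'i::finite \<Rightarrow> 'b \<Rightarrow> real"
  assumes "\<And>i. \<exists>C\<ge>0. \<forall>x. P x \<longrightarrow> f i x \<le> C * g x" and g: "\<And>x. P x \<Longrightarrow> 0 \<le> g x"
  shows "\<exists>C\<ge>0. \<forall>x. P x \<longrightarrow> (\<Sum>i\<in>UNIV. f i x) \<le> C * g x"
proof -
  obtain C where C: "\<And>i. 0 \<le> C i" "\<And>i x. P x \<Longrightarrow> f i x \<le> C i * g x" using assms(1) by metis
  show ?thesis
    by (rule exI[of _ "\<Sum>i\<in>UNIV. C i"]) (auto simp: sum_distrib_right intro!: sum_nonneg sum_mono C)
qed

theorem theorem6p3:
  fixes \<alpha> T CRK R :: real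
    and p :: nat
    and X :: "real \<Rightarrow> real^'d"
    and XX :: "real \<Rightarrow> real \<Rightarrow> real^'d^'d"
    and Z :: "real \<Rightarrow> real^'m"
    and Z' :: "real \<Rightarrow> (real^'d) \<Rightarrow>\<^sub>L (real^'m)"
    and F :: "'m \<Rightarrow> real^'e \<Rightarrow> real^'e"
    and Y :: "real \<Rightarrow> real^'e"
    and Y' :: "real \<Rightarrow> (real^'d) \<Rightarrow>\<^sub>L (real^'e)"
    and Y0 :: "real^'e"
    and A :: "real \<Rightarrow> real \<Rightarrow> 'm \<Rightarrow> real^'q^'q"
    and \<zeta> :: "real \<Rightarrow> real \<Rightarrow> 'm \<Rightarrow> real^'q"
    and S :: "real \<Rightarrow> real \<Rightarrow> real^'e \<Rightarrow> 'q \<Rightarrow> real^'e"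
  defines "\<rho> \<equiv> real (p + 1) * \<alpha>"
    and "\<phi> \<equiv> rde_flow \<alpha> T X XX Z Z' F"
    and "\<Psi> \<equiv> crk_map \<zeta> F S"
  assumes "1 / 3 < \<alpha>" and "\<alpha> \<le> 1 / 2" and "0 < T" and "1 \<le> p" and "1 < \<rho>"
    and "rough_path \<alpha> T X XX"
    and "controlled \<alpha> X 0 T Z Z'"
    and "\<And>a. Cb (p + 1) (F a)"
    and "rde_solution \<alpha> T X XX Z Z' F 0 Y0 Y Y'"
    and "0 < CRK"
    and "\<And>u v a. 0 \<le> u \<Longrightarrow> u \<le> v \<Longrightarrow> v \<le> T \<Longrightarrow>
           mat_infnorm (A u v a) + infnorm (\<zeta> u v a) \<le> CRK * \<bar>v - u\<bar> powr \<alpha>"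
    and "has_tree_order T XX Z Z' A \<zeta> p"
    and "0 < R"
  shows "\<exists>C>0. \<forall>N t.
           is_partition 0 T N t \<and>
           (\<forall>n<N. \<forall>y. rk_stages (A (t n) (t (Suc n))) F y (S (t n) (t (Suc n)) y)) \<and>
           (\<forall>n<N. one_step_iter \<Psi> t Y0 n \<in> cball 0 R \<and>
                  \<phi> (t n) (t (Suc n)) (one_step_iter \<Psi> t Y0 n) \<in> cball 0 R \<and>
                  \<Psi> (t n) (t (Suc n)) (one_step_iter \<Psi> t Y0 n) \<in> cball 0 R) \<longrightarrow>
           Max ((\<lambda>n. norm (Y (t n) - one_step_iter \<Psi> t Y0 n)) ` {0..N})
             \<le> C * (Max ((\<lambda>n. t (Suc n) - t n) ` {..<N})) powr (\<rho> - 1)"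
proof -
  note asm = assms(4-)
  \<comment> \<open>For p = 1 the condition \<rho> > 1 would read 2\<alpha> > 1, against \<alpha>
    \<le> 1/2.\<close>
  have p: "2 \<le> p"
  proof (rule ccontr)
    assume "\<not> 2 \<le> p"
    with asm(4) have "p = 1" by simp
    then show False using asm(2,5) by (simp add: \<rho>_def)
  qed
  obtain M0 where "rough_driver \<alpha> T M0 X XX Z Z'" using rough_driver_exists[OF asm(1-3,6,7)] by blast
  then interpret rough_driver \<alpha> T M0 X XX Z Z' .
  have \<alpha>0: "0 \<le> \<alpha>" "0 < \<alpha>" using asm(1) by auto
  have Yc: "controlled \<alpha> X 0 T Y Y'" "Y 0 = Y0"
    and Ysol: "\<And>t. 0 \<le> t \<Longrightarrow> t \<le> T \<Longrightarrow>
        has_rough_integral XX (\<lambda>r. vf F (Y r)) (\<lambda>r. vf_deriv F (Y r) o\<^sub>L Y' r) Z Z' 0 t (Y t - Y 0)"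
      "\<And>t. 0 \<le> t \<Longrightarrow> t \<le> T \<Longrightarrow> Y' t = vf F (Y t) o\<^sub>L Z' t"
    using asm(9) unfolding rde_solution_def by auto
  obtain M1 where M1: "0 \<le> M1" and M1': "\<forall>s t. 0 \<le> s \<and> s \<le> t \<and> t \<le> T \<longrightarrow>
     norm (Y t - Y s) \<le> M1 * (t - s) powr \<alpha> \<and> norm (Y t) \<le> M1 \<and> norm (Y' t) \<le> M1 \<and>
     norm (Y' t - Y' s) \<le> M1 * (t - s) powr \<alpha> \<and>
     norm (Y t - Y s - Y' s (X t - X s)) \<le> M1 * ((t - s) powr \<alpha>)\<^sup>2"
    using controlled_bounds[OF Yc(1) \<alpha>0(1)] by blast
  have ps: "series F p u v y $ i = (\<Sum>\<tau> | \<tau> \<in> ptrees p p \<and> snd (plabel \<tau>) = i.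
      elem_diff (tcoef F y) \<tau> * tree_coeff XX Z Z' u v (forget \<tau>))" for u v y i
    by (simp add: series_def)
  have "\<exists>C\<ge>0. \<forall>uv. 0 \<le> fst uv \<and> fst uv < snd uv \<and> snd uv \<le> T \<longrightarrow>
     \<bar>(Y (snd uv) - Y (fst uv) - series F p (fst uv) (snd uv) (Y (fst uv))) $ i\<bar> \<le> C * w (fst uv) (snd uv) ^ (p + 1)" for i
  proof -
    have "\<exists>C\<ge>0. \<forall>u v. 0 \<le> u \<and> u < v \<and> v \<le> T \<longrightarrow>
        \<bar>Y v $ i - Y u $ i - series F p u v (Y u) $ i\<bar> \<le> C * w u v ^ (p + 1)"
      unfolding ps
    proof (rule solution_expansion[where ?M1.0 = M1 and Y' = Y'])
      show "norm (Y' s) \<le> M1" if "0 \<le> s" "s \<le> T" for s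
        using M1'[rule_format, of s s] that by simp
    qed (use p asm(8) M1 M1' Ysol in auto)
    then show ?thesis by simp
  qed
  from uniform_bound[where f = "\<lambda>i uv. \<bar>(Y (snd uv) - Y (fst uv) - series F p (fst uv) (snd uv) (Y (fst uv))) $ i\<bar>", OF this]
  obtain C1 where C1: "0 \<le> C1" "\<And>u v. 0 \<le> u \<Longrightarrow> u < v \<Longrightarrow> v \<le> T \<Longrightarrow>
      (\<Sum>i\<in>UNIV. \<bar>(Y v - Y u - series F p u v (Y u)) $ i\<bar>) \<le> C1 * w u v ^ (p + 1)"
    by (auto simp: split_paired_all)
  let ?Q = "\<lambda>(u, v, y). 0 \<le> u \<and> u < v \<and> v \<le> T \<and> rk_stages (A u v) F y (S u v y)"
  \<comment> \<open>The order condition enters here: it replaces the weights of the method by the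
    coefficients of the driver in every tree of the expansion, so that both expansions have the same
    main term.\<close>
  have so: "rk_weight (A u v) (\<zeta> u v) (forget \<tau>) = tree_coeff XX Z Z' u v (forget \<tau>)"
    if "\<tau> \<in> ptrees p p" "0 \<le> u" "u < v" "v \<le> T" for \<tau> :: "('m \<times> 'e) ptree" and u v
    using asm(12) psize_ptrees[OF that(1)] that unfolding has_tree_order_def by (simp add: vertices_forget)
  have "\<exists>C\<ge>0. \<forall>x. ?Q x \<longrightarrow> (\<lambda>(u, v, y). \<bar>(crk_map \<zeta> F S u v y - y - series F p u v y) $ i\<bar>) x
      \<le> C * (\<lambda>(u, v, y). w u v ^ (p + 1)) x" for i
  proof -
    have "\<exists>C\<ge>0. \<forall>u v y. 0 \<le> u \<and> u < v \<and> v \<le> T \<and> rk_stages (A u v) F y (S u v y) \<longrightarrow>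
       \<bar>crk_map \<zeta> F S u v y $ i - y $ i - (\<Sum>\<tau> | \<tau> \<in> ptrees p p \<and> snd (plabel \<tau>) = i.
        elem_diff (tcoef F y) \<tau> * rk_weight (A u v) (\<zeta> u v) (forget \<tau>))\<bar> \<le> C * w u v ^ (p + 1)"
      by (rule crk_expansion[where CRK = CRK]) (use asm \<alpha>0 in auto)
    then obtain C where C: "0 \<le> C" "\<forall>u v y. 0 \<le> u \<and> u < v \<and> v \<le> T \<and> rk_stages (A u v) F y (S u v y) \<longrightarrow>
       \<bar>crk_map \<zeta> F S u v y $ i - y $ i - (\<Sum>\<tau> | \<tau> \<in> ptrees p p \<and> snd (plabel \<tau>) = i.
        elem_diff (tcoef F y) \<tau> * rk_weight (A u v) (\<zeta> u v) (forget \<tau>))\<bar> \<le> C * w u v ^ (p + 1)"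
      by blast
    have "\<bar>(crk_map \<zeta> F S u v y - y - series F p u v y) $ i\<bar> \<le> C * w u v ^ (p + 1)"
      if Q: "0 \<le> u \<and> u < v \<and> v \<le> T \<and> rk_stages (A u v) F y (S u v y)" for u v y
    proof -
      have "series F p u v y $ i = (\<Sum>\<tau> | \<tau> \<in> ptrees p p \<and> snd (plabel \<tau>) = i.
        elem_diff (tcoef F y) \<tau> * rk_weight (A u v) (\<zeta> u v) (forget \<tau>))"
        unfolding ps using so Q by (intro sum.cong) auto
      with C(2)[rule_format, OF Q] show ?thesis by simp
    qed
    with C(1) show ?thesis by auto
  qed
  from uniform_bound[where P = ?Q and f = "\<lambda>i (u, v, y). \<bar>(crk_map \<zeta> F S u v y - y - series F p u v y) $ i\<bar>"
      and g = "\<lambda>(u, v, y). w u v ^ (p + 1)", OF this] obtain C2 where C2: "0 \<le> C2"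
    "\<And>u v y. 0 \<le> u \<Longrightarrow> u < v \<Longrightarrow> v \<le> T \<Longrightarrow> rk_stages (A u v) F y (S u v y) \<Longrightarrow>
      (\<Sum>i\<in>UNIV. \<bar>(crk_map \<zeta> F S u v y - y - series F p u v y) $ i\<bar>) \<le> C2 * w u v ^ (p + 1)"
    by (auto simp del: power_Suc)
  define Ce where "Ce = max C1 C2"
  have Ce: "0 \<le> Ce" "C1 \<le> Ce" "C2 \<le> Ce" using C1(1) by (auto simp: Ce_def)
  \<comment> \<open>R bounds the iterates and M1 the solution; stability needs a common bound for
    both sequences.\<close>
  have "0 \<le> max R M1" using M1 by simp
  note stab_ex = global_stability[where F = F, OF p asm(8) asm(5)[unfolded \<rho>_def] Ce(1) this]
  obtain C where C: "0 < C" and stab: "\<forall>N t x y H. is_partition 0 T N t \<and> (\<forall>n<N. t (Suc n) - t n \<le> H) \<and> 0 < H \<and> x 0 = y 0 \<and>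
     (\<forall>n\<le>N. norm (x n) \<le> max R M1 \<and> norm (y n) \<le> max R M1) \<and>
     (\<forall>n<N. norm (x (Suc n) - x n - series F p (t n) (t (Suc n)) (x n)) \<le> Ce * w (t n) (t (Suc n)) ^ (p + 1) \<and>
            norm (y (Suc n) - y n - series F p (t n) (t (Suc n)) (y n)) \<le> Ce * w (t n) (t (Suc n)) ^ (p + 1)) \<longrightarrow>
     (\<forall>n\<le>N. norm (x n - y n) \<le> C * H powr (real (p + 1) * \<alpha> - 1))"
    using stab_ex by blast
  show ?thesis
  proof (intro exI[of _ C] conjI allI impI C)
    fix N t
    let ?y = "one_step_iter \<Psi> t Y0" and ?H = "Max ((\<lambda>n. t (Suc n) - t n) ` {..<N})"
    assume h: "is_partition 0 T N t \<and>
           (\<forall>n<N. \<forall>y. rk_stages (A (t n) (t (Suc n))) F y (S (t n) (t (Suc n)) y)) \<and>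
           (\<forall>n<N. ?y n \<in> cball 0 R \<and> \<phi> (t n) (t (Suc n)) (?y n) \<in> cball 0 R \<and> \<Psi> (t n) (t (Suc n)) (?y n) \<in> cball 0 R)"
    then have P: "is_partition 0 T N t" by blast
    have N0: "0 < N" using P asm(3) by (cases N) (auto simp: is_partition_def)
    have tn: "0 \<le> t n" "t n \<le> T" if "n \<le> N" for n using is_partition_range[OF P that] by auto
    have lt: "t n < t (Suc n)" if "n < N" for n using P that by (simp add: is_partition_def)
    have mesh: "t (Suc n) - t n \<le> ?H" if "n < N" for n using that by (intro Max_ge) auto
    \<comment> \<open>The ball condition on iterates is stated for n < N; for a positive index the
      bound comes from the image of the previous iterate, which reaches n = N.\<close>
    have yR: "norm (?y n) \<le> R" if "n \<le> N" for n
    proof (cases n)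
      case 0
      then show ?thesis using h N0 by force
    next
      case (Suc m)
      then show ?thesis using h that by force
    qed
    have "norm (Y (t n) - ?y n) \<le> C * ?H powr (real (p + 1) * \<alpha> - 1)" if "n \<le> N" for n
    proof (rule stab[rule_format, OF _ that], intro conjI allI impI)
      show "0 < ?H" using mesh[OF N0] lt[OF N0] by linarith
      show "Y (t 0) = ?y 0" using P Yc(2) by (simp add: is_partition_def)
      fix n
      { assume "n \<le> N"
        then show "norm (Y (t n)) \<le> max R M1" "norm (?y n) \<le> max R M1"
          using M1'[rule_format, of "t n" "t n"] tn[of n] yR[of n] by auto }
      assume n: "n < N"
      have "norm (Y (t (Suc n)) - Y (t n) - series F p (t n) (t (Suc n)) (Y (t n))) \<le> C1 * w (t n) (t (Suc n)) ^ (p + 1)"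
        using C1(2)[of "t n" "t (Suc n)"] tn[of n] tn[of "Suc n"] lt[OF n] n by (intro order_trans[OF norm_le_l1_cart]) auto
      also have "\<dots> \<le> Ce * w (t n) (t (Suc n)) ^ (p + 1)" by (intro mult_right_mono Ce) simp
      finally show "norm (Y (t (Suc n)) - Y (t n) - series F p (t n) (t (Suc n)) (Y (t n))) \<le> Ce * w (t n) (t (Suc n)) ^ (p + 1)" .
      have "norm (?y (Suc n) - ?y n - series F p (t n) (t (Suc n)) (?y n)) \<le> C2 * w (t n) (t (Suc n)) ^ (p + 1)"
        unfolding one_step_iter.simps \<Psi>_def[symmetric]
        using C2(2)[of "t n" "t (Suc n)" "?y n"] h tn[of n] tn[of "Suc n"] lt[OF n] n
        by (intro order_trans[OF norm_le_l1_cart]) (auto simp: \<Psi>_def)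
      also have "\<dots> \<le> Ce * w (t n) (t (Suc n)) ^ (p + 1)" by (intro mult_right_mono Ce) simp
      finally show "norm (?y (Suc n) - ?y n - series F p (t n) (t (Suc n)) (?y n)) \<le> Ce * w (t n) (t (Suc n)) ^ (p + 1)" .
    qed (fact P | rule mesh, assumption)+
    then show "Max ((\<lambda>n. norm (Y (t n) - ?y n)) ` {0..N}) \<le> C * ?H powr (\<rho> - 1)"
      unfolding \<rho>_def by (intro Max.boundedI) auto
  qed
qed

end
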